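(* The scheme $\mathfrak N$ (the Hilbert nilcone of $(\mathrm{Sp}(2n), \mathbb V)$ over $\mathbb Z$) is normal and flat over $\mathbb Z$. Moreover, the number of $G_{\Bbbk}$-orbits of $\mathfrak N_{\Bbbk}$, for $\Bbbk$ an algebraically closed field, is independent of the characteristic of $\Bbbk$.
   Context: $G = \mathrm{Sp}(2n)$ is the symplectic group scheme over $\mathbb Z$, $V_1 = \mathbb Z^{2n}$ is its vector representation, $V_2 := \wedge^2 V_1$, and $\mathbb V := V_1 \oplus V_2$, regarded as an affine space over $\mathbb Z$ with $G$-action. The Hilbert nilcone $\mathfrak N$ is the closed $G$-stable subscheme of $\mathbb V$ defined by the ideal of $\mathbb Z[\mathbb V]$ generated by the $G$-invariant polynomials without constant term, i.e. by $\mathbb Z[\mathbb V]^G_+$. For an algebraically closed field $\Bbbk$, $G_{\Bbbk}$ and $\mathfrak N_{\Bbbk}$ denote the base changes of $G$ and $\mathfrak N$ to $\Bbbk$. *)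

theory Defs
  imports
    "HOL-Computational_Algebra.Polynomial"
    "HOL-Algebra.QuotRing"
    "HOL-Algebra.IntRing"
    "HOL-Algebra.Polynomials"
    "HOL-Algebra.Free_Abelian_Groups"
    "Jordan_Normal_Form.Matrix"
begin

section \<open>Commutative algebra\<close>

subsection \<open>Localization\<close>

definition loc_rel :: "('a, 'x) ring_scheme \<Rightarrow> 'a set \<Rightarrow> (('a \<times> 'a) \<times> ('a \<times> 'a)) set" where
  "loc_rel R S = {((a, s), (b, t)). a \<in> carrier R \<and> b \<in> carrier R \<and> s \<in> S \<and> t \<in> S \<and>
     (\<exists>u\<in>S. u \<otimes>\<^bsub>R\<^esub> (a \<otimes>\<^bsub>R\<^esub> t \<ominus>\<^bsub>R\<^esub> b \<otimes>\<^bsub>R\<^esub> s) = \<zero>\<^bsub>R\<^esub>)}"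

definition loc_frac :: "('a, 'x) ring_scheme \<Rightarrow> 'a set \<Rightarrow> 'a \<Rightarrow> 'a \<Rightarrow> ('a \<times> 'a) set" where
  "loc_frac R S a s = loc_rel R S `` {(a, s)}"

text \<open>The unions below run over representatives; for a multiplicative set \<open>S\<close> all their members
  coincide.\<close>

definition localization :: "('a, 'x) ring_scheme \<Rightarrow> 'a set \<Rightarrow> ('a \<times> 'a) set ring" where
  "localization R S = \<lparr>carrier = (carrier R \<times> S) // loc_rel R S,
     monoid.mult = (\<lambda>C D. \<Union>(a, s)\<in>C. \<Union>(b, t)\<in>D. loc_frac R S (a \<otimes>\<^bsub>R\<^esub> b) (s \<otimes>\<^bsub>R\<^esub> t)),
     one = loc_frac R S \<one>\<^bsub>R\<^esub> \<one>\<^bsub>R\<^esub>,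
     ring.zero = loc_frac R S \<zero>\<^bsub>R\<^esub> \<one>\<^bsub>R\<^esub>,
     ring.add = (\<lambda>C D. \<Union>(a, s)\<in>C. \<Union>(b, t)\<in>D.
              loc_frac R S (a \<otimes>\<^bsub>R\<^esub> t \<oplus>\<^bsub>R\<^esub> b \<otimes>\<^bsub>R\<^esub> s) (s \<otimes>\<^bsub>R\<^esub> t))\<rparr>"

subsection \<open>Normality\<close>

text \<open>Lists of coefficients start with the leading one, as in \<^theory>\<open>HOL-Algebra.Polynomials\<close>.\<close>

definition integral_over :: "('a, 'x) ring_scheme \<Rightarrow> 'a set \<Rightarrow> 'a \<Rightarrow> bool" where
  "integral_over R K x \<longleftrightarrow>
     (\<exists>p. polynomial\<^bsub>R\<^esub> K p \<and> p \<noteq> [] \<and> hd p = \<one>\<^bsub>R\<^esub> \<and> ring.eval R p x = \<zero>\<^bsub>R\<^esub>)"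

definition fraction_ring :: "('a, 'x) ring_scheme \<Rightarrow> ('a \<times> 'a) set ring" where
  "fraction_ring D = localization D (carrier D - {\<zero>\<^bsub>D\<^esub>})"

definition normal_domain :: "('a, 'x) ring_scheme \<Rightarrow> bool" where
  "normal_domain D \<longleftrightarrow> domain D \<and>
     (let D' = (\<lambda>a. loc_frac D (carrier D - {\<zero>\<^bsub>D\<^esub>}) a \<one>\<^bsub>D\<^esub>) ` carrier D in
      \<forall>x\<in>carrier (fraction_ring D). integral_over (fraction_ring D) D' x \<longrightarrow> x \<in> D')"

text \<open>A scheme is normal if all its local rings are integrally closed domains; the local rings of
  \<open>Spec A\<close> are the localizations of \<open>A\<close> at its prime ideals.\<close>

definition normal_Spec :: "('a, 'x) ring_scheme \<Rightarrow> bool" where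
  "normal_Spec A \<longleftrightarrow> cring A \<and>
     (\<forall>P. primeideal P A \<longrightarrow> normal_domain (localization A (carrier A - P)))"

subsection \<open>Flatness\<close>

definition tensor_relators ::
    "('r, 'x) ring_scheme \<Rightarrow> ('r, 'm, 'y) module_scheme \<Rightarrow> ('r, 'n, 'z) module_scheme
     \<Rightarrow> ('m \<times> 'n \<Rightarrow>\<^sub>0 int) set" where
  "tensor_relators R M N =
     {frag_of (x \<oplus>\<^bsub>M\<^esub> x', y) - frag_of (x, y) - frag_of (x', y) | x x' y.
        x \<in> carrier M \<and> x' \<in> carrier M \<and> y \<in> carrier N} \<union>
     {frag_of (x, y \<oplus>\<^bsub>N\<^esub> y') - frag_of (x, y) - frag_of (x, y') | x y y'.
        x \<in> carrier M \<and> y \<in> carrier N \<and> y' \<in> carrier N} \<union>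
     {frag_of (r \<odot>\<^bsub>M\<^esub> x, y) - frag_of (x, r \<odot>\<^bsub>N\<^esub> y) | r x y.
        r \<in> carrier R \<and> x \<in> carrier M \<and> y \<in> carrier N}"

definition tensor_subgroup ::
    "('r, 'x) ring_scheme \<Rightarrow> ('r, 'm, 'y) module_scheme \<Rightarrow> ('r, 'n, 'z) module_scheme
     \<Rightarrow> ('m \<times> 'n \<Rightarrow>\<^sub>0 int) set" where
  "tensor_subgroup R M N =
     generate (free_Abelian_group (carrier M \<times> carrier N)) (tensor_relators R M N)"

definition tensor_product ::
    "('r, 'x) ring_scheme \<Rightarrow> ('r, 'm, 'y) module_scheme \<Rightarrow> ('r, 'n, 'z) module_scheme
     \<Rightarrow> ('m \<times> 'n \<Rightarrow>\<^sub>0 int) set monoid" where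
  "tensor_product R M N = free_Abelian_group (carrier M \<times> carrier N) Mod tensor_subgroup R M N"

definition linear_map ::
    "('r, 'x) ring_scheme \<Rightarrow> ('r, 'm, 'y) module_scheme \<Rightarrow> ('r, 'n, 'z) module_scheme
     \<Rightarrow> ('m \<Rightarrow> 'n) \<Rightarrow> bool" where
  "linear_map R M N f \<longleftrightarrow> f \<in> hom (add_monoid M) (add_monoid N) \<and>
     (\<forall>r\<in>carrier R. \<forall>x\<in>carrier M. f (r \<odot>\<^bsub>M\<^esub> x) = r \<odot>\<^bsub>N\<^esub> f x)"

text \<open>The map of tensor products \<open>M\<^sub>1 \<otimes> N \<rightarrow> M\<^sub>2 \<otimes> N\<close> induced by \<open>f\<close>, on cosets.\<close>

definition tensor_map ::
    "('r, 'x) ring_scheme \<Rightarrow> ('r, 'm1, 'y) module_scheme \<Rightarrow> ('r, 'm2, 'z) module_scheme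
     \<Rightarrow> ('r, 'n, 'w) module_scheme \<Rightarrow> ('m1 \<Rightarrow> 'm2)
     \<Rightarrow> ('m1 \<times> 'n \<Rightarrow>\<^sub>0 int) set \<Rightarrow> ('m2 \<times> 'n \<Rightarrow>\<^sub>0 int) set" where
  "tensor_map R M1 M2 N f C =
     (\<Union>c\<in>C. tensor_subgroup R M2 N #>\<^bsub>free_Abelian_group (carrier M2 \<times> carrier N)\<^esub>
              frag_extend (\<lambda>(x, y). frag_of (f x, y)) c)"

text \<open>The two type arguments are the types carrying the test modules. A result about flatness is
  the full one when it is stated with these types arbitrary.\<close>

definition flat_module ::
    "'p itself \<Rightarrow> 'q itself \<Rightarrow> ('r, 'x) ring_scheme \<Rightarrow> ('r, 'n, 'y) module_scheme \<Rightarrow> bool" where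
  "flat_module P Q R N \<longleftrightarrow> module R N \<and>
     (\<forall>(M1 :: ('r, 'p) module) (M2 :: ('r, 'q) module) f.
        module R M1 \<and> module R M2 \<and> linear_map R M1 M2 f \<and> inj_on f (carrier M1) \<longrightarrow>
        inj_on (tensor_map R M1 M2 N f) (carrier (tensor_product R M1 N)))"

definition int_module :: "('a, 'x) ring_scheme \<Rightarrow> (int, 'a) module" where
  "int_module A = \<lparr>carrier = carrier A, monoid.mult = monoid.mult A, one = \<one>\<^bsub>A\<^esub>,
     ring.zero = \<zero>\<^bsub>A\<^esub>, ring.add = ring.add A, smult = (\<lambda>k a. [k] \<cdot>\<^bsub>A\<^esub> a)\<rparr>"

text \<open>Flatness of \<open>Spec A\<close> over \<open>Spec \<int>\<close>.\<close>

definition flat_Spec_over_int :: "'p itself \<Rightarrow> 'q itself \<Rightarrow> ('a, 'x) ring_scheme \<Rightarrow> bool" where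
  "flat_Spec_over_int P Q A \<longleftrightarrow> flat_module P Q \<Z> (int_module A)"

subsection \<open>Polynomials over the integers\<close>

type_synonym 'v zpoly = "('v \<Rightarrow>\<^sub>0 nat) \<Rightarrow>\<^sub>0 int"

definition Var :: "'v \<Rightarrow> 'v zpoly" where
  "Var v = Poly_Mapping.single (Poly_Mapping.single v 1) 1"

definition zpoly_ring :: "'v set \<Rightarrow> 'v zpoly ring" where
  "zpoly_ring S = \<lparr>carrier = {f. \<forall>m\<in>Poly_Mapping.keys f. Poly_Mapping.keys m \<subseteq> S},
     monoid.mult = (*), one = 1, ring.zero = 0, ring.add = (+)\<rparr>"

definition eval_zpoly :: "('v \<Rightarrow> 'r::comm_ring_1) \<Rightarrow> 'v zpoly \<Rightarrow> 'r" where
  "eval_zpoly x f = (\<Sum>m\<in>Poly_Mapping.keys f. of_int (Poly_Mapping.lookup f m) *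
     (\<Prod>v\<in>Poly_Mapping.keys m. x v ^ Poly_Mapping.lookup m v))"

section \<open>The symplectic group and its representation\<close>

definition symp_form :: "nat \<Rightarrow> 'r::comm_ring_1 mat" where
  "symp_form n = mat (2 * n) (2 * n) (\<lambda>(i, j). if j = i + n then 1 else if i = j + n then - 1 else 0)"

text \<open>The points of the group scheme and of the affine space \<open>\<V>\<close> over a commutative ring.\<close>

definition Sp :: "nat \<Rightarrow> 'r::comm_ring_1 mat set" where
  "Sp n = {g \<in> carrier_mat (2 * n) (2 * n). g\<^sup>T * symp_form n * g = symp_form n}"

text \<open>The second exterior power of the free module of column vectors is represented by the
  alternating matrices: \<open>e\<^sub>i \<and> e\<^sub>j\<close> corresponds to the matrix \<open>E\<^sub>i\<^sub>j - E\<^sub>j\<^sub>i\<close>, and the action of \<open>g\<close>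
  becomes \<open>Y \<mapsto> g Y g\<^sup>T\<close>. The coordinates of a bivector are the entries above the diagonal.\<close>

definition alt_mat :: "nat \<Rightarrow> 'r::comm_ring_1 mat set" where
  "alt_mat m = {Y \<in> carrier_mat m m. Y\<^sup>T = - Y \<and> (\<forall>i<m. Y $$ (i, i) = 0)}"

definition V_points :: "nat \<Rightarrow> ('r::comm_ring_1 vec \<times> 'r mat) set" where
  "V_points n = carrier_vec (2 * n) \<times> alt_mat (2 * n)"

definition act :: "'r::comm_ring_1 mat \<Rightarrow> 'r vec \<times> 'r mat \<Rightarrow> 'r vec \<times> 'r mat" where
  "act g p = (g *\<^sub>v fst p, g * snd p * g\<^sup>T)"

section \<open>Invariant polynomials and the Hilbert nilcone\<close>

text \<open>\<open>CG\<close>: matrix entries of a group element; \<open>CX\<close> and \<open>CY\<close>: coordinates on the two summands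
  of the representation.\<close>

datatype coord = CG nat nat | CX nat | CY nat nat

definition V_coords :: "nat \<Rightarrow> coord set" where
  "V_coords n = {CX i | i. i < 2 * n} \<union> {CY i j | i j. i < j \<and> j < 2 * n}"

definition G_coords :: "nat \<Rightarrow> coord set" where
  "G_coords n = {CG i j | i j. i < 2 * n \<and> j < 2 * n}"

fun coord_val :: "'r::comm_ring_1 vec \<times> 'r mat \<Rightarrow> coord \<Rightarrow> 'r" where
  "coord_val p (CX i) = fst p $ i"
| "coord_val p (CY i j) = snd p $$ (i, j)"
| "coord_val p (CG i j) = 0"

definition gen_group :: "nat \<Rightarrow> coord zpoly mat" where
  "gen_group n = mat (2 * n) (2 * n) (\<lambda>(i, j). Var (CG i j))"

definition gen_point :: "nat \<Rightarrow> coord zpoly vec \<times> coord zpoly mat" where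
  "gen_point n = (vec (2 * n) (\<lambda>i. Var (CX i)),
     mat (2 * n) (2 * n)
       (\<lambda>(i, j). if i < j then Var (CY i j) else if j < i then - Var (CY j i) else 0))"

text \<open>\<open>\<int>[G \<times> \<V>]\<close> is the polynomial ring in all coordinates modulo the following ideal.\<close>

definition Sp_ideal :: "nat \<Rightarrow> coord zpoly set" where
  "Sp_ideal n = genideal (zpoly_ring (G_coords n \<union> V_coords n))
     {((gen_group n)\<^sup>T * symp_form n * gen_group n - symp_form n) $$ (i, j) | i j.
        i < 2 * n \<and> j < 2 * n}"

text \<open>Invariance under the group scheme (not only under its integral points): the pullbacks of \<open>f\<close>
  under the action morphism \<open>G \<times> \<V> \<rightarrow> \<V>\<close> and under the projection agree.\<close>

definition V_invariants :: "nat \<Rightarrow> coord zpoly set" where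
  "V_invariants n = {f \<in> carrier (zpoly_ring (V_coords n)).
     eval_zpoly (coord_val (act (gen_group n) (gen_point n))) f - f \<in> Sp_ideal n}"

definition nilcone_ideal :: "nat \<Rightarrow> coord zpoly set" where
  "nilcone_ideal n = genideal (zpoly_ring (V_coords n))
     {f \<in> V_invariants n. Poly_Mapping.lookup f 0 = 0}"

definition nilcone_ring :: "nat \<Rightarrow> coord zpoly set ring" where
  "nilcone_ring n = zpoly_ring (V_coords n) Quot nilcone_ideal n"

text \<open>For algebraically closed \<open>k\<close>, the orbits of the base change are the orbits of the group of
  \<open>k\<close>-points on the \<open>k\<close>-points of the nilcone.\<close>

definition nilcone_points :: "nat \<Rightarrow> ('k::field vec \<times> 'k mat) set" where
  "nilcone_points n = {p \<in> V_points n. \<forall>f\<in>nilcone_ideal n. eval_zpoly (coord_val p) f = 0}"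

definition nilcone_orbits :: "nat \<Rightarrow> ('k::field vec \<times> 'k mat) set set" where
  "nilcone_orbits n = (\<lambda>p. (\<lambda>g. act g p) ` Sp n) ` nilcone_points n"

end

theory Submission
  imports
    Defs
    "HOL-Library.Countable"
    "HOL-Library.Function_Algebras"
    "HOL-Computational_Algebra.Formal_Power_Series"
    "HOL-Computational_Algebra.Fraction_Field"
    "Jordan_Normal_Form.Determinant"
begin

text \<open>
  The symplectic form turns a bivector \<open>Y\<close> into a self-adjoint endomorphism \<open>A\<close>, and \<open>det (1 - s A)\<close> is
  the square of a polynomial \<open>1 + C\<^sub>1 s + \<dots> + C\<^sub>n s\<^sup>n\<close> with invariant integral coefficients. For a
  generic vector \<open>x\<close> the vectors \<open>x, A x, \<dots>, A\<^sup>n\<^sup>-\<^sup>1 x\<close> span a Lagrangian subspace, so over the function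
  field \<open>(x, Y)\<close> is conjugate to a companion normal form depending only on the \<open>C\<^sub>j\<close>. Hence
  every invariant is a polynomial in the \<open>C\<^sub>j\<close>, and these generate the ideal of the nilcone.

  For a suitable weight the leading monomials of modified generators of this ideal, powers of the
  diagonal entries of the mixed block of \<open>Y\<close>, are pairwise coprime with coefficient 1. Therefore the
  standard monomials form a \<open>\<int>\<close>-basis of the coordinate ring, which is thus flat. Let \<open>A'\<close> be the
  compression of \<open>A\<close> to the first \<open>n - 1\<close> hyperbolic planes and \<open>v\<close> the last column of the mixed block.
  The determinant of the Krylov vectors \<open>v, A' v, \<dots>, A'\<^sup>n\<^sup>-\<^sup>2 v\<close>, projected to a Lagrangian subspace, and
  its mirror image under exchanging the two standard Lagrangian subspaces have leading monomials coprime
  to each other and to the former, so they form a regular sequence on the nilcone. Where one of them is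
  invertible the equations can be solved for one row of \<open>Y\<close>, so this chart is a localization of a
  polynomial ring; the regular sequence carries primality and normality over from the charts.

  A nilpotent self-adjoint endomorphism with a vector \<open>x\<close> is described, over any field, by the lengths of the
  paired Jordan blocks \<open>\<langle>e\<^sub>r, f\<^sub>r\<rangle>\<close> and by exponents \<open>a\<^sub>r\<close> with \<open>x = \<Sum> A\<^sup>a e\<^sub>r\<close> (\<open>a = a\<^sub>r\<close>), which become unique once they
  are saturated. These combinatorial types index the orbits independently of the field.
\<close>

text \<open>Characteristic 2 and scheme-theoretic invariance shape the tools. Skew-symmetric is
  weaker than alternating there and traces of powers of \<open>A\<close> do not suffice, so the
  \<open>C_j\<close> come from a division-free Pfaffian recursion. Their invariance is a congruence
  modulo the equations of the group, an ideal not known here to be prime; it is derived from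
  Pfaffian identities over arbitrary commutative rings instead of from points over fields. For the
  converse a single point is enough, the generic one.

  One Krylov determinant already yields primality. Normality needs both: an integral fraction is
  seen to be regular only on the two charts, and it extends over the common zeros of the two
  determinants because powers of them form a regular sequence of length two, as in a Hartogs
  argument.

  The weight favours the diagonal of the mixed block because there the \<open>C_j\<close> become, up
  to sign, the elementary symmetric functions, whose ideal has a classical triangular Groebner basis
  of complete symmetric functions in shrinking sets of variables. The leading terms of that basis
  are pure powers of different variables, with coefficient 1 over the integers.\<close>

hide_const (open) up_ring.coeff up_ring.monom Polynomials.degree Polynomials.lead_coeff

section \<open>Integral polynomials\<close>

abbreviation keys where "keys \<equiv> Poly_Mapping.keys"
abbreviation lookup where "lookup \<equiv> Poly_Mapping.lookup"
abbreviation single where "single \<equiv> Poly_Mapping.single"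

text \<open>An arbitrary linear order on the coordinates, which the library needs to see that polynomials form
  an integral domain.\<close>

instance coord :: countable by countable_datatype

instantiation coord :: linorder
begin
definition less_eq_coord :: "coord \<Rightarrow> coord \<Rightarrow> bool" where
  "less_eq_coord x y \<longleftrightarrow> to_nat x \<le> to_nat y"
definition less_coord :: "coord \<Rightarrow> coord \<Rightarrow> bool" where
  "less_coord x y \<longleftrightarrow> to_nat x < to_nat y"
instance by standard (auto simp: less_eq_coord_def less_coord_def)
end

definition mon :: "('v \<Rightarrow> 'r::comm_ring_1) \<Rightarrow> ('v \<Rightarrow>\<^sub>0 nat) \<Rightarrow> 'r" where
  "mon x m = (\<Prod>v\<in>keys m. x v ^ lookup m v)"

lemma mon_superset:
  assumes "finite S" "keys m \<subseteq> S"
  shows "mon x m = (\<Prod>v\<in>S. x v ^ lookup m v)"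
  unfolding mon_def using assms by (intro prod.mono_neutral_left) (auto simp: in_keys_iff)

lemma mon_zero [simp]: "mon x 0 = 1"
  by (simp add: mon_def)

lemma mon_add: "mon x (m + n) = mon x m * mon x n"
proof -
  have "keys (m + n) \<subseteq> keys m \<union> keys n" by (rule keys_add)
  hence "mon x (m + n) = (\<Prod>v\<in>keys m \<union> keys n. x v ^ lookup (m + n) v)" by (intro mon_superset) auto
  also have "\<dots> = mon x m * mon x n"
    by (simp add: mon_superset[of "keys m \<union> keys n"] lookup_add power_add prod.distrib)
  finally show ?thesis .
qed

lemma mon_single: "mon x (single v k) = x v ^ k"
  by (simp add: mon_def)

lemma eval_zpoly_superset:
  assumes "finite S" "keys f \<subseteq> S"
  shows "eval_zpoly x f = (\<Sum>m\<in>S. of_int (lookup f m) * mon x m)"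
  unfolding eval_zpoly_def mon_def using assms by (intro sum.mono_neutral_left) (auto simp: in_keys_iff)

lemma eval_zpoly_add: "eval_zpoly x (f + g) = eval_zpoly x f + eval_zpoly x g"
proof -
  have "keys (f + g) \<subseteq> keys f \<union> keys g" by (rule keys_add)
  hence "eval_zpoly x (f + g) = (\<Sum>m\<in>keys f \<union> keys g. of_int (lookup (f + g) m) * mon x m)"
    by (intro eval_zpoly_superset) auto
  also have "\<dots> = eval_zpoly x f + eval_zpoly x g"
    by (simp add: eval_zpoly_superset[of "keys f \<union> keys g"] lookup_add algebra_simps sum.distrib)
  finally show ?thesis .
qed

lemma eval_zpoly_single: "eval_zpoly x (single m c) = of_int c * mon x m"
  by (simp add: eval_zpoly_def mon_def)

lemma eval_zpoly_0 [simp]: "eval_zpoly x 0 = 0"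
  by (simp add: eval_zpoly_def)

lemma poly_mapping_add_induct [case_names zero add]:
  fixes f :: "'a \<Rightarrow>\<^sub>0 'b::monoid_add"
  assumes "P 0" and "\<And>m c f. P f \<Longrightarrow> m \<notin> keys f \<Longrightarrow> c \<noteq> 0 \<Longrightarrow> P (single m c + f)"
  shows "P f"
proof (induction f rule: update_induct)
  case const
  thus ?case by (simp add: assms(1))
next
  case (update f a b)
  have "Poly_Mapping.update a b f = single a b + f" using update(1) by (intro poly_mapping_eqI)
      (auto simp: lookup_update lookup_add lookup_single when_def in_keys_iff)
  with assms(2)[OF update(3) update(1) update(2)] show ?case by simp
qed

lemma eval_zpoly_single_mult:
  "eval_zpoly x (single m c * g) = of_int c * mon x m * eval_zpoly x g"
  by (induction g rule: poly_mapping_add_induct)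
    (simp_all add: distrib_left eval_zpoly_add mult_single eval_zpoly_single mon_add mult_ac)

lemma eval_zpoly_mult: "eval_zpoly x (f * g) = eval_zpoly x f * eval_zpoly x g"
  by (induction f rule: poly_mapping_add_induct)
    (simp_all add: distrib_right eval_zpoly_add eval_zpoly_single_mult eval_zpoly_single)

lemma eval_zpoly_1 [simp]: "eval_zpoly x 1 = 1"
  by (simp flip: single_one add: eval_zpoly_single)

interpretation eval_hom: comm_ring_hom "eval_zpoly x"
  by standard (simp_all add: eval_zpoly_add eval_zpoly_mult)

lemma eval_zpoly_Var [simp]: "eval_zpoly x (Var v) = x v"
  by (simp add: Var_def eval_zpoly_single mon_single)

lemma single_of_int_mult: "single m c = of_int c * single m 1"
  by (simp flip: single_of_int add: mult_single)

lemma single_one_prod: "single m (1::int) = mon Var m"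
proof (induction m rule: poly_mapping_add_induct)
  case (add v k m)
  have "single (single v k) (1::int) = Var v ^ k"
  proof (induction k)
    case (Suc k)
    have "single (single v (Suc k)) (1::int) = single (single v 1 + single v k) (1 * 1)" by (simp flip: single_add)
    also have "\<dots> = Var v * Var v ^ k" unfolding mult_single[symmetric] Suc Var_def ..
    finally show ?case by simp
  qed simp
  moreover have "single (single v k + m) 1 = single (single v k) 1 * single m (1::int)" by (simp add: mult_single)
  ultimately show ?case using add by (simp add: mon_add mon_single)
qed simp

lemma zpoly_expand: "f = (\<Sum>m\<in>keys f. of_int (lookup f m) * mon Var m)"
proof -
  have "f = (\<Sum>m\<in>keys f. single m (lookup f m))"
    by (intro poly_mapping_eqI) (auto simp: lookup_sum lookup_single when_def sum.delta in_keys_iff)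
  also have "\<dots> = (\<Sum>m\<in>keys f. of_int (lookup f m) * mon Var m)"
    by (intro sum.cong refl, subst single_of_int_mult) (simp add: single_one_prod)
  finally show ?thesis .
qed

lemma eval_zpoly_Var_id [simp]: "eval_zpoly Var f = f"
  using zpoly_expand[of f] by (simp add: eval_zpoly_def mon_def)

lemma hom_eval_zpoly:
  assumes "comm_ring_hom h"
  shows "h (eval_zpoly x f) = eval_zpoly (\<lambda>v. h (x v)) f"
proof -
  interpret comm_ring_hom h by fact
  show ?thesis by (simp add: eval_zpoly_def hom_distribs)
qed

subsection \<open>Polynomials in a given set of variables\<close>

definition polys :: "'v set \<Rightarrow> 'v zpoly set" where
  "polys V = {f. \<forall>m\<in>keys f. keys m \<subseteq> V}"

lemma eval_zpoly_cong:
  assumes "f \<in> polys V" "\<And>v. v \<in> V \<Longrightarrow> x v = y v"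
  shows "eval_zpoly x f = eval_zpoly y f"
  unfolding eval_zpoly_def using assms
  by (intro sum.cong arg_cong2[of _ _ _ _ "(*)"] prod.cong) (auto simp: polys_def subset_iff)

lemma polys_closed [simp, intro]:
  "0 \<in> polys V" "1 \<in> polys V" "of_int k \<in> polys V" "of_nat l \<in> polys V"
  "f \<in> polys V \<Longrightarrow> g \<in> polys V \<Longrightarrow> f + g \<in> polys V"
  "f \<in> polys V \<Longrightarrow> g \<in> polys V \<Longrightarrow> f * g \<in> polys V"
  "f \<in> polys V \<Longrightarrow> - f \<in> polys V"
  "f \<in> polys V \<Longrightarrow> g \<in> polys V \<Longrightarrow> f - g \<in> polys V"
  "v \<in> V \<Longrightarrow> Var v \<in> polys V"
proof -
  show "0 \<in> polys V" "1 \<in> polys V" by (auto simp: polys_def)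
  show "of_int k \<in> polys V" by (auto simp: polys_def simp flip: single_of_int split: if_splits)
  show "of_nat l \<in> polys V" by (auto simp: polys_def simp flip: single_of_nat split: if_splits)
  show add: "f + g \<in> polys V" if "f \<in> polys V" "g \<in> polys V" for f g
    using that keys_add[of f g] by (auto simp: polys_def)
  show neg: "- f \<in> polys V" if "f \<in> polys V" for f using that by (auto simp: polys_def)
  show "f - g \<in> polys V" if "f \<in> polys V" "g \<in> polys V" using add[OF that(1) neg[OF that(2)]] by simp
  show "f * g \<in> polys V" if "f \<in> polys V" "g \<in> polys V"
  proof -
    have "keys m \<subseteq> V" if "m \<in> keys (f * g)" for m
    proof -
      from that keys_mult[of f g] obtain a b where "m = a + b" "a \<in> keys f" "b \<in> keys g" by auto
      with keys_add[of a b] \<open>f \<in> polys V\<close> \<open>g \<in> polys V\<close> show ?thesis by (auto simp: polys_def)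
    qed
    thus ?thesis by (auto simp: polys_def)
  qed
  show "Var v \<in> polys V" if "v \<in> V" using that by (auto simp: polys_def Var_def split: if_splits)
qed

lemma polys_power [simp, intro]: "f \<in> polys V \<Longrightarrow> f ^ k \<in> polys V"
  by (induction k) auto

lemma polys_sum [intro]: "(\<And>i. i \<in> S \<Longrightarrow> f i \<in> polys V) \<Longrightarrow> sum f S \<in> polys V"
  by (induction S rule: infinite_finite_induct) auto

lemma polys_prod [intro]: "(\<And>i. i \<in> S \<Longrightarrow> f i \<in> polys V) \<Longrightarrow> prod f S \<in> polys V"
  by (induction S rule: infinite_finite_induct) auto

lemma polys_mono: "V \<subseteq> W \<Longrightarrow> polys V \<subseteq> polys W"
  by (auto simp: polys_def)

lemma polys_UNIV [simp]: "polys UNIV = UNIV"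
  by (auto simp: polys_def)

lemma eval_zpoly_in_polys:
  assumes "f \<in> polys W" "\<And>v. v \<in> W \<Longrightarrow> x v \<in> polys V"
  shows "eval_zpoly x f \<in> polys V"
proof -
  have "x v \<in> polys V" if "m \<in> keys f" "v \<in> keys m" for m v
    using that assms(1) by (intro assms(2)) (auto simp: polys_def)
  thus ?thesis unfolding eval_zpoly_def by (intro polys_sum polys_closed polys_prod polys_power) auto
qed

lemma polys_finite_vars: "\<exists>V. finite V \<and> f \<in> polys V"
  by (rule exI[of _ "\<Union>m\<in>keys f. keys m"]) (auto simp: polys_def)

lemma polys_empty:
  assumes "f \<in> polys {}"
  obtains c where "f = of_int c"
proof -
  from assms have "keys f \<subseteq> {0}" by (auto simp: polys_def)
  hence "f = single 0 (lookup f 0)" by (intro poly_mapping_eqI) (auto simp: lookup_single when_def in_keys_iff)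
  also have "\<dots> = of_int (lookup f 0)" by (simp flip: single_of_int)
  finally show thesis by (rule that)
qed

text \<open>Setting the variables outside \<open>V\<close> to zero is a ring retraction onto
  \<open>polys V\<close>. It brings quotients and ideal memberships found in the ring of all
  variables back to \<open>polys V\<close>.\<close>

definition zrestrict :: "'v set \<Rightarrow> 'v zpoly \<Rightarrow> 'v zpoly" where
  "zrestrict V = eval_zpoly (\<lambda>v. if v \<in> V then Var v else 0)"

lemma zrestrict_hom: "comm_ring_hom (zrestrict V)"
  unfolding zrestrict_def by (rule eval_hom.comm_ring_hom_axioms)

lemma zrestrict_id: "f \<in> polys V \<Longrightarrow> zrestrict V f = f"
  unfolding zrestrict_def by (subst eval_zpoly_cong[of f V _ Var]) auto

lemma zrestrict_in_polys: "zrestrict V f \<in> polys V"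
  unfolding zrestrict_def by (rule eval_zpoly_in_polys[of _ UNIV]) auto

section \<open>Ideals as spans: \<open>idl.span S\<close> is the ideal generated by
  \<open>S\<close>\<close>

interpretation idl: Modules.module "(*) :: 'a::comm_ring_1 \<Rightarrow> 'a \<Rightarrow> 'a"
  by standard (simp_all add: algebra_simps)

declare idl.scale_scale [simp del]

lemma idl_scale_right: "x \<in> idl.span S \<Longrightarrow> x * c \<in> idl.span S"
  by (metis idl.span_scale mult.commute)

lemma ideal_hom_image:
  assumes "comm_ring_hom h" "f \<in> idl.span S" "\<And>s. s \<in> S \<Longrightarrow> h s \<in> idl.span T"
  shows "h f \<in> idl.span T"
proof -
  interpret comm_ring_hom h by fact
  show ?thesis using assms(2) by (induction rule: idl.span_induct_alt)
      (auto simp: hom_distribs idl.span_zero intro!: idl.span_add idl.span_scale assms(3))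
qed

lemma eval_zpoly_cong_ideal:
  assumes "f \<in> polys V" "\<And>v. v \<in> V \<Longrightarrow> x v - y v \<in> idl.span S"
  shows "eval_zpoly x f - eval_zpoly y f \<in> idl.span S"
proof -
  define R where "R a b \<longleftrightarrow> a - b \<in> idl.span S" for a b
  have add: "R (a + c) (b + d)" if "R a b" "R c d" for a b c d
    using idl.span_add[OF that[unfolded R_def]] by (simp add: R_def algebra_simps)
  have mult: "R (a * c) (b * d)" if "R a b" "R c d" for a b c d
  proof -
    have "a * c - b * d = c * (a - b) + b * (c - d)" by (simp add: algebra_simps)
    thus ?thesis unfolding R_def using that[unfolded R_def] by (auto intro!: idl.span_add idl.span_scale)
  qed
  have refl: "R a a" for a by (simp add: R_def idl.span_zero)
  have pow: "R (a ^ k) (b ^ k)" if "R a b" for a b k by (induction k) (auto intro: mult refl that)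
  have R_sum: "R (\<Sum>i\<in>T. p i) (\<Sum>i\<in>T. q i)" if "\<And>i. i \<in> T \<Longrightarrow> R (p i) (q i)"
    for T :: "('v \<Rightarrow>\<^sub>0 nat) set" and p q
    using that by (induction T rule: infinite_finite_induct) (auto intro!: add simp: refl)
  have R_prod: "R (\<Prod>i\<in>T. p i) (\<Prod>i\<in>T. q i)" if "\<And>i. i \<in> T \<Longrightarrow> R (p i) (q i)" for T :: "'v set" and p q
    using that by (induction T rule: infinite_finite_induct) (auto intro!: mult simp: refl)
  have "R (eval_zpoly x f) (eval_zpoly y f)" unfolding eval_zpoly_def using assms
    by (intro R_sum mult refl R_prod pow) (auto simp: R_def polys_def subset_iff)
  thus ?thesis by (simp add: R_def)
qed

lemma zpoly_ring_simps [simp]: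
  "carrier (zpoly_ring V) = polys V" "x \<otimes>\<^bsub>zpoly_ring V\<^esub> y = x * y" "x \<oplus>\<^bsub>zpoly_ring V\<^esub> y = x + y"
  "\<one>\<^bsub>zpoly_ring V\<^esub> = 1" "\<zero>\<^bsub>zpoly_ring V\<^esub> = 0" by (simp_all add: zpoly_ring_def polys_def)

lemma zpoly_ring_cring: "cring (zpoly_ring V)"
proof (rule cringI)
  show "abelian_group (zpoly_ring V)"
  proof (rule abelian_groupI)
    fix x assume "x \<in> carrier (zpoly_ring V)"
    thus "\<exists>y\<in>carrier (zpoly_ring V). y \<oplus>\<^bsub>zpoly_ring V\<^esub> x = \<zero>\<^bsub>zpoly_ring V\<^esub>" by (intro bexI[of _ "- x"]) auto
  qed (simp_all only: zpoly_ring_simps polys_closed add_ac add_0 add_0_right)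
  show "comm_monoid (zpoly_ring V)"
    by (rule comm_monoidI) (simp_all only: zpoly_ring_simps polys_closed mult_ac mult_1 mult_1_right)
  show "(x \<oplus>\<^bsub>zpoly_ring V\<^esub> y) \<otimes>\<^bsub>zpoly_ring V\<^esub> z =
      x \<otimes>\<^bsub>zpoly_ring V\<^esub> z \<oplus>\<^bsub>zpoly_ring V\<^esub> y \<otimes>\<^bsub>zpoly_ring V\<^esub> z" for x y z
    by (simp only: zpoly_ring_simps distrib_right)
qed

interpretation zpoly_ring: cring "zpoly_ring V"
  by (rule zpoly_ring_cring)

lemma zpoly_ring_a_inv [simp]: "f \<in> polys V \<Longrightarrow> \<ominus>\<^bsub>zpoly_ring V\<^esub> f = - f"
  by (rule zpoly_ring.minus_equality) auto

lemma zpoly_ring_minus [simp]: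
  "f \<in> polys V \<Longrightarrow> g \<in> polys V \<Longrightarrow> f \<ominus>\<^bsub>zpoly_ring V\<^esub> g = f - g" by (simp add: a_minus_def)

text \<open>The retraction \<open>zrestrict V\<close> fixes the generators and the element, and
  moves arbitrary coefficients into \<open>polys V\<close>. Ideals can therefore be handled in the
  type of all polynomials.\<close>

lemma genideal_zpoly_ring:
  assumes "S \<subseteq> polys V"
  shows "genideal (zpoly_ring V) S = idl.span S \<inter> polys V" (is "?G = ?I")
proof
  have "ideal ?I (zpoly_ring V)"
  proof (rule idealI)
    show "ring (zpoly_ring V)" by (rule zpoly_ring.ring_axioms)
    have "inv\<^bsub>add_monoid (zpoly_ring V)\<^esub> x = - x" if "x \<in> polys V" for x
      using zpoly_ring_a_inv[OF that] by (simp add: a_inv_def)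
    thus "subgroup ?I (add_monoid (zpoly_ring V))"
      by (intro subgroup.intro) (simp_all add: idl.span_zero idl.span_add idl.span_neg)
  qed (simp_all add: idl.span_scale idl_scale_right)
  thus "?G \<subseteq> ?I" using assms by (intro zpoly_ring.genideal_minimal) (auto intro: idl.span_base)
next
  have id: "ideal ?G (zpoly_ring V)" using assms by (intro zpoly_ring.genideal_ideal) auto
  interpret J: ideal ?G "zpoly_ring V" by (rule id)
  have *: "zrestrict V f \<in> ?G" if "f \<in> idl.span S" for f using that
  proof (induction rule: idl.span_induct_alt)
    case base
    thus ?case using J.zero_closed by (simp add: zrestrict_def)
  next
    case (step c x y)
    interpret h: comm_ring_hom "zrestrict V" by (rule zrestrict_hom)
    have "x \<in> ?G" using step assms zpoly_ring.genideal_self[of S V] by auto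
    hence "zrestrict V c * x \<in> ?G" using J.I_l_closed[of x "zrestrict V c"] zrestrict_in_polys[of V c] by simp
    moreover have "zrestrict V x = x" using step assms by (auto intro: zrestrict_id)
    ultimately show ?case using step J.a_closed by (simp add: h.hom_mult h.hom_add)
  qed
  show "?I \<subseteq> ?G"
  proof (intro subsetI)
    fix f assume "f \<in> ?I"
    with *[of f] zrestrict_id[of f V]
    show "f \<in> ?G" by simp
  qed
qed

subsection \<open>Normality of integral polynomial rings\<close>

text \<open>The hypothesis says that \<open>t\<close> is a common denominator of all powers of
  \<open>r\<close>/\<open>s\<close>, so that this fraction is almost integral. The property survives
  multiplication by \<open>c\<close> and addition of \<open>q\<close>, which is what division steps
  need.\<close>

lemma almost_integral_shift:
  fixes r s t :: "'a::comm_ring_1"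
  assumes "\<And>k. s ^ k dvd t * r ^ k"
  shows "s ^ k dvd t * (c * r + s * q) ^ k"
proof -
  have "t * (c * r + s * q) ^ k = (\<Sum>j\<le>k. of_nat (k choose j) * c ^ j * q ^ (k - j) * ((t * r ^ j) * s ^ (k - j)))"
    by (simp add: binomial_ring sum_distrib_left power_mult_distrib algebra_simps)
  also have "s ^ k dvd \<dots>"
  proof (intro dvd_sum)
    fix j assume "j \<in> {..k}"
    hence "s ^ k = s ^ j * s ^ (k - j)" by (simp flip: power_add)
    hence "s ^ k dvd t * r ^ j * s ^ (k - j)" by (simp add: assms mult_dvd_mono)
    thus "s ^ k dvd of_nat (k choose j) * c ^ j * q ^ (k - j) * (t * r ^ j * s ^ (k - j))" by (rule dvd_mult)
  qed
  finally show ?thesis .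
qed

text \<open>In lowest terms every power of the denominator divides the fixed nonzero
  \<open>c\<close>, so the denominator is a unit.\<close>

lemma almost_integral_int:
  fixes a b c :: int
  assumes "\<And>k. b ^ k dvd c * a ^ k" "b \<noteq> 0" "c \<noteq> 0"
  shows "b dvd a"
proof -
  obtain a' b' where ab: "a = a' * gcd a b" "b = b' * gcd a b" "coprime a' b'"
    using gcd_coprime_exists[of a b] assms(2) by auto
  have "b' ^ k dvd c" for k
  proof -
    have "gcd a b ^ k * b' ^ k dvd gcd a b ^ k * (c * a' ^ k)"
      using assms(1)[of k] ab(1,2) by (metis (no_types, lifting) mult.commute mult.left_commute power_mult_distrib)
    hence "b' ^ k dvd c * a' ^ k" using assms(2) by simp
    thus ?thesis using ab(3)
      by (meson coprime_commute coprime_dvd_mult_left_iff coprime_power_left_iff coprime_power_right_iff)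
  qed
  hence *: "\<bar>b'\<bar> ^ k \<le> \<bar>c\<bar>" for k using dvd_imp_le_int[OF assms(3), of "b' ^ k"] by (simp add: power_abs)
  have "\<bar>b'\<bar> \<le> 1"
  proof (rule ccontr)
    assume "\<not> \<bar>b'\<bar> \<le> 1"
    hence "2 ^ k \<le> \<bar>b'\<bar> ^ k" for k by (intro power_mono) auto
    from this[of "nat \<bar>c\<bar>"] *[of "nat \<bar>c\<bar>"] have "2 ^ nat \<bar>c\<bar> \<le> \<bar>c\<bar>" by linarith
    moreover have "int (nat \<bar>c\<bar>) < 2 ^ nat \<bar>c\<bar>" using of_nat_less_two_power[of "nat \<bar>c\<bar>", where 'a=int] .
    ultimately show False by simp
  qed
  moreover have "b' \<noteq> 0" using ab(2) assms(2) by auto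
  ultimately have "b' = 1 \<or> b' = -1" by linarith
  hence "b dvd gcd a b" using ab(2) by (metis dvd_refl minus_dvd_iff mult_1 mult_minus1)
  thus ?thesis by (meson dvd_trans gcd_dvd1)
qed

lemma poly_eval_hom: "comm_ring_hom (\<lambda>p. poly p (a :: 'a::comm_ring_1))"
  by standard simp_all

text \<open>Comparing leading coefficients shows that the one of \<open>q\<close> is almost integral
  over \<open>d\<close>, hence divisible by \<open>d\<close>. Subtracting the leading term keeps the
  hypothesis and lowers the degree; the measure places the zero polynomial below the
  constants.\<close>

lemma almost_integral_const_poly:
  fixes T q :: "'v::linorder zpoly poly"
  assumes IH: "\<And>r s t. r \<in> A \<Longrightarrow> s \<in> A \<Longrightarrow> t \<in> A \<Longrightarrow> s \<noteq> 0 \<Longrightarrow> t \<noteq> 0 \<Longrightarrow>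
      (\<And>k. s ^ k dvd t * r ^ k) \<Longrightarrow> s dvd r"
    and A: "A = polys W"
    and T: "T \<noteq> 0" "\<And>i. coeff T i \<in> A"
    and d: "d \<noteq> 0" "d \<in> A"
  shows "(\<And>i. coeff q i \<in> A) \<Longrightarrow> (\<And>k. [:d:] ^ k dvd T * q ^ k) \<Longrightarrow> [:d:] dvd q"
proof (induction "if q = 0 then 0 else Suc (degree q)" arbitrary: q rule: less_induct)
  case less
  show ?case
  proof (cases "q = 0")
    case False
    have "d ^ k dvd lead_coeff T * lead_coeff q ^ k" for k
    proof -
      have "[:d ^ k:] dvd T * q ^ k" using less(3)[of k] by (simp add: poly_const_pow)
      hence "d ^ k dvd lead_coeff (T * q ^ k)" by (simp add: const_poly_dvd_iff)
      thus ?thesis by (simp add: lead_coeff_mult lead_coeff_power)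
    qed
    hence "d dvd lead_coeff q" by (intro IH[of "lead_coeff q" d "lead_coeff T"]) (use d T less(2) in simp_all)
    then obtain e' where e': "lead_coeff q = d * e'" by auto
    \<comment> \<open>The quotient may a priori involve variables outside \<open>W\<close>;
      restricting it gives a quotient in \<open>A\<close>.\<close>
    interpret zr: comm_ring_hom "zrestrict W" by (rule zrestrict_hom)
    define e where "e = zrestrict W e'"
    have e: "lead_coeff q = d * e" "e \<in> A"
    proof -
      have "zrestrict W (lead_coeff q) = d * e" using d by (simp add: e' e_def zr.hom_mult zrestrict_id A)
      thus "lead_coeff q = d * e" using less(2) by (simp add: zrestrict_id A)
      show "e \<in> A" by (simp add: e_def A zrestrict_in_polys)
    qed
    \<comment> \<open>The leading term is removed; the factor 1 only brings the expression into the
      shape of \<open>almost_integral_shift\<close>.\<close>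
    define q' where "q' = 1 * q + [:d:] * (- monom e (degree q))"
    have lc: "coeff q' (degree q) = 0" by (simp add: q'_def e(1))
    have "q' = 0 \<or> degree q' < degree q"
    proof (cases "degree q = 0")
      case True
      have "degree q' \<le> degree q" unfolding q'_def
        by (intro degree_add_le) (auto intro: order.trans[OF degree_monom_le] order.trans[OF degree_smult_le])
      with True lc show ?thesis by (metis degree_eq_zeroE leading_coeff_0_iff le_zero_eq)
    next
      case False
      have "degree q' \<le> degree q" unfolding q'_def
        by (intro degree_add_le) (auto intro: order.trans[OF degree_monom_le] order.trans[OF degree_smult_le])
      with lc show ?thesis by (metis le_neq_implies_less leading_coeff_0_iff)
    qed
    moreover have "coeff q' i \<in> A" for i using less(2) d e(2) by (auto simp: q'_def A)
    moreover have "[:d:] ^ k dvd T * q' ^ k" for k unfolding q'_def by (rule almost_integral_shift) (rule less(3))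
    ultimately have "[:d:] dvd q'" using False by (intro less(1)) auto
    moreover have "q = q' + [:d:] * monom e (degree q)" by (simp add: q'_def)
    ultimately show ?thesis by (metis dvd_add dvd_triv_left)
  qed simp
qed

text \<open>Induction on the variables, avoiding factoriality. Pseudo-division in the new variable
  gives d R = S q + rem; the remainder is again almost integral over S, which forces it to vanish
  for degree reasons. The constant d is then removed coefficient by coefficient.\<close>

lemma zpoly_almost_integral_polys:
  fixes r s t :: "'v::linorder zpoly"
  assumes "finite W" "r \<in> polys W" "s \<in> polys W" "t \<in> polys W" "s \<noteq> 0" "t \<noteq> 0"
    "\<And>k. s ^ k dvd t * r ^ k"
  shows "s dvd r"
  using assms
proof (induction W arbitrary: r s t rule: finite_induct)
  case empty
  then obtain a b c where abc: "r = of_int a" "s = of_int b" "t = of_int c" by (meson polys_empty)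
  have bc: "b \<noteq> 0" "c \<noteq> 0" using empty(4,5) by (simp_all add: abc)
  have "b ^ k dvd c * a ^ k" for k
  proof -
    from empty(6)[of k] obtain w where "t * r ^ k = s ^ k * w" by auto
    hence "eval_zpoly (\<lambda>_. 0 :: int) (t * r ^ k) = eval_zpoly (\<lambda>_. 0) (s ^ k * w)" by simp
    hence "c * a ^ k = b ^ k * eval_zpoly (\<lambda>_. 0) w"
      unfolding abc eval_zpoly_mult eval_hom.hom_power eval_hom.hom_of_int by (simp only: of_int_eq_id id_apply)
    thus ?thesis by (rule dvdI)
  qed
  from almost_integral_int[OF this bc] show ?case by (auto simp: abc)
next
  case (insert x W)
  define \<phi> :: "'v zpoly \<Rightarrow> 'v zpoly poly" where
    "\<phi> = eval_zpoly (\<lambda>v. if v = x then [:0, 1:] else [:Var v:])"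
  define \<psi> where "\<psi> p = poly p (Var x)" for p :: "'v zpoly poly"
  interpret \<phi>: comm_ring_hom \<phi> unfolding \<phi>_def by (rule eval_hom.comm_ring_hom_axioms)
  have psi: "comm_ring_hom \<psi>" unfolding \<psi>_def by (rule poly_eval_hom)
  interpret \<psi>: comm_ring_hom \<psi> by (rule psi)
  have \<psi>\<phi>: "\<psi> (\<phi> f) = f" for f
  proof -
    have "(\<lambda>v. \<psi> (if v = x then [:0, 1:] else [:Var v:])) = Var" by (auto simp: \<psi>_def)
    thus ?thesis unfolding \<phi>_def hom_eval_zpoly[OF psi] by simp
  qed
  have \<phi>_nz: "\<phi> f \<noteq> 0" if "f \<noteq> 0" for f using that \<psi>\<phi>[of f] by auto
  define PX where "PX = {p :: 'v zpoly poly. \<forall>i. coeff p i \<in> polys W}"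
  have PX_mult: "p * q \<in> PX" if "p \<in> PX" "q \<in> PX" for p q using that by (auto simp: PX_def coeff_mult)
  have PX_const: "[:c:] \<in> PX" if "c \<in> polys W" for c
    using that by (auto simp: PX_def coeff_pCons split: nat.splits)
  have PX_sum: "sum p S \<in> PX" if "\<And>i. i \<in> S \<Longrightarrow> p i \<in> PX" for p and S :: "('v \<Rightarrow>\<^sub>0 nat) set"
    using that by (auto simp: PX_def coeff_sum)
  have PX_power: "p ^ k \<in> PX" if "p \<in> PX" for p k by (induction k) (auto simp: that PX_mult PX_const one_pCons)
  have PX_prod: "prod p S \<in> PX" if "\<And>i. i \<in> S \<Longrightarrow> p i \<in> PX" for p and S :: "'v set"
    using that by (induction S rule: infinite_finite_induct) (auto simp: PX_mult PX_const one_pCons)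
  have PX: "\<phi> f \<in> PX" if "f \<in> polys (insert x W)" for f unfolding \<phi>_def eval_zpoly_def of_int_poly
  proof (intro PX_sum PX_mult PX_prod PX_power PX_const polys_closed)
    fix m v assume "m \<in> keys f" "v \<in> keys m"
    with that have "v \<in> insert x W" by (auto simp: polys_def)
    thus "(if v = x then [:0, 1:] else [:Var v:]) \<in> PX" by (auto simp: PX_def coeff_pCons split: nat.splits)
  qed
  define R where "R = \<phi> r"
  define S where "S = \<phi> s"
  define T where "T = \<phi> t"
  have RST: "R \<in> PX" "S \<in> PX" "T \<in> PX" "S \<noteq> 0" "T \<noteq> 0"
    using PX[OF insert(4)] PX[OF insert(5)] PX[OF insert(6)] \<phi>_nz[OF insert(7)] \<phi>_nz[OF insert(8)]
    by (simp_all add: R_def S_def T_def)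
  have dvd: "S ^ k dvd T * R ^ k" for k
  proof -
    from insert(9)[of k] obtain w where "t * r ^ k = s ^ k * w" by auto
    hence "\<phi> (t * r ^ k) = \<phi> (s ^ k * w)" by simp
    thus ?thesis by (auto simp: \<phi>.hom_mult \<phi>.hom_power R_def S_def T_def)
  qed
  obtain q rem where qr: "pseudo_divmod R S = (q, rem)" by (cases "pseudo_divmod R S")
  define d where "d = lead_coeff S ^ (Suc (degree R) - degree S)"
  have div: "[:d:] * R = S * q + rem" and deg: "rem = 0 \<or> degree rem < degree S"
    using pseudo_divmod[OF RST(4) qr] by (auto simp: d_def)
  have rem: "rem = 0"
  proof (rule ccontr)
    assume nz: "rem \<noteq> 0"
    \<comment> \<open>With this exponent the degree of S^k exceeds that of T rem^k by at least one,
      since rem has smaller degree than S.\<close>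
    define k where "k = Suc (degree T)"
    have "rem = [:d:] * R + S * (- q)" using div by simp
    hence "S ^ k dvd T * rem ^ k" using almost_integral_shift[of S T R k "[:d:]" "- q"] dvd by simp
    hence "degree (S ^ k) \<le> degree (T * rem ^ k)" using nz RST by (intro dvd_imp_degree_le) auto
    hence "k * degree S \<le> degree T + k * degree rem" using nz RST by (simp add: degree_power_eq degree_mult_eq)
    moreover have "k * Suc (degree rem) \<le> k * degree S" using deg nz by (intro mult_le_mono2) auto
    ultimately show False by (simp add: k_def)
  qed
  have dA: "d \<in> polys W" "d \<noteq> 0" using RST by (simp_all add: d_def PX_def)
  interpret zr: comm_ring_hom "zrestrict W" by (rule zrestrict_hom)
  \<comment> \<open>Nothing is known about the variables in the pseudo-quotient, so its coefficients
    are restricted to \<open>W\<close>.\<close>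
  define q' where "q' = map_poly (zrestrict W) q"
  have mp: "map_poly (zrestrict W) p = p" if "p \<in> PX" for p
    using that by (intro poly_eqI) (simp add: coeff_map_poly PX_def zrestrict_id)
  have div': "[:d:] * R = S * q'"
  proof -
    have "map_poly (zrestrict W) ([:d:] * R) = map_poly (zrestrict W) (S * q)" using div rem by simp
    moreover have "map_poly (zrestrict W) (a * b) = map_poly (zrestrict W) a * map_poly (zrestrict W) b" for a b
      by (intro poly_eqI) (simp add: coeff_map_poly coeff_mult zr.hom_sum zr.hom_mult)
    ultimately have "map_poly (zrestrict W) [:d:] * map_poly (zrestrict W) R = map_poly (zrestrict W) S * q'"
      by (simp only: q'_def)
    thus ?thesis using RST dA by (simp add: mp PX_const del: mult_pCons_left)
  qed
  have "[:d:] ^ k dvd T * q' ^ k" for k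
  proof -
    from dvd[of k] obtain w where w: "T * R ^ k = S ^ k * w" by auto
    have "S ^ k * ([:d:] ^ k * w) = T * ([:d:] * R) ^ k"
      using w by (simp add: power_mult_distrib mult_ac del: mult_pCons_left mult_pCons_right)
    also have "\<dots> = S ^ k * (T * q' ^ k)" unfolding div' by (simp add: power_mult_distrib mult_ac)
    finally have "[:d:] ^ k * w = T * q' ^ k" using RST by simp
    thus ?thesis by (metis dvd_triv_left)
  qed
  note dvd' = this
  have "[:d:] dvd q'"
  proof (rule almost_integral_const_poly[OF _ refl RST(5) _ dA(2,1) _ dvd'])
    show "s dvd r" if "r \<in> polys W" "s \<in> polys W" "t \<in> polys W" "s \<noteq> 0" "t \<noteq> 0"
      "\<And>k. s ^ k dvd t * r ^ k" for r s t using that by (rule insert.IH)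
    show "coeff T i \<in> polys W" for i using RST(3) by (simp add: PX_def)
    show "coeff q' i \<in> polys W" for i by (simp add: q'_def coeff_map_poly zrestrict_in_polys)
  qed
  then obtain q2 where "q' = [:d:] * q2" by auto
  with div' have "[:d:] * R = [:d:] * (S * q2)" by (simp only: mult_ac)
  hence "R = S * q2" using dA by (simp del: mult_pCons_left)
  hence "\<psi> R = \<psi> S * \<psi> q2" by (simp add: \<psi>.hom_mult)
  thus ?case by (simp add: R_def S_def \<psi>\<phi>)
qed

lemma zpoly_almost_integral:
  fixes r s t :: "'v::linorder zpoly"
  assumes "s \<noteq> 0" "t \<noteq> 0" "\<And>k. s ^ k dvd t * r ^ k"
  shows "s dvd r"
proof -
  obtain V1 V2 V3 where V: "finite V1" "r \<in> polys V1" "finite V2" "s \<in> polys V2" "finite V3" "t \<in> polys V3"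
    using polys_finite_vars[of r] polys_finite_vars[of s] polys_finite_vars[of t] by blast
  show ?thesis
  proof (rule zpoly_almost_integral_polys[OF _ _ _ _ assms])
    show "r \<in> polys (V1 \<union> V2 \<union> V3)" by (rule subsetD[OF polys_mono V(2)]) auto
    show "s \<in> polys (V1 \<union> V2 \<union> V3)" by (rule subsetD[OF polys_mono V(4)]) auto
    show "t \<in> polys (V1 \<union> V2 \<union> V3)" by (rule subsetD[OF polys_mono V(6)]) auto
  qed (use V in auto)
qed

text \<open>The monic equation of degree \<open>m\<close> with lower coefficients
  \<open>g i\<close>, evaluated at the fraction \<open>r\<close>/\<open>s\<close> and cleared of
  denominators.\<close>

definition int_rel :: "nat \<Rightarrow> (nat \<Rightarrow> 'a::comm_ring_1) \<Rightarrow> 'a \<Rightarrow> 'a \<Rightarrow> 'a" where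
  "int_rel m g r s = r ^ m + (\<Sum>i<m. g i * r ^ i * s ^ (m - i))"

text \<open>An integral fraction is almost integral: the equation lowers every exponent above
  \<open>m\<close>, so \<open>s ^ m\<close> is a denominator of all powers of
  \<open>r\<close>/\<open>s\<close>.\<close>

lemma zpoly_integrally_closed:
  fixes r s :: "'v::linorder zpoly"
  assumes "s \<noteq> 0" "int_rel m g r s = 0"
  shows "s dvd r"
proof (rule zpoly_almost_integral)
  show "s ^ k dvd s ^ m * r ^ k" for k
  proof (induction k rule: less_induct)
    case (less k)
    show ?case
    proof (cases "k \<le> m")
      case True
      thus ?thesis by (simp add: le_imp_power_dvd)
    next
      case False
      have "r ^ m = - (\<Sum>i<m. g i * r ^ i * s ^ (m - i))"
        using assms(2) by (simp add: int_rel_def eq_neg_iff_add_eq_0)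
      moreover have "r ^ k = r ^ (k - m) * r ^ m" using False by (simp flip: power_add)
      ultimately have "s ^ m * r ^ k = s ^ m * (r ^ (k - m) * - (\<Sum>i<m. g i * r ^ i * s ^ (m - i)))" by simp
      also have "\<dots> = - (\<Sum>i<m. g i * (s ^ (m - i) * (s ^ m * r ^ (k - m + i))))"
        by (simp add: sum_distrib_left power_add mult_ac)
      also have "s ^ k dvd \<dots>" unfolding dvd_minus_iff
      proof (intro dvd_sum)
        fix i assume i: "i \<in> {..<m}"
        hence "s ^ k = s ^ (m - i) * s ^ (k - m + i)" using False by (simp flip: power_add)
        moreover have "s ^ (k - m + i) dvd s ^ m * r ^ (k - m + i)" using i False by (intro less) auto
        ultimately have "s ^ k dvd s ^ (m - i) * (s ^ m * r ^ (k - m + i))" by (simp add: mult_dvd_mono)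
        thus "s ^ k dvd g i * (s ^ (m - i) * (s ^ m * r ^ (k - m + i)))" by (rule dvd_mult)
      qed
      finally show ?thesis .
    qed
  qed
qed (use assms in auto)

section \<open>The Pfaffian characteristic series\<close>

text \<open>Alternating matrices are written here in the basis \<open>e\<^sub>0, f\<^sub>0, e\<^sub>1, f\<^sub>1, \<dots>\<close>, so that the symplectic
  form is block diagonal and truncation to the first \<open>m\<close> hyperbolic planes is a leading block.
  \<open>amap z\<close> is the matrix of the endomorphism \<open>A\<close> corresponding to the bivector \<open>z\<close>, and \<open>zz z m k\<close>
  is the bivector of \<open>A\<^sup>k\<^sup>+\<^sup>1\<close>, with the inner summations restricted to the first \<open>m\<close> planes.\<close>

definition amap :: "(nat \<Rightarrow> nat \<Rightarrow> 'a::comm_ring_1) \<Rightarrow> nat \<Rightarrow> nat \<Rightarrow> 'a" where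
  "amap z p q = (if even q then z p (Suc q) else - z p (q - 1))"

fun zz :: "(nat \<Rightarrow> nat \<Rightarrow> 'a::comm_ring_1) \<Rightarrow> nat \<Rightarrow> nat \<Rightarrow> nat \<Rightarrow> nat \<Rightarrow> 'a" where
  "zz z m 0 p r = z p r"
| "zz z m (Suc k) p r = (\<Sum>q<2 * m. amap z p q * zz z m k q r)"

definition altz :: "(nat \<Rightarrow> nat \<Rightarrow> 'a::comm_ring_1) \<Rightarrow> bool" where
  "altz z \<longleftrightarrow> (\<forall>p q. z p q = - z q p) \<and> (\<forall>p. z p p = 0)"

text \<open>The Schur complement of 1 - s A on the first \<open>m\<close> planes, inside 1 - s A on
  one plane more, is a scalar matrix of size 2. This is its scalar, so the product
  \<open>gser\<close> of these factors is a square root of the determinant.\<close>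

definition gfac :: "(nat \<Rightarrow> nat \<Rightarrow> 'a::comm_ring_1) \<Rightarrow> nat \<Rightarrow> 'a fps" where
  "gfac z m = 1 - fps_X * Abs_fps (\<lambda>k. zz z m k (2 * m) (Suc (2 * m)))"

fun gser :: "(nat \<Rightarrow> nat \<Rightarrow> 'a::comm_ring_1) \<Rightarrow> nat \<Rightarrow> 'a fps" where
  "gser z 0 = 1"
| "gser z (Suc m) = gser z m * gfac z m"

lemma sum_lessThan_double: "(\<Sum>q<2 * m. f q) = (\<Sum>j<m. f (2 * j) + f (Suc (2 * j)) :: 'a::comm_monoid_add)"
  by (induction m) (simp_all add: add_ac)

lemma sum_alternating:
  fixes c :: "nat \<Rightarrow> nat \<Rightarrow> 'a::comm_ring_1"
  assumes "altz c"
  shows "(\<Sum>p<N. \<Sum>q<N. x p * (c p q * x q)) = 0"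
proof (induction N)
  case (Suc N)
  have "(\<Sum>p<N. x p * (c p N * x N)) = - (\<Sum>q<N. x N * (c N q * x q))" unfolding sum_negf[symmetric]
  proof (intro sum.cong refl)
    fix p
    have "c p N = - c N p" using assms unfolding altz_def by blast
    thus "x p * (c p N * x N) = - (x N * (c N p * x p))" by (simp add: mult_ac)
  qed
  moreover have "c N N = 0" using assms unfolding altz_def by blast
  ultimately show ?case using Suc by (simp add: sum.distrib)
qed simp

text \<open>Self-adjointness: the outermost factor may be peeled off on the right instead of on the
  left.\<close>

lemma zz_commute:
  assumes "altz z"
  shows "zz z m (Suc k) p r = (\<Sum>q<2 * m. amap z r q * zz z m k p q)"
proof (induction k arbitrary: p r)
  case 0
  have z: "z a b = - z b a" for a b using assms unfolding altz_def by blast+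
  show ?case unfolding zz.simps sum_lessThan_double
  proof (intro sum.cong refl)
    fix j
    show "amap z p (2 * j) * z (2 * j) r + amap z p (Suc (2 * j)) * z (Suc (2 * j)) r
        = amap z r (2 * j) * z p (2 * j) + amap z r (Suc (2 * j)) * z p (Suc (2 * j))"
      by (simp add: amap_def z[of "2 * j" r] z[of "Suc (2 * j)" r] mult.commute[of "z r _"])
  qed
next
  case (Suc k)
  have "zz z m (Suc (Suc k)) p r = (\<Sum>q<2 * m. amap z p q * (\<Sum>q'<2 * m. amap z r q' * zz z m k q q'))"
    by (subst zz.simps(2)) (simp add: Suc del: zz.simps(2))
  also have "\<dots> = (\<Sum>q'<2 * m. \<Sum>q<2 * m. amap z r q' * (amap z p q * zz z m k q q'))"
    by (subst sum.swap) (simp add: sum_distrib_left mult_ac)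
  also have "\<dots> = (\<Sum>q'<2 * m. amap z r q' * zz z m (Suc k) p q')" by (simp add: sum_distrib_left)
  finally show ?case .
qed

text \<open>The vanishing diagonal does not follow from skew-symmetry in characteristic 2. Moving
  one factor to each side exhibits a diagonal entry as the value of a lower alternating form at a
  single vector; hence the induction in steps of two.\<close>

lemma altz_zz:
  assumes "altz z"
  shows "altz (zz z m k)"
proof (induction k rule: less_induct)
  case (less k)
  consider "k = 0" | "k = 1" | l where "k = Suc (Suc l)" by (metis One_nat_def not0_implies_Suc)
  thus ?case
  proof cases
    case 1
    moreover have "zz z m 0 = z" by (intro ext) simp
    ultimately show ?thesis using assms by simp
  next
    case 2
    have z: "z a b = - z b a" "z a a = 0" for a b using assms unfolding altz_def by blast+
    have "zz z m 1 p r = - zz z m 1 r p" for p r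
    proof -
      have "zz z m 1 p r = (\<Sum>q<2 * m. amap z r q * z p q)" using zz_commute[OF assms, of m 0] by simp
      also have "\<dots> = (\<Sum>q<2 * m. - (amap z r q * z q p))" by (intro sum.cong refl, subst z(1)[of p]) simp
      finally show ?thesis by (simp add: sum_negf)
    qed
    moreover have "zz z m 1 p p = 0" for p
    proof -
      have "amap z p (2 * j) * z (2 * j) p + amap z p (Suc (2 * j)) * z (Suc (2 * j)) p = 0" for j
        by (simp add: amap_def z(1)[of "2 * j" p] z(1)[of "Suc (2 * j)" p])
      thus ?thesis by (simp add: sum_lessThan_double)
    qed
    ultimately show ?thesis unfolding altz_def 2 by blast
  next
    case 3
    have l: "altz (zz z m l)" "altz (zz z m (Suc l))" using less 3 by auto
    have "zz z m k p r = - zz z m k r p" for p r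
    proof -
      have "zz z m k p r = (\<Sum>q<2 * m. amap z r q * zz z m (Suc l) p q)" unfolding 3 by (rule zz_commute[OF assms])
      also have "\<dots> = (\<Sum>q<2 * m. - (amap z r q * zz z m (Suc l) q p))"
      proof (intro sum.cong refl)
        fix q
        have "zz z m (Suc l) p q = - zz z m (Suc l) q p" using l(2) unfolding altz_def by blast
        thus "amap z r q * zz z m (Suc l) p q = - (amap z r q * zz z m (Suc l) q p)" by simp
      qed
      finally show ?thesis by (simp add: 3 sum_negf)
    qed
    moreover have "zz z m k p p = 0" for p
    proof -
      have "zz z m k p p = (\<Sum>q<2 * m. amap z p q * zz z m (Suc l) q p)" by (simp add: 3)
      also have "\<dots> = (\<Sum>q<2 * m. \<Sum>q'<2 * m. amap z p q * (zz z m l q q' * amap z p q'))"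
        by (simp add: zz_commute[OF assms] sum_distrib_left mult_ac del: zz.simps(2))
      also have "\<dots> = 0" by (rule sum_alternating[OF l(1)])
      finally show ?thesis .
    qed
    ultimately show ?thesis unfolding altz_def by blast
  qed
qed

definition dmat :: "(nat \<Rightarrow> nat \<Rightarrow> 'a::comm_ring_1) \<Rightarrow> nat \<Rightarrow> 'a fps mat" where
  "dmat z m = mat (2 * m) (2 * m) (\<lambda>(p, q). (if p = q then 1 else 0) - fps_X * fps_const (amap z p q))"

text \<open>Block elimination of the last plane: the determinant gets multiplied by that of the
  scalar Schur complement, which is the square of \<open>gfac z m\<close>.\<close>

lemma gser_square:
  fixes z :: "nat \<Rightarrow> nat \<Rightarrow> 'a::idom"
  assumes "altz z"
  shows "gser z m ^ 2 = det (dmat z m)"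
proof (induction m)
  case 0
  thus ?case by (simp add: dmat_def)
next
  case (Suc m)
  define w where "w k p r = amap (zz z m k) p r" for k p r
  have w0: "w 0 p r = amap z p r" for p r by (simp add: w_def amap_def)
  have wS: "w (Suc k) p r = (\<Sum>q<2 * m. amap z p q * w k q r)" for k p r by (simp add: w_def amap_def sum_negf)
  \<comment> \<open>The geometric series for (1 - s A)^(-1) s A, with inner summation over the first
    \<open>m\<close> planes.\<close>
  define W where "W p r = fps_X * Abs_fps (\<lambda>k. w k p r)" for p r
  have W_eq: "W p r - fps_X * (\<Sum>q<2 * m. fps_const (amap z p q) * W q r) = fps_X * fps_const (amap z p r)" for p r
  proof -
    have "Abs_fps (\<lambda>k. w k p r) - fps_X * (\<Sum>q<2 * m. fps_const (amap z p q) * Abs_fps (\<lambda>k. w k q r)) = fps_const (amap z p r)"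
    proof (rule fps_ext)
      fix k show "fps_nth (Abs_fps (\<lambda>k. w k p r) - fps_X * (\<Sum>q<2 * m. fps_const (amap z p q) * Abs_fps (\<lambda>k. w k q r))) k = fps_nth (fps_const (amap z p r)) k"
        by (cases k) (simp_all add: w0 wS fps_sum_nth)
    qed
    from arg_cong[OF this, of "(*) fps_X"] show ?thesis
      by (simp add: W_def right_diff_distrib sum_distrib_left mult_ac)
  qed
  have alt: "altz (zz z m k)" for k by (rule altz_zz[OF assms])
  \<comment> \<open>Alternation makes the corner block of size 2 scalar: its off-diagonal entries
    are diagonal entries of \<open>zz\<close>, and the two others are equal by
    skew-symmetry.\<close>
  have w_end: "w k (2 * m + a) (2 * m + b) = (if a = b then zz z m k (2 * m) (Suc (2 * m)) else 0)"
    if "a < 2" "b < 2" for a b k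
  proof -
    have "zz z m k (Suc (2 * m)) (2 * m) = - zz z m k (2 * m) (Suc (2 * m))" "zz z m k p p = 0" for p
      using alt[of k] unfolding altz_def by blast+
    moreover have "a = 0 \<or> a = 1" "b = 0 \<or> b = 1" using that by auto
    ultimately show ?thesis by (auto simp: w_def amap_def)
  qed
  have D: "(if a = b then 1 else 0) - W (2 * m + a) (2 * m + b) = (if a = b then gfac z m else 0)"
    if "a < 2" "b < 2" for a b
    using w_end[OF that] by (simp add: W_def gfac_def flip: fps_const_0_eq_0) (simp add: fps_zero_def[symmetric])
  define e where "e a b = (if a = b then 1 else 0 :: 'a fps)" for a b :: nat
  define M11 where "M11 = dmat z m"
  define M12 where "M12 = mat (2 * m) 2 (\<lambda>(p, b). - (fps_X * fps_const (amap z p (2 * m + b))))"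
  define M21 where "M21 = mat 2 (2 * m) (\<lambda>(a, q). - (fps_X * fps_const (amap z (2 * m + a) q)))"
  define M22 where "M22 = mat 2 2 (\<lambda>(a, b). e a b - fps_X * fps_const (amap z (2 * m + a) (2 * m + b)))"
  define T12 where "T12 = mat (2 * m) 2 (\<lambda>(p, b). W p (2 * m + b))"
  have carr [simp]: "M11 \<in> carrier_mat (2 * m) (2 * m)" "M12 \<in> carrier_mat (2 * m) 2"
    "M21 \<in> carrier_mat 2 (2 * m)" "M22 \<in> carrier_mat 2 2" "T12 \<in> carrier_mat (2 * m) 2"
    by (simp_all add: M11_def M12_def M21_def M22_def T12_def dmat_def)
  have dims [simp]: "dim_row M12 = 2 * m" "dim_col M12 = 2" "dim_row M22 = 2" "dim_col M22 = 2"
    by (simp_all add: M12_def M22_def)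
  have block: "dmat z (Suc m) = four_block_mat M11 M12 M21 M22" by (rule eq_matI)
      (auto simp: dmat_def M11_def M12_def M21_def M22_def e_def index_mat_four_block)
  \<comment> \<open>Right multiplication by this unipotent matrix clears the upper right block and
    leaves the Schur complement in the corner.\<close>
  define T where "T = four_block_mat (1\<^sub>m (2 * m)) T12 (0\<^sub>m 2 (2 * m)) (1\<^sub>m 2)"
  have Tc: "T \<in> carrier_mat (2 * m + 2) (2 * m + 2)" unfolding T_def by (intro four_block_carrier_mat) simp_all
  have detT: "det T = 1" unfolding T_def by (subst det_four_block_mat_lower_left_zero[of _ "2 * m" _ 2]) simp_all
  let ?D = "gfac z m \<cdot>\<^sub>m 1\<^sub>m 2"
  have M12': "M11 * T12 + M12 = 0\<^sub>m (2 * m) 2"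
  proof (rule eq_matI)
    fix p b assume "p < dim_row (0\<^sub>m (2 * m) 2)" "b < dim_col (0\<^sub>m (2 * m) 2)"
    hence pb: "p < 2 * m" "b < 2" by auto
    have "(M11 * T12) $$ (p, b) = (\<Sum>q<2 * m. ((if p = q then 1 else 0) - fps_X * fps_const (amap z p q)) * W q (2 * m + b))"
      using pb by (simp add: M11_def T12_def dmat_def scalar_prod_def atLeast0LessThan)
    also have "\<dots> = (\<Sum>q<2 * m. (if p = q then 1 else 0) * W q (2 * m + b))
        - fps_X * (\<Sum>q<2 * m. fps_const (amap z p q) * W q (2 * m + b))"
      by (simp add: left_diff_distrib sum_subtractf sum_distrib_left mult.assoc)
    also have "(\<Sum>q<2 * m. (if p = q then 1 else 0) * W q (2 * m + b)) = (\<Sum>q<2 * m. if p = q then W q (2 * m + b) else 0)"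
      by (intro sum.cong) auto
    also have "\<dots> = W p (2 * m + b)" using pb by simp
    also have "\<dots> - fps_X * (\<Sum>q<2 * m. fps_const (amap z p q) * W q (2 * m + b)) = fps_X * fps_const (amap z p (2 * m + b))"
      by (rule W_eq)
    finally show "(M11 * T12 + M12) $$ (p, b) = 0\<^sub>m (2 * m) 2 $$ (p, b)"
      using pb carr by (simp add: M12_def index_add_mat(1) del: index_mult_mat)
  qed (use carr in auto)
  have M22': "M21 * T12 + M22 = ?D"
  proof (rule eq_matI)
    fix a b assume "a < dim_row ?D" "b < dim_col ?D"
    hence ab: "a < 2" "b < 2" by auto
    have "(M21 * T12) $$ (a, b) = - (fps_X * (\<Sum>q<2 * m. fps_const (amap z (2 * m + a) q) * W q (2 * m + b)))"
      using ab by (simp add: M21_def T12_def scalar_prod_def atLeast0LessThan sum_negf sum_distrib_left mult.assoc)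
    hence "(M21 * T12 + M22) $$ (a, b) = e a b - W (2 * m + a) (2 * m + b)"
      using ab carr W_eq[of "2 * m + a" "2 * m + b", symmetric]
      by (simp add: M22_def index_add_mat(1) del: index_mult_mat)
    also have "\<dots> = ?D $$ (a, b)" using D[OF ab] ab by (auto simp: e_def)
    finally show "(M21 * T12 + M22) $$ (a, b) = ?D $$ (a, b)" .
  qed (use carr in auto)
  have "dmat z (Suc m) * T = four_block_mat M11 (0\<^sub>m (2 * m) 2) M21 ?D"
    unfolding block T_def M12'[symmetric] M22'[symmetric]
    by (subst mult_four_block_mat[of _ "2 * m" "2 * m" _ 2 _ 2 _ _ "2 * m" _ 2])
      (simp_all add: right_mult_one_mat[OF carr(1)] right_mult_one_mat[OF carr(3)]
        right_add_zero_mat[OF carr(1)] right_add_zero_mat[OF carr(3)])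
  moreover have "dmat z (Suc m) \<in> carrier_mat (2 * m + 2) (2 * m + 2)" by (simp add: dmat_def)
  ultimately have "det (dmat z (Suc m)) * det T = det (four_block_mat M11 (0\<^sub>m (2 * m) 2) M21 ?D)"
    using det_mult[OF _ Tc, of "dmat z (Suc m)"] by simp
  also have "\<dots> = det M11 * det ?D" by (rule det_four_block_mat_upper_right_zero[of _ "2 * m" _ 2]) simp_all
  finally show ?case using Suc by (simp add: detT M11_def power_mult_distrib)
qed

lemma zz_hom:
  assumes "comm_ring_hom h"
  shows "zz (\<lambda>p q. h (z p q)) m k p r = h (zz z m k p r)"
proof -
  interpret comm_ring_hom h by fact
  have "amap (\<lambda>p q. h (z p q)) p q = h (amap z p q)" for p q by (simp add: amap_def hom_uminus)
  thus ?thesis by (induction k arbitrary: p r) (simp_all add: hom_sum hom_mult)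
qed

lemma gser_hom:
  assumes "comm_ring_hom h"
  shows "fps_nth (gser (\<lambda>p q. h (z p q)) m) j = h (fps_nth (gser z m) j)"
proof -
  interpret comm_ring_hom h by fact
  have "fps_nth (gfac (\<lambda>p q. h (z p q)) m) j = h (fps_nth (gfac z m) j)" for m j
    by (cases j) (simp_all add: gfac_def zz_hom[OF assms] hom_minus hom_uminus)
  thus ?thesis by (induction m arbitrary: j) (simp_all add: fps_mult_nth hom_sum hom_mult)
qed

lemma gser_0 [simp]: "fps_nth (gser z m) 0 = 1"
  by (induction m) (simp_all add: gfac_def)

section \<open>Bivectors as self-adjoint endomorphisms\<close>

abbreviation sq_mats :: "nat \<Rightarrow> 'a mat set" where
  "sq_mats n \<equiv> carrier_mat (2 * n) (2 * n)"

lemma symp_form_carrier [simp]: "symp_form n \<in> sq_mats n"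
  "dim_row (symp_form n) = 2 * n" "dim_col (symp_form n) = 2 * n" by (simp_all add: symp_form_def)

lemma sum_symp_form_right:
  fixes a :: "nat \<Rightarrow> 'a::comm_ring_1"
  assumes "j < 2 * n"
  shows "(\<Sum>k<2 * n. a k * symp_form n $$ (k, j)) = (if j < n then - a (j + n) else a (j - n))"
proof -
  have "(\<Sum>k<2 * n. a k * symp_form n $$ (k, j)) =
      (\<Sum>k<2 * n. if k = (if j < n then j + n else j - n) then (if j < n then - a k else a k) else 0)"
    by (intro sum.cong refl) (use assms in \<open>auto simp: symp_form_def\<close>)
  also have "\<dots> = (if j < n then - a (j + n) else a (j - n))" using assms by (subst sum.delta) auto
  finally show ?thesis .
qed

lemma sum_symp_form_left:
  fixes a :: "nat \<Rightarrow> 'a::comm_ring_1"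
  assumes "i < 2 * n"
  shows "(\<Sum>k<2 * n. symp_form n $$ (i, k) * a k) = (if i < n then a (i + n) else - a (i - n))"
proof -
  have "(\<Sum>k<2 * n. symp_form n $$ (i, k) * a k) = (\<Sum>k<2 * n. - a k * symp_form n $$ (k, i))"
    by (intro sum.cong refl) (use assms in \<open>auto simp: symp_form_def\<close>)
  thus ?thesis using sum_symp_form_right[OF assms, of "\<lambda>k. - a k"] by simp
qed

lemma index_mult_sum:
  assumes "A \<in> carrier_mat nr n" "B \<in> carrier_mat n nc" "i < nr" "j < nc"
  shows "(A * B) $$ (i, j) = (\<Sum>k<n. A $$ (i, k) * B $$ (k, j))"
  using assms by (simp add: scalar_prod_def atLeast0LessThan)

lemmas sq_assoc = assoc_mult_mat[of _ "2 * n" "2 * n" _ "2 * n" _ "2 * n" for n]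
  and sq_mult = mult_carrier_mat[of _ "2 * n" "2 * n" _ "2 * n" for n]
  and sq_transpose = transpose_mult[of _ "2 * n" "2 * n" _ "2 * n" for n]
  and sq_assoc_vec = assoc_mult_mat_vec[of _ "2 * n" "2 * n" _ "2 * n" for n]
  and sq_left_one = left_mult_one_mat[of _ "2 * n" "2 * n" for n]
  and sq_mult_vec = mult_mat_vec_carrier[of _ "2 * n" "2 * n" for n]
  and sq_index = index_mult_sum[of _ "2 * n" "2 * n" _ "2 * n" for n]

lemma symp_form_orthogonal: "(symp_form n)\<^sup>T * symp_form n = 1\<^sub>m (2 * n)"
proof (rule eq_matI)
  fix i j assume "i < dim_row (1\<^sub>m (2 * n))" "j < dim_col (1\<^sub>m (2 * n))"
  hence ij: "i < 2 * n" "j < 2 * n" by auto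
  have "((symp_form n)\<^sup>T * symp_form n) $$ (i, j) = (\<Sum>k<2 * n. symp_form n $$ (k, i) * symp_form n $$ (k, j))"
    using ij by (subst sq_index[of _ n]) auto
  also have "\<dots> = 1\<^sub>m (2 * n) $$ (i, j)"
    unfolding sum_symp_form_right[OF ij(2)] using ij by (auto simp: symp_form_def)
  finally show "((symp_form n)\<^sup>T * symp_form n) $$ (i, j) = 1\<^sub>m (2 * n) $$ (i, j)" .
qed auto

definition amat :: "nat \<Rightarrow> 'a::comm_ring_1 mat \<Rightarrow> 'a mat" where
  "amat n Y = Y * (symp_form n)\<^sup>T"

lemma amat_carrier [simp]: "Y \<in> sq_mats n \<Longrightarrow> amat n Y \<in> sq_mats n"
  unfolding amat_def by (rule mult_carrier_mat) auto

lemma amat_index: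
  assumes "Y \<in> sq_mats n" "i < 2 * n" "j < 2 * n"
  shows "amat n Y $$ (i, j) = (if j < n then Y $$ (i, j + n) else - Y $$ (i, j - n))"
proof -
  have "amat n Y $$ (i, j) = (\<Sum>k<2 * n. Y $$ (i, k) * symp_form n $$ (j, k))"
    unfolding amat_def using assms by (subst sq_index[of _ n]) auto
  also have "\<dots> = (\<Sum>k<2 * n. symp_form n $$ (j, k) * Y $$ (i, k))" by (simp add: mult.commute)
  finally show ?thesis by (simp add: sum_symp_form_left[OF assms(3)])
qed

text \<open>The index, in the basis e_0, ..., f_0, ... used by \<open>symp_form\<close>, of the
  vector number \<open>p\<close> of e_0, f_0, e_1, f_1, ...\<close>

definition pos :: "nat \<Rightarrow> nat \<Rightarrow> nat" where
  "pos n p = (if even p then p div 2 else p div 2 + n)"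

definition zmat :: "nat \<Rightarrow> 'a::comm_ring_1 mat \<Rightarrow> nat \<Rightarrow> nat \<Rightarrow> 'a" where
  "zmat n Y p q = (if p < 2 * n \<and> q < 2 * n then Y $$ (pos n p, pos n q) else 0)"

lemma pos_less: "p < 2 * n \<Longrightarrow> pos n p < 2 * n"
  by (auto simp: pos_def)

lemma pos_double [simp]: "pos n (2 * i) = i" "pos n (Suc (2 * i)) = i + n"
  by (simp_all add: pos_def)

lemma alt_matD:
  assumes "Y \<in> alt_mat m"
  shows "Y \<in> carrier_mat m m" "i < m \<Longrightarrow> j < m \<Longrightarrow> Y $$ (i, j) = - Y $$ (j, i)" "i < m \<Longrightarrow> Y $$ (i, i) = 0"
proof -
  show Y: "Y \<in> carrier_mat m m" "i < m \<Longrightarrow> Y $$ (i, i) = 0" using assms by (auto simp: alt_mat_def)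
  assume ij: "i < m" "j < m"
  have "Y\<^sup>T = - Y" using assms by (simp add: alt_mat_def)
  hence "Y\<^sup>T $$ (j, i) = (- Y) $$ (j, i)" by simp
  thus "Y $$ (i, j) = - Y $$ (j, i)" using Y ij by simp
qed

lemma alt_matI:
  assumes "Y \<in> carrier_mat m m" "\<And>i j. i < m \<Longrightarrow> j < m \<Longrightarrow> Y $$ (i, j) = - Y $$ (j, i)"
    "\<And>i. i < m \<Longrightarrow> Y $$ (i, i) = 0"
  shows "Y \<in> alt_mat m"
proof -
  have "Y\<^sup>T = - Y"
  proof (rule eq_matI)
    fix i j assume "i < dim_row (- Y)" "j < dim_col (- Y)"
    thus "Y\<^sup>T $$ (i, j) = (- Y) $$ (i, j)" using assms(1) assms(2)[of j i] by simp
  qed (use assms(1) in auto)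
  thus ?thesis using assms(1,3) by (simp add: alt_mat_def)
qed

lemma altz_zmat:
  assumes "Y \<in> alt_mat (2 * n)"
  shows "altz (zmat n Y)"
  unfolding altz_def
proof (intro conjI allI)
  show "zmat n Y p q = - zmat n Y q p" for p q
    using alt_matD(2)[OF assms pos_less pos_less, of p q] by (auto simp: zmat_def)
  show "zmat n Y p p = 0" for p using alt_matD(3)[OF assms pos_less, of p] by (auto simp: zmat_def)
qed

lemma amap_zmat:
  assumes "Y \<in> sq_mats n" "p < 2 * n" "q < 2 * n"
  shows "amap (zmat n Y) p q = amat n Y $$ (pos n p, pos n q)"
proof (cases "even q")
  case True
  then obtain j where "q = 2 * j" by (elim evenE)
  thus ?thesis using assms pos_less[of p n] by (simp add: amap_def amat_index zmat_def)
next
  case False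
  then obtain j where "q = Suc (2 * j)" by (elim oddE) simp
  thus ?thesis using assms pos_less[of p n] by (simp add: amap_def amat_index zmat_def)
qed

lemma det_permute_both:
  fixes A :: "'a::comm_ring_1 mat"
  assumes A: "A \<in> carrier_mat n n" and p: "p permutes {0..<n}"
  shows "det (mat n n (\<lambda>(i, j). A $$ (p i, p j))) = det A"
proof -
  have pl: "i < n \<Longrightarrow> p i < n" for i using permutes_in_image[OF p, of i] by simp
  define B where "B = mat n n (\<lambda>(i, j). A $$ (p i, j))"
  have B: "B \<in> carrier_mat n n" by (simp add: B_def)
  have "mat n n (\<lambda>(i, j). A $$ (p i, p j)) = (mat n n (\<lambda>(i, j). B\<^sup>T $$ (p i, j)))\<^sup>T"
    by (rule eq_matI) (auto simp: B_def pl)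
  also have "det \<dots> = signof p * det B\<^sup>T"
    by (subst det_transpose[of _ n]) (use det_permute_rows[of "B\<^sup>T" n p] B p in auto)
  also have "det B\<^sup>T = det B" by (rule det_transpose[OF B])
  also have "det B = signof p * det A" unfolding B_def by (rule det_permute_rows[OF A p])
  also have "signof p * (signof p * det A) = det A" by (simp add: sign_def)
  finally show ?thesis .
qed

definition charmat :: "nat \<Rightarrow> 'a::comm_ring_1 mat \<Rightarrow> 'a fps mat" where
  "charmat n C = mat n n (\<lambda>(i, j). (if i = j then 1 else 0) - fps_X * fps_const (C $$ (i, j)))"

lemma det_dmat_zmat:
  assumes "Y \<in> sq_mats n"
  shows "det (dmat (zmat n Y) n) = det (charmat (2 * n) (amat n Y))"
proof -
  define p where "p i = (if i < 2 * n then pos n i else i)" for i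
  have inj: "inj_on p {0..<2 * n}"
  proof (rule inj_onI)
    fix i j assume ij: "i \<in> {0..<2 * n}" "j \<in> {0..<2 * n}" and eq: "p i = p j"
    have "i div 2 < n" "j div 2 < n" using ij by auto
    hence "even i = even j \<and> i div 2 = j div 2" using eq ij by (auto simp: p_def pos_def split: if_splits)
    thus "i = j" by (metis dvd_mult_div_cancel odd_two_times_div_two_succ)
  qed
  have "p ` {0..<2 * n} \<subseteq> {0..<2 * n}" using pos_less by (auto simp: p_def)
  hence "bij_betw p {0..<2 * n} {0..<2 * n}" using inj by (simp add: bij_betw_def endo_inj_surj)
  hence p: "p permutes {0..<2 * n}" by (intro bij_imp_permutes) (auto simp: p_def)
  have "i < 2 * n \<Longrightarrow> j < 2 * n \<Longrightarrow> p i = p j \<longleftrightarrow> i = j" for i j using inj by (auto dest: inj_onD)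
  hence "dmat (zmat n Y) n = mat (2 * n) (2 * n) (\<lambda>(i, j). charmat (2 * n) (amat n Y) $$ (p i, p j))"
    using pos_less[of _ n] by (intro eq_matI) (auto simp: dmat_def charmat_def amap_zmat[OF assms] p_def)
  thus ?thesis using det_permute_both[OF _ p, of "charmat (2 * n) (amat n Y)"] by (simp add: charmat_def)
qed

definition gpol :: "nat \<Rightarrow> 'a::comm_ring_1 mat \<Rightarrow> 'a fps" where
  "gpol n Y = gser (zmat n Y) n"

lemma gpol_square:
  fixes Y :: "'a::idom mat"
  assumes "Y \<in> alt_mat (2 * n)"
  shows "gpol n Y ^ 2 = det (charmat (2 * n) (amat n Y))"
  unfolding gpol_def gser_square[OF altz_zmat[OF assms]] det_dmat_zmat[OF alt_matD(1)[OF assms]] ..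

text \<open>If the roots differed by a sign, the constant terms would give -1 = 1, and then the sign
  makes no difference.\<close>

lemma fps_square_unique:
  fixes f h :: "'a::idom fps"
  assumes "f ^ 2 = h ^ 2" "fps_nth f 0 = 1" "fps_nth h 0 = 1"
  shows "f = h"
proof -
  have "f = h \<or> f = - h" using assms(1) by (simp add: power2_eq_iff)
  moreover have "f = h" if eq: "f = - h"
  proof -
    have "fps_nth f 0 = - fps_nth h 0" unfolding eq by simp
    hence "(- 1 :: 'a) = 1" using assms(2,3) by simp
    hence "- a = a" for a :: 'a by (metis mult_1 mult_minus_left)
    hence "- h = h" by (intro fps_ext) simp
    with eq show ?thesis by simp
  qed
  ultimately show ?thesis by blast
qed

lemma gpol_0 [simp]: "fps_nth (gpol n Y) 0 = 1"
  by (simp add: gpol_def)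

lemma gpol_unique:
  fixes Y Y' :: "'a::idom mat"
  assumes "Y \<in> alt_mat (2 * n)" "Y' \<in> alt_mat (2 * n)"
    and "det (charmat (2 * n) (amat n Y)) = det (charmat (2 * n) (amat n Y'))"
  shows "gpol n Y = gpol n Y'"
  by (rule fps_square_unique) (use assms in \<open>simp_all add: gpol_square\<close>)

lemma charmat_intertwine:
  fixes C D g :: "'a::idom mat"
  assumes C: "C \<in> carrier_mat n n" and D: "D \<in> carrier_mat n n" and g: "g \<in> carrier_mat n n"
    and eq: "D * g = g * C" and nz: "det g \<noteq> 0"
  shows "det (charmat n C) = det (charmat n D)"
proof -
  define G where "G = map_mat fps_const g"
  have G: "G \<in> carrier_mat n n" using g by (simp add: G_def)
  interpret h: comm_ring_hom "fps_const :: 'a \<Rightarrow> 'a fps" by standard simp_all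
  have "charmat n D * G = G * charmat n C"
  proof (rule eq_matI)
    fix i j assume "i < dim_row (G * charmat n C)" "j < dim_col (G * charmat n C)"
    hence ij: "i < n" "j < n" using G by (auto simp: charmat_def)
    have Dg: "fps_const ((D * g) $$ (i, j)) = (\<Sum>k<n. fps_const (D $$ (i, k)) * fps_const (g $$ (k, j)))"
      unfolding index_mult_sum[OF D g ij] h.hom_sum h.hom_mult ..
    have gC: "fps_const ((g * C) $$ (i, j)) = (\<Sum>k<n. fps_const (g $$ (i, k)) * fps_const (C $$ (k, j)))"
      unfolding index_mult_sum[OF g C ij] h.hom_sum h.hom_mult ..
    have "(charmat n D * G) $$ (i, j) = (\<Sum>k<n. (if k = i then fps_const (g $$ (k, j)) else 0) -
        fps_X * (fps_const (D $$ (i, k)) * fps_const (g $$ (k, j))))"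
      using ij g by (subst index_mult_sum[of _ n n _ n])
        (auto simp: charmat_def G_def left_diff_distrib mult.assoc intro!: sum.cong)
    also have "\<dots> = fps_const (g $$ (i, j)) - fps_X * fps_const ((D * g) $$ (i, j))"
      using ij by (simp add: sum_subtractf Dg sum_distrib_left)
    also have "\<dots> = fps_const (g $$ (i, j)) - fps_X * fps_const ((g * C) $$ (i, j))" by (simp only: eq)
    also have "\<dots> = (\<Sum>k<n. (if k = j then fps_const (g $$ (i, k)) else 0) -
        fps_X * (fps_const (g $$ (i, k)) * fps_const (C $$ (k, j))))"
      using ij by (simp add: sum_subtractf gC sum_distrib_left)
    also have "\<dots> = (G * charmat n C) $$ (i, j)" using ij g by (subst index_mult_sum[of _ n n _ n])
        (auto simp: charmat_def G_def right_diff_distrib mult.left_commute intro!: sum.cong)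
    finally show "(charmat n D * G) $$ (i, j) = (G * charmat n C) $$ (i, j)" .
  qed (use G in \<open>auto simp: charmat_def\<close>)
  hence "det (charmat n D) * det G = det G * det (charmat n C)"
    using det_mult[of "charmat n D" n G] det_mult[of G n "charmat n C"] G by (simp add: charmat_def)
  moreover have "det G = fps_const (det g)" unfolding G_def by (rule h.hom_det)
  ultimately have "fps_const (det g) * det (charmat n D) = fps_const (det g) * det (charmat n C)"
    by (simp only: mult.commute[of "fps_const (det g)" "det (charmat n D)"])
  moreover have "fps_const (det g) \<noteq> 0" using nz by simp
  ultimately show ?thesis by (metis mult_left_cancel)
qed

subsection \<open>The symplectic group over a field\<close>

lemma SpD:
  assumes "g \<in> Sp n"
  shows "g \<in> sq_mats n" "g\<^sup>T * symp_form n * g = symp_form n"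
  using assms by (auto simp: Sp_def)

definition sp_inv :: "nat \<Rightarrow> 'a::comm_ring_1 mat \<Rightarrow> 'a mat" where
  "sp_inv n g = (symp_form n)\<^sup>T * g\<^sup>T * symp_form n"

lemma sp_inv_carrier [simp]: "g \<in> sq_mats n \<Longrightarrow> sp_inv n g \<in> sq_mats n"
  unfolding sp_inv_def by (intro mult_carrier_mat[of _ _ "2 * n"]) auto

lemma sp_inv_left:
  assumes "g \<in> Sp n"
  shows "sp_inv n g * g = 1\<^sub>m (2 * n)"
proof -
  note g = SpD[OF assms]
  have "sp_inv n g * g = (symp_form n)\<^sup>T * (g\<^sup>T * symp_form n * g)" unfolding sp_inv_def using g(1)
    by (simp add: sq_assoc[of _ n])
  thus ?thesis by (simp add: g(2) symp_form_orthogonal)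
qed

lemma sp_inv_right:
  fixes g :: "'a::field mat"
  assumes "g \<in> Sp n"
  shows "g * sp_inv n g = 1\<^sub>m (2 * n)"
  by (rule mat_mult_left_right_inverse[of _ "2 * n"])
    (use SpD(1)[OF assms] sp_inv_left[OF assms] in auto)

lemma Sp_det_nonzero:
  fixes g :: "'a::field mat"
  assumes "g \<in> Sp n"
  shows "det g \<noteq> 0"
proof
  assume "det g = 0"
  hence "det (sp_inv n g * g) = 0" using SpD(1)[OF assms] by (subst det_mult[of _ "2 * n"]) auto
  thus False using sp_inv_left[OF assms] by simp
qed

lemma amat_act:
  fixes g :: "'a::field mat"
  assumes "g \<in> Sp n" "Y \<in> sq_mats n"
  shows "amat n (g * Y * g\<^sup>T) * g = g * amat n Y"
proof -
  note g = SpD[OF assms(1)]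
  note assoc = sq_assoc[of _ n]
  note mc = sq_mult[of _ n]
  have "(g\<^sup>T * symp_form n * g)\<^sup>T = g\<^sup>T * (g\<^sup>T * symp_form n)\<^sup>T" by (rule sq_transpose[of _ n]) (use g(1) in auto)
  moreover have "(g\<^sup>T * symp_form n)\<^sup>T = (symp_form n)\<^sup>T * g" using g(1) by (subst sq_transpose[of _ n]) auto
  ultimately have "g\<^sup>T * ((symp_form n)\<^sup>T * g) = (symp_form n)\<^sup>T" by (simp add: g(2))
  thus ?thesis using g assms(2) unfolding amat_def by (simp add: assoc mc)
qed

lemma altz_bounded:
  assumes "Z \<in> alt_mat m"
  shows "altz (\<lambda>p q. if p < m \<and> q < m then Z $$ (p, q) else 0)"
  unfolding altz_def
proof (intro conjI allI)
  fix p q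
  show "(if p < m \<and> q < m then Z $$ (p, q) else 0) = - (if q < m \<and> p < m then Z $$ (q, p) else 0)"
    using alt_matD(2)[OF assms, of p q] by auto
  show "(if p < m \<and> p < m then Z $$ (p, p) else 0) = 0" using alt_matD(3)[OF assms, of p] by auto
qed

lemma act_alt_mat:
  fixes Y :: "'a::comm_ring_1 mat"
  assumes Y: "Y \<in> alt_mat m" and g: "g \<in> carrier_mat m m"
  shows "g * Y * g\<^sup>T \<in> alt_mat m"
proof (rule alt_matI)
  note Yc = alt_matD(1)[OF Y]
  have idx: "(g * Y * g\<^sup>T) $$ (i, j) = (\<Sum>p<m. \<Sum>q<m. g $$ (i, p) * (Y $$ (p, q) * g $$ (j, q)))" if "i < m" "j < m" for i j
  proof -
    have "(g * Y * g\<^sup>T) $$ (i, j) = (\<Sum>q<m. (g * Y) $$ (i, q) * g $$ (j, q))"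
      using that g Yc by (subst index_mult_sum[of _ m m _ m]) auto
    also have "\<dots> = (\<Sum>q<m. \<Sum>p<m. g $$ (i, p) * (Y $$ (p, q) * g $$ (j, q)))"
      using that g Yc by (intro sum.cong refl) (simp add: index_mult_sum[of _ m m _ m] sum_distrib_right mult.assoc del: index_mult_mat)
    finally show ?thesis by (subst sum.swap)
  qed
  show "g * Y * g\<^sup>T \<in> carrier_mat m m" using g Yc by auto
  show "(g * Y * g\<^sup>T) $$ (i, j) = - (g * Y * g\<^sup>T) $$ (j, i)" if "i < m" "j < m" for i j
  proof -
    have "(\<Sum>p<m. \<Sum>q<m. g $$ (i, p) * (Y $$ (p, q) * g $$ (j, q))) = (\<Sum>q<m. \<Sum>p<m. - (g $$ (j, q) * (Y $$ (q, p) * g $$ (i, p))))"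
    proof (subst sum.swap, intro sum.cong refl)
      fix p q assume "p \<in> {..<m}" "q \<in> {..<m}"
      hence "Y $$ (q, p) = - Y $$ (p, q)" by (intro alt_matD(2)[OF Y]) auto
      thus "g $$ (i, q) * (Y $$ (q, p) * g $$ (j, p)) = - (g $$ (j, p) * (Y $$ (p, q) * g $$ (i, q)))"
        by (simp add: mult_ac)
    qed
    thus ?thesis unfolding idx[OF that] idx[OF that(2,1)] by (simp add: sum_negf)
  qed
  show "(g * Y * g\<^sup>T) $$ (i, i) = 0" if "i < m" for i
    unfolding idx[OF that that] using sum_alternating[OF altz_bounded[OF Y], where x = "\<lambda>p. g $$ (i, p)" and N = m] by simp
qed

lemma gpol_act:
  fixes g :: "'a::field mat"
  assumes "g \<in> Sp n" "Y \<in> alt_mat (2 * n)"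
  shows "gpol n (g * Y * g\<^sup>T) = gpol n Y"
proof (rule gpol_unique)
  note Y = alt_matD(1)[OF assms(2)] and g = SpD(1)[OF assms(1)]
  show "g * Y * g\<^sup>T \<in> alt_mat (2 * n)" by (rule act_alt_mat[OF assms(2) g])
  show "det (charmat (2 * n) (amat n (g * Y * g\<^sup>T))) = det (charmat (2 * n) (amat n Y))"
    by (rule charmat_intertwine[symmetric, where g = g])
      (use g Y amat_act[OF assms(1) Y] Sp_det_nonzero[OF assms(1)] in auto)
qed (rule assms)

subsection \<open>Self-adjoint endomorphisms\<close>

text \<open>That \<open>om u u\<close> and \<open>om (A u) u\<close> vanish is assumed outright,
  since symmetry properties do not imply it in characteristic 2. Nondegeneracy and finite dimension
  enter only later, in \<open>symplectic\<close>.\<close>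

locale selfadj =
  fixes sc :: "'k::field \<Rightarrow> 'v::ab_group_add \<Rightarrow> 'v" (infixr "\<star>" 75)
    and A :: "'v \<Rightarrow> 'v" and om :: "'v \<Rightarrow> 'v \<Rightarrow> 'k"
  assumes sc_add: "c \<star> (u + v) = c \<star> u + c \<star> v"
    and sc_left_add: "(c + d) \<star> u = c \<star> u + d \<star> u"
    and sc_sc: "c \<star> d \<star> u = (c * d) \<star> u"
    and sc_one: "1 \<star> u = u"
    and A_add: "A (u + v) = A u + A v"
    and A_sc: "A (c \<star> u) = c \<star> A u"
    and om_add: "om (u + u') v = om u v + om u' v"
    and om_sc: "om (c \<star> u) v = c * om u v"
    and om_add_right: "om v (u + u') = om v u + om v u'"
    and om_sc_right: "om v (c \<star> u) = c * om v u"
    and om_self: "om u u = 0"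
    and om_A_self: "om (A u) u = 0"
    and om_adj: "om (A u) v = om u (A v)"
begin

lemma om_swap: "om u v = - om v u"
proof -
  have "om u v + om v u = 0"
    using om_self[of "u + v"] unfolding om_add om_add_right by (simp add: om_self add.commute)
  thus ?thesis by (rule eq_neg_iff_add_eq_0[THEN iffD2])
qed

lemma sc_zero [simp]: "0 \<star> u = 0" "c \<star> 0 = 0"
  using sc_left_add[of 0 0 u] sc_add[of c 0 0] by auto

lemma A_zero [simp]: "A 0 = 0"
  using A_add[of 0 0] by simp

lemma A_minus: "A (- u) = - A u"
  using A_add[of "- u" u] by (simp add: eq_neg_iff_add_eq_0)

lemma om_zero [simp]: "om 0 v = 0" "om v 0 = 0"
  using om_sc[of 0 0 v] om_sc_right[of v 0 0] by simp_all

lemma om_minus: "om (- u) v = - om u v" "om v (- u) = - om v u"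
  using om_add[of "- u" u v] om_add_right[of v "- u" u] by (auto simp: eq_neg_iff_add_eq_0)

lemma om_diff: "om (u - w) v = om u v - om w v" "om v (u - w) = om v u - om v w"
  using om_add[of u "- w" v] om_add_right[of v u "- w"] by (auto simp: om_minus)

lemma A_diff: "A (u - v) = A u - A v"
  using A_add[of u "- v"] by (simp add: A_minus)

lemma om_sum: "om (sum g S) v = (\<Sum>i\<in>S. om (g i) v)" "om v (sum g S) = (\<Sum>i\<in>S. om v (g i))"
  by (induction S rule: infinite_finite_induct) (simp_all add: om_add om_add_right)

lemma A_sum: "A (sum g S) = (\<Sum>i\<in>S. A (g i))"
  by (induction S rule: infinite_finite_induct) (simp_all add: A_add)

abbreviation pw :: "nat \<Rightarrow> 'v \<Rightarrow> 'v" where "pw i \<equiv> A ^^ i"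

lemma pw_add: "pw i (u + v) = pw i u + pw i v"
  by (induction i) (simp_all add: A_add)

lemma pw_sc: "pw i (c \<star> u) = c \<star> pw i u"
  by (induction i) (simp_all add: A_sc)

lemma pw_zero [simp]: "pw i 0 = 0"
  by (induction i) simp_all

lemma pw_diff: "pw i (u - v) = pw i u - pw i v"
  by (induction i) (simp_all add: A_diff)

lemma pw_sum: "pw i (sum g S) = (\<Sum>j\<in>S. pw i (g j))"
  by (induction i) (simp_all add: A_sum)

lemma pw_pw: "pw i (pw j u) = pw (i + j) u"
  by (simp add: funpow_add)

lemma om_pw: "om u (pw j v) = om (pw j u) v"
proof (induction j arbitrary: u)
  case (Suc j)
  have "om u (pw (Suc j) v) = om (A u) (pw j v)" by (simp add: om_adj)
  also have "\<dots> = om (pw j (A u)) v" by (rule Suc)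
  finally show ?case by (simp add: funpow_swap1)
qed simp

lemma om_pw_pw: "om (pw i u) (pw j v) = om (pw (i + j) u) v"
  by (simp add: om_pw pw_pw add.commute)

text \<open>Distributing the power evenly over the two arguments leaves a value of
  \<open>om w w\<close> or of \<open>om (A w) w\<close>.\<close>

lemma om_pw_self [simp]: "om (pw i u) u = 0"
proof (cases "even i")
  case True
  then obtain j where "i = j + j" by (metis evenE mult_2)
  hence "om (pw i u) u = om (pw j u) (pw j u)" by (simp add: om_pw_pw)
  thus ?thesis by (simp add: om_self)
next
  case False
  then obtain j where "i = Suc (j + j)" by (metis oddE mult_2 Suc_eq_plus1)
  hence "om (pw i u) u = om (pw (Suc j) u) (pw j u)" by (simp add: om_pw_pw del: funpow.simps)
  thus ?thesis by (simp add: om_A_self)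
qed

text \<open>The dual basis of a cyclic isotropic subspace, on which \<open>A\<close> acts by the transposed companion
  matrix.\<close>

fun dualb :: "'v \<Rightarrow> 'v \<Rightarrow> nat \<Rightarrow> 'v" where
  "dualb z f 0 = f"
| "dualb z f (Suc k) = A (dualb z f k) - om z (dualb z f k) \<star> f"

text \<open>Every \<open>dualb z f k\<close> is a polynomial in \<open>A\<close> applied to
  \<open>f\<close>, and such vectors are mutually orthogonal by \<open>om_pw_self\<close>.\<close>

lemma dualb_isotropic: "om (pw i (dualb z f k)) (dualb z f l) = 0"
proof -
  have 0: "om (pw i (dualb z f k)) f = 0" for i k
  proof (induction k arbitrary: i)
    case (Suc k)
    have "pw i (A (dualb z f k)) = pw (Suc i) (dualb z f k)" by (simp add: funpow_swap1)
    thus ?case by (simp only: dualb.simps pw_diff pw_sc om_diff om_sc Suc om_pw_self) simp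
  qed simp
  show ?thesis
  proof (induction l arbitrary: i)
    case (Suc l)
    have "A (pw i (dualb z f k)) = pw (Suc i) (dualb z f k)" by simp
    thus ?case by (simp only: dualb.simps om_diff om_sc_right om_adj[symmetric] Suc 0) simp
  qed (simp add: 0)
qed

text \<open>Adjointness moves the new \<open>A\<close> onto the power of \<open>x\<close>. Only for
  the last power does this leave the given range, producing A^n x, and there the subtracted multiple
  of \<open>f\<close> cancels the result.\<close>

lemma dualb_dual:
  assumes f: "\<And>i. i < n \<Longrightarrow> om (pw i x) f = (if i = n - 1 then 1 else 0)"
  shows "i < n \<Longrightarrow> k < n \<Longrightarrow> om (pw i x) (dualb (pw n x) f k) = (if i + k = n - 1 then 1 else 0)"
proof (induction k arbitrary: i)
  case 0
  thus ?case by (simp add: f)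
next
  case (Suc k)
  let ?g = "dualb (pw n x) f"
  have "om (pw i x) (?g (Suc k)) = om (pw (Suc i) x) (?g k) - om (pw n x) (?g k) * om (pw i x) f"
    by (simp add: om_diff om_sc_right om_adj)
  also have "\<dots> = (if i + Suc k = n - 1 then 1 else 0)"
  proof (cases "i = n - 1")
    case True
    hence "Suc i = n" using Suc by simp
    thus ?thesis using True f[of i] Suc by simp
  next
    case False
    thus ?thesis using Suc.IH[of "Suc i"] f[of i] Suc.prems by simp
  qed
  finally show ?case .
qed

end

subsection \<open>Symplectic bases\<close>

text \<open>Vectors are functions on the natural numbers, so that the type is an additive group
  independent of \<open>n\<close>; the form reads only the first \<open>2 * n\<close>
  coordinates.\<close>

definition omf :: "nat \<Rightarrow> (nat \<Rightarrow> 'a::comm_ring_1) \<Rightarrow> (nat \<Rightarrow> 'a) \<Rightarrow> 'a" where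
  "omf n u v = (\<Sum>i<n. u i * v (i + n) - u (i + n) * v i)"

definition avec :: "nat \<Rightarrow> 'a::comm_ring_1 mat \<Rightarrow> (nat \<Rightarrow> 'a) \<Rightarrow> nat \<Rightarrow> 'a" where
  "avec n Y u i = (if i < 2 * n then (\<Sum>j<2 * n. amat n Y $$ (i, j) * u j) else 0)"

lemma sum_lessThan_2n: "(\<Sum>l<2 * (n :: nat). g l) = (\<Sum>l<n. g l + g (l + n) :: 'a::comm_monoid_add)"
proof -
  have "(\<Sum>l<2 * n. g l) = (\<Sum>l\<in>{..<n} \<union> {n..<2 * n}. g l)" by (intro sum.cong) auto
  also have "\<dots> = (\<Sum>l<n. g l) + (\<Sum>l\<in>{n..<2 * n}. g l)" by (intro sum.union_disjoint) auto
  also have "(\<Sum>l\<in>{n..<2 * n}. g l) = (\<Sum>l<n. g (l + n))"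
    by (rule sum.reindex_bij_witness[of _ "\<lambda>l. l + n" "\<lambda>l. l - n"]) auto
  finally show ?thesis by (simp add: sum.distrib)
qed

lemma omf_matrix: "omf n u v = (\<Sum>i<2 * n. u i * (\<Sum>k<2 * n. symp_form n $$ (i, k) * v k))"
proof -
  have "(\<Sum>i<2 * n. u i * (\<Sum>k<2 * n. symp_form n $$ (i, k) * v k))
      = (\<Sum>i<2 * n. u i * (if i < n then v (i + n) else - v (i - n)))"
    by (intro sum.cong refl) (simp add: sum_symp_form_left)
  thus ?thesis by (simp add: sum_lessThan_2n omf_def)
qed

lemma omf_avec:
  assumes "Y \<in> sq_mats n"
  shows "omf n u (avec n Y v) = (\<Sum>p<2 * n. \<Sum>q<2 * n. u p * ((symp_form n * Y * (symp_form n)\<^sup>T) $$ (p, q) * v q))"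
proof -
  have "(\<Sum>k<2 * n. symp_form n $$ (p, k) * avec n Y v k) = (\<Sum>q<2 * n. (symp_form n * Y * (symp_form n)\<^sup>T) $$ (p, q) * v q)"
    if "p < 2 * n" for p
  proof -
    have "(\<Sum>k<2 * n. symp_form n $$ (p, k) * avec n Y v k) = (\<Sum>k<2 * n. \<Sum>q<2 * n. symp_form n $$ (p, k) * amat n Y $$ (k, q) * v q)"
      by (simp add: avec_def sum_distrib_left mult.assoc)
    also have "\<dots> = (\<Sum>q<2 * n. (symp_form n * amat n Y) $$ (p, q) * v q)" using that assms
      by (subst sum.swap) (intro sum.cong refl, simp add: sq_index[of _ n] sum_distrib_right del: index_mult_mat)
    finally show ?thesis using assms by (simp add: amat_def sq_assoc[of _ n])
  qed
  thus ?thesis by (simp add: omf_matrix sum_distrib_left)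
qed

lemma selfadj_avec:
  fixes Y :: "'k::field mat"
  assumes Y: "Y \<in> alt_mat (2 * n)"
  shows "selfadj (\<lambda>c u i. c * u i) (avec n Y) (omf n)"
proof -
  define Z where "Z = symp_form n * Y * (symp_form n)\<^sup>T"
  have Z: "Z \<in> alt_mat (2 * n)" unfolding Z_def by (rule act_alt_mat[OF Y]) simp
  have omA: "omf n u (avec n Y v) = (\<Sum>p<2 * n. \<Sum>q<2 * n. u p * (Z $$ (p, q) * v q))" for u v
    unfolding Z_def by (rule omf_avec[OF alt_matD(1)[OF Y]])
  have swap: "omf n u v = - omf n v u" for u v :: "nat \<Rightarrow> 'k"
    unfolding omf_def sum_negf[symmetric] by (intro sum.cong refl) (simp add: mult.commute)
  have self: "omf n u (avec n Y u) = 0" for u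
    using sum_alternating[OF altz_bounded[OF Z], where x = u and N = "2 * n"] by (simp add: omA)
  have symm: "omf n u (avec n Y v) = - omf n v (avec n Y u)" for u v
  proof -
    have "(\<Sum>p<2 * n. \<Sum>q<2 * n. v p * (Z $$ (p, q) * u q)) = (\<Sum>p<2 * n. \<Sum>q<2 * n. - (u p * (Z $$ (p, q) * v q)))"
    proof (subst sum.swap, intro sum.cong refl)
      fix p q assume "p \<in> {..<2 * n}" "q \<in> {..<2 * n}"
      hence "Z $$ (q, p) = - Z $$ (p, q)" by (intro alt_matD(2)[OF Z]) auto
      thus "v q * (Z $$ (q, p) * u p) = - (u p * (Z $$ (p, q) * v q))" by (simp add: mult_ac)
    qed
    thus ?thesis unfolding omA by (simp add: sum_negf)
  qed
  show ?thesis
  proof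
    show "avec n Y (u + v) = avec n Y u + avec n Y v" for u v
      by (rule ext) (simp add: avec_def distrib_left sum.distrib)
    show "avec n Y (\<lambda>i. c * u i) = (\<lambda>i. c * avec n Y u i)" for c u
      by (rule ext) (simp add: avec_def sum_distrib_left mult.left_commute)
    show "omf n (u + u') v = omf n u v + omf n u' v" "omf n v (u + u') = omf n v u + omf n v u'" for u u' v :: "nat \<Rightarrow> 'k"
      by (simp_all add: omf_def algebra_simps sum.distrib sum_subtractf)
    show "omf n (\<lambda>i. c * u i) v = c * omf n u v" "omf n v (\<lambda>i. c * u i) = c * omf n v u" for c u v
      by (simp_all add: omf_def algebra_simps sum_distrib_left sum_subtractf)
    show "omf n u u = 0" for u :: "nat \<Rightarrow> 'k" by (simp add: omf_def mult.commute)
    show "omf n (avec n Y u) u = 0" for u using self[of u] swap[of "avec n Y u" u] by simp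
    show "omf n (avec n Y u) v = omf n u (avec n Y v)" for u v using symm[of u v] swap[of "avec n Y u" v] by simp
  qed (auto simp: fun_eq_iff algebra_simps)
qed

definition fmat :: "nat \<Rightarrow> (nat \<Rightarrow> nat \<Rightarrow> 'a) \<Rightarrow> (nat \<Rightarrow> nat \<Rightarrow> 'a) \<Rightarrow> 'a mat" where
  "fmat n w f = mat (2 * n) (2 * n) (\<lambda>(i, j). if j < n then w j i else f (j - n) i)"

definition gram :: "nat \<Rightarrow> nat \<Rightarrow> (nat \<Rightarrow> nat \<Rightarrow> 'a::comm_ring_1) \<Rightarrow> (nat \<Rightarrow> nat \<Rightarrow> 'a) \<Rightarrow> bool" where
  "gram n N w f \<longleftrightarrow> (\<forall>i<N. \<forall>j<N. omf n (w i) (w j) = 0 \<and> omf n (f i) (f j) = 0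
     \<and> omf n (w i) (f j) = (if i = j then 1 else 0))"

lemma fmat_carrier [simp]: "fmat n w f \<in> sq_mats n"
  by (simp add: fmat_def)

lemma omf_swap: "omf n u v = - omf n v u"
  unfolding omf_def sum_negf[symmetric] by (intro sum.cong refl) (simp add: mult.commute)

lemma transpose_symp_carrier [simp]:
  "M \<in> sq_mats n \<Longrightarrow> M\<^sup>T * symp_form n \<in> sq_mats n" by (rule mult_carrier_mat) auto

lemma transpose_symp_index:
  assumes "M \<in> sq_mats n" "k < 2 * n" "l < 2 * n"
  shows "(M\<^sup>T * symp_form n) $$ (k, l) = (if l < n then - M $$ (l + n, k) else M $$ (l - n, k))"
proof -
  have "(M\<^sup>T * symp_form n) $$ (k, l) = (\<Sum>i<2 * n. M $$ (i, k) * symp_form n $$ (i, l))"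
    using assms by (subst sq_index[of _ n]) auto
  thus ?thesis by (simp add: sum_symp_form_right[OF assms(3)])
qed

lemma transpose_symp_sum:
  assumes "M \<in> sq_mats n" "k < 2 * n"
  shows "(\<Sum>l<2 * n. (M\<^sup>T * symp_form n) $$ (k, l) * v l) = omf n (\<lambda>i. M $$ (i, k)) v"
  unfolding sum_lessThan_2n omf_def
  by (intro sum.cong refl) (simp add: transpose_symp_index[OF assms] del: index_mult_mat)

lemma fmat_Sp:
  assumes "gram n n w f"
  shows "fmat n w f \<in> Sp n"
proof -
  let ?M = "fmat n w f"
  have "?M\<^sup>T * symp_form n * ?M = symp_form n"
  proof (rule eq_matI)
    fix i j assume "i < dim_row (symp_form n :: 'a mat)" "j < dim_col (symp_form n :: 'a mat)"
    hence ij: "i < 2 * n" "j < 2 * n" by auto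
    have "(?M\<^sup>T * symp_form n * ?M) $$ (i, j) = (\<Sum>l<2 * n. (?M\<^sup>T * symp_form n) $$ (i, l) * ?M $$ (l, j))"
      using ij by (subst sq_index[of _ n]) auto
    also have "\<dots> = omf n (\<lambda>l. ?M $$ (l, i)) (\<lambda>l. ?M $$ (l, j))" by (rule transpose_symp_sum[OF fmat_carrier ij(1)])
    also have "\<dots> = omf n (if i < n then w i else f (i - n)) (if j < n then w j else f (j - n))"
      unfolding omf_def by (intro sum.cong refl) (use ij in \<open>auto simp: fmat_def\<close>)
    also have "\<dots> = symp_form n $$ (i, j)"
      using assms ij omf_swap[of n "f (i - n)" "w j"] by (auto simp: gram_def symp_form_def)
    finally show "(?M\<^sup>T * symp_form n * ?M) $$ (i, j) = symp_form n $$ (i, j)" .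
  qed (simp_all add: fmat_def)
  thus ?thesis by (simp add: Sp_def)
qed

lemma gram_expand:
  fixes w f :: "nat \<Rightarrow> nat \<Rightarrow> 'k::field"
  assumes "gram n n w f" "i < 2 * n"
  shows "v i = (\<Sum>j<n. omf n v (f j) * w j i - omf n v (w j) * f j i)"
proof -
  define M where "M = fmat n w f"
  have M: "M \<in> Sp n" "M \<in> sq_mats n" using fmat_Sp[OF assms(1)] by (simp_all add: M_def)
  define S where "S = sp_inv n M"
  have S: "S \<in> sq_mats n" using M by (simp add: S_def)
  have Sv: "(\<Sum>l<2 * n. S $$ (j, l) * v l) = (if j < n then omf n v (f j) else - omf n v (w (j - n)))" if j: "j < 2 * n" for j
  proof -
    have "S $$ (j, l) = (if j < n then - (M\<^sup>T * symp_form n) $$ (j + n, l) else (M\<^sup>T * symp_form n) $$ (j - n, l))"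
      if l: "l < 2 * n" for l
    proof -
      have "S = (symp_form n)\<^sup>T * (M\<^sup>T * symp_form n)"
        unfolding S_def sp_inv_def using M(2) by (simp add: sq_assoc[of _ n])
      also have "\<dots> $$ (j, l) = (\<Sum>k<2 * n. (M\<^sup>T * symp_form n) $$ (k, l) * symp_form n $$ (k, j))"
        using j l M(2) by (subst sq_index[of _ n]) (auto simp: mult.commute[of "symp_form n $$ _"] simp del: index_mult_mat)
      finally show ?thesis by (simp add: sum_symp_form_right[OF j] del: index_mult_mat)
    qed
    hence "(\<Sum>l<2 * n. S $$ (j, l) * v l) = (if j < n then - (\<Sum>l<2 * n. (M\<^sup>T * symp_form n) $$ (j + n, l) * v l)
        else (\<Sum>l<2 * n. (M\<^sup>T * symp_form n) $$ (j - n, l) * v l))"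
      by (simp add: sum_negf[symmetric] del: index_mult_mat)
    also have "\<dots> = (if j < n then - omf n (\<lambda>i. M $$ (i, j + n)) v else omf n (\<lambda>i. M $$ (i, j - n)) v)"
      using j transpose_symp_sum[OF M(2), of "j + n" v] transpose_symp_sum[OF M(2), of "j - n" v]
      by (simp del: index_mult_mat)
    also have "\<dots> = (if j < n then - omf n (f j) v else omf n (w (j - n)) v)"
      using j by (auto simp: omf_def M_def fmat_def intro!: sum.cong)
    finally show ?thesis using omf_swap[of n v "f j"] omf_swap[of n v "w (j - n)"] by simp
  qed
  have "v i = (\<Sum>l<2 * n. (M * S) $$ (i, l) * v l)"
    using sp_inv_right[OF M(1)] assms(2) by (simp add: S_def if_distrib[of "\<lambda>x. x * _"] del: index_mult_mat cong: if_cong)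
  also have "\<dots> = (\<Sum>l<2 * n. \<Sum>j<2 * n. M $$ (i, j) * (S $$ (j, l) * v l))" using assms(2) M(2) S
    by (intro sum.cong refl) (simp add: sq_index[of _ n] sum_distrib_right mult.assoc del: index_mult_mat)
  also have "\<dots> = (\<Sum>j<2 * n. M $$ (i, j) * (\<Sum>l<2 * n. S $$ (j, l) * v l))"
    by (subst sum.swap) (simp add: sum_distrib_left)
  also have "\<dots> = (\<Sum>j<2 * n. M $$ (i, j) * (if j < n then omf n v (f j) else - omf n v (w (j - n))))"
    by (intro sum.cong refl) (simp add: Sv)
  also have "\<dots> = (\<Sum>j<n. omf n v (f j) * w j i - omf n v (w j) * f j i)"
    unfolding sum_lessThan_2n using assms(2) by (intro sum.cong refl) (simp add: M_def fmat_def mult.commute)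
  finally show ?thesis .
qed

text \<open>The bivector \<open>\<Sum> b i j e\<^sub>i \<wedge> f\<^sub>j\<close>, for which \<open>A\<close> acts by \<open>b\<close> on the span of the \<open>e\<^sub>i\<close> and by the
  transpose on the span of the \<open>f\<^sub>i\<close>.\<close>

definition bmat :: "nat \<Rightarrow> (nat \<Rightarrow> nat \<Rightarrow> 'a::comm_ring_1) \<Rightarrow> 'a mat" where
  "bmat n b = mat (2 * n) (2 * n) (\<lambda>(i, j). if i < n \<and> n \<le> j then b i (j - n)
     else if n \<le> i \<and> j < n then - b j (i - n) else 0)"

lemma bmat_alt: "bmat n b \<in> alt_mat (2 * n)"
  by (rule alt_matI) (auto simp: bmat_def)

text \<open>The two endomorphisms are compared on the symplectic basis; afterwards the basis matrix
  and the symplectic form are cancelled to get back to bivectors.\<close>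

lemma frame_conj:
  fixes w f :: "nat \<Rightarrow> nat \<Rightarrow> 'k::field"
  assumes "gram n n w f" and Y: "Y \<in> alt_mat (2 * n)"
    and w: "\<And>i j. j < n \<Longrightarrow> i < 2 * n \<Longrightarrow> avec n Y (w j) i = (\<Sum>k<n. b k j * w k i)"
    and f: "\<And>i j. j < n \<Longrightarrow> i < 2 * n \<Longrightarrow> avec n Y (f j) i = (\<Sum>k<n. b j k * f k i)"
  shows "fmat n w f * bmat n b * (fmat n w f)\<^sup>T = Y"
proof -
  define M where "M = fmat n w f"
  note assoc = sq_assoc[of _ n]
  note mc = sq_mult[of _ n]
  have M: "M \<in> Sp n" "M \<in> sq_mats n" using fmat_Sp[OF assms(1)] by (simp_all add: M_def)
  note Yc = alt_matD(1)[OF Y] and Zc = alt_matD(1)[OF bmat_alt[of n b]]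
  have ab: "amat n (bmat n b) $$ (k, j) = (if k < n \<and> j < n then b k j else if n \<le> k \<and> n \<le> j then b (j - n) (k - n) else 0)"
    if "k < 2 * n" "j < 2 * n" for k j unfolding amat_index[OF Zc that] using that by (auto simp: bmat_def)
  have "amat n Y * M = M * amat n (bmat n b)"
  proof (rule eq_matI)
    fix i j assume "i < dim_row (M * amat n (bmat n b))" "j < dim_col (M * amat n (bmat n b))"
    hence ij: "i < 2 * n" "j < 2 * n" using M(2) amat_carrier[OF Zc] by auto
    have "(amat n Y * M) $$ (i, j) = avec n Y (\<lambda>l. M $$ (l, j)) i"
      using ij M(2) amat_carrier[OF Yc] by (subst sq_index[of _ n]) (auto simp: avec_def)
    also have "\<dots> = avec n Y (if j < n then w j else f (j - n)) i"
      using ij by (auto simp: avec_def M_def fmat_def intro!: sum.cong)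
    also have "\<dots> = (\<Sum>k<n. if j < n then b k j * w k i else b (j - n) k * f k i)"
      using ij w[of j i] f[of "j - n" i] by auto
    also have "\<dots> = (\<Sum>k<2 * n. M $$ (i, k) * amat n (bmat n b) $$ (k, j))"
      unfolding sum_lessThan_2n using ij by (intro sum.cong refl) (auto simp: ab M_def fmat_def)
    also have "\<dots> = (M * amat n (bmat n b)) $$ (i, j)"
      using ij M(2) amat_carrier[OF Zc] by (subst sq_index[of _ n]) auto
    finally show "(amat n Y * M) $$ (i, j) = (M * amat n (bmat n b)) $$ (i, j)" .
  qed (use M amat_carrier[OF Yc] amat_carrier[OF Zc] in auto)
  hence "amat n (M * bmat n b * M\<^sup>T) * M = amat n Y * M" using amat_act[OF M(1) Zc] by simp
  note eq = this
  have Xc: "M * bmat n b * M\<^sup>T \<in> sq_mats n" using M(2) Zc by (intro mc) auto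
  note Pc = amat_carrier[OF Xc] and Ac = amat_carrier[OF Yc] and Sc = sp_inv_carrier[OF M(2)]
  have "amat n (M * bmat n b * M\<^sup>T) * M * sp_inv n M = amat n Y * M * sp_inv n M" by (simp only: eq)
  hence "amat n (M * bmat n b * M\<^sup>T) = amat n Y"
    unfolding assoc[OF Pc M(2) Sc] assoc[OF Ac M(2) Sc] sp_inv_right[OF M(1)]
      right_mult_one_mat[OF Pc] right_mult_one_mat[OF Ac] .
  hence "M * bmat n b * M\<^sup>T * (symp_form n)\<^sup>T * symp_form n = Y * (symp_form n)\<^sup>T * symp_form n"
    unfolding amat_def by simp
  moreover have "W * (symp_form n)\<^sup>T * symp_form n = W" if "W \<in> sq_mats n" for W :: "'k mat"
    using assoc[OF that, of "(symp_form n)\<^sup>T" "symp_form n"] right_mult_one_mat[OF that]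
    by (simp add: symp_form_orthogonal)
  ultimately show ?thesis using Xc Yc by (simp add: M_def)
qed

subsection \<open>The companion normal form\<close>

definition compan :: "nat \<Rightarrow> (nat \<Rightarrow> 'a::comm_ring_1) \<Rightarrow> nat \<Rightarrow> nat \<Rightarrow> 'a" where
  "compan n \<beta> i j = (if j = n - 1 then \<beta> i else if i = Suc j then 1 else 0)"

text \<open>Cyclicity is asked only of the projections of the Krylov vectors to the first
  \<open>n\<close> coordinates. This allows the functional dual to the last Krylov vector to be
  found among the last \<open>n\<close> basis vectors, by Cramer's rule; \<open>dualb\<close> then
  completes a symplectic basis.\<close>

lemma cyclic_normal_form:
  fixes Y :: "'k::field mat"
  assumes Y: "Y \<in> alt_mat (2 * n)" and n: "n \<ge> 1"
    and cyc: "det (mat n n (\<lambda>(i, j). (avec n Y ^^ i) x j)) \<noteq> 0"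
  obtains M \<beta> where "M \<in> Sp n" "\<And>i. i < 2 * n \<Longrightarrow> M $$ (i, 0) = x i" "M * bmat n (compan n \<beta>) * M\<^sup>T = Y"
proof -
  interpret selfadj "\<lambda>c u i. c * u i" "avec n Y" "omf n" by (rule selfadj_avec[OF Y])
  define S where "S = mat n n (\<lambda>(i, j). pw i x j)"
  have S: "S \<in> carrier_mat n n" by (simp add: S_def)
  \<comment> \<open>The last column of the inverse of S.\<close>
  define c where "c j = adj_mat S $$ (j, n - 1) / det S" for j
  have c: "(\<Sum>j<n. pw i x j * c j) = (if i = n - 1 then 1 else 0)" if i: "i < n" for i
  proof -
    have "(\<Sum>j<n. pw i x j * c j) = (\<Sum>j<n. S $$ (i, j) * adj_mat S $$ (j, n - 1)) / det S"
      using i by (simp add: c_def S_def sum_divide_distrib)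
    also have "(\<Sum>j<n. S $$ (i, j) * adj_mat S $$ (j, n - 1)) = (S * adj_mat S) $$ (i, n - 1)"
      using i n adj_mat(1)[OF S] by (subst index_mult_sum[OF S]) auto
    also have "\<dots> = (if i = n - 1 then det S else 0)" unfolding adj_mat(2)[OF S] using i n by simp
    finally show ?thesis using cyc by (simp add: S_def)
  qed
  define f where "f k = (if n \<le> k \<and> k < 2 * n then c (k - n) else 0)" for k
  have f: "omf n (pw i x) f = (if i = n - 1 then 1 else 0)" if "i < n" for i
    using c[OF that] by (simp add: omf_def f_def)
  define w where "w i = pw i x" for i
  define g where "g i = dualb (pw n x) f (n - 1 - i)" for i
  define \<beta> where "\<beta> j = omf n (pw n x) (g j)" for j
  have ww: "omf n (w i) (w j) = 0" for i j by (simp add: w_def om_pw_pw)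
  have gg: "omf n (avec n Y (g i)) (g j) = 0" "omf n (g i) (g j) = 0" for i j
    using dualb_isotropic[of 1 "pw n x" f] dualb_isotropic[of 0 "pw n x" f] by (simp_all add: g_def)
  have wg: "omf n (w i) (g j) = (if i = j then 1 else 0)" if "i < n" "j < n" for i j
    using dualb_dual[OF f that(1), of "n - 1 - j"] that by (auto simp: w_def g_def)
  have gram: "gram n n w g" unfolding gram_def using ww gg(2) wg by blast
  have gn: "g (n - 1) = f" by (simp add: g_def)
  have Aw: "avec n Y (w j) i = (\<Sum>k<n. compan n \<beta> k j * w k i)" if j: "j < n" "i < 2 * n" for i j
  proof (cases "j = n - 1")
    case True
    hence "avec n Y (w j) = pw n x" using n by (cases n) (simp_all add: w_def)
    thus ?thesis using gram_expand[OF gram j(2), of "pw n x"] True by (simp add: w_def om_pw_pw compan_def \<beta>_def)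
  next
    case False
    hence "(\<Sum>k<n. compan n \<beta> k j * w k i) = (\<Sum>k<n. if k = Suc j then w k i else 0)"
      by (intro sum.cong refl) (simp add: compan_def)
    thus ?thesis using False j by (simp add: w_def)
  qed
  have Ag: "avec n Y (g j) i = (\<Sum>k<n. compan n \<beta> j k * g k i)" if j: "j < n" "i < 2 * n" for i j
  proof -
    have "(\<Sum>k<n. compan n \<beta> j k * g k i) = (\<Sum>k<n. (if k = n - 1 then \<beta> j * g k i else 0) + (if Suc k = j then g k i else 0))"
      using j by (intro sum.cong refl) (auto simp: compan_def)
    also have "\<dots> = \<beta> j * f i + (\<Sum>k<n. if Suc k = j then g k i else 0)" using n by (simp add: sum.distrib flip: gn)
    also have "\<dots> = avec n Y (g j) i"
    proof (cases j)
      case 0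
      \<comment> \<open>The claimed identity holds because the difference of its sides is orthogonal
        to the whole symplectic basis.\<close>
      define r where "r = avec n Y (g 0) - (\<lambda>i. \<beta> 0 * f i)"
      have "omf n r (g k) = 0" for k using gg(2)[of "n - 1" k, unfolded gn] by (simp add: r_def om_diff om_sc gg)
      moreover have "omf n r (w k) = 0" if k: "k < n" for k
      proof -
        have "omf n (w k) r = omf n (avec n Y (w k)) (g 0) - \<beta> 0 * omf n (w k) f"
          by (simp add: r_def om_diff om_sc_right om_adj)
        also have "\<dots> = 0"
        proof (cases "k = n - 1")
          case True
          hence "avec n Y (w k) = pw n x" using n by (cases n) (simp_all add: w_def)
          thus ?thesis using f[OF k] True by (simp add: \<beta>_def w_def)
        next
          case False
          thus ?thesis using f[OF k] wg[of "Suc k" 0] k by (simp add: w_def)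
        qed
        finally show ?thesis using omf_swap[of n r "w k"] by simp
      qed
      ultimately have "r i = 0" using gram_expand[OF gram j(2), of r] by simp
      thus ?thesis by (simp add: r_def 0)
    next
      case (Suc j')
      have "g j' = avec n Y (g j) - (\<lambda>i. \<beta> j * f i)"
      proof -
        have "n - 1 - j' = Suc (n - 1 - j)" using j Suc by simp
        thus ?thesis by (simp add: g_def \<beta>_def)
      qed
      thus ?thesis using j Suc by simp
    qed
    finally show ?thesis by simp
  qed
  have "fmat n w g * bmat n (compan n \<beta>) * (fmat n w g)\<^sup>T = Y" by (rule frame_conj[OF gram Y Aw Ag])
  moreover have "fmat n w g $$ (i, 0) = x i" if "i < 2 * n" for i using that n by (simp add: fmat_def w_def)
  ultimately show thesis using fmat_Sp[OF gram] that by blast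
qed

text \<open>Column \<open>m\<close> of \<open>b\<close> after \<open>k\<close> multiplications by
  \<open>b\<close>, with summation over the first \<open>m\<close> indices.\<close>

abbreviation bcol where
  "bcol n b m k \<equiv> ((\<lambda>v i. if i < n then \<Sum>l<m. b i l * v l else 0) ^^ k) (\<lambda>i. if i < n then b i m else 0)"

text \<open>The endomorphism of \<open>bmat n b\<close> preserves the span of the e_i, so summands
  through the f_j vanish and the recursion for \<open>zz\<close> becomes iteration of
  \<open>b\<close>.\<close>

lemma gser_bmat:
  assumes "m < n"
  shows "zz (zmat n (bmat n b)) m k (2 * i) (Suc (2 * m)) = bcol n b m k i"
proof (induction k arbitrary: i)
  case 0
  show ?case using assms by (simp add: zmat_def bmat_def)
next
  case (Suc k)
  have "amap (zmat n (bmat n b)) (2 * i) (2 * l) = (if i < n then b i l else 0)" if "l < m" for l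
    using that assms by (simp add: amap_def zmat_def bmat_def)
  moreover have "amap (zmat n (bmat n b)) (2 * i) (Suc (2 * l)) = 0" if "l < m" for l
    using that assms by (simp add: amap_def zmat_def bmat_def)
  ultimately show ?case unfolding zz.simps sum_lessThan_double by (simp add: Suc)
qed

lemma gfac_bmat_strict:
  assumes "m < n" "\<And>i. i \<le> m \<Longrightarrow> b i m = 0" "\<And>i j. i \<le> m \<Longrightarrow> j < m \<Longrightarrow> j \<ge> i \<Longrightarrow> b i j = 0"
  shows "gfac (zmat n (bmat n b)) m = 1"
proof -
  have "bcol n b m k i = 0" if "i \<le> m" for i k using that
  proof (induction k arbitrary: i)
    case (Suc k)
    have "b i l * bcol n b m k l = 0" if "l < m" for l using Suc.IH[of l] that by simp
    thus ?case by simp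
  qed (use assms in simp)
  hence "zz (zmat n (bmat n b)) m k (2 * m) (Suc (2 * m)) = 0" for k unfolding gser_bmat[OF assms(1)] by simp
  thus ?thesis by (simp add: gfac_def fps_zero_def[symmetric])
qed

lemma gser_bmat_strict:
  assumes "m \<le> n" "\<And>i j. i < n \<Longrightarrow> j < m \<Longrightarrow> i \<le> j \<Longrightarrow> b i j = 0"
  shows "gser (zmat n (bmat n b)) m = 1"
  using assms
proof (induction m)
  case (Suc m)
  have "gfac (zmat n (bmat n b)) m = 1" by (rule gfac_bmat_strict) (use Suc.prems in auto)
  with Suc show ?case by simp
qed simp

text \<open>Below the last plane the companion matrix is strictly lower triangular, so all factors
  but the last are 1. In the last one the shift carries the entries of \<beta> one after the other
  into the bottom position.\<close>

lemma gpol_comp: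
  assumes "n \<ge> 1"
  shows "fps_nth (gpol n (bmat n (compan n \<beta>))) j = (if j = 0 then 1 else if j \<le> n then - \<beta> (n - j) else 0)"
proof -
  obtain m where m: "n = Suc m" using assms by (cases n) auto
  let ?b = "compan n \<beta>"
  have "gser (zmat n (bmat n ?b)) m = 1" by (rule gser_bmat_strict) (use m in \<open>auto simp: compan_def\<close>)
  hence "gpol n (bmat n ?b) = gfac (zmat n (bmat n ?b)) m" by (simp add: gpol_def m)
  moreover have "bcol n ?b m k i
      = (if k \<le> i then \<beta> (i - k) else 0)" if "i \<le> m" for i k using that
  proof (induction k arbitrary: i)
    case 0
    thus ?case using m by (simp add: compan_def)
  next
    case (Suc k)
    let ?v = "bcol n ?b m k"
    have "bcol n ?b m (Suc k) i
        = (\<Sum>l<m. ?b i l * ?v l)" using Suc.prems m by simp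
    also have "\<dots> = (\<Sum>l<m. if i = Suc l then ?v l else 0)"
      by (intro sum.cong refl) (use m in \<open>simp add: compan_def\<close>)
    also have "\<dots> = (if Suc k \<le> i then \<beta> (i - Suc k) else 0)"
    proof (cases i)
      case (Suc i')
      hence "i' < m" using Suc.prems \<open>i \<le> m\<close> by simp
      thus ?thesis using Suc.IH[of i'] \<open>i = Suc i'\<close> by simp
    qed simp
    finally show ?case .
  qed
  ultimately show ?thesis unfolding gfac_def gser_bmat[of m n ?b, unfolded m, simplified, folded m]
    by (cases j) (auto simp: gser_bmat[of m n ?b] m)
qed

section \<open>Generic and special points of the group and of the representation\<close>

lemma index_mult_in_polys:
  assumes "A \<in> carrier_mat nr n" "B \<in> carrier_mat n nc" "i < nr" "j < nc"
    and "\<And>k. k < n \<Longrightarrow> A $$ (i, k) \<in> polys V" "\<And>k. k < n \<Longrightarrow> B $$ (k, j) \<in> polys V"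
  shows "(A * B) $$ (i, j) \<in> polys V"
  unfolding index_mult_sum[OF assms(1-4)] using assms(5,6) by (intro polys_sum polys_closed) auto

lemma gen_group_carrier [simp]: "gen_group n \<in> sq_mats n"
  "dim_row (gen_group n) = 2 * n" "dim_col (gen_group n) = 2 * n" by (simp_all add: gen_group_def)

lemma symp_form_in_polys: "i < 2 * n \<Longrightarrow> j < 2 * n \<Longrightarrow> symp_form n $$ (i, j) \<in> polys V"
  by (auto simp: symp_form_def)

lemma map_symp_form:
  assumes "comm_ring_hom h"
  shows "map_mat h (symp_form n) = symp_form n"
proof -
  interpret comm_ring_hom h by fact
  show ?thesis by (rule eq_matI) (auto simp: symp_form_def hom_uminus)
qed

abbreviation Sp_gens :: "nat \<Rightarrow> coord zpoly set" where
  "Sp_gens n \<equiv> {((gen_group n)\<^sup>T * symp_form n * gen_group n - symp_form n) $$ (i, j) | i j.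
        i < 2 * n \<and> j < 2 * n}"

lemma Sp_ideal_span: "Sp_ideal n = idl.span (Sp_gens n) \<inter> polys (G_coords n \<union> V_coords n)"
  unfolding Sp_ideal_def
proof (rule genideal_zpoly_ring, safe)
  let ?P = "polys (G_coords n \<union> V_coords n)" and ?G = "gen_group n :: coord zpoly mat"
  fix i j assume ij: "i < 2 * n" "j < 2 * n"
  have G: "?G $$ (k, l) \<in> ?P" if "k < 2 * n" "l < 2 * n" for k l
    using that by (auto simp: gen_group_def G_coords_def)
  have "(?G\<^sup>T * symp_form n * ?G) $$ (i, j) \<in> ?P"
  proof (rule index_mult_in_polys[of _ "2 * n" "2 * n" _ "2 * n"])
    fix k assume k: "k < 2 * n"
    show "(?G\<^sup>T * symp_form n) $$ (i, k) \<in> ?P"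
      unfolding transpose_symp_index[OF gen_group_carrier(1) ij(1) k] using k ij by (auto intro!: G)
    show "?G $$ (k, j) \<in> ?P" by (rule G[OF k ij(2)])
  qed (use ij in auto)
  thus "(?G\<^sup>T * symp_form n * ?G - symp_form n) $$ (i, j) \<in> ?P"
    using ij by (simp add: symp_form_in_polys del: index_mult_mat)
qed

lemma Sp_ideal_eval:
  fixes g :: "'a::comm_ring_1 mat"
  assumes "q \<in> Sp_ideal n" "g \<in> Sp n" "\<And>i j. i < 2 * n \<Longrightarrow> j < 2 * n \<Longrightarrow> \<sigma> (CG i j) = g $$ (i, j)"
  shows "eval_zpoly \<sigma> q = 0"
proof -
  have hG: "map_mat (eval_zpoly \<sigma>) (gen_group n) = g"
    using SpD(1)[OF assms(2)] assms(3) by (intro eq_matI) (auto simp: gen_group_def)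
  have hGT: "map_mat (eval_zpoly \<sigma>) (gen_group n)\<^sup>T = g\<^sup>T" unfolding hG[symmetric] by (rule eq_matI) auto
  let ?P = "(gen_group n)\<^sup>T * symp_form n * gen_group n :: coord zpoly mat"
  have "map_mat (eval_zpoly \<sigma>) ?P = g\<^sup>T * symp_form n * g"
    by (subst eval_hom.mat_hom_mult[of _ "2 * n" "2 * n" _ "2 * n"], simp, simp,
      subst eval_hom.mat_hom_mult[of _ "2 * n" "2 * n" _ "2 * n"])
     (simp_all add: hG hGT map_symp_form[OF eval_hom.comm_ring_hom_axioms])
  hence P: "map_mat (eval_zpoly \<sigma>) ?P = symp_form n" by (simp add: SpD(2)[OF assms(2)])
  have "eval_zpoly \<sigma> s = 0" if "s \<in> Sp_gens n" for s
  proof -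
    from that obtain i j where s: "s = (?P - symp_form n) $$ (i, j)" and ij: "i < 2 * n" "j < 2 * n" by auto
    have "eval_zpoly \<sigma> (?P $$ (i, j)) = symp_form n $$ (i, j)"
      using arg_cong[OF P, of "\<lambda>M. M $$ (i, j)"] ij by (simp del: index_mult_mat(1))
    moreover have "eval_zpoly \<sigma> (symp_form n $$ (i, j)) = symp_form n $$ (i, j)"
      using arg_cong[OF map_symp_form[OF eval_hom.comm_ring_hom_axioms[of \<sigma>], of n], of "\<lambda>M. M $$ (i, j)"] ij by simp
    ultimately show ?thesis using ij by (simp add: s eval_hom.hom_minus del: index_mult_mat(1))
  qed
  hence "eval_zpoly \<sigma> q \<in> idl.span {}" using assms(1) unfolding Sp_ideal_span
    by (intro ideal_hom_image[OF eval_hom.comm_ring_hom_axioms, of q "Sp_gens n"]) (auto simp: idl.span_zero)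
  thus ?thesis by simp
qed

lemma gen_point_alt: "snd (gen_point n) \<in> alt_mat (2 * n)"
  by (rule alt_matI) (auto simp: gen_point_def)

lemma gen_point_carrier [simp]: "snd (gen_point n) \<in> sq_mats n"
  "fst (gen_point n) \<in> carrier_vec (2 * n)" by (auto simp: gen_point_def)

lemma eval_gen_point:
  assumes "p \<in> V_points n" "\<And>c. c \<in> V_coords n \<Longrightarrow> \<sigma> c = coord_val p c"
  shows "map_vec (eval_zpoly \<sigma>) (fst (gen_point n)) = fst p"
    "map_mat (eval_zpoly \<sigma>) (snd (gen_point n)) = snd p"
proof -
  obtain x Y where p: "p = (x, Y)" by (cases p)
  have x: "x \<in> carrier_vec (2 * n)" and Y: "Y \<in> alt_mat (2 * n)" using assms(1) by (auto simp: p V_points_def)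
  show "map_vec (eval_zpoly \<sigma>) (fst (gen_point n)) = fst p"
    using x assms(2) by (intro eq_vecI) (auto simp: gen_point_def p V_coords_def)
  have up: "\<sigma> (CY i j) = Y $$ (i, j)" if "i < j" "j < 2 * n" for i j
    using assms(2)[of "CY i j"] that by (auto simp: p V_coords_def)
  show "map_mat (eval_zpoly \<sigma>) (snd (gen_point n)) = snd p"
  proof (rule eq_matI)
    fix i j assume "i < dim_row (snd p)" "j < dim_col (snd p)"
    hence ij: "i < 2 * n" "j < 2 * n" using alt_matD(1)[OF Y] by (auto simp: p)
    consider "i < j" | "j < i" | "i = j" by linarith
    thus "map_mat (eval_zpoly \<sigma>) (snd (gen_point n)) $$ (i, j) = snd p $$ (i, j)"
    proof cases
      case 2
      thus ?thesis using ij up[of j i] alt_matD(2)[OF Y ij] by (simp add: gen_point_def p eval_hom.hom_uminus)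
    qed (use ij up alt_matD(3)[OF Y] in \<open>auto simp: gen_point_def p\<close>)
  qed (use alt_matD(1)[OF Y] in \<open>auto simp: gen_point_def p\<close>)
qed

lemma coord_val_hom:
  assumes "comm_ring_hom h" "fst p \<in> carrier_vec (2 * n)" "snd p \<in> sq_mats n" "c \<in> V_coords n"
  shows "h (coord_val p c) = coord_val (map_vec h (fst p), map_mat h (snd p)) c"
  using assms(2-4) by (auto simp: V_coords_def)

lemma act_carrier:
  assumes "g \<in> sq_mats n" "x \<in> carrier_vec (2 * n)" "Y \<in> sq_mats n"
  shows "fst (act g (x, Y)) \<in> carrier_vec (2 * n)" "snd (act g (x, Y)) \<in> sq_mats n"
  using assms by (auto simp: act_def intro!: sq_mult[of _ n])

lemma V_pointsD:
  assumes "p \<in> V_points n"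
  shows "fst p \<in> carrier_vec (2 * n)" "snd p \<in> alt_mat (2 * n)" "snd p \<in> sq_mats n"
  using assms alt_matD(1)[of "snd p" "2 * n"] by (auto simp: V_points_def)

abbreviation eval_pt where "eval_pt p \<equiv> eval_zpoly (coord_val p)"

lemma eval_act_gen:
  assumes p: "p \<in> V_points n" and g: "g \<in> sq_mats n" and f: "f \<in> polys (V_coords n)"
    and \<sigma>: "\<And>i j. i < 2 * n \<Longrightarrow> j < 2 * n \<Longrightarrow> \<sigma> (CG i j) = g $$ (i, j)"
      "\<And>c. c \<in> V_coords n \<Longrightarrow> \<sigma> c = coord_val p c"
  shows "eval_zpoly \<sigma> (eval_pt (act (gen_group n) (gen_point n)) f) = eval_pt (act g p) f"
proof -
  let ?h = "eval_zpoly \<sigma>"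
  have hG: "map_mat ?h (gen_group n) = g" using g \<sigma>(1) by (intro eq_matI) (auto simp: gen_group_def)
  have hGT: "map_mat ?h (gen_group n)\<^sup>T = g\<^sup>T" unfolding hG[symmetric] by (rule eq_matI) auto
  note hp = eval_gen_point[OF p \<sigma>(2), simplified]
  have "map_vec ?h (gen_group n *\<^sub>v fst (gen_point n)) = g *\<^sub>v fst p"
    by (subst eval_hom.mult_mat_vec_hom[of _ "2 * n" "2 * n"]) (simp_all add: hG hp(1))
  moreover have "map_mat ?h (gen_group n * snd (gen_point n) * (gen_group n)\<^sup>T) = g * snd p * g\<^sup>T"
    by (subst eval_hom.mat_hom_mult[of _ "2 * n" "2 * n" _ "2 * n"], simp add: sq_mult[of _ n], simp,
      subst eval_hom.mat_hom_mult[of _ "2 * n" "2 * n" _ "2 * n"]) (simp_all add: hG hGT hp(2))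
  ultimately have "?h (coord_val (act (gen_group n) (gen_point n)) c) = coord_val (act g p) c" if "c \<in> V_coords n" for c
    using act_carrier[of "gen_group n" n "fst (gen_point n)" "snd (gen_point n)"]
      coord_val_hom[OF eval_hom.comm_ring_hom_axioms[of \<sigma>] _ _ that, of "act (gen_group n) (gen_point n)"]
    by (simp add: act_def)
  thus ?thesis unfolding hom_eval_zpoly[OF eval_hom.comm_ring_hom_axioms] by (intro eval_zpoly_cong[OF f]) simp
qed

text \<open>The universal congruence specializes to points over every commutative ring, in
  particular over the function field of the representation.\<close>

lemma V_invariants_eval:
  assumes f: "f \<in> V_invariants n" and g: "g \<in> Sp n" and p: "p \<in> V_points n"
  shows "eval_pt (act g p) f = eval_pt p f"
proof -
  define \<sigma> where "\<sigma> c = (case c of CG i j \<Rightarrow> g $$ (i, j) | _ \<Rightarrow> coord_val p c)" for c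
  have \<sigma>: "\<sigma> (CG i j) = g $$ (i, j)" "c \<in> V_coords n \<Longrightarrow> \<sigma> c = coord_val p c" for i j c
    by (auto simp: \<sigma>_def V_coords_def)
  have fV: "f \<in> polys (V_coords n)" using f by (simp add: V_invariants_def)
  have "eval_zpoly \<sigma> (eval_pt (act (gen_group n) (gen_point n)) f - f) = 0"
    using f by (intro Sp_ideal_eval[OF _ g]) (auto simp: V_invariants_def \<sigma>)
  hence "eval_pt (act g p) f = eval_zpoly \<sigma> f"
    using eval_act_gen[OF p SpD(1)[OF g] fV, of \<sigma>] \<sigma> by (simp add: eval_hom.hom_minus)
  also have "\<dots> = eval_pt p f" by (rule eval_zpoly_cong[OF fV]) (rule \<sigma>(2))
  finally show ?thesis .
qed

subsection \<open>The generic bivector\<close>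

lemma Fract_hom: "comm_ring_hom (\<lambda>x :: 'a::idom. Fract x 1)"
  by standard (simp_all add: One_fract_def Zero_fract_def)

lemma Fract_inj: "Fract x 1 = Fract y 1 \<longleftrightarrow> x = (y :: 'a::idom)"
  by (simp add: eq_fract)

lemma gpol_hom:
  assumes "comm_ring_hom h" "Y \<in> sq_mats n"
  shows "fps_nth (gpol n (map_mat h Y)) j = h (fps_nth (gpol n Y) j)"
proof -
  interpret comm_ring_hom h by fact
  have "zmat n (map_mat h Y) = (\<lambda>p q. h (zmat n Y p q))"
    using assms(2) pos_less[of _ n] by (intro ext) (auto simp: zmat_def)
  thus ?thesis unfolding gpol_def by (simp add: gser_hom[OF assms(1)])
qed

lemma amat_hom:
  assumes "comm_ring_hom h" "Y \<in> sq_mats n" "i < 2 * n" "j < 2 * n"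
  shows "amat n (map_mat h Y) $$ (i, j) = h (amat n Y $$ (i, j))"
proof -
  interpret comm_ring_hom h by fact
  show ?thesis using assms(2-4) by (subst (1 2) amat_index) (auto simp: hom_uminus)
qed

lemma avec_pow_hom:
  assumes "comm_ring_hom h" "Y \<in> sq_mats n"
  shows "(avec n (map_mat h Y) ^^ k) (\<lambda>j. h (u j)) i = h ((avec n Y ^^ k) u i)"
proof -
  interpret comm_ring_hom h by fact
  show ?thesis by (induction k arbitrary: i) (simp_all add: avec_def amat_hom[OF assms] hom_sum hom_mult)
qed

definition Cgen :: "nat \<Rightarrow> nat \<Rightarrow> coord zpoly" where
  "Cgen n j = fps_nth (gpol n (snd (gen_point n))) j"

text \<open>Sign and reversal are chosen so that, by \<open>gpol_comp\<close>, \<open>c j\<close> is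
  the coefficient of degree j of the characteristic series for 1 \<le> j \<le> n.\<close>

definition comp_point :: "nat \<Rightarrow> (nat \<Rightarrow> 'a::comm_ring_1) \<Rightarrow> 'a vec \<times> 'a mat" where
  "comp_point n c = (vec (2 * n) (\<lambda>i. if i = 0 then 1 else 0), bmat n (compan n (\<lambda>i. - c (n - i))))"

lemma comp_point_V: "comp_point n c \<in> V_points n"
  by (simp add: comp_point_def V_points_def bmat_alt)

lemma gen_point_dim [simp]: "dim_row (snd (gen_point n)) = 2 * n" "dim_col (snd (gen_point n)) = 2 * n"
  "dim_vec (fst (gen_point n)) = 2 * n" by (simp_all add: gen_point_def)

lemma gen_point_V: "gen_point n \<in> V_points n"
  using gen_point_alt[of n] gen_point_carrier(2)[of n] by (simp add: V_points_def mem_Times_iff)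

lemma coord_val_gen_point: "c \<in> V_coords n \<Longrightarrow> coord_val (gen_point n) c = Var c"
  by (auto simp: V_coords_def gen_point_def)

lemma eval_coord_val_hom:
  assumes h: "comm_ring_hom h" and p: "p \<in> V_points n" and f: "f \<in> polys (V_coords n)"
  shows "h (eval_pt p f) = eval_pt (map_vec h (fst p), map_mat h (snd p)) f"
  unfolding hom_eval_zpoly[OF h] by (rule eval_zpoly_cong[OF f]) (rule coord_val_hom[OF h V_pointsD(1,3)[OF p]])

lemma eval_gen_point_self: "f \<in> polys (V_coords n) \<Longrightarrow> eval_pt (gen_point n) f = f"
  by (subst eval_zpoly_cong[where y = Var]) (auto simp: coord_val_gen_point)

lemma eval_Cgen:
  assumes "p \<in> V_points n" "\<And>c. c \<in> V_coords n \<Longrightarrow> \<sigma> c = coord_val p c"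
  shows "eval_zpoly \<sigma> (Cgen n j) = fps_nth (gpol n (snd p)) j"
  using gpol_hom[OF eval_hom.comm_ring_hom_axioms[of \<sigma>] gen_point_carrier(1)[of n], of j]
  by (simp add: eval_gen_point(2)[OF assms] Cgen_def)

lemma Cgen_in_polys: "Cgen n j \<in> polys (V_coords n)"
proof -
  have "map_mat (zrestrict (V_coords n)) (snd (gen_point n)) = snd (gen_point n)" unfolding zrestrict_def
    by (rule eval_gen_point(2)[OF gen_point_V]) (simp add: coord_val_gen_point)
  hence "zrestrict (V_coords n) (Cgen n j) = Cgen n j"
    using gpol_hom[OF zrestrict_hom[of "V_coords n"] gen_point_carrier(1)[of n], of j] by (simp add: Cgen_def)
  thus ?thesis using zrestrict_in_polys by metis
qed

lemma Cgen_0: "Cgen n 0 = 1"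
  by (simp add: Cgen_def)

definition xgen :: "nat \<Rightarrow> nat \<Rightarrow> coord zpoly" where
  "xgen n j = (if j < 2 * n then Var (CX j) else 0)"

lemma comp_shift:
  assumes "n \<ge> 1" "k < n"
  shows "(avec n (bmat n (compan n \<beta>)) ^^ k) (\<lambda>i. if i = 0 then 1 else 0) = (\<lambda>i. if i = k then 1 else (0 :: 'a::comm_ring_1))" (is "(?A ^^ _) _ = _")
  using assms(2)
proof (induction k)
  case (Suc k)
  let ?e = "\<lambda>k i. if i = k then 1 else (0 :: 'a)"
  note Zc = alt_matD(1)[OF bmat_alt[of n "compan n \<beta>"]]
  have "?A (?e k) i = (if i = Suc k then 1 else 0)" for i
  proof (cases "i < 2 * n")
    case True
    have "?A (?e k) i = (\<Sum>j<2 * n. if j = k then amat n (bmat n (compan n \<beta>)) $$ (i, j) else 0)"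
      using True by (simp add: avec_def if_distrib[of "\<lambda>x. _ * x"] cong: if_cong)
    also have "\<dots> = amat n (bmat n (compan n \<beta>)) $$ (i, k)" using Suc.prems by simp
    also have "\<dots> = (if i = Suc k then 1 else 0)"
      using True Suc.prems by (subst amat_index[OF Zc]) (auto simp: bmat_def compan_def)
    finally show ?thesis .
  qed (use Suc.prems in \<open>simp add: avec_def\<close>)
  hence "?A (?e k) = ?e (Suc k)" by (rule ext)
  moreover have "(?A ^^ k) (?e 0) = ?e k" using Suc by simp
  ultimately show ?case by simp
qed simp

text \<open>At the companion point with zero parameters the matrix specializes to the
  identity.\<close>

lemma generic_cyclic:
  assumes "n \<ge> 1"
  shows "det (mat n n (\<lambda>(i, j). (avec n (snd (gen_point n)) ^^ i) (xgen n) j)) \<noteq> 0"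
proof
  let ?M = "mat n n (\<lambda>(i, j). (avec n (snd (gen_point n)) ^^ i) (xgen n) j)"
  assume 0: "det ?M = 0"
  define p :: "int vec \<times> int mat" where "p = comp_point n (\<lambda>_. 0)"
  have p: "p \<in> V_points n" by (simp add: p_def comp_point_V)
  let ?h = "eval_pt p"
  have x: "(\<lambda>j. ?h (xgen n j)) = (\<lambda>i. if i = 0 then 1 else 0)"
    using assms by (intro ext) (auto simp: xgen_def p_def comp_point_def)
  have "map_mat ?h ?M = 1\<^sub>m n"
  proof (rule eq_matI)
    fix i j assume "i < dim_row (1\<^sub>m n :: int mat)" "j < dim_col (1\<^sub>m n :: int mat)"
    hence ij: "i < n" "j < n" by auto
    have "map_mat ?h ?M $$ (i, j) = (avec n (map_mat ?h (snd (gen_point n))) ^^ i) (\<lambda>j. ?h (xgen n j)) j"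
      using ij by (simp add: avec_pow_hom[OF eval_hom.comm_ring_hom_axioms])
    also have "\<dots> = 1\<^sub>m n $$ (i, j)" unfolding x eval_gen_point(2)[OF p refl] using ij assms
      by (simp add: p_def comp_point_def comp_shift)
    finally show "map_mat ?h ?M $$ (i, j) = 1\<^sub>m n $$ (i, j)" .
  qed auto
  hence "?h (det ?M) = 1" by (simp flip: eval_hom.hom_det)
  with 0 show False by simp
qed

text \<open>The parameters \<beta> of the normal form over the function field are found by comparing
  characteristic series. They turn out to be the polynomials - \<open>Cgen n j\<close>, and the same
  comparison bounds the degree of the series.\<close>

lemma generic_normal_form:
  assumes n: "n \<ge> 1"
  defines "K \<equiv> \<lambda>x :: coord zpoly. Fract x 1"
  obtains M :: "coord zpoly fract mat" where "M \<in> Sp n"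
    "act M (map_vec K (fst (comp_point n (Cgen n))), map_mat K (snd (comp_point n (Cgen n))))
      = (map_vec K (fst (gen_point n)), map_mat K (snd (gen_point n)))"
    "\<And>j. j > n \<Longrightarrow> Cgen n j = 0"
proof -
  let ?c = "comp_point n (Cgen n)" and ?g = "gen_point n"
  have K: "comm_ring_hom K" unfolding K_def by (rule Fract_hom)
  interpret K: comm_ring_hom K by (rule K)
  define Y where "Y = map_mat K (snd ?g)"
  have Y: "Y \<in> alt_mat (2 * n)"
  proof (rule alt_matI)
    note g = alt_matD[OF gen_point_alt[of n]]
    show "Y $$ (i, j) = - Y $$ (j, i)" if "i < 2 * n" "j < 2 * n" for i j
      using g(1) g(2)[OF that] that by (simp add: Y_def flip: K.hom_uminus)
    show "Y $$ (i, i) = 0" if "i < 2 * n" for i using g(1,3) that by (simp add: Y_def)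
  qed (simp add: Y_def)
  have "mat n n (\<lambda>(i, j). (avec n Y ^^ i) (\<lambda>j. K (xgen n j)) j)
      = map_mat K (mat n n (\<lambda>(i, j). (avec n (snd ?g) ^^ i) (xgen n) j))"
    by (rule eq_matI) (auto simp: Y_def avec_pow_hom[OF K])
  hence "det (mat n n (\<lambda>(i, j). (avec n Y ^^ i) (\<lambda>j. K (xgen n j)) j)) =
      K (det (mat n n (\<lambda>(i, j). (avec n (snd ?g) ^^ i) (xgen n) j)))" by simp
  moreover have "K x \<noteq> 0" if "x \<noteq> 0" for x using that by (simp add: K_def Zero_fract_def eq_fract)
  ultimately have cyc: "det (mat n n (\<lambda>(i, j). (avec n Y ^^ i) (\<lambda>j. K (xgen n j)) j)) \<noteq> 0"
    using generic_cyclic[OF n] by simp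
  obtain M \<beta> where M: "M \<in> Sp n" "\<And>i. i < 2 * n \<Longrightarrow> M $$ (i, 0) = K (xgen n i)"
    and MY: "M * bmat n (compan n \<beta>) * M\<^sup>T = Y"
    by (rule cyclic_normal_form[OF Y n cyc]) blast
  have gp: "K (Cgen n j) = (if j = 0 then 1 else if j \<le> n then - \<beta> (n - j) else 0)" for j
  proof -
    have "K (Cgen n j) = fps_nth (gpol n Y) j" by (simp add: Cgen_def Y_def gpol_hom[OF K])
    also have "gpol n Y = gpol n (bmat n (compan n \<beta>))" using gpol_act[OF M(1) bmat_alt] by (simp flip: MY)
    finally show ?thesis by (simp add: gpol_comp[OF n])
  qed
  have bm: "bmat n (compan n \<beta>) = map_mat K (snd ?c)"
  proof (rule eq_matI)
    have "\<beta> i = K (- Cgen n (n - i))" if "i < n" for i using gp[of "n - i"] that by (simp add: K.hom_uminus)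
    hence "compan n \<beta> i j = K (compan n (\<lambda>i. - Cgen n (n - i)) i j)" if "i < n" for i j
      using that by (simp add: compan_def)
    thus "bmat n (compan n \<beta>) $$ (i, j) = map_mat K (snd ?c) $$ (i, j)"
      if "i < dim_row (map_mat K (snd ?c))" "j < dim_col (map_mat K (snd ?c))" for i j
      using that by (auto simp: comp_point_def bmat_def K.hom_uminus)
  qed (auto simp: bmat_def comp_point_def)
  have "M *\<^sub>v map_vec K (fst ?c) = map_vec K (fst ?g)"
  proof (rule eq_vecI)
    fix i assume "i < dim_vec (map_vec K (fst ?g))"
    hence i: "i < 2 * n" using gen_point_carrier(2)[of n] by simp
    have "(M *\<^sub>v map_vec K (fst ?c)) $ i = (\<Sum>j<2 * n. M $$ (i, j) * K (if j = 0 then 1 else 0))"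
      using i SpD(1)[OF M(1)] by (simp add: comp_point_def scalar_prod_def atLeast0LessThan)
    also have "\<dots> = (\<Sum>j<2 * n. if j = 0 then M $$ (i, j) else 0)" by (intro sum.cong) auto
    also have "\<dots> = K (xgen n i)" using n i M(2)[OF i] by simp
    finally show "(M *\<^sub>v map_vec K (fst ?c)) $ i = map_vec K (fst ?g) $ i"
      using i by (simp add: xgen_def gen_point_def)
  qed (use SpD(1)[OF M(1)] gen_point_carrier(2)[of n] in auto)
  hence "act M (map_vec K (fst ?c), map_mat K (snd ?c))
      = (map_vec K (fst ?g), map_mat K (snd ?g))" using MY by (simp add: act_def Y_def bm)
  moreover have "Cgen n j = 0" if "j > n" for j using gp[of j] that by (simp add: K_def Zero_fract_def eq_fract)
  ultimately show thesis using that M(1) by blast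
qed

lemma Cgen_large:
  assumes "j > n"
  shows "Cgen n j = 0"
proof (cases "n \<ge> 1")
  case True
  thus ?thesis using generic_normal_form[of n] assms by blast
next
  case False
  hence "n = 0" by simp
  thus ?thesis using assms by (simp add: Cgen_def gpol_def)
qed

text \<open>The generic point is conjugate to the companion point over the function field, hence every
  invariant is a polynomial in the \<open>Cgen n j\<close>.\<close>

lemma invariant_comp_point:
  assumes n: "n \<ge> 1" and f: "f \<in> V_invariants n"
  shows "f = eval_pt (comp_point n (Cgen n)) f"
proof -
  let ?K = "\<lambda>x :: coord zpoly. Fract x 1"
  have K: "comm_ring_hom ?K" by (rule Fract_hom)
  have fV: "f \<in> polys (V_coords n)" using f by (simp add: V_invariants_def)
  let ?q = "(map_vec ?K (fst (comp_point n (Cgen n))), map_mat ?K (snd (comp_point n (Cgen n))))"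
  obtain M :: "coord zpoly fract mat" where M: "M \<in> Sp n"
    and eq: "act M ?q = (map_vec ?K (fst (gen_point n)), map_mat ?K (snd (gen_point n)))"
    by (rule generic_normal_form[OF n]) blast
  interpret K: comm_ring_hom ?K by (rule K)
  have q: "?q \<in> V_points n"
  proof -
    have "map_mat ?K (snd (comp_point n (Cgen n))) \<in> alt_mat (2 * n)"
    proof (rule alt_matI)
      note g = alt_matD[OF V_pointsD(2)[OF comp_point_V[of n "Cgen n"]]]
      show "map_mat ?K (snd (comp_point n (Cgen n))) $$ (i, j) = - map_mat ?K (snd (comp_point n (Cgen n))) $$ (j, i)"
        if "i < 2 * n" "j < 2 * n" for i j
        using g(1) g(2)[OF that] that by (simp add: K.hom_uminus[symmetric] del: minus_fract)
      show "map_mat ?K (snd (comp_point n (Cgen n))) $$ (i, i) = 0" if "i < 2 * n" for i using g(1,3) that by simp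
    qed (use V_pointsD(3)[OF comp_point_V[of n "Cgen n"]] in simp)
    thus ?thesis using V_pointsD(1)[OF comp_point_V[of n "Cgen n"]] by (simp add: V_points_def)
  qed
  have "?K f = ?K (eval_pt (gen_point n) f)" by (simp add: eval_gen_point_self[OF fV])
  also have "\<dots> = eval_pt (act M ?q) f" unfolding eq by (rule eval_coord_val_hom[OF K gen_point_V fV])
  also have "\<dots> = eval_pt ?q f" by (rule V_invariants_eval[OF f M q])
  also have "\<dots> = ?K (eval_pt (comp_point n (Cgen n)) f)"
    by (rule eval_coord_val_hom[OF K comp_point_V fV, symmetric])
  finally show ?thesis unfolding Fract_inj .
qed

section \<open>The invariants without constant term lie in the ideal of the coefficients\<close>

abbreviation Cideal :: "nat \<Rightarrow> coord zpoly set" where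
  "Cideal n \<equiv> idl.span (Cgen n ` {1..n})"

lemma eval_zero: "eval_zpoly (\<lambda>_. 0 :: int) f = lookup f 0"
proof -
  have "mon (\<lambda>_. 0 :: int) m = (if m = 0 then 1 else 0)" for m :: "'a \<Rightarrow>\<^sub>0 nat"
  proof (cases "m = 0")
    case False
    then obtain v where "v \<in> keys m" by (metis all_not_in_conv keys_eq_empty)
    thus ?thesis using False by (auto simp: mon_def in_keys_iff intro!: prod_zero bexI[of _ v])
  qed simp
  hence "eval_zpoly (\<lambda>_. 0 :: int) f = (\<Sum>m\<in>keys f. if m = 0 then lookup f m else 0)"
    unfolding eval_zpoly_superset[OF finite_keys subset_refl] by (intro sum.cong) auto
  thus ?thesis by (simp add: in_keys_iff)
qed

lemma gpol_zero: "fps_nth (gpol n (0\<^sub>m (2 * n) (2 * n))) j = (if j = 0 then 1 else 0)"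
proof -
  have "0\<^sub>m (2 * n) (2 * n) = bmat n (\<lambda>_ _. 0 :: 'a)" by (rule eq_matI) (auto simp: bmat_def)
  thus ?thesis by (simp add: gpol_def gser_bmat_strict)
qed

lemma lookup_Cgen_0: "j \<ge> 1 \<Longrightarrow> lookup (Cgen n j) 0 = 0"
proof -
  assume j: "j \<ge> 1"
  let ?p = "(0\<^sub>v (2 * n), 0\<^sub>m (2 * n) (2 * n)) :: int vec \<times> int mat"
  have p: "?p \<in> V_points n" by (auto simp: V_points_def intro!: alt_matI)
  have "eval_zpoly (\<lambda>_. 0 :: int) (Cgen n j) = fps_nth (gpol n (snd ?p)) j"
    by (rule eval_Cgen[OF p]) (auto simp: V_coords_def)
  thus ?thesis using j by (simp add: eval_zero gpol_zero)
qed

text \<open>Modulo the \<open>Cgen n j\<close> the companion point becomes the one with zero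
  parameters, which is defined over the integers. So the invariant is congruent to an integer, and
  that integer is its constant term.\<close>

lemma invariant_in_Cideal:
  assumes f: "f \<in> V_invariants n" and 0: "lookup f 0 = 0"
  shows "f \<in> Cideal n"
proof (cases "n \<ge> 1")
  case True
  have fV: "f \<in> polys (V_coords n)" using f by (simp add: V_invariants_def)
  let ?c = "comp_point n (Cgen n)" and ?d = "comp_point n (\<lambda>_. 0) :: coord zpoly vec \<times> coord zpoly mat"
  have feq: "f = eval_pt ?c f" by (rule invariant_comp_point[OF True f])
  have "eval_pt ?c f - eval_pt ?d f \<in> Cideal n"
  proof (rule eval_zpoly_cong_ideal[OF fV])
    fix v assume "v \<in> V_coords n"
    have base: "Cgen n (n - i) \<in> Cideal n" "- Cgen n (n - i) \<in> Cideal n" if "i < n" for i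
      using that by (auto intro!: idl.span_base idl.span_neg)
    hence "compan n (\<lambda>i. - Cgen n (n - i)) i j - compan n (\<lambda>i. - 0) i j \<in> Cideal n" if "i < n" for i j
      using that by (simp add: compan_def idl.span_zero)
    moreover have "- compan n (\<lambda>i. - Cgen n (n - i)) i j - - compan n (\<lambda>i. - 0) i j \<in> Cideal n" if "i < n" for i j
      using that base by (simp add: compan_def idl.span_zero)
    ultimately show "coord_val ?c v - coord_val ?d v \<in> Cideal n" using \<open>v \<in> V_coords n\<close>
      by (auto simp: V_coords_def comp_point_def bmat_def idl.span_zero)
  qed
  moreover have "eval_pt ?d f = 0"
  proof -
    have h: "comm_ring_hom (of_int :: int \<Rightarrow> coord zpoly)" by standard simp_all
    let ?z = "comp_point n (\<lambda>_. 0) :: int vec \<times> int mat"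
    have "eval_pt ?d f = of_int (eval_pt ?z f)" unfolding hom_eval_zpoly[OF h]
      by (rule eval_zpoly_cong[OF fV]) (auto simp: V_coords_def comp_point_def bmat_def compan_def)
    \<comment> \<open>Putting all variables to zero in f = f(companion point) also leads to zero
      parameters, as the \<open>Cgen n j\<close> have no constant term.\<close>
    moreover have "eval_zpoly (\<lambda>_. 0 :: int) f = eval_pt ?z f"
    proof -
      have "eval_zpoly (\<lambda>_. 0 :: int) f = eval_zpoly (\<lambda>v. eval_zpoly (\<lambda>_. 0) (coord_val ?c v)) f"
        by (subst feq) (rule hom_eval_zpoly[OF eval_hom.comm_ring_hom_axioms])
      also have "\<dots> = eval_pt ?z f" by (rule eval_zpoly_cong[OF fV])
          (auto simp: V_coords_def comp_point_def bmat_def compan_def eval_zero lookup_Cgen_0 eval_hom.hom_uminus)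
      finally show ?thesis .
    qed
    ultimately show ?thesis by (simp add: eval_zero 0)
  qed
  ultimately show ?thesis using feq by simp
next
  case False
  hence "f \<in> polys {}" using f by (auto simp: V_invariants_def V_coords_def polys_def)
  then obtain c where "f = of_int c" by (rule polys_empty)
  hence "f = 0" using 0 by (simp add: lookup_of_int)
  thus ?thesis by (simp add: idl.span_zero)
qed

subsection \<open>The Pfaffian and scheme-theoretic invariance\<close>

lemma symp_form_alt: "symp_form n \<in> alt_mat (2 * n)"
  by (rule alt_matI) (auto simp: symp_form_def)

lemma det_symp_form: "det (symp_form n) * det (symp_form n) = (1 :: 'a::comm_ring_1)"
proof -
  have "det ((symp_form n)\<^sup>T * symp_form n) = (1 :: 'a)" by (simp add: symp_form_orthogonal)
  thus ?thesis by (subst (asm) det_mult[of _ "2 * n"]) (simp_all add: det_transpose[of _ "2 * n"])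
qed

lemma symp_form_orthogonal': "symp_form n * (symp_form n)\<^sup>T = 1\<^sub>m (2 * n)"
proof (rule eq_matI)
  fix i j assume "i < dim_row (1\<^sub>m (2 * n))" "j < dim_col (1\<^sub>m (2 * n))"
  hence ij: "i < 2 * n" "j < 2 * n" by auto
  have "(symp_form n * (symp_form n)\<^sup>T) $$ (i, j) = (\<Sum>k<2 * n. symp_form n $$ (i, k) * symp_form n $$ (j, k))"
    using ij by (subst sq_index[of _ n]) auto
  also have "\<dots> = 1\<^sub>m (2 * n) $$ (i, j)"
    unfolding sum_symp_form_left[OF ij(1)] using ij by (auto simp: symp_form_def)
  finally show "(symp_form n * (symp_form n)\<^sup>T) $$ (i, j) = 1\<^sub>m (2 * n) $$ (i, j)" .
qed auto

lemma det_congruence: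
  fixes A B :: "'a::comm_ring_1 mat"
  assumes A: "A \<in> carrier_mat N N" and B: "B \<in> carrier_mat N N"
  shows "det (A * B * A\<^sup>T) = (det A)\<^sup>2 * det B" "det (A\<^sup>T * B * A) = (det A)\<^sup>2 * det B"
proof -
  have AT: "A\<^sup>T \<in> carrier_mat N N" using A by simp
  show "det (A * B * A\<^sup>T) = (det A)\<^sup>2 * det B"
    unfolding det_mult[OF mult_carrier_mat[OF A B] AT] det_mult[OF A B] det_transpose[OF A]
    by (simp add: power2_eq_square mult_ac)
  show "det (A\<^sup>T * B * A) = (det A)\<^sup>2 * det B"
    unfolding det_mult[OF mult_carrier_mat[OF AT B] A] det_mult[OF AT B] det_transpose[OF A]
    by (simp add: power2_eq_square mult_ac)
qed

lemma act_V_points: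
  assumes "g \<in> sq_mats n" "p \<in> V_points n"
  shows "act g p \<in> V_points n"
  using V_pointsD[OF assms(2)] act_alt_mat[OF V_pointsD(2)[OF assms(2)] assms(1)] assms(1)
  by (auto simp: act_def V_points_def)

lemma bmat_factor:
  fixes b :: "nat \<Rightarrow> nat \<Rightarrow> 'a::comm_ring_1" and n :: nat
  defines "G \<equiv> four_block_mat (mat n n (\<lambda>(i, j). b i j)) (0\<^sub>m n n) (0\<^sub>m n n) (1\<^sub>m n)"
  shows "bmat n b = G * symp_form n * G\<^sup>T"
proof (rule eq_matI)
  have G: "G \<in> sq_mats n" by (simp add: G_def mult_2)
  have Gi: "G $$ (i, j) = (if i < n \<and> j < n then b i j else if i = j then 1 else 0)" if "i < 2 * n" "j < 2 * n" for i j
    using that by (auto simp: G_def)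
  show "bmat n b $$ (i, j) = (G * symp_form n * G\<^sup>T) $$ (i, j)"
    if "i < dim_row (G * symp_form n * G\<^sup>T)" "j < dim_col (G * symp_form n * G\<^sup>T)" for i j
  proof -
    have ij: "i < 2 * n" "j < 2 * n" using that G by auto
    have "(G * symp_form n * G\<^sup>T) $$ (i, j) = (\<Sum>k<2 * n. (G * symp_form n) $$ (i, k) * G $$ (j, k))"
      using ij G by (subst sq_index[of _ n]) auto
    also have "\<dots> = (\<Sum>k<2 * n. (if k < n then - G $$ (i, k + n) else G $$ (i, k - n)) * G $$ (j, k))"
    proof (intro sum.cong refl)
      fix k assume "k \<in> {..<2 * n}"
      hence k: "k < 2 * n" by simp
      have "(G * symp_form n) $$ (i, k) = (\<Sum>l<2 * n. G $$ (i, l) * symp_form n $$ (l, k))"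
        using ij k G by (subst sq_index[of _ n]) auto
      thus "(G * symp_form n) $$ (i, k) * G $$ (j, k) = (if k < n then - G $$ (i, k + n) else G $$ (i, k - n)) * G $$ (j, k)"
        by (simp only: sum_symp_form_right[OF k])
    qed
    also have "\<dots> = (\<Sum>k<n. G $$ (i, k) * G $$ (j, k + n) - G $$ (i, k + n) * G $$ (j, k))"
      unfolding sum_lessThan_2n by (intro sum.cong refl) simp
    also have "\<dots> = (\<Sum>k<n. if k = (if i < n then j - n else i - n) then bmat n b $$ (i, j) else 0)"
      by (intro sum.cong refl) (use ij in \<open>auto simp: Gi bmat_def\<close>)
    also have "\<dots> = bmat n b $$ (i, j)" using ij by (subst sum.delta) (auto simp: bmat_def)
    finally show ?thesis by simp
  qed
  show "dim_row (bmat n b) = dim_row (G * symp_form n * G\<^sup>T)" "dim_col (bmat n b) = dim_col (G * symp_form n * G\<^sup>T)"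
    using G by (auto simp: bmat_def)
qed

lemma det_compan:
  assumes "n \<ge> 1"
  shows "det (mat n n (\<lambda>(i, j). compan n \<beta> i j)) ^ 2 = (\<beta> 0 :: 'a::comm_ring_1) ^ 2"
proof -
  let ?A = "mat n n (\<lambda>(i, j). compan n \<beta> i j)"
  have A: "?A \<in> carrier_mat n n" by simp
  have "det ?A = (\<Sum>j<n. ?A $$ (0, j) * cofactor ?A 0 j)" by (rule laplace_expansion_row[OF A]) (use assms in simp)
  also have "\<dots> = (\<Sum>j<n. if j = n - 1 then \<beta> 0 * cofactor ?A 0 j else 0)"
  proof (intro sum.cong refl)
    fix j assume "j \<in> {..<n}"
    hence "?A $$ (0, j) = (if j = n - 1 then \<beta> 0 else 0)" using assms by (simp add: compan_def)
    thus "?A $$ (0, j) * cofactor ?A 0 j = (if j = n - 1 then \<beta> 0 * cofactor ?A 0 j else 0)" by (simp only:) simp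
  qed
  also have "\<dots> = \<beta> 0 * cofactor ?A 0 (n - 1)" using assms by simp
  also have "mat_delete ?A 0 (n - 1) = 1\<^sub>m (n - 1)" by (rule eq_matI) (auto simp: mat_delete_def compan_def)
  hence "cofactor ?A 0 (n - 1) = (- 1) ^ (n - 1)" by (simp add: cofactor_def)
  finally show ?thesis by (simp add: power_mult_distrib flip: power_mult)
qed

text \<open>The Pfaffian, with the sign left unnormalized: its value at \<open>symp_form n\<close>
  is only shown to have square 1, which is all that is used.\<close>

definition pf :: "nat \<Rightarrow> 'a::comm_ring_1 mat \<Rightarrow> 'a" where
  "pf n Z = fps_nth (gpol n Z) n"

lemma eval_Cgen_pf:
  assumes "p \<in> V_points n" "\<And>c. c \<in> V_coords n \<Longrightarrow> \<sigma> c = coord_val p c"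
  shows "eval_zpoly \<sigma> (Cgen n n) = pf n (snd p)"
  using eval_Cgen[OF assms] by (simp add: pf_def)

lemma pf_hom:
  assumes "comm_ring_hom h" "Y \<in> sq_mats n"
  shows "pf n (map_mat h Y) = h (pf n Y)"
  by (simp add: pf_def gpol_hom[OF assms])

text \<open>The normal form over the function field reduces this to the companion matrix; the
  conjugating matrix has determinant of square 1.\<close>

lemma pf_square_generic: "Cgen n n ^ 2 * det (symp_form n) = det (snd (gen_point n))"
proof (cases "n \<ge> 1")
  case True
  let ?K = "\<lambda>x :: coord zpoly. Fract x 1"
  have K: "comm_ring_hom ?K" by (rule Fract_hom)
  interpret K: comm_ring_hom ?K by (rule K)
  let ?b = "compan n (\<lambda>i. - Cgen n (n - i))"
  obtain M :: "coord zpoly fract mat" where M: "M \<in> Sp n"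
    and eq: "act M (map_vec ?K (fst (comp_point n (Cgen n))), map_mat ?K (snd (comp_point n (Cgen n))))
      = (map_vec ?K (fst (gen_point n)), map_mat ?K (snd (gen_point n)))"
    by (rule generic_normal_form[OF True]) blast
  note Mc = SpD(1)[OF M]
  have Zc: "bmat n ?b \<in> sq_mats n" by (rule alt_matD(1)[OF bmat_alt])
  have "det (M\<^sup>T * symp_form n * M) = det (symp_form n)" by (simp add: SpD(2)[OF M])
  hence "(det M)\<^sup>2 * (det (symp_form n) * det (symp_form n)) = det (symp_form n) * det (symp_form n)"
    unfolding det_congruence(2)[OF Mc symp_form_carrier(1)] by (simp only: mult.assoc[symmetric])
  hence detM: "(det M)\<^sup>2 = 1" by (simp add: det_symp_form)
  have "map_mat ?K (snd (gen_point n)) = M * map_mat ?K (bmat n ?b) * M\<^sup>T"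
    using eq by (simp add: act_def comp_point_def)
  hence "det (map_mat ?K (snd (gen_point n))) = (det M)\<^sup>2 * det (map_mat ?K (bmat n ?b))"
    using Mc Zc by (simp only: det_congruence(1)[of M "2 * n"] map_carrier_mat)
  hence "?K (det (snd (gen_point n))) = ?K (det (bmat n ?b))" by (simp only: detM K.hom_det mult_1)
  hence "det (snd (gen_point n)) = det (bmat n ?b)" by (simp only: Fract_inj)
  also have "\<dots> = det (mat n n (\<lambda>(i, j). ?b i j)) ^ 2 * det (symp_form n)"
  proof -
    let ?G = "four_block_mat (mat n n (\<lambda>(i, j). ?b i j)) (0\<^sub>m n n) (0\<^sub>m n n) (1\<^sub>m n) :: coord zpoly mat"
    have G: "?G \<in> sq_mats n" by (simp add: mult_2)
    have "det ?G = det (mat n n (\<lambda>(i, j). ?b i j))"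
      by (subst det_four_block_mat_lower_left_zero[of _ n _ n]) simp_all
    thus ?thesis unfolding bmat_factor det_congruence(1)[OF G symp_form_carrier(1)] by (simp only:)
  qed
  also have "\<dots> = Cgen n n ^ 2 * det (symp_form n)" by (simp add: det_compan[OF True])
  finally show ?thesis by simp
next
  case False
  hence "n = 0" by simp
  thus ?thesis using symp_form_carrier(1)[of 0, where 'a = "coord zpoly"] gen_point_carrier(1)[of 0] by (simp add: Cgen_0)
qed

lemma pf_square:
  fixes Z :: "'a::comm_ring_1 mat"
  assumes "Z \<in> alt_mat (2 * n)"
  shows "pf n Z ^ 2 * det (symp_form n) = det Z"
proof -
  let ?p = "(0\<^sub>v (2 * n), Z)"
  have p: "?p \<in> V_points n" using assms by (simp add: V_points_def)
  let ?h = "eval_pt ?p"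
  have "?h (Cgen n n ^ 2 * det (symp_form n)) = ?h (det (snd (gen_point n)))" by (simp only: pf_square_generic)
  hence "pf n Z ^ 2 * det (map_mat ?h (symp_form n)) = det (map_mat ?h (snd (gen_point n)))"
    by (simp only: eval_hom.hom_det eval_zpoly_mult eval_hom.hom_power eval_Cgen_pf[OF p refl] snd_conv)
  thus ?thesis
    by (simp only: map_symp_form[OF eval_hom.comm_ring_hom_axioms] eval_gen_point(2)[OF p refl] snd_conv)
qed

lemma pf_symp_form: "pf n (symp_form n) * pf n (symp_form n) = (1 :: 'a::comm_ring_1)"
proof -
  have "pf n (symp_form n) ^ 2 * (det (symp_form n) * det (symp_form n)) = det (symp_form n) * (det (symp_form n) :: 'a)"
    using arg_cong[OF pf_square[OF symp_form_alt[of n]], of "\<lambda>x :: 'a. x * det (symp_form n)"]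
    by (simp only: mult.assoc)
  thus ?thesis by (simp add: det_symp_form power2_eq_square)
qed

section \<open>The Pfaffian under congruence, over any commutative ring\<close>

lemma pf_gen_eval:
  fixes h W :: "'a::comm_ring_1 mat"
  assumes W: "W \<in> alt_mat (2 * n)" and h: "h \<in> sq_mats n"
  defines "\<sigma> \<equiv> \<lambda>c. case c of CG i j \<Rightarrow> h $$ (i, j) | _ \<Rightarrow> coord_val (0\<^sub>v (2 * n), W) c"
  shows "eval_zpoly \<sigma> (pf n (snd (act (gen_group n) (gen_point n)))) = pf n (h * W * h\<^sup>T)"
    "eval_zpoly \<sigma> (det (gen_group n) * pf n (snd (gen_point n))) = det h * pf n W"
proof -
  let ?G = "gen_group n" and ?P = "gen_point n"
  let ?p = "(0\<^sub>v (2 * n), W)"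
  have aV: "act ?G ?P \<in> V_points n" by (rule act_V_points[OF gen_group_carrier(1) gen_point_V])
  have u: "pf n (snd (act ?G ?P)) = eval_pt (act ?G ?P) (Cgen n n)" by (rule eval_Cgen_pf[OF aV refl, symmetric])
  have p: "?p \<in> V_points n" using W by (simp add: V_points_def)
  have \<sigma>': "\<sigma> (CG i j) = h $$ (i, j)" "c \<in> V_coords n \<Longrightarrow> \<sigma> c = coord_val ?p c" for i j c
    by (auto simp: \<sigma>_def V_coords_def)
  have "eval_zpoly \<sigma> (pf n (snd (act ?G ?P))) = eval_pt (act h ?p) (Cgen n n)"
    unfolding u by (rule eval_act_gen[OF p h Cgen_in_polys]) (simp_all add: \<sigma>')
  also have "\<dots> = pf n (snd (act h ?p))" by (rule eval_Cgen_pf[OF act_V_points[OF h p] refl])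
  finally show "eval_zpoly \<sigma> (pf n (snd (act ?G ?P))) = pf n (h * W * h\<^sup>T)" by (simp add: act_def)
  have "map_mat (eval_zpoly \<sigma>) ?G = h" using h by (intro eq_matI) (auto simp: gen_group_def \<sigma>'(1))
  thus "eval_zpoly \<sigma> (det ?G * pf n (snd ?P)) = det h * pf n W"
    using eval_gen_point(2)[OF p \<sigma>'(2)] pf_hom[OF eval_hom.comm_ring_hom_axioms[of \<sigma>] gen_point_carrier(1)[of n]]
    by (simp add: eval_zpoly_mult flip: eval_hom.hom_det)
qed

text \<open>It suffices to treat the generic matrices, whose entries lie in a domain. There the
  squares agree, and the sign is decided by one integral specialization.\<close>

lemma pf_conj:
  fixes Z :: "'a::comm_ring_1 mat"
  assumes Z: "Z \<in> alt_mat (2 * n)" and g: "g \<in> sq_mats n"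
  shows "pf n (g * Z * g\<^sup>T) = det g * pf n Z"
proof -
  let ?G = "gen_group n" and ?P = "gen_point n"
  define u where "u = pf n (snd (act ?G ?P))"
  define v where "v = det ?G * pf n (snd ?P)"
  have aV: "act ?G ?P \<in> V_points n" by (rule act_V_points[OF gen_group_carrier(1) gen_point_V])
  have "u = v"
  proof (rule ccontr)
    assume "u \<noteq> v"
    have "u ^ 2 * det (symp_form n) = det (?G * snd ?P * ?G\<^sup>T)"
      unfolding u_def using pf_square[OF V_pointsD(2)[OF aV]] by (simp add: act_def)
    also have "\<dots> = (det ?G)\<^sup>2 * det (snd ?P)"
      by (rule det_congruence(1)[OF gen_group_carrier(1) gen_point_carrier(1)])
    also have "\<dots> = v ^ 2 * det (symp_form n)"
      unfolding pf_square[OF gen_point_alt, symmetric] v_def by (simp add: power2_eq_square mult_ac)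
    finally have "u ^ 2 * (det (symp_form n) * det (symp_form n)) = v ^ 2 * (det (symp_form n) * det (symp_form n))"
      by (simp only: mult.assoc[symmetric])
    hence "u ^ 2 = v ^ 2" by (simp add: det_symp_form)
    with \<open>u \<noteq> v\<close> have "u = - v" by (simp add: power2_eq_iff)
    \<comment> \<open>At the identity matrix and the standard form both sides are the same nonzero
      integer, which excludes the negative sign.\<close>
    let ?\<sigma> = "\<lambda>c. case c of CG i j \<Rightarrow> 1\<^sub>m (2 * n) $$ (i, j) | _ \<Rightarrow> coord_val (0\<^sub>v (2 * n), symp_form n :: int mat) c"
    have "eval_zpoly ?\<sigma> u = - eval_zpoly ?\<sigma> v" unfolding \<open>u = - v\<close> by (simp add: eval_hom.hom_uminus)
    hence "pf n (1\<^sub>m (2 * n) * symp_form n * (1\<^sub>m (2 * n))\<^sup>T) = - (det (1\<^sub>m (2 * n)) * pf n (symp_form n :: int mat))"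
      using pf_gen_eval[OF symp_form_alt[of n] one_carrier_mat[of "2 * n"], where 'a = int] by (simp add: u_def v_def)
    hence "pf n (symp_form n :: int mat) = 0"
      by (simp add: sq_left_one[of _ n] right_mult_one_mat[of _ "2 * n" "2 * n"])
    thus False using pf_symp_form[of n, where 'a = int] by simp
  qed
  thus ?thesis using pf_gen_eval[OF Z g] by (simp add: u_def v_def)
qed

lemma pf_cong_ideal:
  fixes Z :: "'a::comm_ring_1 mat"
  assumes "Z \<in> alt_mat (2 * n)" "Z' \<in> alt_mat (2 * n)"
    and "\<And>i j. i < 2 * n \<Longrightarrow> j < 2 * n \<Longrightarrow> Z $$ (i, j) - Z' $$ (i, j) \<in> idl.span S"
  shows "pf n Z - pf n Z' \<in> idl.span S"
proof -
  have p: "(0\<^sub>v (2 * n), Z) \<in> V_points n" "(0\<^sub>v (2 * n), Z') \<in> V_points n"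
    using assms by (simp_all add: V_points_def)
  have "eval_pt (0\<^sub>v (2 * n), Z) (Cgen n n) - eval_pt (0\<^sub>v (2 * n), Z') (Cgen n n) \<in> idl.span S"
    by (rule eval_zpoly_cong_ideal[OF Cgen_in_polys]) (auto simp: V_coords_def idl.span_zero intro!: assms(3))
  thus ?thesis by (simp add: eval_Cgen_pf[OF p(1) refl] eval_Cgen_pf[OF p(2) refl])
qed

text \<open>J - s Y is an alternating matrix over power series whose Pfaffian is the characteristic
  series up to a constant unit. Through it \<open>pf_conj\<close> applies to all
  \<open>Cgen n j\<close> at once.\<close>

definition pencil :: "nat \<Rightarrow> 'a::comm_ring_1 mat \<Rightarrow> 'a fps mat" where
  "pencil n Y = symp_form n - fps_X \<cdot>\<^sub>m map_mat fps_const Y"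

lemma fps_const_hom: "comm_ring_hom (fps_const :: 'a::comm_ring_1 \<Rightarrow> 'a fps)"
  by standard simp_all

lemma pencil_alt:
  assumes "Y \<in> alt_mat (2 * n)"
  shows "pencil n Y \<in> alt_mat (2 * n)"
proof (rule alt_matI)
  note Y = alt_matD[OF assms] and J = alt_matD[OF symp_form_alt[of n]]
  show "pencil n Y \<in> sq_mats n" using Y(1) by (auto simp: pencil_def intro!: minus_carrier_mat)
  show "pencil n Y $$ (i, j) = - pencil n Y $$ (j, i)" if "i < 2 * n" "j < 2 * n" for i j
  proof -
    have "Y $$ (i, j) = - Y $$ (j, i)" "symp_form n $$ (i, j) = - symp_form n $$ (j, i)"
      using Y(2)[OF that] J(2)[OF that] by blast+
    thus ?thesis using Y(1) that by (simp add: pencil_def flip: fps_const_neg)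
  qed
  show "pencil n Y $$ (i, i) = 0" if "i < 2 * n" for i
    using Y(1) Y(3)[OF that] J(3)[OF that] that by (simp add: pencil_def)
qed

text \<open>The endomorphism attached to the pencil is 1 - s A, so the squares agree; the constant
  term, which comes from J, fixes the sign.\<close>

lemma pf_pencil:
  fixes Y :: "'a::idom mat"
  assumes Y: "Y \<in> alt_mat (2 * n)"
  shows "pf n (pencil n Y) = fps_const (pf n (symp_form n)) * gpol n Y"
proof -
  note Yc = alt_matD(1)[OF Y] and Pa = pencil_alt[OF Y]
  note Pc = alt_matD(1)[OF Pa]
  have eq: "amat n (pencil n Y) = charmat (2 * n) (amat n Y)"
  proof (rule eq_matI)
    fix i j assume "i < dim_row (charmat (2 * n) (amat n Y))" "j < dim_col (charmat (2 * n) (amat n Y))"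
    hence ij: "i < 2 * n" "j < 2 * n" by (auto simp: charmat_def)
    show "amat n (pencil n Y) $$ (i, j) = charmat (2 * n) (amat n Y) $$ (i, j)"
      unfolding amat_index[OF Pc ij] using ij Yc amat_index[OF Yc ij]
      by (auto simp: charmat_def pencil_def symp_form_def simp flip: fps_const_neg)
  qed (use amat_carrier[OF Pc] in \<open>auto simp: charmat_def\<close>)
  have "det (amat n (pencil n Y)) = det (pencil n Y) * det (symp_form n)"
    unfolding amat_def using Pc by (subst det_mult[of _ "2 * n"]) (auto simp: det_transpose[of _ "2 * n"])
  also have "\<dots> = pf n (pencil n Y) ^ 2 * (det (symp_form n) * det (symp_form n))"
    unfolding pf_square[OF Pa, symmetric] by (simp add: mult.assoc)
  finally have "pf n (pencil n Y) ^ 2 = gpol n Y ^ 2" by (simp add: det_symp_form gpol_square[OF Y] eq)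
  hence pm: "pf n (pencil n Y) = gpol n Y \<or> pf n (pencil n Y) = - gpol n Y" by (simp add: power2_eq_iff)
  have h0: "comm_ring_hom (\<lambda>f :: 'a fps. fps_nth f 0)" by standard simp_all
  have "map_mat (\<lambda>f. fps_nth f 0) (pencil n Y) = symp_form n"
    using Yc by (intro eq_matI) (auto simp: pencil_def symp_form_def)
  hence 0: "fps_nth (pf n (pencil n Y)) 0 = pf n (symp_form n)" using pf_hom[OF h0 Pc] by simp
  from pm show ?thesis
  proof
    assume eq: "pf n (pencil n Y) = gpol n Y"
    with 0 have "pf n (symp_form n) = (1 :: 'a)" by simp
    with eq show ?thesis by simp
  next
    assume eq: "pf n (pencil n Y) = - gpol n Y"
    with 0 have "pf n (symp_form n) = (- 1 :: 'a)" by simp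
    with eq show ?thesis by (simp flip: fps_const_neg)
  qed
qed

text \<open>The generic g only satisfies E = g^T J g \<equiv> J modulo the ideal of the group, so it
  cannot be treated as a symplectic matrix over a field. The Pfaffian of the transformed pencil is
  compared with the original one by congruences, using the version of \<open>pf_conj\<close> that
  needs no relation on g.\<close>

lemma Cgen_invariant: "Cgen n j \<in> V_invariants n"
proof -
  let ?G = "gen_group n" and ?Y = "snd (gen_point n)"
  let ?S = "Sp_gens n" and ?J = "symp_form n" and ?P = "polys (G_coords n \<union> V_coords n)" and ?N = "2 * n"
  note mc = sq_mult[of _ n]
  note assoc = sq_assoc[of _ n]
  define E where "E = ?G\<^sup>T * ?J * ?G"
  have Gc: "?G \<in> sq_mats n" "?G\<^sup>T \<in> sq_mats n" by simp_all
  have Ec: "E \<in> sq_mats n" unfolding E_def by (intro mc) auto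
  have E: "E $$ (i, j) - ?J $$ (i, j) \<in> idl.span ?S" if "i < 2 * n" "j < 2 * n" for i j
  proof (rule idl.span_base)
    have "E $$ (i, j) - ?J $$ (i, j) = (E - ?J) $$ (i, j)" using that by simp
    thus "E $$ (i, j) - ?J $$ (i, j) \<in> ?S" using that unfolding E_def by blast
  qed
  define \<pi> where "\<pi> = pf n (?J :: coord zpoly mat)"
  have \<pi>: "\<pi> * \<pi> = 1" unfolding \<pi>_def by (rule pf_symp_form)
  have Ealt: "E \<in> alt_mat (2 * n)" using act_alt_mat[OF symp_form_alt Gc(2)] by (simp add: E_def)
  \<comment> \<open>The Pfaffian of E is det g times that of J, while E \<equiv> J; this gives det g
    \<equiv> 1, which is stronger than det g^2 \<equiv> 1.\<close>
  have detG: "det ?G - 1 \<in> idl.span ?S"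
  proof -
    have "pf n E = det ?G * \<pi>"
      using pf_conj[OF symp_form_alt Gc(2)] by (simp add: E_def \<pi>_def det_transpose[OF Gc(1)])
    hence "det ?G * \<pi> - \<pi> \<in> idl.span ?S" using pf_cong_ideal[OF Ealt symp_form_alt E] by (simp add: \<pi>_def)
    hence "\<pi> * (det ?G * \<pi> - \<pi>) \<in> idl.span ?S" by (rule idl.span_scale)
    moreover have "\<pi> * (det ?G * \<pi> - \<pi>) = det ?G * (\<pi> * \<pi>) - \<pi> * \<pi>" by (simp only: algebra_simps)
    ultimately show ?thesis by (simp add: \<pi>)
  qed
  \<comment> \<open>Series with coefficients in the ideal form an ideal of the ring of series, in
    which the pencils can be compared.\<close>
  define IF where "IF = {f :: coord zpoly fps. \<forall>i. fps_nth f i \<in> idl.span ?S}"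
  have sub: "idl.subspace IF" unfolding IF_def by (rule idl.subspaceI)
      (auto simp: idl.span_zero fps_mult_nth intro!: idl.span_add idl.span_sum idl.span_scale)
  have IF: "idl.span IF = IF" using sub by (simp add: idl.span_eq_iff)
  have IF_const: "fps_const c \<in> IF" if "c \<in> idl.span ?S" for c using that by (simp add: IF_def idl.span_zero)
  have IF_diff: "a - b \<in> IF" if "a \<in> IF" "b \<in> IF" for a b using sub that by (rule idl.subspace_diff)
  have IF_mult: "a * b \<in> IF" if "b \<in> IF" for a b using sub that by (rule idl.subspace_scale)
  have hc: "comm_ring_hom (fps_const :: coord zpoly \<Rightarrow> coord zpoly fps)" by (rule fps_const_hom)
  interpret hc: comm_ring_hom "fps_const :: coord zpoly \<Rightarrow> coord zpoly fps" by (rule hc)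
  let ?c = "map_mat fps_const :: coord zpoly mat \<Rightarrow> coord zpoly fps mat"
  have cJ: "?c ?J = ?J" by (rule map_symp_form[OF hc])
  have cT: "?c (M\<^sup>T) = (?c M)\<^sup>T" for M by (rule eq_matI) auto
  note Yc = gen_point_carrier(1)[of n]
  note cm = hc.mat_hom_mult[of _ "2 * n" "2 * n" _ "2 * n"]
  have conj_pencil: "h * pencil n W * h\<^sup>T = h * ?J * h\<^sup>T - fps_X \<cdot>\<^sub>m (h * ?c W * h\<^sup>T)"
    if "h \<in> sq_mats n" "W \<in> sq_mats n" for h W
  proof -
    have "h * pencil n W = h * ?J - fps_X \<cdot>\<^sub>m (h * ?c W)" unfolding pencil_def using that
      by (subst mult_minus_distrib_mat[of _ "2 * n" "2 * n" _ "2 * n"]) (auto simp: mult_smult_distrib[of _ "2 * n" "2 * n" _ "2 * n"])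
    thus ?thesis using that by (simp, subst minus_mult_distrib_mat[of _ ?N ?N _ _ ?N])
        (auto simp: mult_smult_assoc_mat[of _ "2 * n" "2 * n" _ "2 * n"] mc)
  qed
  \<comment> \<open>Congruence by g^T J turns the pencil of g Y g^T into E - s E Y E^T, which
    involves g through E alone; congruence by J does the same to the pencil of Y with J in place of
    E.\<close>
  define h where "h = ?c (?G\<^sup>T * ?J)"
  have hcarr: "h \<in> sq_mats n" by (simp add: h_def)
  define Y1 where "Y1 = ?G * ?Y * ?G\<^sup>T"
  have Y1alt: "Y1 \<in> alt_mat (2 * n)" unfolding Y1_def by (rule act_alt_mat[OF gen_point_alt Gc(1)])
  note Y1c = alt_matD(1)[OF Y1alt]
  have JJ: "?J * ?J\<^sup>T = (1\<^sub>m (2 * n) :: coord zpoly mat)" by (rule symp_form_orthogonal')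
  have T1: "(?G\<^sup>T * ?J)\<^sup>T = ?J\<^sup>T * ?G" by (subst sq_transpose[of _ n]) auto
  have hJ: "(?G\<^sup>T * ?J) * ?J * (?G\<^sup>T * ?J)\<^sup>T = E"
  proof -
    have "(?G\<^sup>T * ?J) * ?J * (?J\<^sup>T * ?G) = ?G\<^sup>T * ?J * ((?J * ?J\<^sup>T) * ?G)" using Gc by (simp add: assoc mc)
    thus ?thesis unfolding T1 JJ E_def using Gc by (simp add: sq_left_one[of _ n])
  qed
  have ET: "E\<^sup>T = ?G\<^sup>T * (?G\<^sup>T * ?J)\<^sup>T" unfolding E_def by (rule sq_transpose[of _ n]) auto
  have hY: "(?G\<^sup>T * ?J) * Y1 * (?G\<^sup>T * ?J)\<^sup>T = E * ?Y * E\<^sup>T"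
  proof -
    have c: "?G\<^sup>T * ?J \<in> sq_mats n" "(?G\<^sup>T * ?J)\<^sup>T \<in> sq_mats n" by simp_all
    have "(?G\<^sup>T * ?J) * Y1 = E * ?Y * ?G\<^sup>T" unfolding Y1_def E_def using Gc Yc
      by (simp only: assoc[OF c(1) mc[OF Gc(1) Yc] Gc(2), symmetric] assoc[OF c(1) Gc(1) Yc, symmetric])
    thus ?thesis unfolding ET using assoc[OF mc[OF Ec Yc] Gc(2) c(2)] by simp
  qed
  have m1: "h * pencil n Y1 * h\<^sup>T = ?c E - fps_X \<cdot>\<^sub>m ?c (E * ?Y * E\<^sup>T)"
  proof -
    have c: "?G\<^sup>T * ?J \<in> sq_mats n" "(?G\<^sup>T * ?J)\<^sup>T \<in> sq_mats n" by simp_all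
    have "h * ?J * h\<^sup>T = ?c ((?G\<^sup>T * ?J) * ?J * (?G\<^sup>T * ?J)\<^sup>T)"
      unfolding h_def cT[symmetric] using cm[OF mc[OF c(1) symp_form_carrier(1)] c(2)] cm[OF c(1) symp_form_carrier(1)]
      by (simp only: cJ)
    moreover have "h * ?c Y1 * h\<^sup>T = ?c ((?G\<^sup>T * ?J) * Y1 * (?G\<^sup>T * ?J)\<^sup>T)"
      unfolding h_def cT[symmetric] using cm[OF mc[OF c(1) Y1c] c(2)] cm[OF c(1) Y1c] by (simp only:)
    ultimately show ?thesis unfolding conj_pencil[OF hcarr Y1c] hJ hY by simp
  qed
  have m2: "?J * pencil n ?Y * ?J\<^sup>T = ?c ?J - fps_X \<cdot>\<^sub>m ?c (?J * ?Y * ?J\<^sup>T)"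
  proof -
    have "?J * ?J * ?J\<^sup>T = (?J :: coord zpoly fps mat)"
    proof -
      have "?c (?J * ?J * ?J\<^sup>T) = ?c ?J" by (subst assoc) (auto simp: JJ)
      thus ?thesis
        using cm[OF mc[OF symp_form_carrier(1) symp_form_carrier(1)], of "?J\<^sup>T"] cm[OF symp_form_carrier(1) symp_form_carrier(1)]
        by (simp add: cJ cT)
    qed
    moreover have "?J * ?c ?Y * ?J\<^sup>T = ?c (?J * ?Y * ?J\<^sup>T)"
      using cm[OF mc[OF symp_form_carrier(1) Yc], of "?J\<^sup>T"] cm[OF symp_form_carrier(1) Yc] by (simp add: cJ cT)
    ultimately show ?thesis using conj_pencil[OF symp_form_carrier(1) Yc] by (simp add: cJ)
  qed
  have cong: "(h * pencil n Y1 * h\<^sup>T) $$ (i, j) - (?J * pencil n ?Y * ?J\<^sup>T) $$ (i, j) \<in> IF"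
    if ij: "i < 2 * n" "j < 2 * n" for i j
  proof -
    have idx: "(M * ?Y * M\<^sup>T) $$ (i, j) = (\<Sum>q<2 * n. (\<Sum>p<2 * n. M $$ (i, p) * ?Y $$ (p, q)) * M $$ (j, q))"
      if "M \<in> sq_mats n" for M using that ij mc[OF that Yc] by (subst sq_index[of _ n])
        (auto simp: index_mult_sum[OF that Yc ij(1)] simp del: index_mult_mat(1) intro!: sum.cong)
    have "(E * ?Y * E\<^sup>T) $$ (i, j) - (?J * ?Y * ?J\<^sup>T) $$ (i, j) \<in> idl.span ?S"
      unfolding idx[OF Ec] idx[OF symp_form_carrier(1)] sum_subtractf[symmetric]
    proof (intro idl.span_sum)
      fix q assume q: "q \<in> {..<2 * n}"
      have "(\<Sum>p<2 * n. E $$ (i, p) * ?Y $$ (p, q)) * E $$ (j, q) - (\<Sum>p<2 * n. ?J $$ (i, p) * ?Y $$ (p, q)) * ?J $$ (j, q)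
          = (\<Sum>p<2 * n. E $$ (i, p) * ?Y $$ (p, q)) * (E $$ (j, q) - ?J $$ (j, q))
           + ?J $$ (j, q) * (\<Sum>p<2 * n. ?Y $$ (p, q) * (E $$ (i, p) - ?J $$ (i, p)))"
        by (simp add: right_diff_distrib left_diff_distrib sum_subtractf mult_ac)
      also have "\<dots> \<in> idl.span ?S" using ij q by (intro idl.span_add idl.span_scale idl.span_sum E) auto
      finally show "(\<Sum>p<2 * n. E $$ (i, p) * ?Y $$ (p, q)) * E $$ (j, q) - (\<Sum>p<2 * n. ?J $$ (i, p) * ?Y $$ (p, q)) * ?J $$ (j, q) \<in> idl.span ?S" .
    qed
    hence "fps_const (E $$ (i, j) - ?J $$ (i, j)) - fps_X * fps_const ((E * ?Y * E\<^sup>T) $$ (i, j) - (?J * ?Y * ?J\<^sup>T) $$ (i, j)) \<in> IF"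
      using E[OF ij] by (intro IF_diff IF_mult IF_const)
    moreover have c: "E * ?Y * E\<^sup>T \<in> sq_mats n" "?J * ?Y * ?J\<^sup>T \<in> sq_mats n" using Ec Yc by (auto intro!: mc)
    moreover have "(h * pencil n Y1 * h\<^sup>T) $$ (i, j) - (?J * pencil n ?Y * ?J\<^sup>T) $$ (i, j) =
        fps_const (E $$ (i, j) - ?J $$ (i, j)) - fps_X * fps_const ((E * ?Y * E\<^sup>T) $$ (i, j) - (?J * ?Y * ?J\<^sup>T) $$ (i, j))"
      unfolding m1 m2 using ij Ec c by (simp add: algebra_simps flip: fps_const_sub del: index_mult_mat(1))
    ultimately show ?thesis by simp
  qed
  have alt1: "h * pencil n Y1 * h\<^sup>T \<in> alt_mat (2 * n)" by (rule act_alt_mat[OF pencil_alt[OF Y1alt] hcarr])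
  have alt2: "?J * pencil n ?Y * ?J\<^sup>T \<in> alt_mat (2 * n)" by (rule act_alt_mat[OF pencil_alt[OF gen_point_alt] symp_form_carrier(1)])
  have "pf n (h * pencil n Y1 * h\<^sup>T) - pf n (?J * pencil n ?Y * ?J\<^sup>T) \<in> IF"
    using pf_cong_ideal[OF alt1 alt2, of IF] cong by (simp only: IF)
  hence 1: "det h * pf n (pencil n Y1) - det ?J * pf n (pencil n ?Y) \<in> IF"
    by (simp only: pf_conj[OF pencil_alt[OF Y1alt] hcarr] pf_conj[OF pencil_alt[OF gen_point_alt] symp_form_carrier(1)])
  define \<delta> where "\<delta> = det (?J :: coord zpoly mat)"
  have dJ: "det (?J :: coord zpoly fps mat) = fps_const \<delta>" unfolding \<delta>_def by (simp only: cJ[symmetric] hc.hom_det)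
  have dh: "det h = fps_const (det ?G * \<delta>)"
    unfolding h_def hc.hom_det \<delta>_def by (subst det_mult[of _ ?N]) (auto simp: det_transpose[OF Gc(1)])
  have d2: "fps_const \<delta> * fps_const \<delta> = 1" by (simp add: \<delta>_def det_symp_form)
  have p2: "fps_const \<pi> * fps_const \<pi> = 1" by (simp add: \<pi>)
  let ?g1 = "gpol n Y1" and ?g2 = "gpol n ?Y"
  \<comment> \<open>What remains is to cancel \<delta> and \<pi>, whose squares are 1, and det g,
    which is congruent to 1.\<close>
  have "fps_const \<delta> * (fps_const (det ?G) * (fps_const \<pi> * ?g1)) - fps_const \<delta> * (fps_const \<pi> * ?g2) \<in> IF"
    using 1 unfolding dh dJ pf_pencil[OF Y1alt] pf_pencil[OF gen_point_alt] \<pi>_def[symmetric]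
    by (simp only: fps_const_mult[symmetric] mult_ac)
  hence "(fps_const \<pi> * fps_const \<delta>) * (fps_const \<delta> * (fps_const (det ?G) * (fps_const \<pi> * ?g1)) - fps_const \<delta> * (fps_const \<pi> * ?g2)) \<in> IF"
    by (rule IF_mult)
  moreover have "(fps_const \<pi> * fps_const \<delta>) * (fps_const \<delta> * (fps_const (det ?G) * (fps_const \<pi> * ?g1)) - fps_const \<delta> * (fps_const \<pi> * ?g2))
      = (fps_const \<pi> * fps_const \<pi>) * (fps_const \<delta> * fps_const \<delta>) * (fps_const (det ?G) * ?g1 - ?g2)"
    by (simp only: right_diff_distrib mult_ac)
  ultimately have "fps_const (det ?G) * ?g1 - ?g2 \<in> IF" by (simp only: d2 p2 mult_1)
  moreover have "?g1 * fps_const (det ?G - 1) \<in> IF" by (intro IF_mult IF_const detG)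
  ultimately have "(fps_const (det ?G) * ?g1 - ?g2) - ?g1 * fps_const (det ?G - 1) \<in> IF" by (rule IF_diff)
  moreover have "(fps_const (det ?G) * ?g1 - ?g2) - ?g1 * fps_const (det ?G - 1) = ?g1 - ?g2"
    by (simp add: right_diff_distrib mult.commute flip: fps_const_sub)
  ultimately have "fps_nth (?g1 - ?g2) j \<in> idl.span ?S" by (simp add: IF_def)
  moreover have ev: "eval_pt (act ?G (gen_point n)) (Cgen n j) = fps_nth ?g1 j"
    using eval_Cgen[OF act_V_points[OF gen_group_carrier(1) gen_point_V] refl, of n j] by (simp add: act_def Y1_def)
  ultimately have "eval_pt (act ?G (gen_point n)) (Cgen n j) - Cgen n j \<in> idl.span ?S" by (simp add: Cgen_def)
  moreover have "eval_pt (act ?G (gen_point n)) (Cgen n j) \<in> ?P"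
  proof (rule eval_zpoly_in_polys[OF Cgen_in_polys])
    have G: "?G $$ (k, l) \<in> ?P" if "k < 2 * n" "l < 2 * n" for k l
      using that by (auto simp: gen_group_def G_coords_def)
    have Y: "?Y $$ (k, l) \<in> ?P" if "k < 2 * n" "l < 2 * n" for k l
      using that by (auto simp: gen_point_def V_coords_def)
    have x: "fst (gen_point n) $ k \<in> ?P" if "k < 2 * n" for k using that by (auto simp: gen_point_def V_coords_def)
    have GY: "(?G * ?Y) $$ (k, l) \<in> ?P" if "k < 2 * n" "l < 2 * n" for k l
      by (rule index_mult_in_polys[OF Gc(1) Yc that]) (use G Y that in auto)
    fix c assume "c \<in> V_coords n"
    then consider i where "c = CX i" "i < 2 * n" | i j where "c = CY i j" "i < j" "j < 2 * n"
      by (auto simp: V_coords_def)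
    thus "coord_val (act ?G (gen_point n)) c \<in> ?P"
    proof cases
      case 1
      thus ?thesis by (auto simp: act_def scalar_prod_def intro!: polys_sum polys_closed G x)
    next
      case 2
      have "(?G * ?Y * ?G\<^sup>T) $$ (i, j) \<in> ?P"
        by (rule index_mult_in_polys[OF mc[OF Gc(1) Yc] Gc(2)]) (use GY G 2 in \<open>auto simp del: index_mult_mat\<close>)
      thus ?thesis by (simp add: act_def 2)
    qed
  qed
  moreover have "Cgen n j \<in> ?P" using Cgen_in_polys polys_mono[of "V_coords n" "G_coords n \<union> V_coords n"] by auto
  ultimately show ?thesis using Cgen_in_polys[of n j] by (auto simp: V_invariants_def Sp_ideal_span)
qed

theorem nilcone_ideal_eq: "nilcone_ideal n = Cideal n \<inter> polys (V_coords n)"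
proof -
  let ?F = "{f \<in> V_invariants n. lookup f 0 = 0}"
  have "nilcone_ideal n = idl.span ?F \<inter> polys (V_coords n)"
    unfolding nilcone_ideal_def by (rule genideal_zpoly_ring) (auto simp: V_invariants_def)
  moreover have "idl.span ?F = Cideal n"
  proof (rule antisym)
    show "idl.span ?F \<subseteq> Cideal n"
      by (rule idl.span_minimal[OF _ idl.subspace_span]) (use invariant_in_Cideal in blast)
    have "Cgen n ` {1..n} \<subseteq> ?F" using Cgen_invariant lookup_Cgen_0 by auto
    thus "Cideal n \<subseteq> idl.span ?F" by (rule idl.span_mono)
  qed
  ultimately show ?thesis by simp
qed

section \<open>Leading monomials\<close>

definition wt :: "('v \<Rightarrow> nat) \<Rightarrow> ('v \<Rightarrow>\<^sub>0 nat) \<Rightarrow> nat" where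
  "wt \<kappa> m = (\<Sum>v\<in>keys m. lookup m v * \<kappa> v)"

abbreviation deg where "deg \<equiv> wt (\<lambda>_. 1)"

lemma wt_superset:
  assumes "finite S" "keys m \<subseteq> S"
  shows "wt \<kappa> m = (\<Sum>v\<in>S. lookup m v * \<kappa> v)"
  unfolding wt_def using assms by (intro sum.mono_neutral_left) (auto simp: in_keys_iff)

lemma wt_zero [simp]: "wt \<kappa> 0 = 0"
  by (simp add: wt_def)

lemma wt_add: "wt \<kappa> (m + k) = wt \<kappa> m + wt \<kappa> k"
proof -
  have "keys (m + k) \<subseteq> keys m \<union> keys k" by (rule keys_add)
  hence "wt \<kappa> (m + k) = (\<Sum>v\<in>keys m \<union> keys k. lookup (m + k) v * \<kappa> v)" by (intro wt_superset) auto
  also have "\<dots> = wt \<kappa> m + wt \<kappa> k"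
    by (simp add: wt_superset[of "keys m \<union> keys k"] lookup_add distrib_right sum.distrib)
  finally show ?thesis .
qed

lemma wt_single: "wt \<kappa> (single v k) = k * \<kappa> v"
  by (simp add: wt_def)

lemma wt_le_deg:
  assumes "\<And>v. \<kappa> v \<le> M"
  shows "wt \<kappa> m \<le> M * deg m"
  unfolding wt_def sum_distrib_left by (intro sum_mono) (use assms in \<open>simp add: mult.commute mult_le_mono1\<close>)

text \<open>Homogeneous polynomials of degree \<open>D\<close> all of whose monomials weigh at least
  \<open>c\<close>. Lower bounds are enough, since leading means of least weight.\<close>

definition HB :: "('v \<Rightarrow> nat) \<Rightarrow> nat \<Rightarrow> nat \<Rightarrow> 'v zpoly set" where
  "HB \<kappa> D c = {f. \<forall>m\<in>keys f. deg m = D \<and> c \<le> wt \<kappa> m}"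

lemma HB_zero [simp]: "0 \<in> HB \<kappa> D c"
  by (simp add: HB_def)

lemma HB_add: "f \<in> HB \<kappa> D c \<Longrightarrow> g \<in> HB \<kappa> D c \<Longrightarrow> f + g \<in> HB \<kappa> D c"
  using keys_add[of f g] by (auto simp: HB_def)

lemma HB_uminus: "f \<in> HB \<kappa> D c \<Longrightarrow> - f \<in> HB \<kappa> D c"
  by (simp add: HB_def)

lemma HB_sum: "(\<And>i. i \<in> S \<Longrightarrow> f i \<in> HB \<kappa> D c) \<Longrightarrow> sum f S \<in> HB \<kappa> D c"
  by (induction S rule: infinite_finite_induct) (auto intro: HB_add)

lemma HB_mono: "f \<in> HB \<kappa> D c \<Longrightarrow> c' \<le> c \<Longrightarrow> f \<in> HB \<kappa> D c'"
  by (auto simp: HB_def)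

lemma HB_mult:
  assumes "f \<in> HB \<kappa> D c" "g \<in> HB \<kappa> D' c'"
  shows "f * g \<in> HB \<kappa> (D + D') (c + c')"
proof -
  have "deg m = D + D' \<and> c + c' \<le> wt \<kappa> m" if "m \<in> keys (f * g)" for m
  proof -
    from that keys_mult[of f g] obtain a b where "m = a + b" "a \<in> keys f" "b \<in> keys g" by auto
    thus ?thesis using assms by (auto simp: HB_def wt_add intro: add_mono)
  qed
  thus ?thesis by (simp add: HB_def)
qed

lemma HB_one: "1 \<in> HB \<kappa> 0 0"
  by (simp add: HB_def)

lemma HB_Var: "Var v \<in> HB \<kappa> 1 (\<kappa> v)"
  by (simp add: HB_def Var_def wt_single)

lemma HB_prod:
  assumes "finite S" "\<And>i. i \<in> S \<Longrightarrow> f i \<in> HB \<kappa> (D i) (c i)"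
  shows "prod f S \<in> HB \<kappa> (sum D S) (sum c S)"
  using assms by (induction S rule: finite_induct) (auto intro: HB_one HB_mult)

text \<open>A homogeneous polynomial in which \<open>m\<close> has coefficient 1 and is the only
  monomial of least weight.\<close>

definition lead :: "('v \<Rightarrow> nat) \<Rightarrow> 'v zpoly \<Rightarrow> ('v \<Rightarrow>\<^sub>0 nat) \<Rightarrow> bool" where
  "lead \<kappa> f m \<longleftrightarrow> f - single m 1 \<in> HB \<kappa> (deg m) (Suc (wt \<kappa> m))"

lemma HB_single: "single m k \<in> HB \<kappa> (deg m) (wt \<kappa> m)"
  by (simp add: HB_def)

lemma lead_HB: "lead \<kappa> f m \<Longrightarrow> f \<in> HB \<kappa> (deg m) (wt \<kappa> m)"
  using HB_add[OF HB_single[of m 1] HB_mono[of "f - single m 1" \<kappa> "deg m" "Suc (wt \<kappa> m)" "wt \<kappa> m"]]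
  by (simp add: lead_def)

lemma lead_mult:
  assumes "lead \<kappa> f m" "lead \<kappa> g k"
  shows "lead \<kappa> (f * g) (m + k)"
proof -
  have "f * g - single (m + k) 1 = (f - single m 1) * g + single m 1 * (g - single k 1)"
    by (simp add: algebra_simps mult_single)
  moreover have "(f - single m 1) * g \<in> HB \<kappa> (deg (m + k)) (Suc (wt \<kappa> (m + k)))"
    using HB_mult[of "f - single m 1" \<kappa> "deg m" "Suc (wt \<kappa> m)" g "deg k" "wt \<kappa> k"] assms lead_HB[OF assms(2)]
    by (simp add: lead_def wt_add)
  moreover have "single m 1 * (g - single k 1) \<in> HB \<kappa> (deg (m + k)) (Suc (wt \<kappa> (m + k)))"
    using HB_mult[OF HB_single[of m 1 \<kappa>], of "g - single k 1" "deg k" "Suc (wt \<kappa> k)"] assms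
    by (simp add: lead_def wt_add)
  ultimately show ?thesis by (simp add: lead_def HB_add)
qed

lemma lead_one: "lead \<kappa> 1 0"
  by (simp add: lead_def)

lemma lead_Var: "lead \<kappa> (Var v) (single v 1)"
  by (simp add: lead_def Var_def)

lemma lead_prod:
  assumes "finite S" "\<And>i. i \<in> S \<Longrightarrow> lead \<kappa> (f i) (m i)"
  shows "lead \<kappa> (prod f S) (sum m S)"
  using assms by (induction S rule: finite_induct) (auto intro: lead_one lead_mult)

lemma lead_power: "lead \<kappa> f m \<Longrightarrow> lead \<kappa> (f ^ N) (\<Sum>i<N. m)"
  using lead_prod[of "{..<N}" \<kappa> "\<lambda>_. f" "\<lambda>_. m"] by simp

lemma lead_add_HB:
  assumes "lead \<kappa> f m" "g \<in> HB \<kappa> (deg m) (Suc (wt \<kappa> m))"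
  shows "lead \<kappa> (f + g) m"
proof -
  have eq: "f + g - single m 1 = (f - single m 1) + g" by simp
  show ?thesis using assms unfolding lead_def eq by (rule HB_add)
qed

lemma lead_lookup: "lead \<kappa> f m \<Longrightarrow> lookup f m = 1"
proof -
  assume "lead \<kappa> f m"
  hence "m \<notin> keys (f - single m 1)" by (auto simp: lead_def HB_def)
  thus ?thesis by (simp add: in_keys_iff lookup_minus)
qed

lemma lead_nonzero: "lead \<kappa> f m \<Longrightarrow> f \<noteq> 0"
  using lead_lookup by fastforce

definition mdvd :: "('v \<Rightarrow>\<^sub>0 nat) \<Rightarrow> ('v \<Rightarrow>\<^sub>0 nat) \<Rightarrow> bool" where
  "mdvd a b \<longleftrightarrow> (\<exists>c. b = a + c)"

lemma mdvd_iff: "mdvd a b \<longleftrightarrow> (\<forall>v. lookup a v \<le> lookup b v)"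
proof
  assume le: "\<forall>v. lookup a v \<le> lookup b v"
  have "b = a + (b - a)" by (rule poly_mapping_eqI) (use le in \<open>simp add: lookup_add lookup_minus\<close>)
  thus "mdvd a b" by (auto simp: mdvd_def)
qed (auto simp: mdvd_def lookup_add)

lemma mdvd_add_disjoint:
  assumes "mdvd a (m + b)" "keys a \<inter> keys b = {}"
  shows "mdvd a m"
  unfolding mdvd_iff
proof
  fix v
  show "lookup a v \<le> lookup m v"
  proof (cases "v \<in> keys a")
    case True
    hence "lookup b v = 0" using assms(2) by (auto simp: in_keys_iff)
    moreover have "lookup a v \<le> lookup m v + lookup b v" using assms(1) by (simp add: mdvd_iff lookup_add)
    ultimately show ?thesis by simp
  qed (simp add: in_keys_iff)
qed

text \<open>Pairwise coprime leading monomials with coefficient 1: the situation of Buchberger's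
  product criterion, valid over the integers. Rewriting increases weights, so it is the upper bound
  \<open>M\<close> that makes it terminate.\<close>

locale leading =
  fixes \<kappa> :: "'v::linorder \<Rightarrow> nat" and M :: nat and F :: "nat \<Rightarrow> 'v zpoly" and lm :: "nat \<Rightarrow> ('v \<Rightarrow>\<^sub>0 nat)"
    and N :: "nat set"
  assumes bound: "\<And>v. \<kappa> v \<le> M"
    and lead: "\<And>i. i \<in> N \<Longrightarrow> lead \<kappa> (F i) (lm i)"
    and coprime: "\<And>i j. i \<in> N \<Longrightarrow> j \<in> N \<Longrightarrow> i \<noteq> j \<Longrightarrow> keys (lm i) \<inter> keys (lm j) = {}"
    and fin: "finite N"
begin

definition Std :: "nat set \<Rightarrow> ('v \<Rightarrow>\<^sub>0 nat) set" where
  "Std T = {m. \<forall>i\<in>T. \<not> mdvd (lm i) m}"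

abbreviation I :: "nat set \<Rightarrow> 'v zpoly set" where "I T \<equiv> idl.span (F ` T)"

definition red :: "nat set \<Rightarrow> 'v zpoly set" where
  "red T = {f. keys f \<subseteq> Std T}"

lemma red_add: "f \<in> red T \<Longrightarrow> g \<in> red T \<Longrightarrow> f + g \<in> red T"
  using keys_add[of f g] by (auto simp: red_def)

lemma red_diff: "f \<in> red T \<Longrightarrow> g \<in> red T \<Longrightarrow> f - g \<in> red T"
  using red_add[of f T "- g"] by (simp add: red_def)

lemma red_of_int_mult: "f \<in> red T \<Longrightarrow> of_int c * f \<in> red T"
proof -
  assume f: "f \<in> red T"
  have "lookup (of_int c * f) m = c * lookup f m" for m
  proof -
    have "of_int c * f = single 0 c * f" by (simp flip: single_of_int)
    also have "\<dots> = Poly_Mapping.map ((*) c) f" by (rule mult_map_scale_conv_mult[symmetric])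
    finally show ?thesis by (simp add: Poly_Mapping.map.rep_eq when_def)
  qed
  hence "keys (of_int c * f) \<subseteq> keys f" by (auto simp: in_keys_iff)
  with f show ?thesis by (auto simp: red_def)
qed

lemma red_zero [simp]: "0 \<in> red T"
  by (simp add: red_def)

lemma red_sum: "(\<And>k. k \<in> S \<Longrightarrow> f k \<in> red T) \<Longrightarrow> sum f S \<in> red T"
  by (induction S rule: infinite_finite_induct) (auto intro: red_add)

text \<open>Rewriting a leading monomial preserves the degree and strictly raises the weight, which
  cannot exceed \<open>M\<close> times the degree.\<close>

lemma reduce_monomial:
  assumes "T \<subseteq> N"
  shows "\<exists>g\<in>red T. single m 1 - g \<in> I T"
proof (induction "M * deg m - wt \<kappa> m" arbitrary: m rule: less_induct)
  case less
  show ?case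
  proof (cases "m \<in> Std T")
    case True
    thus ?thesis by (intro bexI[of _ "single m 1"]) (auto simp: red_def idl.span_zero)
  next
    case False
    then obtain i c where i: "i \<in> T" and m: "m = lm i + c" by (auto simp: Std_def mdvd_def)
    define r where "r = F i - single (lm i) 1"
    have r: "r \<in> HB \<kappa> (deg (lm i)) (Suc (wt \<kappa> (lm i)))" using lead[of i] i assms by (auto simp: r_def lead_def)
    have "\<exists>g\<in>red T. single (k + c) 1 - g \<in> I T" if "k \<in> keys r" for k
    proof (rule less)
      have "deg (k + c) = deg m" "wt \<kappa> m < wt \<kappa> (k + c)" using r that by (auto simp: HB_def m wt_add)
      moreover have "wt \<kappa> (k + c) \<le> M * deg (k + c)" by (rule wt_le_deg[OF bound])
      ultimately show "M * deg (k + c) - wt \<kappa> (k + c) < M * deg m - wt \<kappa> m" by simp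
    qed
    then obtain g where g: "\<And>k. k \<in> keys r \<Longrightarrow> g k \<in> red T" "\<And>k. k \<in> keys r \<Longrightarrow> single (k + c) 1 - g k \<in> I T" by metis
    define h where "h = (\<Sum>k\<in>keys r. of_int (lookup r k) * g k)"
    have h: "h \<in> red T" unfolding h_def by (rule red_sum) (auto intro: red_of_int_mult g)
    have "r * single c 1 = (\<Sum>k\<in>keys r. of_int (lookup r k) * single (k + c) 1)"
    proof -
      have "r = (\<Sum>k\<in>keys r. of_int (lookup r k) * single k 1)"
        using zpoly_expand[of r] by (simp add: single_one_prod)
      hence "r * single c 1 = (\<Sum>k\<in>keys r. of_int (lookup r k) * single k 1) * single c 1" by simp
      thus ?thesis by (simp add: sum_distrib_right mult.assoc mult_single)
    qed
    hence "r * single c 1 - h = (\<Sum>k\<in>keys r. of_int (lookup r k) * (single (k + c) 1 - g k))"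
      by (simp add: h_def right_diff_distrib sum_subtractf)
    also have "\<dots> \<in> I T" by (intro idl.span_sum idl.span_scale g(2))
    finally have 1: "r * single c 1 - h \<in> I T" .
    have "single m 1 - (- h) = single c 1 * F i - (r * single c 1 - h)"
      by (simp add: r_def m algebra_simps mult_single)
    also have "\<dots> \<in> I T" by (rule idl.span_diff[OF idl.span_scale[OF idl.span_base] 1]) (use i in simp)
    finally have "single m 1 - (- h) \<in> I T" .
    moreover have "- h \<in> red T" using h by (simp add: red_def)
    ultimately show ?thesis by blast
  qed
qed

lemma reduce:
  assumes "T \<subseteq> N"
  shows "\<exists>g\<in>red T. f - g \<in> I T"
proof -
  obtain g where g: "\<And>m. g m \<in> red T" "\<And>m. single m 1 - g m \<in> I T" using reduce_monomial[OF assms] by metis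
  define h where "h = (\<Sum>m\<in>keys f. of_int (lookup f m) * g m)"
  have "f = (\<Sum>m\<in>keys f. of_int (lookup f m) * single m 1)" using zpoly_expand[of f] by (simp add: single_one_prod)
  hence "f - h = (\<Sum>m\<in>keys f. of_int (lookup f m) * single m 1) - h" by simp
  also have "\<dots> = (\<Sum>m\<in>keys f. of_int (lookup f m) * (single m 1 - g m))"
    by (simp add: h_def right_diff_distrib sum_subtractf)
  also have "\<dots> \<in> I T" by (intro idl.span_sum idl.span_scale g(2))
  finally have "f - h \<in> I T" .
  moreover have "h \<in> red T" unfolding h_def by (intro red_sum red_of_int_mult g(1))
  ultimately show ?thesis by blast
qed

definition mincost :: "'v zpoly \<Rightarrow> nat" where
  "mincost f = Min (wt \<kappa> ` keys f)"

lemma mincost_le: "m \<in> keys f \<Longrightarrow> mincost f \<le> wt \<kappa> m"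
  by (simp add: mincost_def)

lemma mincost_ex: "f \<noteq> 0 \<Longrightarrow> \<exists>m\<in>keys f. wt \<kappa> m = mincost f"
proof -
  assume "f \<noteq> 0"
  hence "Min (wt \<kappa> ` keys f) \<in> wt \<kappa> ` keys f" by (intro Min_in) auto
  thus ?thesis by (auto simp: mincost_def)
qed

text \<open>In the lowest possible weight of a product, only the leading monomial of the factor
  \<open>F j\<close> contributes.\<close>

lemma lookup_mult_lead:
  assumes j: "j \<in> N" and w: "wt \<kappa> k \<le> mincost g + wt \<kappa> (lm j)"
  shows "lookup (g * F j) k = (if mdvd (lm j) k then lookup g (k - lm j) else 0)"
proof -
  define r where "r = F j - single (lm j) 1"
  have r: "r \<in> HB \<kappa> (deg (lm j)) (Suc (wt \<kappa> (lm j)))" using lead[OF j] by (simp add: r_def lead_def)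
  have "k \<notin> keys (g * r)"
  proof
    assume "k \<in> keys (g * r)"
    then obtain a b where ab: "k = a + b" "a \<in> keys g" "b \<in> keys r" using keys_mult[of g r] by auto
    have "mincost g \<le> wt \<kappa> a" "Suc (wt \<kappa> (lm j)) \<le> wt \<kappa> b" using ab mincost_le r by (auto simp: HB_def)
    with w show False by (simp add: ab(1) wt_add)
  qed
  hence "lookup (g * r) k = 0" by (simp add: in_keys_iff)
  moreover have "g * F j = g * single (lm j) 1 + g * r" by (simp add: r_def right_diff_distrib)
  ultimately have "lookup (g * F j) k = lookup (g * single (lm j) 1) k" by (simp add: lookup_add)
  also have "\<dots> = (if mdvd (lm j) k then lookup g (k - lm j) else 0)"
  proof (induction g rule: poly_mapping_add_induct)
    case (add m c f)
    have "single m c * single (lm j) 1 = single (m + lm j) c" by (simp add: mult_single)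
    moreover have "lookup (single (m + lm j) c) k = (if mdvd (lm j) k then lookup (single m c) (k - lm j) else 0)"
    proof (cases "k = m + lm j")
      case True
      thus ?thesis by (auto simp: mdvd_def add.commute)
    next
      case False
      thus ?thesis by (auto simp: mdvd_def lookup_single when_def add.commute)
    qed
    ultimately show ?case using add by (simp add: distrib_right lookup_add)
  qed simp
  finally show ?thesis .
qed

text \<open>Write f = f' + g F_j with f' in the ideal of the earlier generators and g reduced modulo
  it. Lowest monomials of f' are nonstandard for the earlier generators, those of g F_j are standard
  for them; hence they cannot cancel.\<close>

lemma ideal_lead:
  assumes "T \<subseteq> N" "f \<in> I T" "m \<in> keys f" "wt \<kappa> m = mincost f"
  shows "m \<notin> Std T"
proof -
  have "finite T" using assms(1) fin by (rule finite_subset)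
  thus ?thesis using assms
  proof (induction T arbitrary: f m rule: finite_induct)
    case empty
    thus ?case by simp
  next
    case (insert j T)
    have jN: "j \<in> N" and TN: "T \<subseteq> N" using insert by auto
    have "F ` insert j T = insert (F j) (F ` T)" by simp
    then obtain k where k: "f - k * F j \<in> I T" using insert.prems(2) by (auto simp: idl.span_insert)
    \<comment> \<open>Reducing the coefficient of F_j changes f only by an element of the smaller
      ideal.\<close>
    obtain g where g: "g \<in> red T" "k - g \<in> I T" using reduce[OF TN] by blast
    define f' where "f' = f - g * F j"
    have f': "f' \<in> I T"
    proof -
      have "f' = (f - k * F j) + F j * (k - g)" by (simp add: f'_def algebra_simps)
      thus ?thesis using k g(2) by (auto intro: idl.span_add idl.span_scale)
    qed
    have f: "f = f' + g * F j" by (simp add: f'_def)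
    show ?case
    proof (cases "g = 0")
      case True
      hence "m \<notin> Std T" using insert.IH[OF TN f'] insert.prems(3,4) f by simp
      thus ?thesis by (auto simp: Std_def)
    next
      case False
      define c where "c = mincost g + wt \<kappa> (lm j)"
      have low: "lookup (g * F j) k = (if mdvd (lm j) k then lookup g (k - lm j) else 0)" if "wt \<kappa> k \<le> c" for k
        using lookup_mult_lead[OF jN] that by (simp add: c_def)
      \<comment> \<open>A lowest monomial of g F_j is lm_j + e with e standard; coprimality keeps it
        standard for \<open>T\<close>.\<close>
      have std: "k \<in> Std T \<and> mdvd (lm j) k" if "wt \<kappa> k \<le> c" "lookup (g * F j) k \<noteq> 0" for k
      proof -
        from low[OF that(1)] that(2) have d: "mdvd (lm j) k" and nz: "lookup g (k - lm j) \<noteq> 0"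
          by (auto split: if_splits)
        then obtain e where e: "k = lm j + e" by (auto simp: mdvd_def)
        with nz have "e \<in> keys g" by (simp add: in_keys_iff)
        hence "e \<in> Std T" using g(1) by (auto simp: red_def)
        have "\<not> mdvd (lm i) k" if "i \<in> T" for i
        proof
          assume "mdvd (lm i) k"
          moreover have "keys (lm i) \<inter> keys (lm j) = {}" using coprime[of i j] that TN jN insert.hyps(2) by auto
          ultimately have "mdvd (lm i) e" unfolding e add.commute[of "lm j"] by (rule mdvd_add_disjoint)
          thus False using \<open>e \<in> Std T\<close> that by (auto simp: Std_def)
        qed
        thus ?thesis using d by (auto simp: Std_def)
      qed
      have below: "lookup (g * F j) k = 0" if "wt \<kappa> k < c" for k
      proof (rule ccontr)
        assume "lookup (g * F j) k \<noteq> 0"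
        with low[of k] that have "mdvd (lm j) k" "k - lm j \<in> keys g" by (auto simp: in_keys_iff split: if_splits)
        hence "mincost g \<le> wt \<kappa> (k - lm j)" "k = lm j + (k - lm j)" using mincost_le by (auto simp: mdvd_def)
        thus False using that wt_add[of \<kappa> "lm j" "k - lm j"] by (simp add: c_def)
      qed
      obtain e where e: "e \<in> keys g" "wt \<kappa> e = mincost g" using mincost_ex[OF False] by blast
      have emin: "lookup (g * F j) (e + lm j) \<noteq> 0" "wt \<kappa> (e + lm j) = c"
        using low[of "e + lm j"] e by (auto simp: c_def wt_add in_keys_iff mdvd_def add.commute)
      have nonstd: "k \<notin> Std T" if "k \<in> keys f'" "wt \<kappa> k = mincost f'" for k using insert.IH[OF TN f' that] .
      \<comment> \<open>The lowest weight of f is at most the lowest weights of both summands,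
        because one of the lowest monomials survives.\<close>
      have mc: "mincost f \<le> c \<and> (f' \<noteq> 0 \<longrightarrow> mincost f \<le> mincost f')"
      proof (cases "f' = 0 \<or> c < mincost f'")
        case True
        have "lookup f' (e + lm j) = 0"
        proof (rule ccontr)
          assume "lookup f' (e + lm j) \<noteq> 0"
          thus False using mincost_le[of "e + lm j" f'] emin(2) True by (auto simp: in_keys_iff)
        qed
        hence "e + lm j \<in> keys f" using emin(1) by (simp add: f lookup_add in_keys_iff)
        thus ?thesis using mincost_le[of "e + lm j" f] emin(2) True by auto
      next
        case False
        then obtain k where k: "k \<in> keys f'" "wt \<kappa> k = mincost f'" using mincost_ex by blast
        hence "k \<notin> Std T" by (rule nonstd)
        hence "lookup (g * F j) k = 0" using std[of k] k(2) False by auto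
        hence "k \<in> keys f" using k(1) by (simp add: f lookup_add in_keys_iff)
        thus ?thesis using mincost_le[of k f] k(2) False by auto
      qed
      have mle: "wt \<kappa> m \<le> c" using mc insert.prems(4) by simp
      show ?thesis
      proof (cases "lookup (g * F j) m = 0")
        case True
        hence "m \<in> keys f'" using insert.prems(3) by (simp add: f lookup_add in_keys_iff)
        moreover hence "wt \<kappa> m = mincost f'" using mincost_le[of m f'] mc insert.prems(4) by fastforce
        ultimately show ?thesis using nonstd by (auto simp: Std_def)
      next
        case False
        thus ?thesis using std[OF mle] by (auto simp: Std_def)
      qed
    qed
  qed
qed

lemma reduced_unique:
  assumes "T \<subseteq> N" "f \<in> red T" "f \<in> I T"
  shows "f = 0"
proof (rule ccontr)
  assume "f \<noteq> 0"
  then obtain m where "m \<in> keys f" "wt \<kappa> m = mincost f" using mincost_ex by blast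
  thus False using ideal_lead[OF assms(1,3)] assms(2) by (auto simp: red_def)
qed

text \<open>For a nonzero reduced g the lowest monomial of g F_j would be lm_j + e, nonstandard by
  \<open>ideal_lead\<close>; coprimality would make e itself nonstandard.\<close>

lemma regular:
  assumes "T \<subseteq> N" "j \<in> N" "j \<notin> T" "g * F j \<in> I T"
  shows "g \<in> I T"
proof -
  obtain g' where g': "g' \<in> red T" "g - g' \<in> I T" using reduce[OF assms(1)] by blast
  have "g' * F j = g * F j - F j * (g - g')" by (simp add: algebra_simps)
  hence gF: "g' * F j \<in> I T" using assms(4) g'(2) by (auto intro: idl.span_diff idl.span_scale)
  have "g' = 0"
  proof (rule ccontr)
    assume nz: "g' \<noteq> 0"
    then obtain e where e: "e \<in> keys g'" "wt \<kappa> e = mincost g'" using mincost_ex by blast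
    have low: "lookup (g' * F j) k = (if mdvd (lm j) k then lookup g' (k - lm j) else 0)"
      if "wt \<kappa> k \<le> mincost g' + wt \<kappa> (lm j)" for k by (rule lookup_mult_lead[OF assms(2) that])
    have ein: "e + lm j \<in> keys (g' * F j)"
      using low[of "e + lm j"] e by (auto simp: wt_add in_keys_iff mdvd_def add.commute)
    have "wt \<kappa> (e + lm j) \<le> wt \<kappa> k" if "k \<in> keys (g' * F j)" for k
    proof (rule ccontr)
      assume less: "\<not> wt \<kappa> (e + lm j) \<le> wt \<kappa> k"
      hence "mdvd (lm j) k" "k - lm j \<in> keys g'"
        using low[of k] that e(2) by (auto simp: in_keys_iff wt_add split: if_splits)
      hence "mincost g' \<le> wt \<kappa> (k - lm j)" "k = lm j + (k - lm j)" using mincost_le by (auto simp: mdvd_def)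
      thus False using less wt_add[of \<kappa> "lm j" "k - lm j"] e(2) by (simp add: wt_add)
    qed
    hence "mincost (g' * F j) = wt \<kappa> (e + lm j)" unfolding mincost_def using ein by (intro Min_eqI) auto
    hence "e + lm j \<notin> Std T" using ideal_lead[OF assms(1) gF ein] by simp
    then obtain i where i: "i \<in> T" "mdvd (lm i) (e + lm j)" by (auto simp: Std_def)
    have "keys (lm i) \<inter> keys (lm j) = {}" using coprime[of i j] i(1) assms(1-3) by auto
    hence "mdvd (lm i) e" by (rule mdvd_add_disjoint[OF i(2)])
    thus False using e(1) g'(1) i(1) by (auto simp: red_def Std_def)
  qed
  thus ?thesis using g'(2) by simp
qed

end

section \<open>Leading monomials of the equations of the nilcone\<close>

text \<open>More than i (i - 1) for i \<le> n, the weight of the leading monomial of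
  \<open>Gen n i\<close>: one off-diagonal coordinate is already too heavy.\<close>

definition unit_cost :: "nat \<Rightarrow> nat" where
  "unit_cost n = n * n + 1"

text \<open>More than any path along the superdiagonal, so that a monomial leaving the mixed block
  cannot lead in a Krylov coordinate. It is also the bound \<open>M\<close> of the locale
  \<open>leading\<close>.\<close>

definition top_cost :: "nat \<Rightarrow> nat" where
  "top_cost n = unit_cost n * (2 * n + 2)"

text \<open>Least weight singles out paths along the superdiagonal of the block of mixed coordinates: an
  entry at distance \<open>d\<close> from the diagonal weighs more than \<open>d\<close> entries at distance \<open>1\<close>, and the
  diagonal entries are almost free.\<close>

definition cost :: "nat \<Rightarrow> coord \<Rightarrow> nat" where
  "cost n c = (case c of CY i j \<Rightarrow>
      if i < n \<and> n \<le> j \<and> j < 2 * n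
      then if j = i + n then i
           else if i + n < j then unit_cost n * (2 * (j - (i + n)) - 1)
           else unit_cost n * (2 * (i + n - j) - 1)
      else top_cost n
    | _ \<Rightarrow> top_cost n)"

lemma cost_le: "cost n c \<le> top_cost n"
proof -
  have "unit_cost n * (2 * d - 1) \<le> unit_cost n * (2 * n + 2)" if "d \<le> n" for d
    using that by (intro mult_le_mono2) auto
  moreover have "i \<le> unit_cost n * (2 * n + 2)" if "i < n" for i using that by (auto simp: unit_cost_def)
  ultimately show ?thesis by (auto simp: cost_def top_cost_def split: coord.splits)
qed

definition ycoord :: "nat \<Rightarrow> nat \<Rightarrow> coord" where
  "ycoord n k = CY k (k + n)"

lemma cost_ycoord: "k < n \<Longrightarrow> cost n (ycoord n k) = k"
  by (simp add: cost_def ycoord_def)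

lemma cost_mixed:
  assumes "i < n" "j < n" "i \<noteq> j"
  shows "cost n (CY i (j + n)) = unit_cost n * (2 * (if i < j then j - i else i - j) - 1)"
  using assms by (auto simp: cost_def)

lemma cost_ge:
  assumes "c \<notin> ycoord n ` {..<n}"
  shows "unit_cost n \<le> cost n c"
proof -
  have "unit_cost n \<le> unit_cost n * (2 * d - 1)" if "d \<ge> 1" for d :: nat
  proof -
    have "1 \<le> 2 * d - 1" using that by arith
    hence "unit_cost n * 1 \<le> unit_cost n * (2 * d - 1)" by (rule mult_le_mono2)
    thus ?thesis by simp
  qed
  moreover have "unit_cost n \<le> top_cost n" by (simp add: top_cost_def)
  ultimately show ?thesis using assms by (auto simp: cost_def ycoord_def split: coord.splits)
qed

abbreviation zg :: "nat \<Rightarrow> nat \<Rightarrow> nat \<Rightarrow> coord zpoly" where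
  "zg n \<equiv> zmat n (snd (gen_point n))"

lemma Cgen_gser: "Cgen n j = fps_nth (gser (zg n) n) j"
  by (simp add: Cgen_def gpol_def)

lemma zg_mixed:
  assumes "i < n" "j < n"
  shows "zg n (2 * i) (Suc (2 * j)) = Var (CY i (j + n))" "zg n (Suc (2 * j)) (2 * i) = - Var (CY i (j + n))"
  using assms by (auto simp: zmat_def gen_point_def)

lemma zg_top:
  assumes "even p = even q"
  shows "zg n p q \<in> HB (cost n) 1 (top_cost n)"
proof -
  have *: "Var (CY i j) \<in> HB (cost n) 1 (top_cost n)" if "\<not> (i < n \<and> n \<le> j \<and> j < 2 * n)" for i j
    using HB_Var[of "CY i j" "cost n"] that by (auto simp: cost_def)
  have "snd (gen_point n) $$ (i, j) \<in> HB (cost n) 1 (top_cost n)"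
    if "i < 2 * n" "j < 2 * n" "i < n \<longleftrightarrow> j < n" for i j
    using that *[of i j] *[of j i] by (auto simp: gen_point_def intro!: HB_uminus)
  moreover have "pos n p < n \<longleftrightarrow> pos n q < n" if "p < 2 * n" "q < 2 * n" using that assms by (auto simp: pos_def)
  ultimately show ?thesis using pos_less[of p n] pos_less[of q n] by (auto simp: zmat_def)
qed

lemma zg_HB: "zg n p q \<in> HB (cost n) 1 0"
proof -
  have "snd (gen_point n) $$ (i, j) \<in> HB (cost n) 1 0" if "i < 2 * n" "j < 2 * n" for i j
    using that HB_mono[OF HB_Var, of 0] by (auto simp: gen_point_def intro!: HB_uminus)
  thus ?thesis using pos_less[of p n] pos_less[of q n] by (auto simp: zmat_def)
qed

lemma amap_zg_HB: "amap (zg n) p q \<in> HB (cost n) 1 0"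
  using zg_HB[of n p] by (auto simp: amap_def intro: HB_uminus)

lemma amap_zg_even: "i < n \<Longrightarrow> j < n \<Longrightarrow> amap (zg n) (2 * i) (2 * j) = Var (CY i (j + n))"
  by (simp add: amap_def zg_mixed)

lemma amap_zg_top: "amap (zg n) (2 * i) (Suc (2 * j)) \<in> HB (cost n) 1 (top_cost n)"
  using zg_top[of "2 * i" "2 * j" n] by (simp add: amap_def HB_uminus)

lemma zz_zg_HB: "zz (zg n) m k p r \<in> HB (cost n) (Suc k) 0"
proof (induction k arbitrary: p)
  case (Suc k)
  have "amap (zg n) p q * zz (zg n) m k q r \<in> HB (cost n) (Suc (Suc k)) 0" for q
    using HB_mult[OF amap_zg_HB[of n p q] Suc[of q]] by simp
  thus ?case by (auto intro: HB_sum)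
qed (use zg_HB in simp)

lemma gser_zg_HB: "fps_nth (gser (zg n) m) j \<in> HB (cost n) j 0"
proof (induction m arbitrary: j)
  case 0
  thus ?case by (cases j) (simp_all add: HB_one)
next
  case (Suc m)
  have "fps_nth (gfac (zg n) m) j \<in> HB (cost n) j 0" for j
    using zz_zg_HB by (cases j) (auto simp: gfac_def HB_one intro: HB_uminus)
  hence "fps_nth (gser (zg n) m) i * fps_nth (gfac (zg n) m) (j - i) \<in> HB (cost n) j 0" if "i \<le> j" for i
    using HB_mult[OF Suc[of i], of "fps_nth (gfac (zg n) m) (j - i)" "j - i" 0] that by simp
  thus ?case by (auto simp: fps_mult_nth intro!: HB_sum)
qed

text \<open>\<open>hs n t\<close> is the generating series of the complete symmetric functions of the last \<open>t\<close> diagonal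
  coordinates.\<close>

fun hs :: "nat \<Rightarrow> nat \<Rightarrow> coord zpoly fps" where
  "hs n 0 = 1"
| "hs n (Suc t) = Abs_fps (\<lambda>j. Var (ycoord n (n - Suc t)) ^ j) * hs n t"

lemma hs_0 [simp]: "fps_nth (hs n t) 0 = 1"
  by (induction t) simp_all

lemma Var_power_HB: "Var v ^ j \<in> HB \<kappa> j (j * \<kappa> v)"
  by (induction j) (use HB_mult[OF HB_Var] in \<open>auto simp: HB_one\<close>)

lemma hs_HB: "t \<le> n \<Longrightarrow> fps_nth (hs n t) d \<in> HB (cost n) d ((n - t) * d)"
proof (induction t arbitrary: d)
  case 0
  thus ?case by (cases d) (simp_all add: HB_one)
next
  case (Suc t)
  let ?a = "n - Suc t"
  have "Var (ycoord n ?a) ^ j * fps_nth (hs n t) (d - j) \<in> HB (cost n) d (?a * d)" if j: "j \<le> d" for j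
  proof -
    have "Var (ycoord n ?a) ^ j \<in> HB (cost n) j (j * ?a)"
      using Var_power_HB[of "ycoord n ?a" j "cost n"] Suc.prems by (simp add: cost_ycoord)
    moreover have "fps_nth (hs n t) (d - j) \<in> HB (cost n) (d - j) (?a * (d - j))"
      using Suc by (intro HB_mono[OF Suc.IH]) (auto intro: mult_le_mono1)
    ultimately have "Var (ycoord n ?a) ^ j * fps_nth (hs n t) (d - j) \<in> HB (cost n) (j + (d - j)) (j * ?a + ?a * (d - j))"
      by (rule HB_mult)
    moreover have "j * ?a + ?a * (d - j) = ?a * d" using j by (metis add_mult_distrib2 le_add_diff_inverse mult.commute)
    ultimately show ?thesis using j by simp
  qed
  thus ?case by (auto simp: fps_mult_nth intro!: HB_sum)
qed

lemma hs_lead: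
  assumes "Suc t \<le> n"
  shows "lead (cost n) (fps_nth (hs n (Suc t)) d) (single (ycoord n (n - Suc t)) d)"
proof -
  let ?a = "n - Suc t"
  let ?s = "\<lambda>j. Var (ycoord n ?a) ^ j * fps_nth (hs n t) (d - j)"
  let ?H = "HB (cost n) (deg (single (ycoord n ?a) d)) (Suc (wt (cost n) (single (ycoord n ?a) d)))"
  have c: "cost n (ycoord n ?a) = ?a" using assms by (simp add: cost_ycoord)
  have "fps_nth (hs n (Suc t)) d = (\<Sum>j=0..d. ?s j)" by (simp add: fps_mult_nth)
  also have "{0..d} = insert d {0..<d}" by auto
  finally have eq: "fps_nth (hs n (Suc t)) d = Var (ycoord n ?a) ^ d + (\<Sum>j=0..<d. ?s j)" by simp
  have "lead (cost n) (Var (ycoord n ?a) ^ d) (single (ycoord n ?a) d)"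
    using single_one_prod[of "single (ycoord n ?a) d"] by (simp add: lead_def mon_single)
  moreover have "(\<Sum>j=0..<d. ?s j) \<in>
      ?H"
  proof (rule HB_sum)
    fix j assume j: "j \<in> {0..<d}"
    have "?s j \<in> HB (cost n) (j + (d - j)) (j * ?a + (n - t) * (d - j))"
      using Var_power_HB[of "ycoord n ?a" j "cost n"] assms c by (intro HB_mult hs_HB) auto
    moreover have "Suc (d * ?a) \<le> j * ?a + (n - t) * (d - j)"
    proof -
      have "n - t = Suc ?a" using assms by simp
      hence "(n - t) * (d - j) = (d - j) + ?a * (d - j)" by (simp only: mult_Suc)
      moreover have "d * ?a = j * ?a + ?a * (d - j)" using j
        by (metis add_mult_distrib atLeastLessThan_iff le_add_diff_inverse less_or_eq_imp_le mult.commute)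
      moreover have "d - j \<ge> 1" using j by simp
      ultimately show ?thesis by linarith
    qed
    ultimately show "?s j \<in>
        ?H" using j c by (auto simp: wt_single intro: HB_mono)
  qed
  ultimately show ?thesis unfolding eq by (rule lead_add_HB)
qed

text \<open>On diagonal bivectors \<open>gser\<close> is the product of the 1 - s y_j, and the
  factor \<open>hs\<close> cancels all but the first i - 1 factors. Hence the second term has no
  purely diagonal monomial, and the first, the complete symmetric function of degree i in y_(i-1),
  ..., y_(n-1), provides the leading monomial.\<close>

definition Gen :: "nat \<Rightarrow> nat \<Rightarrow> coord zpoly" where
  "Gen n i = fps_nth (hs n (n - (i - 1))) i - fps_nth (gser (zg n) n * hs n (n - (i - 1))) i"

lemma lookup_zrestrict: "lookup (zrestrict V f) m = (if keys m \<subseteq> V then lookup f m else 0)"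
proof (induction f rule: poly_mapping_add_induct)
  case zero
  thus ?case by (simp add: zrestrict_def)
next
  case (add k c f)
  interpret zr: comm_ring_hom "zrestrict V" by (rule zrestrict_hom)
  have "zrestrict V (single k c) = (if keys k \<subseteq> V then single k c else 0)"
  proof (cases "keys k \<subseteq> V")
    case True
    thus ?thesis by (simp add: zrestrict_id polys_def)
  next
    case False
    then obtain v where "v \<in> keys k" "v \<notin> V" by auto
    hence "mon (\<lambda>v. if v \<in> V then Var v else 0 :: 'a zpoly) k = 0"
      unfolding mon_def by (intro prod_zero) (auto simp: in_keys_iff power_0_left intro!: bexI[of _ v])
    thus ?thesis using False by (simp add: zrestrict_def eval_zpoly_single)
  qed
  thus ?case using add by (auto simp: zr.hom_add lookup_add lookup_single when_def)
qed

text \<open>A polynomial vanishing on diagonal bivectors has an off-diagonal coordinate in each of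
  its monomials.\<close>

lemma HB_restrict_zero:
  assumes f: "f \<in> HB (cost n) D 0" and 0: "zrestrict (ycoord n ` {..<n}) f = 0"
  shows "f \<in> HB (cost n) D (unit_cost n)"
proof -
  have "unit_cost n \<le> wt (cost n) m" if m: "m \<in> keys f" for m
  proof -
    have "lookup (zrestrict (ycoord n ` {..<n}) f) m = 0" using 0 by simp
    then obtain v where v: "v \<in> keys m" "v \<notin> ycoord n ` {..<n}"
      using m unfolding lookup_zrestrict by (auto simp: in_keys_iff split: if_splits)
    have "lookup m v \<ge> 1" using v(1) by (simp add: in_keys_iff)
    hence "cost n v \<le> lookup m v * cost n v" by simp
    also have "\<dots> \<le> wt (cost n) m" unfolding wt_def using v(1) by (intro member_le_sum) auto
    finally show ?thesis using cost_ge[OF v(2)] by simp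
  qed
  thus ?thesis using f by (auto simp: HB_def)
qed

lemma gser_diag:
  assumes "m \<le> n"
  shows "gser (zmat n (bmat n (\<lambda>i j. if i = j then y i else 0))) m = (\<Prod>i<m. 1 - fps_X * fps_const (y i))"
  using assms
proof (induction m)
  case (Suc m)
  let ?b = "\<lambda>i j. if i = j then y i else 0"
  have "zz (zmat n (bmat n ?b)) m k (2 * m) (Suc (2 * m)) = (if k = 0 then y m else 0)" for k
    using Suc.prems by (subst gser_bmat, simp, cases k) (auto intro!: sum.neutral)
  hence "gfac (zmat n (bmat n ?b)) m = 1 - fps_X * fps_const (y m)"
    unfolding gfac_def by (auto intro!: arg_cong[of _ _ "\<lambda>f. 1 - fps_X * f"] fps_ext)
  thus ?case using Suc by simp
qed simp

lemma prod_linear_nth: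
  fixes y :: "nat \<Rightarrow> 'a::comm_ring_1"
  shows "j > s \<Longrightarrow> fps_nth (\<Prod>i<s. 1 - fps_X * fps_const (y i)) j = 0"
proof (induction s arbitrary: j)
  case (Suc s)
  define P where "P = (\<Prod>i<s. 1 - fps_X * fps_const (y i))"
  obtain j' where j: "j = Suc j'" using Suc.prems by (cases j) auto
  have "(\<Prod>i<Suc s. 1 - fps_X * fps_const (y i)) = P - fps_X * (P * fps_const (y s))"
    by (simp add: P_def algebra_simps)
  thus ?case using Suc j by (simp add: P_def)
qed simp

lemma prod_hs:
  assumes "t \<le> n"
  shows "(\<Prod>i<n. 1 - fps_X * fps_const (Var (ycoord n i))) * hs n t = (\<Prod>i<n - t. 1 - fps_X * fps_const (Var (ycoord n i)))"
  using assms
proof (induction t)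
  case (Suc t)
  let ?f = "\<lambda>i. 1 - fps_X * fps_const (Var (ycoord n i))"
  let ?a = "n - Suc t"
  have geo: "?f ?a * Abs_fps (\<lambda>j. Var (ycoord n ?a) ^ j) = 1"
  proof (rule fps_ext)
    fix j
    show "fps_nth (?f ?a * Abs_fps (\<lambda>j. Var (ycoord n ?a) ^ j)) j = fps_nth 1 j"
      by (cases j) (simp_all add: left_diff_distrib mult.assoc)
  qed
  have "(\<Prod>i<n. ?f i) * hs n (Suc t) = ((\<Prod>i<n. ?f i) * hs n t) * Abs_fps (\<lambda>j. Var (ycoord n ?a) ^ j)"
    by (simp add: mult_ac)
  also have "(\<Prod>i<n. ?f i) * hs n t = (\<Prod>i<n - t. ?f i)" using Suc by simp
  also have "n - t = Suc ?a" using Suc.prems by simp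
  finally show ?case using geo by (simp add: mult.assoc)
qed simp

lemma map_fps_mult_nth:
  assumes "comm_ring_hom h"
  shows "h (fps_nth (f * g) i) = (\<Sum>l=0..i. h (fps_nth f l) * h (fps_nth g (i - l)))"
proof -
  interpret comm_ring_hom h by fact
  show ?thesis by (simp add: fps_mult_nth hom_sum hom_mult)
qed

lemma polys_fps_nth_mult:
  "(\<And>l. fps_nth f l \<in> polys V) \<Longrightarrow> (\<And>l. fps_nth g l \<in> polys V) \<Longrightarrow> fps_nth (f * g) i \<in> polys V"
  by (auto simp: fps_mult_nth intro!: polys_sum polys_closed)

lemma hs_polys: "t \<le> n \<Longrightarrow> fps_nth (hs n t) d \<in> polys (ycoord n ` {..<n})"
  by (induction t arbitrary: d) (auto intro!: polys_fps_nth_mult polys_power polys_closed)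

lemma Gen_lead:
  assumes i: "1 \<le> i" "i \<le> n"
  shows "lead (cost n) (Gen n i) (single (ycoord n (i - 1)) i)"
proof -
  define t where "t = n - i"
  have t: "n - (i - 1) = Suc t" "n - Suc t = i - 1" "Suc t \<le> n" using i by (auto simp: t_def)
  let ?V = "ycoord n ` {..<n}"
  let ?G = "fps_nth (gser (zg n) n * hs n (Suc t)) i"
  have GHB: "?G \<in> HB (cost n) i 0"
  proof -
    have "fps_nth (gser (zg n) n) l * fps_nth (hs n (Suc t)) (i - l) \<in> HB (cost n) i 0" if "l \<le> i" for l
      using HB_mult[OF gser_zg_HB[of n n l] HB_mono[OF hs_HB[OF t(3)], of 0 "i - l"]] that by simp
    thus ?thesis by (auto simp: fps_mult_nth intro!: HB_sum)
  qed
  interpret zr: comm_ring_hom "zrestrict ?V" by (rule zrestrict_hom)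
  let ?y = "\<lambda>i. Var (ycoord n i)"
  let ?D = "bmat n (\<lambda>i j. if i = j then ?y i else 0)"
  let ?l = "single (ycoord n (i - 1)) i"
  have Y: "map_mat (zrestrict ?V) (snd (gen_point n)) = ?D"
  proof (rule eq_matI)
    fix p q assume "p < dim_row ?D" "q < dim_col ?D"
    hence pq: "p < 2 * n" "q < 2 * n" by (auto simp: bmat_def)
    have v: "zrestrict ?V (Var (CY a b)) = (if a < n \<and> b = a + n then ?y a else 0)" for a b
      unfolding zrestrict_def by (auto simp: ycoord_def)
    show "map_mat (zrestrict ?V) (snd (gen_point n)) $$ (p, q) = ?D $$ (p, q)"
      using pq by (auto simp: gen_point_def bmat_def v zr.hom_uminus)
  qed (auto simp: bmat_def)
  have gs: "zrestrict ?V (fps_nth (gser (zg n) n) l) = fps_nth (\<Prod>i<n. 1 - fps_X * fps_const (?y i)) l" for l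
    using gpol_hom[OF zrestrict_hom[of ?V] gen_point_carrier(1)[of n], of l] gser_diag[of n n ?y]
    unfolding Y by (simp add: gpol_def)
  have hsr: "zrestrict ?V (fps_nth (hs n (Suc t)) l) = fps_nth (hs n (Suc t)) l" for l
    by (rule zrestrict_id[OF hs_polys[OF t(3)]])
  have "zrestrict ?V ?G = fps_nth ((\<Prod>i<n. 1 - fps_X * fps_const (?y i)) * hs n (Suc t)) i"
    unfolding map_fps_mult_nth[OF zrestrict_hom] gs hsr by (simp only: fps_mult_nth)
  also have "\<dots> = 0" unfolding prod_hs[OF t(3)] using i t by (intro prod_linear_nth) simp
  finally have "?G \<in> HB (cost n) i (unit_cost n)" by (rule HB_restrict_zero[OF GHB])
  moreover have "Suc (i * (i - 1)) \<le> unit_cost n"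
    using i mult_le_mono[of i n "i - 1" n] by (simp add: unit_cost_def)
  ultimately have "- ?G \<in> HB (cost n) (deg ?l) (Suc (wt (cost n) ?l))"
    using i by (auto simp: wt_single cost_ycoord intro!: HB_uminus intro: HB_mono)
  hence "lead (cost n) (fps_nth (hs n (Suc t)) i + - ?G) ?l"
    using hs_lead[OF t(3), of i] unfolding t(2) by (intro lead_add_HB)
  thus ?thesis by (simp add: Gen_def t(1)[simplified])
qed

text \<open>As \<open>Cgen n 0\<close> is 1, the first term of the product cancels; what is left is,
  up to sign, a unitriangular change of generators.\<close>

lemma Gen_expand:
  assumes "1 \<le> i"
  shows "Gen n i = - Cgen n i - (\<Sum>l=1..<i. fps_nth (hs n (n - (i - 1))) (i - l) * Cgen n l)"
proof -
  let ?h = "fps_nth (hs n (n - (i - 1)))"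
  have "{0..i} = insert 0 (insert i {1..<i})" using assms by auto
  hence "(\<Sum>l=0..i. Cgen n l * ?h (i - l)) = ?h i + (Cgen n i + (\<Sum>l=1..<i. Cgen n l * ?h (i - l)))"
    using assms by (simp del: One_nat_def add: Cgen_0)
  moreover have "(\<Sum>l=1..<i. Cgen n l * ?h (i - l)) = (\<Sum>l=1..<i. ?h (i - l) * Cgen n l)"
    by (intro sum.cong refl mult.commute)
  ultimately show ?thesis unfolding Gen_def fps_mult_nth Cgen_gser[symmetric] by simp
qed

lemma Gen_ideal: "idl.span (Gen n ` {1..n}) = Cideal n"
proof (rule antisym)
  have "Gen n i \<in> Cideal n" if "i \<in> {1..n}" for i
  proof -
    have i: "1 \<le> i" using that by simp
    have "Cgen n l \<in> Cideal n" if "1 \<le> l" "l \<le> i" for l using that \<open>i \<in> {1..n}\<close> by (intro idl.span_base) auto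
    thus ?thesis unfolding Gen_expand[OF i]
      using i by (intro idl.span_diff idl.span_neg idl.span_sum idl.span_scale) auto
  qed
  thus "idl.span (Gen n ` {1..n}) \<subseteq> Cideal n" by (intro idl.span_minimal idl.subspace_span) auto
  have "Cgen n i \<in> idl.span (Gen n ` {1..n})" if "i \<in> {1..n}" for i using that
  proof (induction i rule: less_induct)
    case (less i)
    have "Cgen n i = - Gen n i - (\<Sum>l=1..<i. fps_nth (hs n (n - (i - 1))) (i - l) * Cgen n l)"
      using Gen_expand[of i n] less.prems by simp
    also have "\<dots> \<in> idl.span (Gen n ` {1..n})"
    proof (intro idl.span_diff idl.span_neg idl.span_sum idl.span_scale)
      show "Gen n i \<in> idl.span (Gen n ` {1..n})" using less.prems by (auto intro: idl.span_base)
      show "Cgen n l \<in> idl.span (Gen n ` {1..n})" if "l \<in> {1..<i}" for l using that less by auto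
    qed
    finally show ?case .
  qed
  thus "Cideal n \<subseteq> idl.span (Gen n ` {1..n})" by (intro idl.span_minimal idl.subspace_span) auto
qed

subsection \<open>The Krylov determinants\<close>

definition bcoord :: "nat \<Rightarrow> nat \<Rightarrow> coord" where
  "bcoord n t = CY t (Suc t + n)"

definition pathm :: "nat \<Rightarrow> nat \<Rightarrow> nat \<Rightarrow> (coord \<Rightarrow>\<^sub>0 nat)" where
  "pathm n v m = (\<Sum>t=v..<m. single (bcoord n t) 1)"

text \<open>The coordinate along e_v of A'^k applied to the last column, where A' is the compression
  to the first n - 1 planes.\<close>

definition krylov :: "nat \<Rightarrow> nat \<Rightarrow> nat \<Rightarrow> coord zpoly" where
  "krylov n k v = zz (zg n) (n - 1) k (2 * v) (Suc (2 * (n - 1)))"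

lemma krylov_Suc:
  assumes n: "n = Suc m" and v: "v < m"
  shows "krylov n (Suc k) v = (\<Sum>j<m. Var (CY v (j + n)) * krylov n k j
      + amap (zg n) (2 * v) (Suc (2 * j)) * zz (zg n) m k (Suc (2 * j)) (Suc (2 * m)))"
proof -
  have m: "n - 1 = m" and vn: "v < n" using n v by simp_all
  have "amap (zg n) (2 * v) (2 * j) = Var (CY v (j + n))" if "j < m" for j
    using that n by (intro amap_zg_even[OF vn]) simp
  thus ?thesis unfolding krylov_def m zz.simps sum_lessThan_double by (intro sum.cong refl) simp
qed

lemma krylov_0: "n = Suc m \<Longrightarrow> v < m \<Longrightarrow> krylov n 0 v = Var (CY v (m + n))"
  by (simp add: krylov_def zg_mixed)

text \<open>Monomials are walks from \<open>v\<close> to \<open>m\<close> in k + 1 steps, a step of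
  length d costing 2 d - 1 units. Such a walk costs at least 2 (m - v) - (k + 1) and at least m - v
  units; the truncated subtraction expresses both bounds.\<close>

lemma krylov_HB:
  assumes n: "n = Suc m" and v: "v < m"
  shows "krylov n k v \<in> HB (cost n) (Suc k) (unit_cost n * ((m - v) + ((m - v) - Suc k)))"
  using v
proof (induction k arbitrary: v)
  case 0
  have "cost n (CY v (m + n)) = unit_cost n * (2 * (m - v) - 1)" using 0 n cost_mixed[of v n m] by simp
  moreover have "2 * (m - v) - 1 = (m - v) + ((m - v) - Suc 0)" using 0 by simp
  ultimately show ?case using HB_Var[of "CY v (m + n)" "cost n"] 0 by (simp add: krylov_0[OF n])
next
  case (Suc k)
  let ?u = "unit_cost n" and ?d = "m - v"
  let ?e = "?u * (?d + (?d - Suc (Suc k)))"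
  let ?g = "\<lambda>j. amap (zg n) (2 * v) (Suc (2 * j)) * zz (zg n) m k (Suc (2 * j)) (Suc (2 * m))"
  show ?case unfolding krylov_Suc[OF n Suc.prems]
  proof (intro HB_sum HB_add)
    fix j assume "j \<in> {..<m}"
    hence j: "j < m" by simp
    have "?e \<le> cost n (CY v (j + n)) + ?u * ((m - j) + ((m - j) - Suc k))"
    proof (cases "j = v")
      case True
      have "?e \<le> ?u * (?d + (?d - Suc k))" by (intro mult_le_mono2) simp
      thus ?thesis unfolding True by (rule trans_le_add2)
    next
      case False
      have "?d + (?d - Suc (Suc k)) \<le> (2 * (if v < j then j - v else v - j) - 1) + ((m - j) + ((m - j) - Suc k))"
        using False j Suc.prems by auto
      hence "?e \<le> ?u * ((2 * (if v < j then j - v else v - j) - 1) + ((m - j) + ((m - j) - Suc k)))"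
        by (rule mult_le_mono2)
      moreover have "cost n (CY v (j + n)) = ?u * (2 * (if v < j then j - v else v - j) - 1)"
        using cost_mixed[of v n j] False j Suc.prems n by simp
      ultimately show ?thesis by (simp only: distrib_left)
    qed
    moreover have "Var (CY v (j + n)) * krylov n k j \<in> HB (cost n) (1 + Suc k) (cost n (CY v (j + n)) + ?u * ((m - j) + ((m - j) - Suc k)))"
      by (intro HB_mult HB_Var Suc.IH j)
    ultimately show "Var (CY v (j + n)) * krylov n k j \<in> HB (cost n) (Suc (Suc k)) ?e" by (auto intro: HB_mono)
    have "?e \<le> top_cost n" unfolding top_cost_def using n by (intro mult_le_mono2) simp
    moreover have "?g j \<in> HB (cost n) (1 + Suc k) (top_cost n + 0)" by (intro HB_mult amap_zg_top zz_zg_HB)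
    ultimately show "?g j \<in> HB (cost n) (Suc (Suc k)) ?e" by (auto intro: HB_mono)
  qed
qed

lemma wt_sum: "wt \<kappa> (sum f S) = (\<Sum>i\<in>S. wt \<kappa> (f i))"
  by (induction S rule: infinite_finite_induct) (simp_all add: wt_add)

lemma wt_pathm:
  assumes "n = Suc m" "v \<le> m"
  shows "deg (pathm n v m) = m - v" "wt (cost n) (pathm n v m) = unit_cost n * (m - v)"
proof -
  show "deg (pathm n v m) = m - v" by (simp add: pathm_def wt_sum wt_single)
  have "cost n (bcoord n t) = unit_cost n" if "t < m" for t
    using cost_mixed[of t n "Suc t"] that assms by (simp add: bcoord_def)
  hence "wt (cost n) (pathm n v m) = (\<Sum>t=v..<m. unit_cost n)"
    unfolding pathm_def wt_sum wt_single by (intro sum.cong) auto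
  thus "wt (cost n) (pathm n v m) = unit_cost n * (m - v)" by (simp add: mult.commute)
qed

text \<open>When the number of steps equals the distance, every walk other than the one by unit
  steps along the superdiagonal is heavier by at least one unit.\<close>

lemma krylov_lead:
  assumes n: "n = Suc m" and v: "m - v = Suc k"
  shows "lead (cost n) (krylov n k v) (pathm n v m)"
  using v
proof (induction k arbitrary: v)
  case 0
  hence "v < m" "m = Suc v" by auto
  thus ?case using lead_Var[of "cost n" "bcoord n v"] by (simp add: krylov_0[OF n] pathm_def bcoord_def)
next
  case (Suc k)
  let ?u = "unit_cost n"
  have vm: "v < m" "Suc v < m" "m - Suc v = Suc k" using Suc.prems by auto
  let ?f = "\<lambda>j. Var (CY v (j + n)) * krylov n k j"
  let ?g = "\<lambda>j. amap (zg n) (2 * v) (Suc (2 * j)) * zz (zg n) m k (Suc (2 * j)) (Suc (2 * m))"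
  let ?T = "HB (cost n) (deg (pathm n v m)) (Suc (wt (cost n) (pathm n v m)))"
  have T: "?T = HB (cost n) (Suc (Suc k)) (Suc (?u * Suc (Suc k)))" using wt_pathm[OF n, of v] Suc.prems vm by simp
  have u: "?u \<ge> 1" by (simp add: unit_cost_def)
  have "krylov n (Suc k) v = ?f (Suc v) + ((\<Sum>j\<in>{..<m} - {Suc v}. ?f j) + (\<Sum>j<m. ?g j))"
    unfolding krylov_Suc[OF n vm(1)] using vm(2) by (simp add: sum.distrib sum.remove[of "{..<m}" "Suc v"])
  moreover have "lead (cost n) (?f (Suc v)) (pathm n v m)"
  proof -
    have "pathm n v m = single (bcoord n v) 1 + pathm n (Suc v) m"
      unfolding pathm_def using vm by (simp add: sum.atLeast_Suc_lessThan)
    thus ?thesis using lead_mult[OF lead_Var[of "cost n" "bcoord n v"] Suc.IH[OF vm(3)]] by (simp add: bcoord_def)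
  qed
  moreover have "(\<Sum>j\<in>{..<m} - {Suc v}. ?f j) + (\<Sum>j<m. ?g j) \<in> ?T" unfolding T
  proof (intro HB_add HB_sum)
    fix j assume "j \<in> {..<m} - {Suc v}"
    hence j: "j < m" "j \<noteq> Suc v" by auto
    have "Suc (?u * Suc (Suc k)) \<le> cost n (CY v (j + n)) + ?u * ((m - j) + ((m - j) - Suc k))"
    proof (cases "j = v")
      case True
      hence "Suc (Suc k) + 1 \<le> (m - j) + ((m - j) - Suc k)" using Suc.prems by simp
      hence "?u * (Suc (Suc k) + 1) \<le> ?u * ((m - j) + ((m - j) - Suc k))" by (rule mult_le_mono2)
      thus ?thesis using u by simp
    next
      case False
      have "Suc (Suc k) + 1 \<le> (2 * (if v < j then j - v else v - j) - 1) + ((m - j) + ((m - j) - Suc k))"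
        using False j Suc.prems by auto
      hence "?u * (Suc (Suc k) + 1) \<le> ?u * ((2 * (if v < j then j - v else v - j) - 1) + ((m - j) + ((m - j) - Suc k)))"
        by (rule mult_le_mono2)
      moreover have "cost n (CY v (j + n)) = ?u * (2 * (if v < j then j - v else v - j) - 1)"
        using cost_mixed[of v n j] False j vm n by simp
      ultimately have "?u * (Suc (Suc k) + 1) \<le> cost n (CY v (j + n)) + ?u * ((m - j) + ((m - j) - Suc k))"
        by (simp only: distrib_left)
      thus ?thesis using u by simp
    qed
    moreover have "?f j \<in> HB (cost n) (1 + Suc k) (cost n (CY v (j + n)) + ?u * ((m - j) + ((m - j) - Suc k)))"
      by (intro HB_mult HB_Var krylov_HB n j)
    ultimately show "?f j \<in> HB (cost n) (Suc (Suc k)) (Suc (?u * Suc (Suc k)))" by (auto intro: HB_mono)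
  next
    fix j
    have "?u * (Suc (Suc k) + 1) \<le> top_cost n"
      unfolding top_cost_def using n Suc.prems by (intro mult_le_mono2) simp
    moreover have "?g j \<in> HB (cost n) (1 + Suc k) (top_cost n + 0)" by (intro HB_mult amap_zg_top zz_zg_HB)
    ultimately show "?g j \<in> HB (cost n) (Suc (Suc k)) (Suc (?u * Suc (Suc k)))" using u by (auto intro: HB_mono)
  qed
  ultimately show ?case by (simp only: lead_add_HB)
qed

text \<open>The parts Suc i of the weights have the same sum for every permutation. A permutation
  other than the identity moves some k upwards, and this excess makes its product heavier than the
  diagonal one.\<close>

lemma lead_det:
  fixes A :: "'v zpoly mat"
  assumes A: "A \<in> carrier_mat m m" and c: "c \<ge> 1"
    and diag: "\<And>k. k < m \<Longrightarrow> lead \<kappa> (A $$ (k, k)) (\<mu> k)"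
    and \<mu>: "\<And>k. k < m \<Longrightarrow> deg (\<mu> k) = D k" "\<And>k. k < m \<Longrightarrow> wt \<kappa> (\<mu> k) = c * Suc k"
    and entry: "\<And>k i. k < m \<Longrightarrow> i < m \<Longrightarrow> A $$ (k, i) \<in> HB \<kappa> (D k) (c * (Suc i + (i - k)))"
  shows "lead \<kappa> (det A) (\<Sum>k<m. \<mu> k)"
proof -
  let ?H = "HB \<kappa> (deg (\<Sum>k<m. \<mu> k)) (Suc (wt \<kappa> (\<Sum>k<m. \<mu> k)))"
  let ?f = "\<lambda>p. signof p * (\<Prod>k=0..<m. A $$ (k, p k))"
  let ?P = "{p. p permutes {0..<m}}"
  have idP: "id \<in> ?P" by (simp add: permutes_id)
  have fin: "finite ?P" by (simp add: finite_permutations)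
  have "det A = ?f id + (\<Sum>p\<in>?P - {id}. ?f p)" unfolding det_def'[OF A] by (rule sum.remove[OF fin idP])
  moreover have "lead \<kappa> (?f id) (\<Sum>k<m. \<mu> k)"
    using lead_prod[of "{0..<m}" \<kappa> "\<lambda>k. A $$ (k, k)" \<mu>] diag by (simp add: atLeast0LessThan)
  moreover have "(\<Sum>p\<in>?P - {id}. ?f p) \<in> ?H"
  proof (rule HB_sum)
    fix p assume "p \<in> ?P - {id}"
    hence p: "p permutes {0..<m}" "p \<noteq> id" by auto
    have pl: "k < m \<Longrightarrow> p k < m" for k using permutes_in_image[OF p(1), of k] by simp
    have sp: "(\<Sum>k=0..<m. Suc (p k)) = (\<Sum>k=0..<m. Suc k)" using sum.permute[OF p(1), of Suc] by (simp add: comp_def)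
    have "\<exists>k<m. k < p k"
    proof (rule ccontr)
      assume "\<not> (\<exists>k<m. k < p k)"
      hence le: "p k \<le> k" if "k < m" for k using that by auto
      have "p k = k" if k: "k < m" for k
      proof (rule ccontr)
        assume "p k \<noteq> k"
        hence "(\<Sum>k=0..<m. Suc (p k)) < (\<Sum>k=0..<m. Suc k)"
          using le k by (intro sum_strict_mono_ex1) (auto intro!: bexI[of _ k] simp: less_le)
        thus False using sp by simp
      qed
      hence "p x = id x" for x using permutes_not_in[OF p(1), of x] by (cases "x < m") auto
      hence "p = id" by blast
      thus False using p(2) by simp
    qed
    then obtain k0 where k0: "k0 < m" "k0 < p k0" by blast
    have "(\<Prod>k=0..<m. A $$ (k, p k)) \<in> HB \<kappa> (\<Sum>k=0..<m. D k) (\<Sum>k=0..<m. c * (Suc (p k) + (p k - k)))"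
      using entry pl by (intro HB_prod) auto
    moreover have "(\<Sum>k=0..<m. D k) = deg (\<Sum>k<m. \<mu> k)"
      unfolding wt_sum atLeast0LessThan by (intro sum.cong refl \<mu>(1)[symmetric]) simp
    moreover have "Suc (wt \<kappa> (\<Sum>k<m. \<mu> k)) \<le> (\<Sum>k=0..<m. c * (Suc (p k) + (p k - k)))"
    proof -
      have w: "wt \<kappa> (\<Sum>k<m. \<mu> k) = (\<Sum>k=0..<m. c * Suc k)"
        unfolding wt_sum atLeast0LessThan by (intro sum.cong refl) (use \<mu>(2) in auto)
      have "c * 1 \<le> c * (p k0 - k0)" using k0 by (intro mult_le_mono2) simp
      also have "\<dots> \<le> (\<Sum>k=0..<m. c * (p k - k))" using k0 by (intro member_le_sum) auto
      finally have "Suc (\<Sum>k=0..<m. c * Suc k) \<le> (\<Sum>k=0..<m. c * Suc k) + (\<Sum>k=0..<m. c * (p k - k))" using c by simp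
      also have "(\<Sum>k=0..<m. c * Suc k) = (\<Sum>k=0..<m. c * Suc (p k))"
        using sp by (simp only: sum_distrib_left[symmetric])
      finally show ?thesis unfolding w by (simp only: distrib_left sum.distrib sum_distrib_left[symmetric] sp)
    qed
    ultimately have "(\<Prod>k=0..<m. A $$ (k, p k)) \<in> ?H" by (simp only: HB_mono)
    thus "?f p \<in> ?H" by (auto simp: sign_def HB_uminus)
  qed
  ultimately show ?thesis by (simp only: lead_add_HB)
qed

text \<open>The columns are reversed so that the leading walks, whose distance equals the number of
  steps, lie on the diagonal.\<close>

definition kmat :: "nat \<Rightarrow> coord zpoly mat" where
  "kmat n = mat (n - 1) (n - 1) (\<lambda>(k, i). krylov n k (n - 1 - 1 - i))"

definition kdet :: "nat \<Rightarrow> coord zpoly" where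
  "kdet n = det (kmat n)"

definition kdet_lm :: "nat \<Rightarrow> (coord \<Rightarrow>\<^sub>0 nat)" where
  "kdet_lm n = (\<Sum>k<n - 1. pathm n (n - 1 - 1 - k) (n - 1))"

lemma kdet_lead:
  assumes n: "n = Suc m"
  shows "lead (cost n) (kdet n) (kdet_lm n)"
  unfolding kdet_def kdet_lm_def n diff_Suc_1 unfolding n[symmetric]
proof (rule lead_det[where c = "unit_cost n" and D = Suc])
  show "kmat n \<in> carrier_mat m m" by (simp add: kmat_def n)
  show "1 \<le> unit_cost n" by (simp add: unit_cost_def)
  fix k assume k: "k < m"
  have mv: "m - (m - 1 - k) = Suc k" using k by simp
  show "lead (cost n) (kmat n $$ (k, k)) (pathm n (m - 1 - k) m)"
    using krylov_lead[OF n mv] k by (simp add: kmat_def n)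
  show "deg (pathm n (m - 1 - k) m) = Suc k" "wt (cost n) (pathm n (m - 1 - k) m) = unit_cost n * Suc k"
    using wt_pathm[OF n, of "m - 1 - k"] mv by simp_all
  fix i assume i: "i < m"
  have "m - (m - 1 - i) = Suc i" using i by simp
  thus "kmat n $$ (k, i) \<in> HB (cost n) (Suc k) (unit_cost n * (Suc i + (i - k)))"
    using krylov_HB[OF n, of "m - 1 - i" k] k i by (simp add: kmat_def n)
qed

lemma keys_kdet_lm: "keys (kdet_lm n) \<subseteq> bcoord n ` {..<n - 1}"
proof -
  have "keys (sum f S) \<subseteq> U" if "\<And>i. i \<in> S \<Longrightarrow> keys (f i) \<subseteq> U" for f :: "nat \<Rightarrow> coord \<Rightarrow>\<^sub>0 nat" and S U using that
  proof (induction S rule: infinite_finite_induct)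
    case (insert x S)
    thus ?case using keys_add[of "f x" "sum f S"] by auto
  qed auto
  note * = this
  show ?thesis unfolding kdet_lm_def pathm_def by (intro *) auto
qed

subsection \<open>Exchanging the two Lagrangian subspaces\<close>

text \<open>The effect of J on the coordinates of a bivector. No signs occur, so it is a permutation
  of variables: it exchanges the two pure blocks and transposes the mixed one, whence it preserves
  \<open>cost\<close>.\<close>

definition swapc :: "nat \<Rightarrow> coord \<Rightarrow> coord" where
  "swapc n c = (case c of CY i j \<Rightarrow>
      if i < j \<and> j < n then CY (i + n) (j + n)
      else if i < n \<and> n \<le> j \<and> j < 2 * n then CY (j - n) (i + n)
      else if n \<le> i \<and> i < j \<and> j < 2 * n then CY (i - n) (j - n) else c
    | _ \<Rightarrow> c)"

abbreviation swapp :: "nat \<Rightarrow> coord zpoly \<Rightarrow> coord zpoly" where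
  "swapp n \<equiv> eval_zpoly (\<lambda>v. Var (swapc n v))"

lemma swapc_swapc: "swapc n (swapc n c) = c"
  by (cases c) (auto simp: swapc_def)

lemma swapp_swapp: "swapp n (swapp n f) = f"
  unfolding hom_eval_zpoly[OF eval_hom.comm_ring_hom_axioms] by (simp add: swapc_swapc)

text \<open>J itself is symplectic, and J Y J^T is the generic bivector with permuted coordinates;
  the vector does not enter the characteristic series.\<close>

lemma swapp_Cgen: "swapp n (Cgen n j) = Cgen n j"
proof -
  let ?J = "symp_form n :: coord zpoly mat" and ?Y = "snd (gen_point n)"
  have J: "?J \<in> Sp n"
  proof -
    have "?J\<^sup>T * ?J * ?J = ?J" unfolding symp_form_orthogonal by (rule left_mult_one_mat[OF symp_form_carrier(1)])
    thus ?thesis by (simp add: Sp_def)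
  qed
  let ?p = "(fst (gen_point n), ?J * ?Y * ?J\<^sup>T)"
  have JY: "?J * ?Y * ?J\<^sup>T \<in> alt_mat (2 * n)" by (rule act_alt_mat[OF gen_point_alt symp_form_carrier(1)])
  have p: "?p \<in> V_points n" using V_pointsD(1)[OF gen_point_V[of n]] JY by (simp add: V_points_def)
  have idx: "(?J * ?Y * ?J\<^sup>T) $$ (i, j) = (if i < n then (if j < n then ?Y $$ (i + n, j + n) else - ?Y $$ (i + n, j - n))
      else (if j < n then - ?Y $$ (i - n, j + n) else ?Y $$ (i - n, j - n)))" if ij: "i < 2 * n" "j < 2 * n" for i j
  proof -
    have c: "?J * ?Y \<in> sq_mats n" by (intro mult_carrier_mat) auto
    have r: "(?J * ?Y) $$ (i, k) = (if i < n then ?Y $$ (i + n, k) else - ?Y $$ (i - n, k))" if "k < 2 * n" for k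
      using ij that by (subst sq_index[of _ n]) (auto simp: sum_symp_form_left)
    have "(?J * ?Y * ?J\<^sup>T) $$ (i, j) = amat n (?J * ?Y) $$ (i, j)" by (simp add: amat_def)
    thus ?thesis using ij by (auto simp: amat_index[OF c ij] r simp del: index_mult_mat(1))
  qed
  have "swapp n (Cgen n j) = fps_nth (gpol n (snd ?p)) j"
  proof (rule eval_Cgen[OF p])
    fix c assume "c \<in> V_coords n"
    then consider i where "c = CX i" "i < 2 * n" | i j where "c = CY i j" "i < j" "j < 2 * n"
      by (auto simp: V_coords_def)
    thus "Var (swapc n c) = coord_val ?p c"
    proof cases
      case 1
      thus ?thesis by (simp add: swapc_def gen_point_def)
    next
      case 2
      hence ij: "i < 2 * n" "j < 2 * n" by auto
      have "coord_val ?p c = (?J * ?Y * ?J\<^sup>T) $$ (i, j)" using 2 by simp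
      thus ?thesis unfolding idx[OF ij] using 2 by (auto simp: swapc_def gen_point_def)
    qed
  qed
  also have "\<dots> = eval_pt (act ?J (gen_point n)) (Cgen n j)"
    using eval_Cgen[OF act_V_points[OF symp_form_carrier(1) gen_point_V] refl, of n j] by (simp add: act_def)
  also have "\<dots> = eval_pt (gen_point n) (Cgen n j)" by (rule V_invariants_eval[OF Cgen_invariant J gen_point_V])
  also have "\<dots> = Cgen n j" by (rule eval_gen_point_self[OF Cgen_in_polys])
  finally show ?thesis .
qed

lemma swapp_Cideal: "f \<in> Cideal n \<Longrightarrow> swapp n f \<in> Cideal n"
  by (rule ideal_hom_image[OF eval_hom.comm_ring_hom_axioms]) (auto simp: swapp_Cgen intro: idl.span_base)

definition swapm :: "nat \<Rightarrow> (coord \<Rightarrow>\<^sub>0 nat) \<Rightarrow> (coord \<Rightarrow>\<^sub>0 nat)" where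
  "swapm n m = (\<Sum>v\<in>keys m. single (swapc n v) (lookup m v))"

lemma cost_swapc: "cost n (swapc n c) = cost n c"
  by (cases c) (auto simp: swapc_def cost_def)

lemma wt_swapm: "wt (cost n) (swapm n m) = wt (cost n) m" "deg (swapm n m) = deg m"
  unfolding swapm_def wt_sum wt_single cost_swapc by (simp_all add: wt_def)

lemma mon_swap: "mon (\<lambda>v. Var (swapc n v)) m = mon Var (swapm n m)"
proof -
  have "mon Var (sum f S) = (\<Prod>i\<in>S. mon Var (f i))" for f :: "coord \<Rightarrow> coord \<Rightarrow>\<^sub>0 nat" and S
    by (induction S rule: infinite_finite_induct) (simp_all add: mon_add)
  thus ?thesis by (simp add: swapm_def mon_def[of _ m] mon_single)
qed

lemma swapp_HB: "f \<in> HB (cost n) D c \<Longrightarrow> swapp n f \<in> HB (cost n) D c"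
proof -
  assume f: "f \<in> HB (cost n) D c"
  have "swapp n f = (\<Sum>m\<in>keys f. single (swapm n m) (lookup f m))"
    unfolding eval_zpoly_superset[OF finite_keys subset_refl] mon_swap single_one_prod[symmetric]
    by (intro sum.cong refl, subst (2) single_of_int_mult) simp
  moreover have "single (swapm n m) (lookup f m) \<in> HB (cost n) D c" if "m \<in> keys f" for m
  proof -
    have "D = deg (swapm n m)" "c \<le> wt (cost n) (swapm n m)" using f that unfolding HB_def wt_swapm by auto
    thus ?thesis by (simp only: HB_mono[OF HB_single])
  qed
  ultimately show ?thesis by (simp only: HB_sum)
qed

lemma swapp_lead:
  assumes "lead (cost n) f m"
  shows "lead (cost n) (swapp n f) (swapm n m)"
proof -
  have "swapp n (single m 1) = single (swapm n m) 1" unfolding single_one_prod[of "swapm n m"] mon_swap[symmetric]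
    by (simp only: eval_zpoly_single of_int_1 mult_1_left)
  hence "swapp n f - single (swapm n m) 1 = swapp n (f - single m 1)" by (simp only: eval_hom.hom_minus)
  thus ?thesis using swapp_HB assms unfolding lead_def wt_swapm by (simp only:)
qed

lemma keys_swapm: "keys (swapm n m) \<subseteq> swapc n ` keys m"
proof -
  have "keys (\<Sum>v\<in>S. single (swapc n v) (lookup m v)) \<subseteq> swapc n ` S" for S
  proof (induction S rule: infinite_finite_induct)
    case (insert x S)
    thus ?case using keys_add[of "single (swapc n x) (lookup m x)" "\<Sum>v\<in>S. single (swapc n v) (lookup m v)"]
      by (auto split: if_splits)
  qed auto
  thus ?thesis by (simp add: swapm_def)
qed

lemma keys_power_lm: "keys (\<Sum>i<(N::nat). m) \<subseteq> keys (m :: 'v \<Rightarrow>\<^sub>0 nat)"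
proof (induction N)
  case (Suc N)
  have "keys (m + (\<Sum>i<N. m)) \<subseteq> keys m \<union> keys (\<Sum>i<N. m)" by (rule keys_add)
  thus ?case using Suc unfolding sum.lessThan_Suc by (auto simp: add.commute)
qed simp

text \<open>Any powers of the two Krylov determinants thus form a regular sequence modulo the equations.\<close>

lemma leading_nilcone:
  assumes n: "n \<ge> 1"
  shows "leading (cost n) (top_cost n)
    (\<lambda>i. if i = 0 then kdet n ^ N else if i \<le> n then Gen n i else swapp n (kdet n) ^ M)
    (\<lambda>i. if i = 0 then \<Sum>j<N. kdet_lm n else if i \<le> n then single (ycoord n (i - 1)) i
       else \<Sum>j<M. swapm n (kdet_lm n)) {0..Suc n}" (is "leading _ _ ?F ?K _")
proof
  let ?B = "(\<lambda>t. CY (Suc t) (t + n)) ` {..<n - 1}"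
  obtain m where m: "n = Suc m" using n by (cases n) auto
  show "lead (cost n) (?F i) (?K i)"
    if "i \<in> {0..Suc n}" for i
    using kdet_lead[OF m] Gen_lead[of i n] swapp_lead[OF kdet_lead[OF m]] by (auto intro: lead_power)
  have a: "keys (\<Sum>j<N. kdet_lm n) \<subseteq> bcoord n ` {..<n - 1}"
    using keys_power_lm[where N = N and m = "kdet_lm n"] keys_kdet_lm[of n] by auto
  have b: "keys (\<Sum>j<M. swapm n (kdet_lm n)) \<subseteq> ?B"
  proof -
    have "keys (\<Sum>j<M. swapm n (kdet_lm n)) \<subseteq> keys (swapm n (kdet_lm n))" by (rule keys_power_lm)
    also have "\<dots> \<subseteq> swapc n ` keys (kdet_lm n)" by (rule keys_swapm)
    also have "\<dots> \<subseteq> swapc n ` bcoord n ` {..<n - 1}" by (intro image_mono keys_kdet_lm)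
    also have "\<dots> = ?B" unfolding image_image by (intro image_cong) (auto simp: swapc_def bcoord_def)
    finally show ?thesis .
  qed
  have y: "keys (single (ycoord n (i - 1)) i) \<subseteq> {ycoord n (i - 1)}" for i :: nat by simp
  \<comment> \<open>The supports lie in the superdiagonal, in single diagonal entries and in the
    subdiagonal of the mixed block.\<close>
  let ?U = "\<lambda>i. if i = 0 then bcoord n ` {..<n - 1} else if i \<le> n then {ycoord n (i - 1)} else ?B"
  have K: "keys (?K i) \<subseteq> ?U i" for i using a b y[of i] by simp
  show "keys (?K i) \<inter> keys (?K j) = {}" if "i \<in> {0..Suc n}" "j \<in> {0..Suc n}" "i \<noteq> j" for i j
  proof -
    have "?U i \<inter> ?U j = {}" using that by (auto simp: bcoord_def ycoord_def)
    thus ?thesis using K[of i] K[of j] by blast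
  qed
qed (auto simp: cost_le)

section \<open>Charts of the nilcone\<close>

lemma zpoly_induct [case_names const Var add mult]:
  assumes "\<And>c. P (of_int c)" "\<And>v. P (Var v)" "\<And>f g. P f \<Longrightarrow> P g \<Longrightarrow> P (f + g)"
    "\<And>f g. P f \<Longrightarrow> P g \<Longrightarrow> P (f * g)"
  shows "P (f :: 'v zpoly)"
proof -
  have 0: "P 0" and 1: "P 1" using assms(1)[of 0] assms(1)[of 1] by simp_all
  have pow: "P (Var v ^ k)" for v :: 'v and k by (induction k) (simp_all add: 1 assms)
  have prod: "P (prod h S)" if "\<And>x. P (h x)" for h :: "'v \<Rightarrow> 'v zpoly" and S
    by (induction S rule: infinite_finite_induct) (simp_all add: 1 assms that)
  have sum: "P (sum h S)" if "\<And>x. P (h x)" for h :: "('v \<Rightarrow>\<^sub>0 nat) \<Rightarrow> 'v zpoly" and S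
    by (induction S rule: infinite_finite_induct) (simp_all add: 0 assms that)
  show ?thesis by (subst zpoly_expand) (auto simp: mon_def intro!: sum prod assms(4) assms(1) pow)
qed

lemma span_cong_mult:
  assumes "a - a' \<in> idl.span S" "b - b' \<in> idl.span S"
  shows "a * b - a' * b' \<in> idl.span (S :: 'a::comm_ring_1 set)"
proof -
  have "a * b - a' * b' = b * (a - a') + a' * (b - b')" by (simp add: algebra_simps)
  thus ?thesis using assms by (auto intro: idl.span_add idl.span_scale)
qed

lemma span_cong_scale:
  assumes "a - a' \<in> idl.span S"
  shows "c * a - c * a' \<in> idl.span (S :: 'a::comm_ring_1 set)"
  unfolding right_diff_distrib[symmetric] by (rule idl.span_scale[OF assms])

lemma span_cong_add:
  assumes "a - a' \<in> idl.span S" "b - b' \<in> idl.span S"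
  shows "(a + b) - (a' + b') \<in> idl.span (S :: 'a::comm_ring_1 set)"
  using idl.span_add[OF assms] by (simp add: algebra_simps)

lemma span_cong_sum:
  assumes "\<And>i. i \<in> T \<Longrightarrow> a i - b i \<in> idl.span S"
  shows "sum a T - sum b T \<in> idl.span (S :: 'a::comm_ring_1 set)"
  unfolding sum_subtractf[symmetric] by (rule idl.span_sum) (rule assms)

lemma span_cong_power:
  assumes "a - a' \<in> idl.span S"
  shows "a ^ k - a' ^ k \<in> idl.span (S :: 'a::comm_ring_1 set)"
  by (induction k) (simp_all add: span_cong_mult[OF assms] idl.span_zero)

lemma span_cong_mem:
  assumes "a - a' \<in> idl.span S"
  shows "a \<in> idl.span S \<longleftrightarrow> a' \<in> idl.span (S :: 'a::comm_ring_1 set)"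
proof
  assume "a \<in> idl.span S"
  from idl.span_diff[OF this assms] show "a' \<in> idl.span S" by (simp only: diff_diff_eq2 add_diff_cancel_left')
next
  assume "a' \<in> idl.span S"
  from idl.span_add[OF assms this] show "a \<in> idl.span S" by (simp only: diff_add_cancel)
qed

lemma polys_fps_inverse:
  assumes "fps_nth f 0 = 1" "\<And>i. fps_nth f i \<in> polys V"
  obtains h where "f * h = 1" "fps_nth h 0 = 1" "\<And>i. fps_nth h i \<in> polys V"
proof
  let ?h = "fps_right_inverse f 1"
  show fh: "f * ?h = 1" by (rule fps_right_inverse) (simp add: assms)
  show h0: "fps_nth ?h 0 = 1" by simp
  show "fps_nth ?h i \<in> polys V" for i
  proof (induction i rule: less_induct)
    case (less i)
    show ?case
    proof (cases i)
      case (Suc j)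
      have "0 = fps_nth (f * ?h) i" using fh Suc by simp
      also have "\<dots> = fps_nth ?h i + (\<Sum>l=1..i. fps_nth f l * fps_nth ?h (i - l))"
        by (simp add: fps_mult_nth sum.atLeast_Suc_atMost assms(1))
      finally have "fps_nth ?h i = - (\<Sum>l=1..i. fps_nth f l * fps_nth ?h (i - l))"
        by (simp only: eq_neg_iff_add_eq_0)
      also have "\<dots> \<in> polys V" by (intro polys_closed(6,7) polys_sum assms(2) less.IH) auto
      finally show ?thesis .
    qed simp
  qed
qed

lemma polys_det:
  assumes "A \<in> carrier_mat k k" "\<And>i j. i < k \<Longrightarrow> j < k \<Longrightarrow> A $$ (i, j) \<in> polys V"
  shows "det A \<in> polys V"
  unfolding det_def'[OF assms(1)]
proof (intro polys_sum polys_closed polys_prod)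
  fix p i assume "p \<in> {p. p permutes {0..<k}}" "i \<in> {0..<k}"
  hence "p i < k" "i < k" using permutes_in_image[of p "{0..<k}" i] by auto
  thus "A $$ (i, p i) \<in> polys V" by (intro assms(2))
qed

lemma polys_adj_mat:
  assumes A: "A \<in> carrier_mat k k" "\<And>i j. i < k \<Longrightarrow> j < k \<Longrightarrow> A $$ (i, j) \<in> polys V"
    and ij: "i < k" "j < k"
  shows "adj_mat A $$ (i, j) \<in> polys V"
proof -
  have "det (mat_delete A j i) \<in> polys V"
  proof (rule polys_det)
    show "mat_delete A j i \<in> carrier_mat (k - 1) (k - 1)" using A(1) by (rule mat_delete_carrier)
    show "mat_delete A j i $$ (a, b) \<in> polys V" if "a < k - 1" "b < k - 1" for a b
      using that A(1) ij by (auto simp: mat_delete_def intro!: A(2))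
  qed
  moreover have "(- 1) ^ l \<in> polys V" for l :: nat by (intro polys_power polys_closed)
  ultimately show ?thesis using A(1) ij by (simp add: adj_mat_def cofactor_def polys_closed)
qed

lemma cramer_adj:
  fixes A :: "'a::comm_ring_1 mat"
  assumes A: "A \<in> carrier_mat k k" and i: "i < k"
  shows "(\<Sum>j<k. adj_mat A $$ (i, j) * (\<Sum>l<k. A $$ (j, l) * u l)) = det A * u i"
proof -
  have "(\<Sum>j<k. adj_mat A $$ (i, j) * A $$ (j, l)) = (adj_mat A * A) $$ (i, l)" if "l < k" for l
    using A adj_mat(1)[OF A] i that by (subst index_mult_sum[of _ k k _ k]) auto
  hence e: "(\<Sum>j<k. adj_mat A $$ (i, j) * A $$ (j, l)) = (if i = l then det A else 0)" if "l < k" for l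
    using that i by (simp add: adj_mat(3)[OF A])
  have "(\<Sum>j<k. adj_mat A $$ (i, j) * (\<Sum>l<k. A $$ (j, l) * u l)) = (\<Sum>l<k. (\<Sum>j<k. adj_mat A $$ (i, j) * A $$ (j, l)) * u l)"
    unfolding sum_distrib_left sum_distrib_right by (subst sum.swap) (simp add: mult.assoc)
  also have "\<dots> = (\<Sum>l<k. if i = l then det A * u l else 0)" by (intro sum.cong refl) (auto simp: e)
  also have "\<dots> = det A * u i" using i by simp
  finally show ?thesis .
qed

subsection \<open>Solving for the last row\<close>

text \<open>The equations determine the coordinates \<open>Y(n - 1, i + n)\<close> as functions of the others, up to
  the denominator \<open>kdet n\<close>.\<close>

definition W :: "nat \<Rightarrow> coord set" where
  "W n = - {CY (n - 1) (i + n) | i. i < n}"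

context
  fixes n m :: nat
  assumes n: "n = Suc m"
begin

lemma zg_W:
  assumes "p \<noteq> 2 * m" "q \<noteq> 2 * m"
  shows "zg n p q \<in> polys (W n)"
proof -
  have "pos n p \<noteq> n - 1" "pos n q \<noteq> n - 1" if "p < 2 * n" "q < 2 * n" using assms that n by (auto simp: pos_def)
  moreover have "Var (CY i j) \<in> polys (W n)" if "i \<noteq> n - 1" for i j using that by (auto simp: W_def)
  ultimately show ?thesis using pos_less[of p n] pos_less[of q n] by (auto simp: zmat_def gen_point_def)
qed

lemma amap_zg_W: "p \<noteq> 2 * m \<Longrightarrow> q < 2 * m \<Longrightarrow> amap (zg n) p q \<in> polys (W n)"
  unfolding amap_def by (auto intro!: zg_W polys_closed) presburger

lemma zz_zg_W: "p \<noteq> 2 * m \<Longrightarrow> r \<noteq> 2 * m \<Longrightarrow> k \<le> m \<Longrightarrow> zz (zg n) k l p r \<in> polys (W n)"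
proof (induction l arbitrary: p)
  case (Suc l)
  have "amap (zg n) p q * zz (zg n) k l q r \<in> polys (W n)" if "q \<in> {..<2 * k}" for q
    using that Suc by (intro polys_closed amap_zg_W Suc.IH) auto
  thus ?case unfolding zz.simps by (rule polys_sum)
qed (simp add: zg_W)

lemma gser_zg_W: "k \<le> m \<Longrightarrow> fps_nth (gser (zg n) k) i \<in> polys (W n)"
proof (induction k arbitrary: i)
  case 0
  thus ?case by (cases i) simp_all
next
  case (Suc k)
  have "fps_nth (gfac (zg n) k) i \<in> polys (W n)" for i using Suc.prems zz_zg_W[of "2 * k" "Suc (2 * k)" k "i - 1"]
    by (cases i) (auto simp: gfac_def intro: polys_closed)
  thus ?case using Suc by (auto intro!: polys_fps_nth_mult)
qed

text \<open>The contribution of the walks whose first step goes from the last plane to some f_j; it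
  is free of the unknown row.\<close>

definition rest :: "nat \<Rightarrow> coord zpoly" where
  "rest k = (\<Sum>j<m. amap (zg n) (2 * m) (Suc (2 * j)) * zz (zg n) m k (Suc (2 * j)) (Suc (2 * m)))"

lemma rest_W: "rest k \<in> polys (W n)"
proof -
  have "amap (zg n) (2 * m) (Suc (2 * j)) \<in> polys (W n)" if "j < m" for j
    using that by (auto simp: amap_def zmat_def pos_def gen_point_def W_def n intro!: polys_closed)
  moreover have "zz (zg n) m k (Suc (2 * j)) (Suc (2 * m)) \<in> polys (W n)" for j by (rule zz_zg_W) presburger+
  ultimately show ?thesis unfolding rest_def by (intro polys_sum polys_closed(6)) auto
qed

lemma krylov_W: "v < m \<Longrightarrow> krylov n k v \<in> polys (W n)"
  unfolding krylov_def n diff_Suc_1 unfolding n[symmetric] by (rule zz_zg_W) presburger+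

text \<open>The equations are affine linear in the unknown row, with the Krylov coordinates as
  coefficients, so Cramer's rule applies.\<close>

lemma tau_expand:
  "zz (zg n) m (Suc k) (2 * m) (Suc (2 * m)) = (\<Sum>j<m. krylov n k j * Var (CY m (j + n))) + rest k"
proof -
  have "amap (zg n) (2 * m) (2 * j) = Var (CY m (j + n))" if "j < m" for j
    using that n by (intro amap_zg_even) auto
  moreover have "krylov n k j = zz (zg n) m k (2 * j) (Suc (2 * m))" for j by (simp add: krylov_def n)
  ultimately show ?thesis unfolding zz.simps sum_lessThan_double rest_def sum.distrib[symmetric]
    by (intro sum.cong refl) (simp add: mult.commute)
qed

lemma gfac_nth:
  "fps_nth (gfac (zg n) m) 0 = 1" "fps_nth (gfac (zg n) m) (Suc 0) = - Var (CY m (m + n))"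
  "fps_nth (gfac (zg n) m) (Suc (Suc k)) = - (\<Sum>j<m. krylov n k j * Var (CY m (j + n))) - rest k"
  using tau_expand[of k] zg_mixed(1)[of m n m] n by (simp_all add: gfac_def del: zz.simps(2))

text \<open>Modulo the ideal the series of all \<open>n\<close> planes is 1, so the last factor has
  to be the inverse of the series of the first \<open>m\<close> planes, which does not involve the
  unknowns.\<close>

definition ginv :: "coord zpoly fps" where
  "ginv = (SOME h. gser (zg n) m * h = 1 \<and> fps_nth h 0 = 1 \<and> (\<forall>i. fps_nth h i \<in> polys (W n)))"

lemma ginv: "gser (zg n) m * ginv = 1" "fps_nth ginv 0 = 1" "fps_nth ginv i \<in> polys (W n)"
proof -
  have "\<exists>h. gser (zg n) m * h = 1 \<and> fps_nth h 0 = 1 \<and> (\<forall>i. fps_nth h i \<in> polys (W n))"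
    using polys_fps_inverse[of "gser (zg n) m" "W n"] gser_zg_W[of m] by (metis gser_0 order_refl)
  from someI_ex[OF this, folded ginv_def]
  show "gser (zg n) m * ginv = 1" "fps_nth ginv 0 = 1" "fps_nth ginv i \<in> polys (W n)" by blast+
qed

lemma Cgen_in_Cideal: "j \<ge> 1 \<Longrightarrow> Cgen n j \<in> Cideal n"
  using Cgen_large[of n j] n by (cases "j \<le> n") (auto intro: idl.span_base idl.span_zero)

lemma gfac_cong: "fps_nth (gfac (zg n) m) j - fps_nth ginv j \<in> Cideal n"
proof -
  have "gfac (zg n) m = (gser (zg n) m * ginv) * gfac (zg n) m" by (simp add: ginv)
  also have "\<dots> = gser (zg n) n * ginv" by (simp add: n mult_ac)
  finally have "fps_nth (gfac (zg n) m) j = (\<Sum>i=0..j. Cgen n i * fps_nth ginv (j - i))"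
    by (simp add: fps_mult_nth Cgen_gser)
  also have "\<dots> = fps_nth ginv j + (\<Sum>i=1..j. Cgen n i * fps_nth ginv (j - i))"
    by (simp add: sum.atLeast_Suc_atMost Cgen_0)
  finally show ?thesis using Cgen_in_Cideal by (auto intro!: idl.span_sum idl_scale_right)
qed

definition rhs :: "nat \<Rightarrow> coord zpoly" where
  "rhs k = - fps_nth ginv (Suc (Suc k)) - rest k"

lemma rhs_W: "rhs k \<in> polys (W n)"
  unfolding rhs_def by (intro polys_closed ginv rest_W)

lemma kmat_carrier: "kmat n \<in> carrier_mat m m"
  by (simp add: kmat_def n)

lemma kmat_W: "i < m \<Longrightarrow> j < m \<Longrightarrow> kmat n $$ (i, j) \<in> polys (W n)"
  using krylov_W[of "m - 1 - j" i] by (simp add: kmat_def n)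

lemma kdet_W: "kdet n \<in> polys (W n)"
  unfolding kdet_def by (rule polys_det[OF kmat_carrier kmat_W])

lemma kmat_row:
  assumes "k < m"
  shows "(\<Sum>i<m. kmat n $$ (k, i) * u (m - 1 - i)) = (\<Sum>j<m. krylov n k j * u j)"
proof -
  have "(\<Sum>i<m. kmat n $$ (k, i) * u (m - 1 - i)) = (\<Sum>i<m. krylov n k (m - Suc i) * u (m - Suc i))"
    using assms by (intro sum.cong refl) (auto simp: kmat_def n)
  also have "\<dots> = (\<Sum>j<m. krylov n k j * u j)" by (rule sum.nat_diff_reindex)
  finally show ?thesis .
qed

text \<open>The numerator in Cramer's rule; the index m - 1 - j undoes the reversal of the columns
  of \<open>kmat\<close>.\<close>

definition soln :: "nat \<Rightarrow> coord zpoly" where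
  "soln j = (\<Sum>k<m. adj_mat (kmat n) $$ (m - 1 - j, k) * rhs k)"

lemma soln_W: "j < m \<Longrightarrow> soln j \<in> polys (W n)"
  unfolding soln_def by (intro polys_sum polys_closed polys_adj_mat[OF kmat_carrier kmat_W] rhs_W) auto

lemma soln_cong:
  assumes "j < m"
  shows "kdet n * Var (CY m (j + n)) - soln j \<in> Cideal n"
proof -
  have "(\<Sum>l<m. kmat n $$ (k, l) * Var (CY m (m - 1 - l + n))) - rhs k \<in> Cideal n" if "k < m" for k
    using gfac_cong[of "Suc (Suc k)"] unfolding gfac_nth rhs_def
      kmat_row[OF that, of "\<lambda>j. Var (CY m (j + n))"] by (auto dest: idl.span_neg simp: algebra_simps)
  hence "(\<Sum>k<m. adj_mat (kmat n) $$ (m - 1 - j, k) * (\<Sum>l<m. kmat n $$ (k, l) * Var (CY m (m - 1 - l + n)))) - soln j \<in> Cideal n"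
    unfolding soln_def by (intro span_cong_sum span_cong_mult) (auto simp: idl.span_zero)
  moreover have "m - 1 - j < m" "m - 1 - (m - 1 - j) = j" using assms by auto
  ultimately show ?thesis using cramer_adj[OF kmat_carrier, of "m - 1 - j" "\<lambda>l. Var (CY m (m - 1 - l + n))"]
    unfolding kdet_def by simp
qed

text \<open>Where \<open>kdet n\<close> is invertible, the coordinate ring of the nilcone is
  generated by the variables in \<open>W n\<close>.\<close>

lemma chart_reduce: "\<exists>N. \<exists>g\<in>polys (W n). kdet n ^ N * f - g \<in> Cideal n"
proof (induction f rule: zpoly_induct)
  case (const c)
  show ?case by (intro exI[of _ 0] bexI[of _ "of_int c"]) (simp_all add: idl.span_zero)
next
  case (Var v)
  consider "v \<in> W n" | j where "j < m" "v = CY m (j + n)" | "v = CY m (m + n)" by (auto simp: W_def n less_Suc_eq)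
  thus ?case
  proof cases
    case 1
    thus ?thesis by (intro exI[of _ 0] bexI[of _ "Var v"]) (simp_all add: idl.span_zero)
  next
    case 2
    thus ?thesis using soln_cong[of j] soln_W[of j] by (intro exI[of _ 1] bexI[of _ "soln j"]) simp_all
  next
    case 3
    thus ?thesis using idl.span_neg[OF gfac_cong[of "Suc 0"]] ginv(3)[of "Suc 0"]
      by (intro exI[of _ 0] bexI[of _ "- fps_nth ginv (Suc 0)"]) (simp_all add: gfac_nth add.commute)
  qed
next
  case (add f g)
  then obtain N1 g1 N2 g2 where *: "g1 \<in> polys (W n)" "kdet n ^ N1 * f - g1 \<in> Cideal n"
    "g2 \<in> polys (W n)" "kdet n ^ N2 * g - g2 \<in> Cideal n" by blast
  have "kdet n ^ (N1 + N2) * (f + g) = kdet n ^ N2 * (kdet n ^ N1 * f) + kdet n ^ N1 * (kdet n ^ N2 * g)"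
    by (simp add: power_add algebra_simps)
  hence "kdet n ^ (N1 + N2) * (f + g) - (kdet n ^ N2 * g1 + kdet n ^ N1 * g2) \<in> Cideal n"
    using span_cong_add[OF span_cong_scale[OF *(2)] span_cong_scale[OF *(4)]] by (simp only:)
  moreover have "kdet n ^ N2 * g1 + kdet n ^ N1 * g2 \<in> polys (W n)"
    by (intro polys_closed(5,6) polys_power kdet_W *)
  ultimately show ?case by blast
next
  case (mult f g)
  then obtain N1 g1 N2 g2 where *: "g1 \<in> polys (W n)" "kdet n ^ N1 * f - g1 \<in> Cideal n"
    "g2 \<in> polys (W n)" "kdet n ^ N2 * g - g2 \<in> Cideal n" by blast
  have "kdet n ^ (N1 + N2) * (f * g) = (kdet n ^ N1 * f) * (kdet n ^ N2 * g)"
    by (simp add: power_add algebra_simps)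
  hence "kdet n ^ (N1 + N2) * (f * g) - g1 * g2 \<in> Cideal n" using span_cong_mult[OF *(2,4)] by (simp only:)
  moreover have "g1 * g2 \<in> polys (W n)" by (intro polys_closed(6) *)
  ultimately show ?case by blast
qed

lemma kdet_nonzero: "kdet n \<noteq> 0"
  using kdet_lead[OF n] lead_nonzero by blast

text \<open>Sending the unknowns to the solution of the linear system is a homomorphism to the
  function field that kills the ideal and is injective on \<open>polys (W n)\<close>. With
  \<open>chart_reduce\<close> this identifies the chart as a localized polynomial ring.\<close>

lemma chart_disjoint:
  assumes f: "f \<in> polys (W n)" "f \<in> Cideal n"
  shows "f = 0"
proof -
  define K :: "coord zpoly \<Rightarrow> coord zpoly fract" where "K x = Fract x 1" for x
  have Kh: "comm_ring_hom K" unfolding K_def by (rule Fract_hom)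
  interpret K: comm_ring_hom K by (rule Kh)
  \<comment> \<open>The last diagonal entry is forced by the coefficient of degree 1, the other
    unknowns by Cramer's rule; b - n recovers the column from the coordinate.\<close>
  define \<sigma> where "\<sigma> v = (if v \<in> W n then K (Var v) else if v = CY m (m + n) then - K (fps_nth ginv (Suc 0))
    else case v of CY a b \<Rightarrow> K (soln (b - n)) / K (kdet n) | _ \<Rightarrow> 0)" for v
  define E where "E = eval_zpoly \<sigma>"
  have E: "E g = K g" if "g \<in> polys (W n)" for g
  proof -
    have "E g = eval_zpoly (\<lambda>v. K (Var v)) g" unfolding E_def by (rule eval_zpoly_cong[OF that]) (simp add: \<sigma>_def)
    also have "\<dots> = K g" by (subst hom_eval_zpoly[OF Kh, symmetric]) simp
    finally show ?thesis .
  qed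
  have inj: "K x = 0 \<Longrightarrow> x = 0" for x unfolding K_def using Fract_inj[of x 0] by (simp add: Zero_fract_def)
  have Ey: "E (Var (CY m (m + n))) = - K (fps_nth ginv (Suc 0))" by (auto simp: E_def \<sigma>_def W_def n)
  have Eu: "E (Var (CY m (j + n))) = K (soln j) / K (kdet n)" if "j < m" for j
    using that by (auto simp: E_def \<sigma>_def W_def n)
  have sol: "(\<Sum>j<m. K (krylov n k j) * E (Var (CY m (j + n)))) = K (rhs k)" if k: "k < m" for k
  proof -
    have "(\<Sum>j<m. krylov n k j * soln j) = (\<Sum>i<m. kmat n $$ (k, i) * soln (m - 1 - i))"
      by (rule kmat_row[OF k, symmetric])
    also have "\<dots> = (\<Sum>i<m. kmat n $$ (k, i) * (\<Sum>l<m. adj_mat (kmat n) $$ (i, l) * rhs l))"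
      by (intro sum.cong refl) (auto simp: soln_def)
    also have "\<dots> = (\<Sum>l<m. (\<Sum>i<m. kmat n $$ (k, i) * adj_mat (kmat n) $$ (i, l)) * rhs l)"
      unfolding sum_distrib_left sum_distrib_right by (subst sum.swap) (simp add: mult.assoc)
    also have "\<dots> = (\<Sum>l<m. if k = l then kdet n * rhs l else 0)"
    proof (intro sum.cong refl)
      fix l assume "l \<in> {..<m}"
      hence "(\<Sum>i<m. kmat n $$ (k, i) * adj_mat (kmat n) $$ (i, l)) = (kmat n * adj_mat (kmat n)) $$ (k, l)"
        using k adj_mat(1)[OF kmat_carrier] kmat_carrier by (subst index_mult_sum[of _ m m _ m]) auto
      also have "\<dots> = (if k = l then kdet n else 0)"
        using k \<open>l \<in> {..<m}\<close> unfolding adj_mat(2)[OF kmat_carrier] kdet_def by simp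
      finally show "(\<Sum>i<m. kmat n $$ (k, i) * adj_mat (kmat n) $$ (i, l)) * rhs l = (if k = l then kdet n * rhs l else 0)"
        by simp
    qed
    also have "\<dots> = kdet n * rhs k" using k by simp
    finally have "(\<Sum>j<m. K (krylov n k j) * K (soln j)) = K (kdet n) * K (rhs k)"
      by (simp flip: K.hom_mult K.hom_sum)
    moreover have "(\<Sum>j<m. K (krylov n k j) * E (Var (CY m (j + n)))) = (\<Sum>j<m. K (krylov n k j) * K (soln j)) / K (kdet n)"
      unfolding sum_divide_distrib by (intro sum.cong refl) (simp add: Eu)
    moreover have "K (kdet n) \<noteq> 0" using inj kdet_nonzero by blast
    ultimately show ?thesis by simp
  qed
  \<comment> \<open>The n unknowns were chosen to satisfy exactly the conditions in degrees 1 to n,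
    and these are the degrees of the generators.\<close>
  have Eg: "E (fps_nth (gfac (zg n) m) j) = K (fps_nth ginv j)" if "j \<le> n" for j
  proof -
    consider "j = 0" | "j = Suc 0" | k where "j = Suc (Suc k)" "k < m"
    proof (cases j)
      case (Suc j')
      show ?thesis using that that(3)[of "j' - 1"] \<open>j \<le> n\<close> n Suc by (cases j') auto
    qed (use that in simp)
    thus ?thesis
    proof cases
      case 3
      have "E (fps_nth (gfac (zg n) m) j) = - (\<Sum>i<m. E (krylov n k i) * E (Var (CY m (i + n)))) - E (rest k)"
        unfolding 3 gfac_nth E_def
        by (simp only: eval_hom.hom_minus eval_hom.hom_uminus eval_hom.hom_sum eval_hom.hom_mult)
      also have "(\<Sum>i<m. E (krylov n k i) * E (Var (CY m (i + n)))) = (\<Sum>i<m. K (krylov n k i) * E (Var (CY m (i + n))))"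
        by (intro sum.cong refl) (simp add: E krylov_W)
      also have "\<dots> = K (rhs k)" by (rule sol[OF 3(2)])
      finally show ?thesis by (simp add: E rest_W rhs_def 3 K.hom_minus K.hom_uminus)
    next
      case 2
      thus ?thesis using Ey by (simp add: gfac_nth E_def eval_hom.hom_uminus)
    qed (simp add: gfac_nth ginv E_def)
  qed
  have "E (Cgen n j) = 0" if j: "j \<in> {1..n}" for j
  proof -
    have "Cgen n j = (\<Sum>i=0..j. fps_nth (gser (zg n) m) i * fps_nth (gfac (zg n) m) (j - i))"
      by (simp add: Cgen_gser n fps_mult_nth)
    hence "E (Cgen n j) = (\<Sum>i=0..j. E (fps_nth (gser (zg n) m) i) * E (fps_nth (gfac (zg n) m) (j - i)))"
      by (simp only: E_def eval_hom.hom_sum eval_hom.hom_mult)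
    also have "\<dots> = (\<Sum>i=0..j. K (fps_nth (gser (zg n) m) i * fps_nth ginv (j - i)))"
      using j by (intro sum.cong refl) (simp only: E[OF gser_zg_W[OF order_refl]] Eg[OF le_trans[OF diff_le_self]] K.hom_mult atLeastAtMost_iff)
    also have "\<dots> = K (fps_nth (gser (zg n) m * ginv) j)" by (simp add: fps_mult_nth K.hom_sum)
    finally show ?thesis using j by (simp add: ginv)
  qed
  hence "E f \<in> idl.span {}" unfolding E_def by (intro ideal_hom_image[OF eval_hom.comm_ring_hom_axioms f(2)]) auto
  hence "K f = 0" using E[OF f(1)] by simp
  thus ?thesis by (rule inj)
qed

end

subsection \<open>Primality and normality of the ideal of the nilcone\<close>

lemma leading_ideal:
  "idl.span ((\<lambda>i. if i = 0 then a else if i \<le> n then Gen n i else b) ` {1..n}) = Cideal n"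
proof -
  have "(\<lambda>i. if i = 0 then a else if i \<le> n then Gen n i else b) ` {1..n} = Gen n ` {1..n}"
    by (rule image_cong) auto
  thus ?thesis using Gen_ideal[of n] by (simp only:)
qed

lemma kdet_regular:
  assumes "n \<ge> 1" "g * kdet n ^ e \<in> Cideal n"
  shows "g \<in> Cideal n"
proof -
  interpret leading "cost n" "top_cost n"
    "\<lambda>i. if i = 0 then kdet n ^ e else if i \<le> n then Gen n i else swapp n (kdet n) ^ 0"
    "\<lambda>i. if i = 0 then \<Sum>j<e. kdet_lm n else if i \<le> n then single (ycoord n (i - 1)) i
       else \<Sum>j<(0::nat). swapm n (kdet_lm n)" "{0..Suc n}" by (rule leading_nilcone[OF assms(1)])
  show ?thesis using regular[of "{1..n}" 0 g] assms(2) unfolding leading_ideal by auto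
qed

text \<open>Regularity of the mirrored determinant after a power of \<open>kdet n\<close> has been
  adjoined to the equations.\<close>

lemma kdet_regular2:
  assumes "n \<ge> 1" "g * swapp n (kdet n) ^ d - kdet n ^ e * h \<in> Cideal n"
  shows "\<exists>k. g - kdet n ^ e * k \<in> Cideal n"
proof -
  let ?F = "\<lambda>i. if i = 0 then kdet n ^ e else if i \<le> n then Gen n i else swapp n (kdet n) ^ d"
  interpret leading "cost n" "top_cost n" ?F
    "\<lambda>i. if i = 0 then \<Sum>j<e. kdet_lm n else if i \<le> n then single (ycoord n (i - 1)) i
       else \<Sum>j<d. swapm n (kdet_lm n)" "{0..Suc n}" by (rule leading_nilcone[OF assms(1)])
  have im: "?F ` {0..n} = insert (kdet n ^ e) (?F ` {1..n})"
  proof -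
    have "{0..n} = insert 0 {1..n}" by auto
    thus ?thesis by (simp only: image_insert refl if_True)
  qed
  have *: "f \<in> I {0..n} \<longleftrightarrow> (\<exists>k. f - k * kdet n ^ e \<in> Cideal n)" for f
    unfolding im idl.span_insert leading_ideal by simp
  have "g * ?F (Suc n) \<in> I {0..n}" unfolding * using assms(2) unfolding mult.commute[of "kdet n ^ e"] by auto
  hence "g \<in> I {0..n}" by (rule regular[rotated 3]) auto
  then obtain k where "g - k * kdet n ^ e \<in> Cideal n" unfolding * by blast
  thus ?thesis unfolding mult.commute[of k] by blast
qed

lemma one_notin_Cideal: "1 \<notin> Cideal n"
proof (cases n)
  case (Suc m)
  thus ?thesis using chart_disjoint[OF Suc, of 1] by auto
qed simp

text \<open>Up to powers of \<open>kdet n\<close>, both factors may be replaced by polynomials in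
  \<open>W n\<close>, where products vanish only trivially; the powers are cancelled by
  regularity.\<close>

lemma Cideal_prime:
  assumes "f * g \<in> Cideal n"
  shows "f \<in> Cideal n \<or> g \<in> Cideal n"
proof (cases n)
  case 0
  thus ?thesis using assms by simp
next
  case (Suc m)
  obtain N1 f' N2 g' where *: "f' \<in> polys (W n)" "kdet n ^ N1 * f - f' \<in> Cideal n"
    "g' \<in> polys (W n)" "kdet n ^ N2 * g - g' \<in> Cideal n" using chart_reduce[OF Suc] by metis
  have "(kdet n ^ N1 * f) * (kdet n ^ N2 * g) = kdet n ^ (N1 + N2) * (f * g)" by (simp add: power_add mult_ac)
  also have "\<dots> \<in> Cideal n" by (rule idl.span_scale[OF assms])
  finally have "f' * g' \<in> Cideal n" using span_cong_mem[OF span_cong_mult[OF *(2,4)]] by simp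
  hence "f' * g' = 0" by (intro chart_disjoint[OF Suc] polys_closed(6) *(1,3))
  then consider "f' = 0" | "g' = 0" by auto
  thus ?thesis
  proof cases
    case 1
    hence "f * kdet n ^ N1 \<in> Cideal n" using *(2) by (simp only: mult.commute diff_zero)
    hence "f \<in> Cideal n" by (rule kdet_regular[rotated]) (use Suc in simp)
    thus ?thesis by (rule disjI1)
  next
    case 2
    hence "g * kdet n ^ N2 \<in> Cideal n" using *(4) by (simp only: mult.commute diff_zero)
    hence "g \<in> Cideal n" by (rule kdet_regular[rotated]) (use Suc in simp)
    thus ?thesis by (rule disjI2)
  qed
qed

text \<open>The integral equation is transported into \<open>polys (W n)\<close>, which is
  integrally closed; the price is a power of \<open>kdet n\<close> in the denominator.\<close>

lemma chart_integral:
  assumes n: "n = Suc m" and s: "s \<notin> Cideal n" and rel: "int_rel d g r s \<in> Cideal n"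
  shows "\<exists>N q. kdet n ^ N * r - s * q \<in> Cideal n"
proof -
  let ?a = "kdet n"
  have lift: "\<exists>f'\<in>polys (W n). ?a ^ N' * f - f' \<in> Cideal n"
    if "f' \<in> polys (W n)" "?a ^ N * f - f' \<in> Cideal n" "N \<le> N'" for f f' N N'
  proof (rule bexI)
    have "?a ^ N' * f = ?a ^ (N' - N) * (?a ^ N * f)" using that(3) unfolding mult.assoc[symmetric] by (simp flip: power_add)
    thus "?a ^ N' * f - ?a ^ (N' - N) * f' \<in> Cideal n" using span_cong_scale[OF that(2)] by (simp only:)
    show "?a ^ (N' - N) * f' \<in> polys (W n)" by (intro polys_closed(6) polys_power kdet_W[OF n] that(1))
  qed
  obtain Nf where Nf: "\<And>f. \<exists>f'\<in>polys (W n). ?a ^ Nf f * f - f' \<in> Cideal n" using chart_reduce[OF n] by metis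
  \<comment> \<open>One exponent that brings \<open>r\<close>, \<open>s\<close> and all coefficients
    into the chart.\<close>
  define N where "N = Nf r + Nf s + (\<Sum>i<d. Nf (g i))"
  have Ng: "Nf (g i) \<le> N" if "i < d" for i
    using member_le_sum[of i "{..<d}" "\<lambda>i. Nf (g i)"] that by (simp add: N_def)
  have ex: "\<exists>f'\<in>polys (W n). ?a ^ N * f - f' \<in> Cideal n" if "Nf f \<le> N" for f using Nf[of f] lift that by blast
  obtain r' where r': "r' \<in> polys (W n)" "?a ^ N * r - r' \<in> Cideal n" using ex[of r] by (auto simp: N_def)
  obtain s' where s': "s' \<in> polys (W n)" "?a ^ N * s - s' \<in> Cideal n" using ex[of s] by (auto simp: N_def)
  have "\<forall>i\<in>{..<d}. \<exists>f'. f' \<in> polys (W n) \<and> ?a ^ N * g i - f' \<in> Cideal n" using ex Ng by blast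
  then obtain g' where g': "\<And>i. i < d \<Longrightarrow> g' i \<in> polys (W n)" "\<And>i. i < d \<Longrightarrow> ?a ^ N * g i - g' i \<in> Cideal n"
    by (metis lessThan_iff)
  \<comment> \<open>Scaling numerator by a^(2 N) and denominator by a^N multiplies the fraction by
    a^N. The coefficient of degree i then acquires a^(N (d - i)): one factor a^N brings it into the
    chart, the others are kept in \<open>g2\<close>.\<close>
  define \<rho> where "\<rho> = ?a ^ N * r'"
  define g2 where "g2 i = g' i * ?a ^ (N * (d - 1 - i))" for i
  have "?a ^ (N * d) * (?a ^ (N * d) * int_rel d g r s) - int_rel d g2 \<rho> s' \<in> Cideal n"
  proof -
    have "?a ^ (N * d) * (?a ^ (N * d) * int_rel d g r s) = (?a ^ N * (?a ^ N * r)) ^ d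
       + (\<Sum>i<d. (?a ^ N * g i * ?a ^ (N * (d - 1 - i))) * (?a ^ N * (?a ^ N * r)) ^ i * (?a ^ N * s) ^ (d - i))"
      unfolding int_rel_def distrib_left sum_distrib_left
    proof (intro arg_cong2[where f = "(+)"] sum.cong refl)
      show "?a ^ (N * d) * (?a ^ (N * d) * r ^ d) = (?a ^ N * (?a ^ N * r)) ^ d"
        by (simp add: power_mult_distrib power_mult[symmetric])
      fix i assume "i \<in> {..<d}"
      then obtain e where d: "d = i + Suc e" by (metis lessThan_iff less_imp_add_positive Suc_pred)
      show "?a ^ (N * d) * (?a ^ (N * d) * (g i * r ^ i * s ^ (d - i))) =
          ?a ^ N * g i * ?a ^ (N * (d - 1 - i)) * (?a ^ N * (?a ^ N * r)) ^ i * (?a ^ N * s) ^ (d - i)"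
        unfolding d by (simp add: power_mult_distrib power_mult[symmetric] power_add add_mult_distrib2 mult_ac)
    qed
    moreover have "(?a ^ N * (?a ^ N * r)) ^ d
       + (\<Sum>i<d. (?a ^ N * g i * ?a ^ (N * (d - 1 - i))) * (?a ^ N * (?a ^ N * r)) ^ i * (?a ^ N * s) ^ (d - i))
       - int_rel d g2 \<rho> s' \<in> Cideal n" unfolding int_rel_def g2_def \<rho>_def
      by (intro span_cong_add span_cong_sum span_cong_mult span_cong_power r' s' g')
        (simp_all add: idl.span_zero)
    ultimately show ?thesis by (simp only:)
  qed
  hence "int_rel d g2 \<rho> s' \<in> Cideal n" using span_cong_mem idl.span_scale[OF idl.span_scale[OF rel]] by blast
  moreover have "int_rel d g2 \<rho> s' \<in> polys (W n)" unfolding int_rel_def g2_def \<rho>_def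
    by (intro polys_closed(5,6) polys_sum polys_power r' s' g' kdet_W[OF n]) simp
  ultimately have "int_rel d g2 \<rho> s' = 0" by (intro chart_disjoint[OF n])
  moreover have "s' \<noteq> 0"
  proof
    assume "s' = 0"
    hence "s * ?a ^ N \<in> Cideal n" using s'(2) by (simp only: mult.commute diff_zero)
    thus False using kdet_regular[of n s N] s n by simp
  qed
  ultimately obtain q where q: "\<rho> = s' * q" using zpoly_integrally_closed by (metis dvdE)
  have "?a ^ (N + N) * r - s * (?a ^ N * q) = ?a ^ N * (?a ^ N * r - r') - q * (?a ^ N * s - s')"
  proof -
    have "?a ^ N * (?a ^ N * r - r') - q * (?a ^ N * s - s') = ?a ^ (N + N) * r - s * (?a ^ N * q) - (\<rho> - s' * q)"
      by (simp add: \<rho>_def power_add algebra_simps)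
    thus ?thesis by (simp add: q)
  qed
  also have "\<dots> \<in> Cideal n" by (intro idl.span_diff idl.span_scale r' s')
  finally show ?thesis by blast
qed

text \<open>On the two charts a^N r \<equiv> s q1 and b^M r \<equiv> s q2. Cancelling s gives q1 b^M
  \<equiv> a^N q2, so by regularity q1 is a multiple of a^N, and a^N can be cancelled as
  well.\<close>

lemma Cideal_normal:
  assumes s: "s \<notin> Cideal n" and rel: "int_rel d g r s \<in> Cideal n"
  shows "\<exists>q. r - s * q \<in> Cideal n"
proof (cases n)
  case 0
  hence "s dvd r" using assms by (intro zpoly_integrally_closed) auto
  thus ?thesis using 0 by (auto simp: dvd_def)
next
  case (Suc m)
  let ?a = "kdet n" and ?b = "swapp n (kdet n)"
  obtain N q1 where 1: "?a ^ N * r - s * q1 \<in> Cideal n" using chart_integral[OF Suc s rel] by blast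
  \<comment> \<open>The second chart is the mirror image of the first under the symmetry
    \<open>swapp n\<close> of the ideal.\<close>
  have s2: "swapp n s \<notin> Cideal n" using s swapp_Cideal[of "swapp n s" n] by (auto simp: swapp_swapp)
  have "int_rel d (\<lambda>i. swapp n (g i)) (swapp n r) (swapp n s) = swapp n (int_rel d g r s)"
    unfolding int_rel_def by (simp only: eval_hom.hom_add eval_hom.hom_sum eval_hom.hom_mult eval_hom.hom_power)
  hence "int_rel d (\<lambda>i. swapp n (g i)) (swapp n r) (swapp n s) \<in> Cideal n" using swapp_Cideal[OF rel] by simp
  from chart_integral[OF Suc s2 this] obtain M q2 where "?a ^ M * swapp n r - swapp n s * q2 \<in> Cideal n" by blast
  from swapp_Cideal[OF this] have 2: "?b ^ M * r - s * swapp n q2 \<in> Cideal n"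
    by (simp add: eval_hom.hom_minus eval_hom.hom_mult eval_hom.hom_power swapp_swapp)
  have "s * (q1 * ?b ^ M - ?a ^ N * swapp n q2) = ?a ^ N * (?b ^ M * r - s * swapp n q2) - ?b ^ M * (?a ^ N * r - s * q1)"
    by (simp add: algebra_simps)
  also have "\<dots> \<in> Cideal n" by (intro idl.span_diff idl.span_scale 1 2)
  finally have "q1 * ?b ^ M - ?a ^ N * swapp n q2 \<in> Cideal n" using Cideal_prime s by blast
  then obtain k where k: "q1 - ?a ^ N * k \<in> Cideal n" using kdet_regular2[of n] Suc by force
  have "(r - s * k) * ?a ^ N = (?a ^ N * r - s * q1) + s * (q1 - ?a ^ N * k)" by (simp add: algebra_simps)
  also have "\<dots> \<in> Cideal n" by (intro idl.span_add idl.span_scale 1 k)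
  finally show ?thesis using kdet_regular[of n] Suc by auto
qed

lemma zrestrict_Cideal: "f \<in> Cideal n \<Longrightarrow> zrestrict (V_coords n) f \<in> Cideal n"
  by (rule ideal_hom_image[OF zrestrict_hom]) (auto simp: zrestrict_id Cgen_in_polys intro: idl.span_base)

lemma Cideal_normal_V:
  assumes "s \<in> polys (V_coords n)" "r \<in> polys (V_coords n)" "s \<notin> Cideal n" "int_rel d g r s \<in> Cideal n"
  shows "\<exists>q\<in>polys (V_coords n). r - s * q \<in> Cideal n"
proof -
  interpret zr: comm_ring_hom "zrestrict (V_coords n)" by (rule zrestrict_hom)
  obtain q where "r - s * q \<in> Cideal n" using Cideal_normal[OF assms(3,4)] by blast
  from zrestrict_Cideal[OF this] show ?thesis
    using assms(1,2) zrestrict_in_polys by (auto simp: zr.hom_minus zr.hom_mult zrestrict_id)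
qed

section \<open>Localizations of domains and normality\<close>

locale domain_loc = domain R for R (structure) +
  fixes S :: "'a set"
  assumes S: "S \<subseteq> carrier R - {\<zero>}" "\<one> \<in> S" "\<And>s t. s \<in> S \<Longrightarrow> t \<in> S \<Longrightarrow> s \<otimes> t \<in> S"
begin

lemma S_carrier [simp]: "s \<in> S \<Longrightarrow> s \<in> carrier R"
  using S(1) by auto

lemma S_nonzero: "s \<in> S \<Longrightarrow> s \<noteq> \<zero>"
  using S(1) by auto

lemma S_mult [simp]: "s \<in> S \<Longrightarrow> t \<in> S \<Longrightarrow> s \<otimes> t \<in> S"
  by (rule S(3))

lemma S_one [simp]: "\<one> \<in> S"
  by (rule S(2))

lemma S_pow [simp]: "s \<in> S \<Longrightarrow> s [^] (k :: nat) \<in> S"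
  by (induction k) simp_all

lemma loc_rel_iff:
  "((a, s), (b, t)) \<in> loc_rel R S \<longleftrightarrow> a \<in> carrier R \<and> b \<in> carrier R \<and> s \<in> S \<and> t \<in> S \<and> a \<otimes> t = b \<otimes> s"
proof -
  have "(\<exists>u\<in>S. u \<otimes> (a \<otimes> t \<ominus> b \<otimes> s) = \<zero>) \<longleftrightarrow> a \<otimes> t = b \<otimes> s"
    if "a \<in> carrier R" "b \<in> carrier R" "s \<in> S" "t \<in> S"
    using that S_nonzero by (auto simp: integral_iff intro!: bexI[of _ \<one>])
  thus ?thesis by (auto simp: loc_rel_def)
qed

lemma loc_rel_equiv: "equiv (carrier R \<times> S) (loc_rel R S)"
proof (rule equivI)
  show "loc_rel R S \<subseteq> (carrier R \<times> S) \<times> (carrier R \<times> S)" by (auto simp: loc_rel_iff)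
  show "refl_on (carrier R \<times> S) (loc_rel R S)" by (auto simp: refl_on_def loc_rel_iff)
  show "sym (loc_rel R S)" by (auto simp: sym_def loc_rel_iff)
  show "trans (loc_rel R S)"
  proof (rule transI, clarify)
    fix a s b t c u assume "((a, s), b, t) \<in> loc_rel R S" "((b, t), c, u) \<in> loc_rel R S"
    hence c: "a \<in> carrier R" "b \<in> carrier R" "c \<in> carrier R" "s \<in> S" "t \<in> S" "u \<in> S"
      and e: "a \<otimes> t = b \<otimes> s" "b \<otimes> u = c \<otimes> t" by (auto simp: loc_rel_iff)
    have "t \<otimes> (a \<otimes> u) = (a \<otimes> t) \<otimes> u" using c by (simp add: m_ac)
    also have "\<dots> = s \<otimes> (b \<otimes> u)" unfolding e(1) using c by (simp add: m_ac)
    also have "\<dots> = t \<otimes> (c \<otimes> s)" unfolding e(2) using c by (simp add: m_ac)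
    finally have "a \<otimes> u = c \<otimes> s" using c S_nonzero by (simp add: m_lcancel)
    thus "((a, s), c, u) \<in> loc_rel R S" using c by (simp add: loc_rel_iff)
  qed
qed

abbreviation fr where "fr \<equiv> loc_frac R S"

lemma frac_eq:
  assumes "a \<in> carrier R" "s \<in> S" "b \<in> carrier R" "t \<in> S"
  shows "fr a s = fr b t \<longleftrightarrow> a \<otimes> t = b \<otimes> s"
  unfolding loc_frac_def using assms by (subst eq_equiv_class_iff[OF loc_rel_equiv]) (auto simp: loc_rel_iff)

lemma mem_frac:
  assumes "a \<in> carrier R" "s \<in> S"
  shows "(b, t) \<in> fr a s \<longleftrightarrow> b \<in> carrier R \<and> t \<in> S \<and> a \<otimes> t = b \<otimes> s"
  using assms by (auto simp: loc_frac_def loc_rel_iff)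

abbreviation L where "L \<equiv> localization R S"

lemma carrier_L: "carrier L = {fr a s | a s. a \<in> carrier R \<and> s \<in> S}"
  by (auto simp: localization_def loc_frac_def quotient_def)

lemma frac_closed [simp]: "a \<in> carrier R \<Longrightarrow> s \<in> S \<Longrightarrow> fr a s \<in> carrier L"
  by (auto simp: carrier_L)

lemma L_cases:
  assumes "x \<in> carrier L"
  obtains a s where "a \<in> carrier R" "s \<in> S" "x = fr a s" using assms by (auto simp: carrier_L)

lemma L_one: "\<one>\<^bsub>L\<^esub> = fr \<one> \<one>" and L_zero: "\<zero>\<^bsub>L\<^esub> = fr \<zero> \<one>"
  by (simp_all add: localization_def)

text \<open>The operations of \<open>localization\<close> are unions over representatives; when all
  members coincide, the union is that common value.\<close>

lemma UN_frac:
  assumes as: "a \<in> carrier R" "s \<in> S" "b \<in> carrier R" "t \<in> S"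
    and c: "\<And>a' s' b' t'. a' \<in> carrier R \<Longrightarrow> s' \<in> S \<Longrightarrow> b' \<in> carrier R \<Longrightarrow> t' \<in> S
      \<Longrightarrow> a \<otimes> s' = a' \<otimes> s \<Longrightarrow> b \<otimes> t' = b' \<otimes> t \<Longrightarrow> F a' s' b' t' = (C :: 'c set)"
  shows "(\<Union>(a, s)\<in>fr a s. \<Union>(b, t)\<in>fr b t. F a s b t) = C"
proof -
  have "(a, s) \<in> fr a s" "(b, t) \<in> fr b t" using as by (auto simp: mem_frac)
  moreover have "F a' s' b' t' = C" if "(a', s') \<in> fr a s" "(b', t') \<in> fr b t" for a' s' b' t'
    using that as by (intro c) (auto simp: mem_frac)
  ultimately show ?thesis by (auto simp: split_beta)
qed

lemma frac_mult:
  assumes as: "a \<in> carrier R" "s \<in> S" "b \<in> carrier R" "t \<in> S"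
  shows "fr a s \<otimes>\<^bsub>L\<^esub> fr b t = fr (a \<otimes> b) (s \<otimes> t)"
  unfolding localization_def monoid.simps
proof (rule UN_frac[OF as, where F = "\<lambda>a s b t. fr (a \<otimes> b) (s \<otimes> t)"])
  fix a' s' b' t' assume c: "a' \<in> carrier R" "s' \<in> S" "b' \<in> carrier R" "t' \<in> S"
    and e: "a \<otimes> s' = a' \<otimes> s" "b \<otimes> t' = b' \<otimes> t"
  have "(a' \<otimes> b') \<otimes> (s \<otimes> t) = (a' \<otimes> s) \<otimes> (b' \<otimes> t)" using as c by (simp add: m_ac)
  also have "\<dots> = (a \<otimes> b) \<otimes> (s' \<otimes> t')" unfolding e[symmetric] using as c by (simp add: m_ac)
  finally show "fr (a' \<otimes> b') (s' \<otimes> t') = fr (a \<otimes> b) (s \<otimes> t)" using as c by (simp add: frac_eq)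
qed

lemma frac_add:
  assumes as: "a \<in> carrier R" "s \<in> S" "b \<in> carrier R" "t \<in> S"
  shows "fr a s \<oplus>\<^bsub>L\<^esub> fr b t = fr (a \<otimes> t \<oplus> b \<otimes> s) (s \<otimes> t)"
  unfolding localization_def ring_record_simps
proof (rule UN_frac[OF as, where F = "\<lambda>a s b t. fr (a \<otimes> t \<oplus> b \<otimes> s) (s \<otimes> t)"])
  fix a' s' b' t' assume c: "a' \<in> carrier R" "s' \<in> S" "b' \<in> carrier R" "t' \<in> S"
    and e: "a \<otimes> s' = a' \<otimes> s" "b \<otimes> t' = b' \<otimes> t"
  have "(a' \<otimes> t' \<oplus> b' \<otimes> s') \<otimes> (s \<otimes> t) = (a' \<otimes> s) \<otimes> (t' \<otimes> t) \<oplus> (b' \<otimes> t) \<otimes> (s' \<otimes> s)"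
    using as c by (simp add: m_ac l_distr r_distr)
  also have "\<dots> = (a \<otimes> t \<oplus> b \<otimes> s) \<otimes> (s' \<otimes> t')" unfolding e[symmetric] using as c by (simp add: m_ac l_distr r_distr)
  finally show "fr (a' \<otimes> t' \<oplus> b' \<otimes> s') (s' \<otimes> t') = fr (a \<otimes> t \<oplus> b \<otimes> s) (s \<otimes> t)" using as c by (simp add: frac_eq)
qed

lemma frac_zero: "a \<in> carrier R \<Longrightarrow> s \<in> S \<Longrightarrow> fr a s = \<zero>\<^bsub>L\<^esub> \<longleftrightarrow> a = \<zero>"
  by (simp add: L_zero frac_eq)

lemma L_domain: "domain L"
proof (intro domain.intro domain_axioms.intro)
  show "cring L"
  proof (rule cringI)
    show "abelian_group L"
    proof (rule abelian_groupI)
      show "x \<oplus>\<^bsub>L\<^esub> y \<in> carrier L" if "x \<in> carrier L" "y \<in> carrier L" for x y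
        using that by (elim L_cases) (simp add: frac_add)
      show "\<zero>\<^bsub>L\<^esub> \<in> carrier L" by (simp add: L_zero)
      show "x \<oplus>\<^bsub>L\<^esub> y \<oplus>\<^bsub>L\<^esub> z = x \<oplus>\<^bsub>L\<^esub> (y \<oplus>\<^bsub>L\<^esub> z)"
        if "x \<in> carrier L" "y \<in> carrier L" "z \<in> carrier L" for x y z
        using that by (elim L_cases) (simp add: frac_add frac_eq m_ac l_distr r_distr a_ac)
      show "x \<oplus>\<^bsub>L\<^esub> y = y \<oplus>\<^bsub>L\<^esub> x" if "x \<in> carrier L" "y \<in> carrier L" for x y
        using that by (elim L_cases) (simp add: frac_add frac_eq m_ac a_ac)
      show "\<zero>\<^bsub>L\<^esub> \<oplus>\<^bsub>L\<^esub> x = x" if "x \<in> carrier L" for x using that by (elim L_cases) (simp add: L_zero frac_add)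
      show "\<exists>y\<in>carrier L. y \<oplus>\<^bsub>L\<^esub> x = \<zero>\<^bsub>L\<^esub>" if x: "x \<in> carrier L" for x
      proof -
        obtain a s where as: "a \<in> carrier R" "s \<in> S" "x = fr a s" using x by (rule L_cases)
        hence "fr (\<ominus> a) s \<oplus>\<^bsub>L\<^esub> x = \<zero>\<^bsub>L\<^esub>" by (simp add: frac_add frac_zero l_minus l_neg)
        thus ?thesis using as by (intro bexI[of _ "fr (\<ominus> a) s"]) auto
      qed
    qed
    show "comm_monoid L"
    proof (rule comm_monoidI)
      show "x \<otimes>\<^bsub>L\<^esub> y \<in> carrier L" if "x \<in> carrier L" "y \<in> carrier L" for x y
        using that by (elim L_cases) (simp add: frac_mult)
      show "\<one>\<^bsub>L\<^esub> \<in> carrier L" by (simp add: L_one)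
      show "x \<otimes>\<^bsub>L\<^esub> y \<otimes>\<^bsub>L\<^esub> z = x \<otimes>\<^bsub>L\<^esub> (y \<otimes>\<^bsub>L\<^esub> z)"
        if "x \<in> carrier L" "y \<in> carrier L" "z \<in> carrier L" for x y z
        using that by (elim L_cases) (simp add: frac_mult m_ac)
      show "\<one>\<^bsub>L\<^esub> \<otimes>\<^bsub>L\<^esub> x = x" if "x \<in> carrier L" for x using that by (elim L_cases) (simp add: L_one frac_mult)
      show "x \<otimes>\<^bsub>L\<^esub> y = y \<otimes>\<^bsub>L\<^esub> x" if "x \<in> carrier L" "y \<in> carrier L" for x y
        using that by (elim L_cases) (simp add: frac_mult m_ac)
    qed
    show "(x \<oplus>\<^bsub>L\<^esub> y) \<otimes>\<^bsub>L\<^esub> z = x \<otimes>\<^bsub>L\<^esub> z \<oplus>\<^bsub>L\<^esub> y \<otimes>\<^bsub>L\<^esub> z"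
      if "x \<in> carrier L" "y \<in> carrier L" "z \<in> carrier L" for x y z
      using that by (elim L_cases) (simp add: frac_add frac_mult frac_eq m_ac l_distr r_distr)
  qed
  show "\<one>\<^bsub>L\<^esub> \<noteq> \<zero>\<^bsub>L\<^esub>" by (simp add: L_one frac_zero)
  show "x = \<zero>\<^bsub>L\<^esub> \<or> y = \<zero>\<^bsub>L\<^esub>" if 0: "x \<otimes>\<^bsub>L\<^esub> y = \<zero>\<^bsub>L\<^esub>" and xy: "x \<in> carrier L" "y \<in> carrier L" for x y
  proof -
    obtain a s b t where as: "a \<in> carrier R" "s \<in> S" "x = fr a s" "b \<in> carrier R" "t \<in> S" "y = fr b t"
      using xy by (elim L_cases)
    thus ?thesis using 0 by (simp add: frac_mult frac_zero integral_iff)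
  qed
qed

end

text \<open>\<open>hev R [c\<^sub>0, \<dots>, c\<^sub>d] a b\<close> is \<open>\<Sum>i\<le>d. c\<^sub>i * a\<^sup>d\<^sup>-\<^sup>i * b\<^sup>i\<close>.\<close>

primrec hev :: "('a, 'x) ring_scheme \<Rightarrow> 'a list \<Rightarrow> 'a \<Rightarrow> 'a \<Rightarrow> 'a" where
  "hev R [] a b = \<zero>\<^bsub>R\<^esub>"
| "hev R (c # cs) a b = c \<otimes>\<^bsub>R\<^esub> a [^]\<^bsub>R\<^esub> length cs \<oplus>\<^bsub>R\<^esub> b \<otimes>\<^bsub>R\<^esub> hev R cs a b"

text \<open>The entry at index i is multiplied by \<open>u\<close> to the power i: up to a power of
  \<open>u\<close>, the substitution that multiplies the roots by \<open>u\<close>.\<close>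

primrec scale_list :: "('a, 'x) ring_scheme \<Rightarrow> 'a \<Rightarrow> 'a list \<Rightarrow> 'a list" where
  "scale_list R u [] = []"
| "scale_list R u (c # cs) = c # map ((\<otimes>\<^bsub>R\<^esub>) u) (scale_list R u cs)"

lemma length_scale_list [simp]: "length (scale_list R u cs) = length cs"
  by (induction cs) simp_all

context cring
begin

lemma hev_closed [simp]: "set cs \<subseteq> carrier R \<Longrightarrow> a \<in> carrier R \<Longrightarrow> b \<in> carrier R \<Longrightarrow> hev R cs a b \<in> carrier R"
  by (induction cs) simp_all

lemma eval_eq_hev:
  assumes "set cs \<subseteq> carrier R" "x \<in> carrier R"
  shows "eval cs x = hev R cs x \<one>"
  using assms by (induction cs) (simp_all add: eval_in_carrier)

lemma hev_map_mult:
  assumes "set cs \<subseteq> carrier R" "a \<in> carrier R" "b \<in> carrier R" "u \<in> carrier R"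
  shows "hev R (map ((\<otimes>) u) cs) a b = u \<otimes> hev R cs a b"
  using assms by (induction cs) (simp_all add: r_distr m_ac)

lemma scale_list_closed: "set cs \<subseteq> carrier R \<Longrightarrow> u \<in> carrier R \<Longrightarrow> set (scale_list R u cs) \<subseteq> carrier R"
  by (induction cs) auto

lemma hev_scale_list:
  assumes "set (c # cs) \<subseteq> carrier R" "a \<in> carrier R" "b \<in> carrier R" "u \<in> carrier R"
  shows "hev R (scale_list R u (c # cs)) (u \<otimes> a) b = u [^] length cs \<otimes> hev R (c # cs) a b"
  using assms
proof (induction cs arbitrary: c)
  case Nil
  thus ?case by simp
next
  case (Cons d ds)
  have "hev R (scale_list R u (c # d # ds)) (u \<otimes> a) b
      = c \<otimes> (u \<otimes> a) [^] length (d # ds) \<oplus> b \<otimes> hev R (map ((\<otimes>) u) (scale_list R u (d # ds))) (u \<otimes> a) b"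
    by (simp only: scale_list.simps(1) scale_list.simps(2)[of R u c] hev.simps length_map length_scale_list)
  also have "hev R (map ((\<otimes>) u) (scale_list R u (d # ds))) (u \<otimes> a) b = u \<otimes> (u [^] length ds \<otimes> hev R (d # ds) a b)"
    using Cons.prems scale_list_closed[of "d # ds" u] Cons.IH[of d] by (simp add: hev_map_mult del: scale_list.simps hev.simps)
  finally show ?case using Cons.prems by (simp add: r_distr nat_pow_distrib m_ac del: scale_list.simps hev.simps)
      (simp add: r_distr nat_pow_distrib m_ac)
qed

text \<open>If a/b satisfies an equation with leading coefficient \<open>u\<close>, then u a/b
  satisfies a monic one.\<close>

lemma monic_scale_list:
  assumes cs: "set cs \<subseteq> carrier R" "a \<in> carrier R" "b \<in> carrier R" "u \<in> carrier R"
  shows "u \<otimes> hev R (\<one> # scale_list R u cs) (u \<otimes> a) b = u [^] length cs \<otimes> hev R (u # cs) a b"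
proof (cases cs)
  case Nil
  thus ?thesis using cs by simp
next
  case (Cons d ds)
  have h: "hev R (scale_list R u cs) (u \<otimes> a) b = u [^] length ds \<otimes> hev R cs a b"
    unfolding Cons by (rule hev_scale_list) (use cs Cons in auto)
  show ?thesis unfolding hev.simps(2)[of R \<one>] hev.simps(2)[of R u] length_scale_list h
    using cs Cons by (simp add: r_distr nat_pow_distrib m_ac del: hev.simps)
qed

end

lemma (in ring_hom_cring) hom_hev:
  assumes "set cs \<subseteq> carrier R" "a \<in> carrier R" "b \<in> carrier R"
  shows "hev S (map h cs) (h a) (h b) = h (hev R cs a b)"
  using assms by (induction cs) (simp_all add: hom_nat_pow)

context domain_loc
begin

sublocale L: domain "localization R S" by (rule L_domain)

lemma frac_pow: "a \<in> carrier R \<Longrightarrow> s \<in> S \<Longrightarrow> fr a s [^]\<^bsub>L\<^esub> (k::nat) = fr (a [^] k) (s [^] k)"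
  by (induction k) (simp_all add: L_one frac_mult)

text \<open>The length of the list is one more than the degree; the factor \<open>v\<close> in the
  numerator makes up for this and keeps the formula valid for the empty list.\<close>

lemma hev_frac:
  assumes "set cs \<subseteq> carrier R" "u \<in> S" "r \<in> carrier R" "t \<in> carrier R" "v \<in> S"
  shows "hev L (map (\<lambda>c. fr c u) cs) (fr r v) (fr t v)
    = fr (v \<otimes> hev R cs r t) (u \<otimes> v [^] length cs)" using assms
proof (induction cs)
  case Nil
  thus ?case by (simp add: L_zero frac_eq)
next
  case (Cons c cs)
  thus ?case by (simp add: frac_pow frac_mult frac_add frac_eq) (simp add: l_distr r_distr m_ac)
qed

lemma common_denominator:
  assumes "set xs \<subseteq> carrier L"
  shows "\<exists>u\<in>S. \<exists>cs. set cs \<subseteq> carrier R \<and> xs = map (\<lambda>c. fr c u) cs"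
  using assms
proof (induction xs)
  case Nil
  thus ?case by (intro bexI[of _ \<one>] exI[of _ "[]"]) simp_all
next
  case (Cons x xs)
  then obtain u cs where u: "u \<in> S" "set cs \<subseteq> carrier R" "xs = map (\<lambda>c. fr c u) cs" by auto
  obtain a s where a: "a \<in> carrier R" "s \<in> S" "x = fr a s" using Cons.prems by (auto elim: L_cases)
  have "map (\<lambda>c. fr c u) cs = map (\<lambda>c. fr c (u \<otimes> s)) (map (\<lambda>c. c \<otimes> s) cs)" unfolding map_map comp_def
  proof (rule map_cong)
    fix c assume "c \<in> set cs"
    thus "fr c u = fr (c \<otimes> s) (u \<otimes> s)" using u(1,2) a(1,2) by (subst frac_eq) (auto simp: m_ac)
  qed simp
  moreover have "x = fr (a \<otimes> u) (u \<otimes> s)" using u a by (simp add: frac_eq m_ac)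
  ultimately have "x # xs = map (\<lambda>c. fr c (u \<otimes> s)) (a \<otimes> u # map (\<lambda>c. c \<otimes> s) cs)" using u(3) by simp
  thus ?case using u a by (intro bexI[of _ "u \<otimes> s"] exI[of _ "a \<otimes> u # map (\<lambda>c. c \<otimes> s) cs"]) auto
qed

lemma common_denominator2:
  assumes "x \<in> carrier L" "y \<in> carrier L"
  obtains r t v where "r \<in> carrier R" "t \<in> carrier R" "v \<in> S" "x = fr r v" "y = fr t v"
proof -
  have "set [x, y] \<subseteq> carrier L" using assms by simp
  from common_denominator[OF this] obtain v cs
    where *: "v \<in> S" "set cs \<subseteq> carrier R" "[x, y] = map (\<lambda>c. fr c v) cs" by (elim bexE exE conjE)
  have "length cs = 2" using arg_cong[OF *(3), of length] by simp
  then obtain r t where "cs = [r, t]" by (metis One_nat_def Suc_1 length_0_conv length_Suc_conv)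
  thus ?thesis using that[of r t v] * by simp
qed

end

text \<open>Integral closedness phrased for pairs (r, s) instead of elements of a fraction field;
  this form passes easily to localizations and can be checked on representatives of a quotient
  ring.\<close>

definition normal_elementwise :: "('a, 'x) ring_scheme \<Rightarrow> bool" where
  "normal_elementwise R \<longleftrightarrow> (\<forall>r\<in>carrier R. \<forall>s\<in>carrier R. \<forall>cs. s \<noteq> \<zero>\<^bsub>R\<^esub> \<longrightarrow> set cs \<subseteq> carrier R \<longrightarrow>
     hev R (\<one>\<^bsub>R\<^esub> # cs) r s = \<zero>\<^bsub>R\<^esub> \<longrightarrow> (\<exists>q\<in>carrier R. r = s \<otimes>\<^bsub>R\<^esub> q))"

text \<open>A common denominator \<open>u\<close> of the coefficients becomes the leading
  coefficient. Then \<open>u\<close> times the fraction is integral over \<open>R\<close> itself,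
  and \<open>u\<close> is invertible in the localization.\<close>

lemma (in domain_loc) normal_elementwise_L:
  assumes "normal_elementwise R"
  shows "normal_elementwise L"
  unfolding normal_elementwise_def
proof (intro ballI allI impI)
  fix x y xs assume xy: "x \<in> carrier L" "y \<in> carrier L" "y \<noteq> \<zero>\<^bsub>L\<^esub>" and xs: "set xs \<subseteq> carrier L"
    and 0: "hev L (\<one>\<^bsub>L\<^esub> # xs) x y = \<zero>\<^bsub>L\<^esub>"
  obtain r t v where rt: "r \<in> carrier R" "t \<in> carrier R" "v \<in> S" "x = fr r v" "y = fr t v"
    by (rule common_denominator2[OF xy(1,2)])
  obtain u cs where u: "u \<in> S" "set cs \<subseteq> carrier R" "xs = map (\<lambda>c. fr c u) cs"
    using common_denominator[OF xs] by blast
  have t0: "t \<noteq> \<zero>" using xy(3) rt by (simp add: frac_zero)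
  have "\<one>\<^bsub>L\<^esub> = fr u u" using u by (simp add: L_one frac_eq)
  hence "\<one>\<^bsub>L\<^esub> # xs = map (\<lambda>c. fr c u) (u # cs)" using u by simp
  hence "hev L (map (\<lambda>c. fr c u) (u # cs)) (fr r v) (fr t v) = \<zero>\<^bsub>L\<^esub>" using 0 rt by (simp only:)
  hence "v \<otimes> hev R (u # cs) r t = \<zero>" using u rt by (subst (asm) hev_frac) (simp_all add: frac_zero del: hev.simps)
  hence "hev R (u # cs) r t = \<zero>" using u rt S_nonzero by (simp add: integral_iff del: hev.simps)
  hence "u \<otimes> hev R (\<one> # scale_list R u cs) (u \<otimes> r) t = \<zero>"
    using monic_scale_list[of cs r t u] u rt by (simp del: hev.simps)
  hence "hev R (\<one> # scale_list R u cs) (u \<otimes> r) t = \<zero>"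
    using u rt S_nonzero scale_list_closed[of cs u] by (simp add: integral_iff del: hev.simps)
  then obtain q where q: "q \<in> carrier R" "u \<otimes> r = t \<otimes> q"
    using assms u rt t0 scale_list_closed[of cs u] unfolding normal_elementwise_def by (metis S_carrier m_closed)
  have "x = y \<otimes>\<^bsub>L\<^esub> fr q u"
  proof -
    have "r \<otimes> (v \<otimes> u) = v \<otimes> (u \<otimes> r)" using rt u by (simp add: m_ac)
    also have "\<dots> = t \<otimes> q \<otimes> v" unfolding q(2) using rt q by (simp add: m_ac)
    finally show ?thesis using rt u q by (simp add: frac_mult frac_eq)
  qed
  thus "\<exists>q\<in>carrier L. x = y \<otimes>\<^bsub>L\<^esub> q" using q u by auto
qed

lemma (in domain) normal_domainI:
  assumes "normal_elementwise R"
  shows "normal_domain R"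
proof -
  define T where "T = carrier R - {\<zero>}"
  interpret domain_loc R T by unfold_locales (auto simp: integral_iff T_def)
  have K: "fraction_ring R = L" by (simp add: fraction_ring_def T_def)
  let ?\<iota> = "\<lambda>a. fr a \<one>"
  have "x \<in> ?\<iota> ` carrier R"
    if x: "x \<in> carrier L" and int: "integral_over L (?\<iota> ` carrier R) x" for x
  proof -
    obtain r t where rt: "r \<in> carrier R" "t \<in> T" "x = fr r t" using x by (rule L_cases)
    obtain p where p: "polynomial\<^bsub>L\<^esub> (?\<iota> ` carrier R) p" "p \<noteq> []" "hd p = \<one>\<^bsub>L\<^esub>"
      "L.eval p x = \<zero>\<^bsub>L\<^esub>" using int unfolding integral_over_def by blast
    obtain ps where ps: "p = \<one>\<^bsub>L\<^esub> # ps" using p(2,3) by (cases p) auto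
    have "ps \<in> lists (?\<iota> ` carrier R)" using p(1) ps by (auto simp: polynomial_def)
    then obtain cs where cs: "set cs \<subseteq> carrier R" "ps = map ?\<iota> cs" unfolding lists_image by auto
    have p': "p = map ?\<iota> (\<one> # cs)" by (simp add: ps cs L_one)
    \<comment> \<open>Writing 1 as t/t gives both arguments the same denominator, as
      \<open>hev_frac\<close> requires.\<close>
    have one: "\<one>\<^bsub>L\<^esub> = fr t t" using rt by (simp add: L_one frac_eq)
    have "set p \<subseteq> carrier L" using cs(1) unfolding p' by auto
    hence "hev L (map ?\<iota> (\<one> # cs)) (fr r t) (fr t t) = \<zero>\<^bsub>L\<^esub>"
      using p(4) L.eval_eq_hev[of p x] x unfolding p' one rt(3) by simp
    hence "t \<otimes> hev R (\<one> # cs) r t = \<zero>"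
      using cs rt by (subst (asm) hev_frac) (simp_all add: frac_zero del: hev.simps)
    moreover have t0: "t \<noteq> \<zero>" using rt S_nonzero by simp
    ultimately have "hev R (\<one> # cs) r t = \<zero>" using cs rt by (simp add: integral_iff del: hev.simps)
    then obtain q where q: "q \<in> carrier R" "r = t \<otimes> q"
      using assms cs rt t0 S_carrier unfolding normal_elementwise_def by blast
    hence "x = fr q \<one>" using rt by (simp add: frac_eq m_ac)
    thus ?thesis using q by auto
  qed
  thus ?thesis unfolding normal_domain_def Let_def K T_def[symmetric] using domain_axioms by blast
qed

lemma (in domain) normal_SpecI:
  assumes "normal_elementwise R"
  shows "normal_Spec R"
  unfolding normal_Spec_def
proof (intro conjI allI impI)
  show "cring R" by (rule is_cring)
  fix P assume "primeideal P R"
  then interpret P: primeideal P R .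
  interpret domain_loc R "carrier R - P"
  proof unfold_locales
    show "carrier R - P \<subseteq> carrier R - {\<zero>}" using P.zero_closed by auto
    show "\<one> \<in> carrier R - P" using P.I_notcarr P.one_imp_carrier by auto
    show "s \<otimes> t \<in> carrier R - P" if "s \<in> carrier R - P" "t \<in> carrier R - P" for s t
      using that P.I_prime[of s t] by auto
  qed
  show "normal_domain (localization R (carrier R - P))"
    by (rule L.normal_domainI[OF normal_elementwise_L[OF assms]])
qed

subsection \<open>The nilcone is normal\<close>

lemma nilcone_ideal_ideal: "ideal (nilcone_ideal n) (zpoly_ring (V_coords n))"
  unfolding nilcone_ideal_def by (intro zpoly_ring.genideal_ideal) (auto simp: V_invariants_def)

lemma nilcone_ideal_prime: "primeideal (nilcone_ideal n) (zpoly_ring (V_coords n))"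
proof (rule primeidealI[OF nilcone_ideal_ideal zpoly_ring_cring])
  show "carrier (zpoly_ring (V_coords n)) \<noteq> nilcone_ideal n"
    using one_notin_Cideal[of n] by (auto simp: nilcone_ideal_eq)
  show "a \<in> nilcone_ideal n \<or> b \<in> nilcone_ideal n"
    if "a \<in> carrier (zpoly_ring (V_coords n))" "b \<in> carrier (zpoly_ring (V_coords n))"
      "a \<otimes>\<^bsub>zpoly_ring (V_coords n)\<^esub> b \<in> nilcone_ideal n" for a b
    using that Cideal_prime[of a b n] by (auto simp: nilcone_ideal_eq)
qed

lemma hev_zpoly_ring:
  "hev (zpoly_ring V) cs r s = (\<Sum>j<length cs. cs ! (length cs - 1 - j) * r ^ j * s ^ (length cs - 1 - j))"
proof (induction cs)
  case (Cons c cs)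
  let ?d = "length cs"
  have pow: "r [^]\<^bsub>zpoly_ring V\<^esub> k = r ^ k" for k :: nat by (induction k) (simp_all add: mult.commute)
  have "s * (\<Sum>j<?d. cs ! (?d - 1 - j) * r ^ j * s ^ (?d - 1 - j))
      = (\<Sum>j<?d. (c # cs) ! (?d - j) * r ^ j * s ^ (?d - j))" unfolding sum_distrib_left
  proof (intro sum.cong refl)
    fix j assume "j \<in> {..<?d}"
    then obtain e where "?d - j = Suc e" "?d - 1 - j = e" by (cases "?d - j") auto
    thus "s * (cs ! (?d - 1 - j) * r ^ j * s ^ (?d - 1 - j)) = (c # cs) ! (?d - j) * r ^ j * s ^ (?d - j)"
      by (simp add: mult_ac)
  qed
  thus ?case using Cons by (simp add: pow)
qed simp

lemma nilcone_ring_domain: "domain (nilcone_ring n)"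
  unfolding nilcone_ring_def by (rule primeideal.quotient_is_domain[OF nilcone_ideal_prime])

lemma nilcone_ring_normal_elementwise: "normal_elementwise (nilcone_ring n)"
  unfolding normal_elementwise_def
proof (intro ballI allI impI)
  let ?Q = "nilcone_ring n" and ?A = "zpoly_ring (V_coords n)" and ?J = "nilcone_ideal n"
  interpret J: ideal ?J ?A by (rule nilcone_ideal_ideal)
  interpret Q: domain ?Q by (rule nilcone_ring_domain)
  let ?h = "(+>\<^bsub>?A\<^esub>) ?J"
  interpret h: ring_hom_cring ?A ?Q ?h
    using J.rcos_ring_hom_cring[OF zpoly_ring_cring] by (simp add: nilcone_ring_def)
  have surj: "\<exists>f\<in>polys (V_coords n). x = ?h f" if "x \<in> carrier ?Q" for x
    using that by (auto simp: nilcone_ring_def FactRing_def A_RCOSETS_def')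
  have zero: "?h f = \<zero>\<^bsub>?Q\<^esub> \<longleftrightarrow> f \<in> Cideal n" if "f \<in> polys (V_coords n)" for f
    using that J.a_rcos_const[of f] J.a_rcos_self[of f]
    by (auto simp: nilcone_ring_def FactRing_def nilcone_ideal_eq)
  fix x y xs assume x: "x \<in> carrier ?Q" and y: "y \<in> carrier ?Q"
    and y0: "y \<noteq> \<zero>\<^bsub>?Q\<^esub>" and xs: "set xs \<subseteq> carrier ?Q"
    and 0: "hev ?Q (\<one>\<^bsub>?Q\<^esub> # xs) x y = \<zero>\<^bsub>?Q\<^esub>"
  obtain r where r: "r \<in> polys (V_coords n)" "x = ?h r" using surj[OF x] by blast
  obtain s where s: "s \<in> polys (V_coords n)" "y = ?h s" using surj[OF y] by blast
  have "\<exists>cs. set cs \<subseteq> polys (V_coords n) \<and> xs = map ?h cs" using xs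
  proof (induction xs)
    case (Cons z zs)
    then obtain cs where "set cs \<subseteq> polys (V_coords n)" "zs = map ?h cs" by auto
    moreover obtain c where "c \<in> polys (V_coords n)" "z = ?h c" using surj[of z] Cons.prems by auto
    ultimately show ?case by (intro exI[of _ "c # cs"]) simp
  qed simp
  then obtain cs where cs: "set cs \<subseteq> polys (V_coords n)" "xs = map ?h cs" by blast
  have "\<one>\<^bsub>?Q\<^esub> # xs = map ?h (1 # cs)" using h.hom_one cs by simp
  hence "?h (hev ?A (1 # cs) r s) = \<zero>\<^bsub>?Q\<^esub>" using 0 h.hom_hev[of "1 # cs" r s] cs r s by (simp del: hev.simps)
  hence "hev ?A (1 # cs) r s \<in> Cideal n"
    using zero[of "hev ?A (1 # cs) r s"] zpoly_ring.hev_closed[of "1 # cs" "V_coords n" r s] cs r s by (simp del: hev.simps)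
  moreover have "hev ?A (1 # cs) r s = int_rel (length cs) (\<lambda>j. cs ! (length cs - 1 - j)) r s"
    unfolding hev_zpoly_ring int_rel_def by (simp add: add.commute)
  ultimately have "\<exists>q\<in>polys (V_coords n). r - s * q \<in> Cideal n"
    using zero[of s] r s y0 by (intro Cideal_normal_V) auto
  then obtain q where q: "q \<in> polys (V_coords n)" "r - s * q \<in> Cideal n" by blast
  have "?h (r \<ominus>\<^bsub>?A\<^esub> s \<otimes>\<^bsub>?A\<^esub> q) = \<zero>\<^bsub>?Q\<^esub>" using zero[of "r - s * q"] q r s by (simp add: polys_closed)
  moreover have "?h (r \<ominus>\<^bsub>?A\<^esub> s \<otimes>\<^bsub>?A\<^esub> q) = x \<ominus>\<^bsub>?Q\<^esub> y \<otimes>\<^bsub>?Q\<^esub> ?h q"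
  proof -
    have "r \<in> carrier ?A" "s \<in> carrier ?A" "q \<in> carrier ?A" using q r s by auto
    thus ?thesis unfolding r(2) s(2) by (simp add: a_minus_def del: zpoly_ring_simps)
  qed
  ultimately have "x \<ominus>\<^bsub>?Q\<^esub> y \<otimes>\<^bsub>?Q\<^esub> ?h q = \<zero>\<^bsub>?Q\<^esub>" by (simp only:)
  moreover have "?h q \<in> carrier ?Q" using q by simp
  ultimately have "x = y \<otimes>\<^bsub>?Q\<^esub> ?h q" using Q.r_right_minus_eq[of x "y \<otimes>\<^bsub>?Q\<^esub> ?h q"] x y by simp
  thus "\<exists>q\<in>carrier ?Q. x = y \<otimes>\<^bsub>?Q\<^esub> q" using q by auto
qed

lemma nilcone_normal: "normal_Spec (nilcone_ring n)"
  by (rule domain.normal_SpecI[OF nilcone_ring_domain nilcone_ring_normal_elementwise])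

section \<open>Flatness of free modules over the integers\<close>

lemma frag_induct [consumes 1, case_names zero diff base]:
  assumes "keys x \<subseteq> S" "P 0"
    and "\<And>x y. keys x \<subseteq> S \<Longrightarrow> keys y \<subseteq> S \<Longrightarrow> P x \<Longrightarrow> P y \<Longrightarrow> P (x - y)" "\<And>a. a \<in> S \<Longrightarrow> P (frag_of a)"
  shows "P x"
  using assms by (rule free_Abelian_group_induct)

locale int_tensor =
  fixes M :: "(int, 'm, 'y) module_scheme" (structure) and N :: "(int, 'n, 'z) module_scheme"
  assumes M: "module \<Z> M" and N: "module \<Z> N"
begin

sublocale M: module \<Z> M by (rule M)
sublocale N: module \<Z> N by (rule N)

abbreviation FG where "FG \<equiv> free_Abelian_group (carrier M \<times> carrier N)"
abbreviation T where "T \<equiv> tensor_subgroup \<Z> M N"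

lemma relators_cases:
  assumes "r \<in> tensor_relators \<Z> M N"
  obtains (l) x x' y where "x \<in> carrier M" "x' \<in> carrier M" "y \<in> carrier N"
        "r = frag_of (x \<oplus> x', y) - frag_of (x, y) - frag_of (x', y)"
      | (r) x y y' where "x \<in> carrier M" "y \<in> carrier N" "y' \<in> carrier N"
        "r = frag_of (x, y \<oplus>\<^bsub>N\<^esub> y') - frag_of (x, y) - frag_of (x, y')"
      | (s) k x y where "x \<in> carrier M" "y \<in> carrier N" "r = frag_of (k \<odot> x, y) - frag_of (x, k \<odot>\<^bsub>N\<^esub> y)"
  using assms unfolding tensor_relators_def Un_iff mem_Collect_eq
  by (elim disjE exE conjE) (rule l r s; assumption)+

lemma relators_carrier: "tensor_relators \<Z> M N \<subseteq> carrier FG"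
proof -
  have *: "keys (a - b) \<subseteq> S" if "keys a \<subseteq> S" "keys b \<subseteq> S" for a b :: "('m \<times> 'n) \<Rightarrow>\<^sub>0 int" and S
    using that keys_diff[of a b] by blast
  have "keys r \<subseteq> carrier M \<times> carrier N" if "r \<in> tensor_relators \<Z> M N" for r
  proof -
    from that show ?thesis
    proof (cases rule: relators_cases)
      case l
      show ?thesis unfolding l(4) by (intro *) (use l in simp_all)
    next
      case r
      show ?thesis unfolding r(4) by (intro *) (use r in simp_all)
    next
      case s
      show ?thesis unfolding s(3) by (intro *) (use s in simp_all)
    qed
  qed
  thus ?thesis by (intro subsetI) (simp only: carrier_free_Abelian_group_iff)
qed

lemma T_subgroup: "subgroup T FG"
  unfolding tensor_subgroup_def by (rule group.generate_is_subgroup[OF group_free_Abelian_group relators_carrier])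

lemma T_zero: "0 \<in> T"
  using subgroup.one_closed[OF T_subgroup] by simp

lemma T_add: "a \<in> T \<Longrightarrow> b \<in> T \<Longrightarrow> a + b \<in> T"
  using subgroup.m_closed[OF T_subgroup] by simp

lemma T_keys: "a \<in> T \<Longrightarrow> keys a \<subseteq> carrier M \<times> carrier N"
  using subgroup.mem_carrier[OF T_subgroup, of a] by (simp only: carrier_free_Abelian_group_iff)

lemma T_neg: "a \<in> T \<Longrightarrow> - a \<in> T"
  using subgroup.m_inv_closed[OF T_subgroup, of a] T_keys[of a] by simp

lemma T_diff: "a \<in> T \<Longrightarrow> b \<in> T \<Longrightarrow> a - b \<in> T"
  using T_add[of a "- b"] T_neg[of b] by simp

lemma T_sum: "(\<And>i. i \<in> I \<Longrightarrow> a i \<in> T) \<Longrightarrow> sum a I \<in> T"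
  by (induction I rule: infinite_finite_induct) (auto intro: T_zero T_add)

lemma T_base: "r \<in> tensor_relators \<Z> M N \<Longrightarrow> r \<in> T"
  unfolding tensor_subgroup_def by (rule generate.incl)

lemma T_left:
  "x \<in> carrier M \<Longrightarrow> x' \<in> carrier M \<Longrightarrow> y \<in> carrier N \<Longrightarrow>
    frag_of (x \<oplus> x', y) - frag_of (x, y) - frag_of (x', y) \<in> T" by (rule T_base) (auto simp: tensor_relators_def)

lemma T_right:
  "x \<in> carrier M \<Longrightarrow> y \<in> carrier N \<Longrightarrow> y' \<in> carrier N \<Longrightarrow>
    frag_of (x, y \<oplus>\<^bsub>N\<^esub> y') - frag_of (x, y) - frag_of (x, y') \<in> T"
  by (rule T_base) (auto simp: tensor_relators_def)

lemma T_left_zero: "y \<in> carrier N \<Longrightarrow> frag_of (\<zero>, y) \<in> T"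
  using T_neg[OF T_left[of "\<zero>" "\<zero>" y]] by simp

lemma T_right_zero: "x \<in> carrier M \<Longrightarrow> frag_of (x, \<zero>\<^bsub>N\<^esub>) \<in> T"
  using T_neg[OF T_right[of x "\<zero>\<^bsub>N\<^esub>" "\<zero>\<^bsub>N\<^esub>"]] by simp

lemma T_left_diff:
  assumes "x \<in> carrier M" "x' \<in> carrier M" "y \<in> carrier N"
  shows "frag_of (x \<ominus> x', y) - (frag_of (x, y) - frag_of (x', y)) \<in> T"
proof -
  have "x = (x \<ominus> x') \<oplus> x'" using assms by (simp add: M.minus_eq M.a_assoc M.l_neg)
  hence "frag_of (x, y) - frag_of (x \<ominus> x', y) - frag_of (x', y) \<in> T" using T_left[of "x \<ominus> x'" x' y] assms by simp
  from T_neg[OF this] show ?thesis by (simp add: algebra_simps)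
qed

lemma T_right_diff:
  assumes "x \<in> carrier M" "y \<in> carrier N" "y' \<in> carrier N"
  shows "frag_of (x, y \<ominus>\<^bsub>N\<^esub> y') - (frag_of (x, y) - frag_of (x, y')) \<in> T"
proof -
  have "y = (y \<ominus>\<^bsub>N\<^esub> y') \<oplus>\<^bsub>N\<^esub> y'" using assms by (simp add: N.minus_eq N.a_assoc N.l_neg)
  hence "frag_of (x, y) - frag_of (x, y \<ominus>\<^bsub>N\<^esub> y') - frag_of (x, y') \<in> T"
    using T_right[of x "y \<ominus>\<^bsub>N\<^esub> y'" y'] assms by simp
  from T_neg[OF this] show ?thesis by (simp add: algebra_simps)
qed

lemma T_combine:
  assumes "x - (g - h) \<in> T" "s - (a - b) \<in> T" "g - a \<in> T" "h - b \<in> T"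
  shows "x - s \<in> T"
proof -
  have "x - s = (x - (g - h)) - (s - (a - b)) + ((g - a) - (h - b))" by simp
  thus ?thesis using T_add[OF T_diff[OF assms(1,2)] T_diff[OF assms(3,4)]] by (simp only:)
qed

lemma coset: "T #>\<^bsub>FG\<^esub> c = {x. x - c \<in> T}"
proof -
  have "x \<in> T #>\<^bsub>FG\<^esub> c" if "x - c \<in> T" for x using that by (auto simp: r_coset_def intro!: bexI[of _ "x - c"])
  thus ?thesis by (auto simp: r_coset_def)
qed

lemma coset_eq: "T #>\<^bsub>FG\<^esub> c = T #>\<^bsub>FG\<^esub> c' \<longleftrightarrow> c - c' \<in> T"
proof
  assume "T #>\<^bsub>FG\<^esub> c = T #>\<^bsub>FG\<^esub> c'"
  moreover have "c \<in> T #>\<^bsub>FG\<^esub> c" by (simp add: coset T_zero)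
  ultimately show "c - c' \<in> T" by (simp add: coset)
next
  assume c: "c - c' \<in> T"
  have "x - c' \<in> T" if "x - c \<in> T" for x using T_add[OF that c] by simp
  moreover have "x - c \<in> T" if "x - c' \<in> T" for x using T_diff[OF that c] by simp
  ultimately show "T #>\<^bsub>FG\<^esub> c = T #>\<^bsub>FG\<^esub> c'" by (auto simp: coset)
qed

end

text \<open>\<open>\<rho>\<close> is an isomorphism onto \<open>N\<close> from the free abelian
  group on \<open>B\<close>.\<close>

locale int_free_tensor = int_tensor M N
  for M :: "(int, 'm, 'y) module_scheme" (structure) and N :: "(int, 'n, 'z) module_scheme" +
  fixes \<rho> :: "('b \<Rightarrow>\<^sub>0 int) \<Rightarrow> 'n" and B :: "'b set"
  assumes image: "carrier N = \<rho> ` {h. keys h \<subseteq> B}"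
    and inj: "inj_on \<rho> {h. keys h \<subseteq> B}"
    and add: "\<And>g h. keys g \<subseteq> B \<Longrightarrow> keys h \<subseteq> B \<Longrightarrow> \<rho> (g + h) = \<rho> g \<oplus>\<^bsub>N\<^esub> \<rho> h"
    and smult: "\<And>k h. keys h \<subseteq> B \<Longrightarrow> \<rho> (frag_cmul k h) = k \<odot>\<^bsub>N\<^esub> \<rho> h"
begin

definition crd :: "'n \<Rightarrow> 'b \<Rightarrow>\<^sub>0 int" where
  "crd y = inv_into {h. keys h \<subseteq> B} \<rho> y"

lemma crd: "y \<in> carrier N \<Longrightarrow> keys (crd y) \<subseteq> B" "y \<in> carrier N \<Longrightarrow> \<rho> (crd y) = y"
  using inv_into_into[of y \<rho> "{h. keys h \<subseteq> B}"] f_inv_into_f[of y \<rho> "{h. keys h \<subseteq> B}"]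
  by (auto simp: crd_def image)

lemma crd_rho: "keys h \<subseteq> B \<Longrightarrow> crd (\<rho> h) = h"
  using inj by (simp add: crd_def)

lemma rho_closed [simp]: "keys h \<subseteq> B \<Longrightarrow> \<rho> h \<in> carrier N"
  by (auto simp: image)

lemma rho_zero: "\<rho> 0 = \<zero>\<^bsub>N\<^esub>"
  using add[of 0 0] rho_closed[of 0] N.add.r_cancel_one'[of "\<rho> 0" "\<rho> 0"] by simp

lemma rho_diff:
  assumes "keys g \<subseteq> B" "keys h \<subseteq> B"
  shows "\<rho> (g - h) = \<rho> g \<ominus>\<^bsub>N\<^esub> \<rho> h"
proof -
  have d: "keys (g - h) \<subseteq> B" using assms keys_diff[of g h] by auto
  have "\<rho> g = \<rho> (g - h) \<oplus>\<^bsub>N\<^esub> \<rho> h" using add[OF d assms(2)] by simp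
  thus ?thesis using assms d by (simp add: N.minus_eq N.a_assoc N.r_neg)
qed

lemma crd_add: "y \<in> carrier N \<Longrightarrow> y' \<in> carrier N \<Longrightarrow> crd (y \<oplus>\<^bsub>N\<^esub> y') = crd y + crd y'"
proof -
  assume y: "y \<in> carrier N" "y' \<in> carrier N"
  have "keys (crd y + crd y') \<subseteq> B" using keys_add[of "crd y" "crd y'"] crd(1)[OF y(1)] crd(1)[OF y(2)] by blast
  from crd_rho[OF this] show ?thesis using add[OF crd(1)[OF y(1)] crd(1)[OF y(2)]] y by (simp add: crd(2))
qed

lemma crd_smult: "y \<in> carrier N \<Longrightarrow> crd (k \<odot>\<^bsub>N\<^esub> y) = frag_cmul k (crd y)"
proof -
  assume y: "y \<in> carrier N"
  have "keys (frag_cmul k (crd y)) \<subseteq> B" using keys_cmul[of k "crd y"] crd(1)[OF y] by blast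
  from crd_rho[OF this] show ?thesis using smult[OF crd(1)[OF y]] y by (simp add: crd(2))
qed

text \<open>The component at \<open>b\<close> of the isomorphism from M \<otimes> N to a direct sum
  of copies of M, defined on generators by the universal property.\<close>

definition cf :: "'b \<Rightarrow> ('m \<times> 'n \<Rightarrow>\<^sub>0 int) \<Rightarrow> 'm" where
  "cf b = (SOME h. h \<in> hom FG (add_monoid M) \<and>
    (\<forall>p\<in>carrier M \<times> carrier N. h (frag_of p) = lookup (crd (snd p)) b \<odot> fst p))"

lemma cf: "cf b \<in> hom FG (add_monoid M)"
  "x \<in> carrier M \<Longrightarrow> y \<in> carrier N \<Longrightarrow> cf b (frag_of (x, y)) = lookup (crd y) b \<odot> x"
proof -
  have "comm_group (add_monoid M)" by (rule M.a_comm_group)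
  then obtain h where "h \<in> hom FG (add_monoid M)"
    "\<And>p. p \<in> carrier M \<times> carrier N \<Longrightarrow> h (frag_of p) = lookup (crd (snd p)) b \<odot> fst p"
    by (rule comm_group.free_Abelian_group_universal[where S = "carrier M \<times> carrier N"
      and f = "\<lambda>p. lookup (crd (snd p)) b \<odot> fst p"]) auto
  hence "\<exists>h. h \<in> hom FG (add_monoid M) \<and>
    (\<forall>p\<in>carrier M \<times> carrier N. h (frag_of p) = lookup (crd (snd p)) b \<odot> fst p)" by blast
  from someI_ex[OF this, folded cf_def]
  show "cf b \<in> hom FG (add_monoid M)"
    "x \<in> carrier M \<Longrightarrow> y \<in> carrier N \<Longrightarrow> cf b (frag_of (x, y)) = lookup (crd y) b \<odot> x" by auto
qed

lemma cf_closed [simp]: "d \<in> carrier FG \<Longrightarrow> cf b d \<in> carrier M"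
  using hom_in_carrier[OF cf(1)[of b]] by simp

lemma cf_add: "d \<in> carrier FG \<Longrightarrow> d' \<in> carrier FG \<Longrightarrow> cf b (d + d') = cf b d \<oplus> cf b d'"
  using hom_mult[OF cf(1)[of b]] by simp

lemma cf_zero: "cf b 0 = \<zero>"
  using cf_add[of 0 0 b] M.add.r_cancel_one'[of "cf b 0" "cf b 0"] cf_closed[of 0 b] by simp

lemma cf_diff:
  assumes "d \<in> carrier FG" "d' \<in> carrier FG"
  shows "cf b (d - d') = cf b d \<ominus> cf b d'"
proof -
  have d: "d - d' \<in> carrier FG" using assms keys_diff[of d d'] by auto
  have "cf b d = cf b (d - d') \<oplus> cf b d'" using cf_add[OF d assms(2)] by simp
  thus ?thesis using cf_closed[OF assms(2)] cf_closed[OF d] by (simp add: M.minus_eq M.a_assoc M.r_neg)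
qed

lemma cf_T: "d \<in> T \<Longrightarrow> cf b d = \<zero>"
proof -
  let ?K = "{d \<in> carrier FG. cf b d = \<zero>}"
  have "subgroup ?K FG"
  proof (rule group.subgroupI[OF group_free_Abelian_group])
    show "inv\<^bsub>FG\<^esub> a \<in> ?K" if "a \<in> ?K" for a using that cf_diff[of 0 a b] by (simp add: cf_zero M.minus_eq)
    show "a \<otimes>\<^bsub>FG\<^esub> c \<in> ?K" if "a \<in> ?K" "c \<in> ?K" for a c using that keys_add[of a c] cf_add[of a c b] by auto
    have "0 \<in> ?K" by (simp add: cf_zero)
    thus "?K \<noteq> {}" by blast
  qed auto
  moreover have "tensor_relators \<Z> M N \<subseteq> ?K"
  proof (intro subsetI CollectI conjI)
    fix r assume r: "r \<in> tensor_relators \<Z> M N"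
    thus "r \<in> carrier FG" using relators_carrier by blast
    have fr: "frag_of (x, y) \<in> carrier FG" if "x \<in> carrier M" "y \<in> carrier N" for x y using that by simp
    have fd: "frag_of p - frag_of q \<in> carrier FG" if "p \<in> carrier M \<times> carrier N" "q \<in> carrier M \<times> carrier N" for p q
      using that keys_diff[of "frag_of p" "frag_of q"] by auto
    from r show "cf b r = \<zero>"
    proof (cases rule: relators_cases)
      case l
      thus ?thesis
        by (simp add: cf_diff fr fd cf M.smult_r_distr M.minus_eq M.a_ac M.r_neg M.r_neg1 del: carrier_free_Abelian_group_iff)
    next
      case r
      have "\<And>i j. (i + j) \<odot> x = i \<odot> x \<oplus> j \<odot> x"
        if "x \<in> carrier M" for x using M.smult_l_distr[of _ _ x] that by simp
      with r show ?thesis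
        by (simp add: cf_diff fr fd cf crd_add lookup_add M.minus_eq M.a_ac M.r_neg M.r_neg1 del: carrier_free_Abelian_group_iff)
    next
      case s
      have "\<And>i j. i \<odot> (j \<odot> x) = (i * j) \<odot> x"
        if "x \<in> carrier M" for x using M.smult_assoc1[of _ _ x] that by simp
      with s show ?thesis
        by (simp add: cf_diff fr fd cf crd_smult M.minus_eq M.r_neg mult.commute del: carrier_free_Abelian_group_iff)
    qed
  qed
  ultimately have "T \<subseteq> ?K"
    unfolding tensor_subgroup_def by (intro group.generate_subgroup_incl[OF group_free_Abelian_group])
  thus "d \<in> T \<Longrightarrow> cf b d = \<zero>" by blast
qed

abbreviation E where "E b x \<equiv> frag_of (x, \<rho> (frag_of b))"

lemma expand_right:
  assumes x: "x \<in> carrier M" and B0: "finite B0" "B0 \<subseteq> B" and h: "keys h \<subseteq> B0"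
  shows "frag_of (x, \<rho> h) - (\<Sum>b\<in>B0. E b (lookup h b \<odot> x)) \<in> T"
  using h
proof (induction rule: frag_induct)
  case zero
  have "x \<in> carrier M \<Longrightarrow> 0 \<odot> x = \<zero>" using M.smult_l_null[of x] by simp
  thus ?case using x B0 unfolding rho_zero
    by (intro T_diff T_sum T_right_zero) (auto intro!: T_left_zero rho_closed)
next
  case (diff g h)
  have gB: "keys g \<subseteq> B" "keys h \<subseteq> B" using diff B0 by auto
  have "lookup (g - h) b \<odot> x = lookup g b \<odot> x \<ominus> lookup h b \<odot> x" for b
    using M.smult_l_distr[of "lookup (g - h) b" "lookup h b" x] x
    by (simp add: lookup_minus M.minus_eq M.a_assoc M.r_neg)
  hence "E b (lookup (g - h) b \<odot> x) -
      (E b (lookup g b \<odot> x) - E b (lookup h b \<odot> x)) \<in> T" if "b \<in> B0" for b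
    using T_left_diff[of "lookup g b \<odot> x" "lookup h b \<odot> x" "\<rho> (frag_of b)"] x that B0 by auto
  from T_sum[of B0, OF this]
  have 1: "(\<Sum>b\<in>B0. E b (lookup (g - h) b \<odot> x)) -
      ((\<Sum>b\<in>B0. E b (lookup g b \<odot> x)) - (\<Sum>b\<in>B0. E b (lookup h b \<odot> x))) \<in> T" by (simp only: sum_subtractf)
  have 2: "frag_of (x, \<rho> (g - h)) - (frag_of (x, \<rho> g) - frag_of (x, \<rho> h)) \<in> T"
    unfolding rho_diff[OF gB] by (rule T_right_diff) (use x gB in auto)
  show ?case by (rule T_combine[OF 2 1 diff(3,4)])
next
  case (base a)
  have one: "1 \<odot> x = x" using M.smult_one[OF x] by simp
  have null: "0 \<odot> x = \<zero>" using M.smult_l_null[OF x] by simp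
  have "(\<Sum>b\<in>B0. E b (lookup (frag_of a) b \<odot> x))
      = frag_of (x, \<rho> (frag_of a)) + (\<Sum>b\<in>B0 - {a}. E b \<zero>)"
    using base B0 one by (subst sum.remove[of B0 a]) (auto simp: null lookup_single intro!: sum.cong)
  moreover have "(\<Sum>b\<in>B0 - {a}. E b \<zero>) \<in> T" using B0 by (intro T_sum T_left_zero) auto
  ultimately show ?case using T_neg by simp
qed

lemma expand:
  assumes d: "keys d \<subseteq> S" and S: "S \<subseteq> carrier M \<times> carrier N" "\<And>p. p \<in> S \<Longrightarrow> keys (crd (snd p)) \<subseteq> B0"
    and B0: "finite B0" "B0 \<subseteq> B"
  shows "d - (\<Sum>b\<in>B0. E b (cf b d)) \<in> T"
  using d
proof (induction rule: frag_induct)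
  case zero
  show ?case unfolding cf_zero using B0 by (intro T_diff T_zero T_sum T_left_zero) auto
next
  case (diff d e)
  have c: "d \<in> carrier FG" "e \<in> carrier FG" using diff S by auto
  have "E b (cf b (d - e)) - (E b (cf b d) - E b (cf b e)) \<in> T"
    if "b \<in> B0" for b
    unfolding cf_diff[OF c] using that B0 cf_closed[OF c(1)] cf_closed[OF c(2)] by (intro T_left_diff) auto
  from T_sum[of B0, OF this]
  have 1: "(\<Sum>b\<in>B0. E b (cf b (d - e))) -
      ((\<Sum>b\<in>B0. E b (cf b d)) - (\<Sum>b\<in>B0. E b (cf b e))) \<in> T" by (simp only: sum_subtractf)
  have 2: "(d - e) - (d - e) \<in> T" by (simp add: T_zero)
  show ?case by (rule T_combine[OF 2 1 diff(3,4)])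
next
  case (base p)
  obtain x y where p: "p = (x, y)" by (cases p)
  have xy: "x \<in> carrier M" "y \<in> carrier N" "keys (crd y) \<subseteq> B0" using base S(2)[of p] S(1) p by auto
  show ?case using expand_right[OF xy(1) B0 xy(3)] xy by (simp add: p cf crd)
qed

text \<open>Modulo the relators \<open>d\<close> is the sum of its components tensored with basis
  elements, so it vanishes as soon as they all do. Finitely many basis elements occur in
  \<open>d\<close>.\<close>

lemma T_iff:
  assumes "d \<in> carrier FG"
  shows "d \<in> T \<longleftrightarrow> (\<forall>b. cf b d = \<zero>)"
proof
  assume 0: "\<forall>b. cf b d = \<zero>"
  define B0 where "B0 = (\<Union>p\<in>keys d. keys (crd (snd p)))"
  have B0: "finite B0" "B0 \<subseteq> B"
  proof -
    have "keys (crd (snd p)) \<subseteq> B" if "p \<in> keys d" for p by (rule crd(1)) (use that assms in auto)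
    thus "B0 \<subseteq> B" by (auto simp: B0_def)
  qed (simp add: B0_def)
  have "d - (\<Sum>b\<in>B0. E b (cf b d)) \<in> T" by (rule expand[of d "keys d"]) (use assms B0 in \<open>auto simp: B0_def\<close>)
  moreover have "(\<Sum>b\<in>B0. E b (cf b d)) \<in> T" using 0 B0 by (intro T_sum) (auto intro!: T_left_zero)
  ultimately show "d \<in> T" using T_add by fastforce
qed (use cf_T in blast)

end

text \<open>On components the induced map of tensor products is \<open>f\<close> itself, so
  injectivity is inherited. This needs no torsion argument and works for all test modules.\<close>

lemma flat_int_free:
  fixes N :: "(int, 'n, 'z) module_scheme" and \<rho> :: "('b \<Rightarrow>\<^sub>0 int) \<Rightarrow> 'n"
  assumes N: "module \<Z> N"
    and \<rho>: "carrier N = \<rho> ` {h. keys h \<subseteq> B}" "inj_on \<rho> {h. keys h \<subseteq> B}"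
      "\<And>g h. keys g \<subseteq> B \<Longrightarrow> keys h \<subseteq> B \<Longrightarrow> \<rho> (g + h) = \<rho> g \<oplus>\<^bsub>N\<^esub> \<rho> h"
      "\<And>k h. keys h \<subseteq> B \<Longrightarrow> \<rho> (frag_cmul k h) = k \<odot>\<^bsub>N\<^esub> \<rho> h"
  shows "flat_module P Q \<Z> N"
  unfolding flat_module_def
proof (intro conjI N allI impI)
  fix M1 :: "(int, 'a) module" and M2 :: "(int, 'c) module" and f
  assume a: "module \<Z> M1 \<and> module \<Z> M2 \<and> linear_map \<Z> M1 M2 f \<and> inj_on f (carrier M1)"
  hence M: "module \<Z> M1" "module \<Z> M2" by simp_all
  interpret T1: int_free_tensor M1 N \<rho> B
    by (rule int_free_tensor.intro[OF int_tensor.intro[OF M(1) N] int_free_tensor_axioms.intro[OF \<rho>]])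
  interpret T2: int_free_tensor M2 N \<rho> B
    by (rule int_free_tensor.intro[OF int_tensor.intro[OF M(2) N] int_free_tensor_axioms.intro[OF \<rho>]])
  have f: "f \<in> hom (add_monoid M1) (add_monoid M2)" and fs: "\<And>k x. x \<in> carrier M1 \<Longrightarrow> f (k \<odot>\<^bsub>M1\<^esub> x) = k \<odot>\<^bsub>M2\<^esub> f x"
    and fi: "inj_on f (carrier M1)" using a by (auto simp: linear_map_def)
  have fc: "f x \<in> carrier M2" if "x \<in> carrier M1" for x using hom_in_carrier[OF f] that by simp
  have fa: "f (x \<oplus>\<^bsub>M1\<^esub> y) = f x \<oplus>\<^bsub>M2\<^esub> f y" if "x \<in> carrier M1" "y \<in> carrier M1" for x y
    using hom_mult[OF f] that by simp
  have f0: "f \<zero>\<^bsub>M1\<^esub> = \<zero>\<^bsub>M2\<^esub>"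
    using fa[of "\<zero>\<^bsub>M1\<^esub>" "\<zero>\<^bsub>M1\<^esub>"] fc[of "\<zero>\<^bsub>M1\<^esub>"] T2.M.add.r_cancel_one'[of "f \<zero>\<^bsub>M1\<^esub>" "f \<zero>\<^bsub>M1\<^esub>"] by simp
  have fd: "f (x \<ominus>\<^bsub>M1\<^esub> y) = f x \<ominus>\<^bsub>M2\<^esub> f y" if xy: "x \<in> carrier M1" "y \<in> carrier M1" for x y
  proof -
    have "x = (x \<ominus>\<^bsub>M1\<^esub> y) \<oplus>\<^bsub>M1\<^esub> y" using xy by (simp add: T1.M.minus_eq T1.M.a_assoc T1.M.l_neg)
    hence "f x = f (x \<ominus>\<^bsub>M1\<^esub> y) \<oplus>\<^bsub>M2\<^esub> f y" using fa[of "x \<ominus>\<^bsub>M1\<^esub> y" y] xy by simp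
    thus ?thesis using xy fc by (simp add: T2.M.minus_eq T2.M.a_assoc T2.M.r_neg)
  qed
  let ?\<phi> = "frag_extend (\<lambda>(x, y). frag_of (f x, y))"
  have \<phi>: "keys (?\<phi> d) \<subseteq> carrier M2 \<times> carrier N \<and> (\<forall>b. T2.cf b (?\<phi> d) = f (T1.cf b d))"
    if "keys d \<subseteq> carrier M1 \<times> carrier N" for d using that
  proof (induction rule: frag_induct)
    case zero
    thus ?case by (simp add: T1.cf_zero T2.cf_zero f0)
  next
    case (diff d e)
    thus ?case using keys_diff[of "?\<phi> d" "?\<phi> e"]
      by (auto simp: frag_extend_diff T1.cf_diff T2.cf_diff fd T1.cf_closed)
  next
    case (base p)
    thus ?case by (cases p) (simp add: T1.cf T2.cf fs fc)
  qed
  have inj: "?\<phi> d \<in> T2.T \<longleftrightarrow> d \<in> T1.T" if d: "keys d \<subseteq> carrier M1 \<times> carrier N" for d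
  proof -
    have "f (T1.cf b d) = \<zero>\<^bsub>M2\<^esub> \<longleftrightarrow> T1.cf b d = \<zero>\<^bsub>M1\<^esub>" for b
      using inj_onD[OF fi, of "T1.cf b d" "\<zero>\<^bsub>M1\<^esub>"] f0 T1.cf_closed[of d b] d by auto
    thus ?thesis using T1.T_iff[of d] T2.T_iff[of "?\<phi> d"] \<phi>[OF d] d by simp
  qed
  have map: "tensor_map \<Z> M1 M2 N f (T1.T #>\<^bsub>T1.FG\<^esub> c) = T2.T #>\<^bsub>T2.FG\<^esub> ?\<phi> c" if c: "keys c \<subseteq> carrier M1 \<times> carrier N" for c
  proof -
    have "T2.T #>\<^bsub>T2.FG\<^esub> ?\<phi> c' = T2.T #>\<^bsub>T2.FG\<^esub> ?\<phi> c" if "c' \<in> T1.T #>\<^bsub>T1.FG\<^esub> c" for c'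
    proof -
      have "c' - c \<in> T1.T" using that by (simp add: T1.coset)
      hence "?\<phi> (c' - c) \<in> T2.T" using inj[of "c' - c"] T1.T_keys by blast
      thus ?thesis by (simp add: T2.coset_eq frag_extend_diff)
    qed
    moreover have "c \<in> T1.T #>\<^bsub>T1.FG\<^esub> c" by (simp add: T1.coset T1.T_zero)
    ultimately show ?thesis unfolding tensor_map_def by blast
  qed
  show "inj_on (tensor_map \<Z> M1 M2 N f) (carrier (tensor_product \<Z> M1 N))"
  proof (rule inj_onI)
    fix C D assume CD: "C \<in> carrier (tensor_product \<Z> M1 N)" "D \<in> carrier (tensor_product \<Z> M1 N)"
      and eq: "tensor_map \<Z> M1 M2 N f C = tensor_map \<Z> M1 M2 N f D"
    obtain c d where c: "keys c \<subseteq> carrier M1 \<times> carrier N" "C = T1.T #>\<^bsub>T1.FG\<^esub> c"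
      and d: "keys d \<subseteq> carrier M1 \<times> carrier N" "D = T1.T #>\<^bsub>T1.FG\<^esub> d"
      using CD by (auto simp: tensor_product_def FactGroup_def RCOSETS_def)
    have "?\<phi> (c - d) \<in> T2.T"
      using eq unfolding c(2) d(2) map[OF c(1)] map[OF d(1)] T2.coset_eq by (simp add: frag_extend_diff)
    hence "c - d \<in> T1.T" using inj[of "c - d"] c d keys_diff[of c d] by auto
    thus "C = D" by (simp add: c(2) d(2) T1.coset_eq)
  qed
qed

subsection \<open>The nilcone is flat\<close>

lemma (in ring) int_module_module: "module \<Z> (int_module R)"
proof (rule moduleI)
  let ?M = "int_module R"
  show "cring \<Z>" by (rule int_is_cring)
  show "abelian_group ?M" by (rule abelian_groupI) (auto simp: int_module_def a_ac intro: a_inv_closed l_neg)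
  show "(a \<otimes>\<^bsub>\<Z>\<^esub> b) \<odot>\<^bsub>?M\<^esub> x = a \<odot>\<^bsub>?M\<^esub> (b \<odot>\<^bsub>?M\<^esub> x)"
    if "x \<in> carrier ?M" for a b x
    using that add.int_pow_pow[of x a b] by (simp add: int_module_def add_pow_def mult.commute)
  show "(a \<oplus>\<^bsub>\<Z>\<^esub> b) \<odot>\<^bsub>?M\<^esub> x = a \<odot>\<^bsub>?M\<^esub> x \<oplus>\<^bsub>?M\<^esub> b \<odot>\<^bsub>?M\<^esub> x"
    if "x \<in> carrier ?M" for a b x using that add.int_pow_mult[of x a b] by (simp add: int_module_def add_pow_def)
  show "a \<odot>\<^bsub>?M\<^esub> (x \<oplus>\<^bsub>?M\<^esub> y) = a \<odot>\<^bsub>?M\<^esub> x \<oplus>\<^bsub>?M\<^esub> a \<odot>\<^bsub>?M\<^esub> y"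
    if "x \<in> carrier ?M" "y \<in> carrier ?M" for a x y
    using that add.int_pow_distrib[of x y a] by (simp add: int_module_def add_pow_def)
qed (auto simp: int_module_def add.int_pow_closed add_pow_def[symmetric])

definition gen_lm :: "nat \<Rightarrow> nat \<Rightarrow> (coord \<Rightarrow>\<^sub>0 nat)" where
  "gen_lm n i = single (ycoord n (i - 1)) i"

lemma leading_Gen: "leading (cost n) (top_cost n) (Gen n) (gen_lm n) {1..n}"
proof
  show "lead (cost n) (Gen n i) (gen_lm n i)" if "i \<in> {1..n}" for i
    unfolding gen_lm_def by (rule Gen_lead) (use that in auto)
  show "keys (gen_lm n i) \<inter> keys (gen_lm n j) = {}"
    if "i \<in> {1..n}" "j \<in> {1..n}" "i \<noteq> j" for i j using that by (auto simp: ycoord_def gen_lm_def)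
qed (auto simp: cost_le)

lemma nilcone_flat: "flat_Spec_over_int P Q (nilcone_ring n)"
  unfolding flat_Spec_over_int_def
proof -
  let ?Q = "nilcone_ring n" and ?A = "zpoly_ring (V_coords n)" and ?J = "nilcone_ideal n"
  interpret J: ideal ?J ?A by (rule nilcone_ideal_ideal)
  interpret Q: domain ?Q by (rule nilcone_ring_domain)
  let ?h = "(+>\<^bsub>?A\<^esub>) ?J"
  interpret h: ring_hom_cring ?A ?Q ?h
    using J.rcos_ring_hom_cring[OF zpoly_ring_cring] by (simp add: nilcone_ring_def)
  interpret leading "cost n" "top_cost n" "Gen n" "gen_lm n" "{1..n}" by (rule leading_Gen)
  \<comment> \<open>The standard monomials in the coordinates of the representation; the reduction
    and uniqueness statements of \<open>leading\<close> make them a basis.\<close>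
  define B where "B = {b. b \<in> Std {1..n} \<and> keys b \<subseteq> V_coords n}"
  have B: "keys f \<subseteq> B \<longleftrightarrow> f \<in> red {1..n} \<and> f \<in> polys (V_coords n)" for f by (auto simp: B_def red_def polys_def)
  have eq: "?h f = ?h g \<longleftrightarrow> f - g \<in> Cideal n" if "f \<in> polys (V_coords n)" "g \<in> polys (V_coords n)" for f g
    using that zpoly_ring.quotient_eq_iff_same_a_r_cos[OF J.ideal_axioms, of f g] by (simp add: nilcone_ideal_eq)
  have smult: "?h (frag_cmul k f) = [k] \<cdot>\<^bsub>?Q\<^esub> ?h f" if f: "f \<in> polys (V_coords n)" for k f
  proof -
    have cl: "?h f \<in> carrier ?Q" using f by simp
    have cm: "frag_cmul k f \<in> polys (V_coords n)" for k using f keys_cmul[of k f] by (auto simp: polys_def)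
    have st: "?h (frag_cmul (k + l) f) = ?h (frag_cmul k f) \<oplus>\<^bsub>?Q\<^esub> ?h (frag_cmul l f)" for k l
      using h.hom_add[of "frag_cmul k f" "frag_cmul l f"] cm by (simp add: frag_cmul_distrib)
    have neg: "?h (frag_cmul (- 1) f) = \<ominus>\<^bsub>?Q\<^esub> ?h f" using h.hom_a_inv[of f] f by simp
    have pw: "[(k + l)] \<cdot>\<^bsub>?Q\<^esub> ?h f = [k] \<cdot>\<^bsub>?Q\<^esub> ?h f \<oplus>\<^bsub>?Q\<^esub> [l] \<cdot>\<^bsub>?Q\<^esub> ?h f" for k l :: int
      using Q.add.int_pow_mult[of "?h f" k l] cl by (simp add: add_pow_def)
    have pneg: "[(- 1 :: int)] \<cdot>\<^bsub>?Q\<^esub> ?h f = \<ominus>\<^bsub>?Q\<^esub> ?h f"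
      using Q.add.int_pow_neg[of "?h f" 1] Q.add.int_pow_1[of "?h f"] cl by (simp add: add_pow_def a_inv_def)
    have pone: "[(1 :: int)] \<cdot>\<^bsub>?Q\<^esub> ?h f = ?h f" using Q.add.int_pow_1[of "?h f"] cl by (simp add: add_pow_def)
    show ?thesis
    proof (induction k rule: int_induct[where k = 0])
      case base
      have "[(0 :: int)] \<cdot>\<^bsub>?Q\<^esub> ?h f = \<zero>\<^bsub>?Q\<^esub>" by (simp add: add_pow_def)
      thus ?case using h.hom_zero by simp
    next
      case (step1 i)
      thus ?case by (simp only: st pw pone frag_cmul_one)
    next
      case (step2 i)
      have "i - 1 = i + (- 1)" by simp
      thus ?case using step2 by (simp only: st pw neg pneg)
    qed
  qed
  show "flat_module P Q \<Z> (int_module ?Q)"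
  proof (rule flat_int_free[where B = B and \<rho> = ?h])
    show "module \<Z> (int_module ?Q)" by (rule Q.int_module_module)
    show "carrier (int_module ?Q) = ?h ` {h. keys h \<subseteq> B}"
    proof -
      have "x \<in> ?h ` {h. keys h \<subseteq> B}" if x: "x \<in> carrier ?Q" for x
      proof -
        obtain f where f: "f \<in> polys (V_coords n)" "x = ?h f"
          using x by (auto simp: nilcone_ring_def FactRing_def A_RCOSETS_def')
        obtain g where g: "g \<in> red {1..n}" "f - g \<in> Cideal n"
          using reduce[of "{1..n}" f] unfolding Gen_ideal by blast
        let ?g = "zrestrict (V_coords n) g"
        interpret zr: comm_ring_hom "zrestrict (V_coords n)" by (rule zrestrict_hom)
        have "?g \<in> red {1..n}" using g(1) by (auto simp: red_def in_keys_iff lookup_zrestrict split: if_splits)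
        hence 1: "keys ?g \<subseteq> B" unfolding B using zrestrict_in_polys by blast
        have "f - ?g \<in> Cideal n" using zrestrict_Cideal[OF g(2)] f(1) by (simp add: zr.hom_minus zrestrict_id)
        hence "x = ?h ?g" using eq[OF f(1) zrestrict_in_polys] f(2) by blast
        thus ?thesis using 1 by blast
      qed
      moreover have "?h g \<in> carrier ?Q" if "keys g \<subseteq> B" for g using that unfolding B by simp
      ultimately show ?thesis by (auto simp: int_module_def)
    qed
    show "inj_on ?h {h. keys h \<subseteq> B}"
    proof (rule inj_onI)
      fix f g assume fg: "f \<in> {h. keys h \<subseteq> B}" "g \<in> {h. keys h \<subseteq> B}" "?h f = ?h g"
      hence "f - g \<in> Cideal n" using eq[of f g] unfolding mem_Collect_eq B by blast
      hence "f - g = 0"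
        using fg unfolding mem_Collect_eq B Gen_ideal[symmetric] by (intro reduced_unique red_diff) auto
      thus "f = g" by simp
    qed
    show "?h (f + g) = ?h f \<oplus>\<^bsub>int_module ?Q\<^esub> ?h g" if "keys f \<subseteq> B" "keys g \<subseteq> B" for f g
      using h.hom_add[of f g] that unfolding B by (simp add: int_module_def)
    show "?h (frag_cmul k f) = k \<odot>\<^bsub>int_module ?Q\<^esub> ?h f" if "keys f \<subseteq> B" for k f
      using smult[of f k] that unfolding B by (simp add: int_module_def)
  qed
qed

section \<open>Normal forms for a nilpotent self-adjoint endomorphism and a vector\<close>

text \<open>The dimension 2 n enters only through \<open>dependent\<close>,
  \<open>orthogonal\<close> and \<open>system\<close>, all consequences of counting unknowns. Their
  index types are those of the families of vectors to which they are applied.\<close>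

locale symplectic = selfadj sc A om
  for sc :: "'k::field \<Rightarrow> 'v::ab_group_add \<Rightarrow> 'v" (infixr "\<star>" 75) and A :: "'v \<Rightarrow> 'v" and om :: "'v \<Rightarrow> 'v \<Rightarrow> 'k" +
  fixes V :: "'v set" and n :: nat
  assumes V_zero: "0 \<in> V" and V_diff: "u \<in> V \<Longrightarrow> v \<in> V \<Longrightarrow> u - v \<in> V"
    and V_sc: "u \<in> V \<Longrightarrow> c \<star> u \<in> V" and V_A: "u \<in> V \<Longrightarrow> A u \<in> V"
    and nondeg: "u \<in> V \<Longrightarrow> u \<noteq> 0 \<Longrightarrow> \<exists>v\<in>V. om u v = 1"
    and dependent: "\<And>(J :: (nat \<times> bool \<times> nat) set) w. finite J \<Longrightarrow> 2 * n < card J \<Longrightarrow> w ` J \<subseteq> V \<Longrightarrow>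
      \<exists>x. (\<exists>j\<in>J. x j \<noteq> 0) \<and> (\<Sum>j\<in>J. x j \<star> w j) = 0"
    and orthogonal: "\<And>(I :: (nat \<times> bool \<times> nat) set) w. finite I \<Longrightarrow> card I < 2 * n \<Longrightarrow>
      \<exists>u\<in>V. u \<noteq> 0 \<and> (\<forall>i\<in>I. om u (w i) = 0)"
    and system: "\<And>(I :: (nat \<times> bool) set) J a. finite I \<Longrightarrow> finite J \<Longrightarrow> card I < card J \<Longrightarrow>
      \<exists>x :: nat \<times> bool \<Rightarrow> 'k. (\<exists>j\<in>J. x j \<noteq> 0) \<and> (\<forall>i\<in>I. (\<Sum>j\<in>J. x j * a i j) = 0)"
begin

lemma V_add: "u \<in> V \<Longrightarrow> v \<in> V \<Longrightarrow> u + v \<in> V"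
  using V_diff[of u "0 - v"] V_diff[OF V_zero, of v] by simp

lemma V_sum: "(\<And>i. i \<in> I \<Longrightarrow> w i \<in> V) \<Longrightarrow> sum w I \<in> V"
  by (induction I rule: infinite_finite_induct) (auto intro: V_zero V_add)

lemma V_pw: "u \<in> V \<Longrightarrow> pw i u \<in> V"
  by (induction i) (auto intro: V_A)

lemma om_sum_sc: "om (\<Sum>p\<in>J. x p \<star> w p) v = (\<Sum>p\<in>J. x p * om (w p) v)"
  by (simp add: om_sum om_sc)

definition sg :: "bool \<Rightarrow> bool \<Rightarrow> 'k" where
  "sg b b' = (if b = b' then 0 else if b then 1 else - 1)"

text \<open>A frame consists of pairs \<open>e\<^sub>r = g r True\<close>, \<open>f\<^sub>r = g r False\<close> generating mutually orthogonal
  \<open>A\<close>-stable subspaces of dimension \<open>2 * ls ! r\<close>, in each of which \<open>A\<^sup>i e\<^sub>r\<close> is dual to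
  \<open>A\<^sup>l\<^sup>-\<^sup>1\<^sup>-\<^sup>i f\<^sub>r\<close>.\<close>

definition frame :: "nat list \<Rightarrow> (nat \<Rightarrow> bool \<Rightarrow> 'v) \<Rightarrow> bool" where
  "frame ls g \<longleftrightarrow> (\<forall>r<length ls. 0 < ls ! r \<and> (\<forall>b. g r b \<in> V \<and> pw (ls ! r) (g r b) = 0)) \<and>
     (\<forall>r<length ls. \<forall>s<length ls. \<forall>b b' i. om (pw i (g r b)) (g s b') = (if r = s \<and> i = ls ! r - 1 then sg b b' else 0))"

lemma frameD:
  assumes "frame ls g" "r < length ls"
  shows "0 < ls ! r" "g r b \<in> V" "pw (ls ! r) (g r b) = 0"
    "s < length ls \<Longrightarrow> om (pw i (g r b)) (g s b') = (if r = s \<and> i = ls ! r - 1 then sg b b' else 0)"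
  using assms by (auto simp: frame_def)

lemma pw_ge: "pw l u = 0 \<Longrightarrow> l \<le> i \<Longrightarrow> pw i u = 0"
  using pw_pw[of "i - l" l u] by simp

definition Js :: "nat list \<Rightarrow> (nat \<times> bool \<times> nat) set" where
  "Js ls = (SIGMA r:{..<length ls}. UNIV \<times> {..<ls ! r})"

lemma Js_finite: "finite (Js ls)" and card_Js: "card (Js ls) = 2 * sum_list ls"
proof -
  show "finite (Js ls)" by (simp add: Js_def)
  have "card (Js ls) = (\<Sum>r<length ls. 2 * ls ! r)" unfolding Js_def by (simp add: card_cartesian_product)
  thus "card (Js ls) = 2 * sum_list ls" by (simp add: sum_list_sum_nth sum_distrib_left atLeast0LessThan)
qed

abbreviation bas :: "(nat \<Rightarrow> bool \<Rightarrow> 'v) \<Rightarrow> nat \<times> bool \<times> nat \<Rightarrow> 'v" where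
  "bas g p \<equiv> pw (snd (snd p)) (g (fst p) (fst (snd p)))"

text \<open>Up to the sign \<open>ep\<close>, the dual family of \<open>bas g\<close> within a
  frame: the partner generator with the complementary power.\<close>

abbreviation dua :: "nat list \<Rightarrow> (nat \<Rightarrow> bool \<Rightarrow> 'v) \<Rightarrow> nat \<times> bool \<times> nat \<Rightarrow> 'v" where
  "dua ls g p \<equiv> pw (ls ! fst p - 1 - snd (snd p)) (g (fst p) (\<not> fst (snd p)))"

abbreviation ep :: "nat \<times> bool \<times> nat \<Rightarrow> 'k" where
  "ep p \<equiv> sg (fst (snd p)) (\<not> fst (snd p))"

lemma ep_ep [simp]: "ep p * ep p = 1" "ep p * (ep p * c) = c"
  by (auto simp: sg_def)

lemma ep_nonzero [simp]: "ep p \<noteq> 0"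
  by (simp add: sg_def)

lemma comb_pair:
  assumes g: "frame ls g" and q: "q \<in> Js ls"
  shows "om (\<Sum>p\<in>Js ls. x p \<star> bas g p) (dua ls g q) = x q * ep q"
proof -
  have "om (bas g p) (dua ls g q) = (if p = q then ep q else 0)" if p: "p \<in> Js ls" for p
  proof -
    obtain r b c s b' c' where pq: "p = (r, b, c)" "q = (s, b', c')" by (metis prod.collapse)
    have *: "r < length ls" "c < ls ! r" "s < length ls" "c' < ls ! s" using p q by (auto simp: Js_def pq)
    have "om (bas g p) (dua ls g q) = (if r = s \<and> c + (ls ! s - 1 - c') = ls ! r - 1 then sg b (\<not> b') else 0)"
      unfolding pq om_pw_pw using frameD(4)[OF g *(1,3)] by simp
    thus ?thesis using * by (auto simp: pq sg_def)
  qed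
  hence "om (\<Sum>p\<in>Js ls. x p \<star> bas g p) (dua ls g q) = (\<Sum>p\<in>Js ls. if p = q then x q * ep q else 0)"
    unfolding om_sum_sc by (intro sum.cong refl) auto
  thus ?thesis using q Js_finite by simp
qed

definition orth :: "nat list \<Rightarrow> (nat \<Rightarrow> bool \<Rightarrow> 'v) \<Rightarrow> 'v \<Rightarrow> bool" where
  "orth ls g u \<longleftrightarrow> (\<forall>r<length ls. \<forall>b i. om u (pw i (g r b)) = 0)"

lemma orthI:
  assumes g: "frame ls g" and u: "\<And>q. q \<in> Js ls \<Longrightarrow> om u (dua ls g q) = 0"
  shows "orth ls g u"
  unfolding orth_def
proof (intro allI impI)
  fix r b i assume r: "r < length ls"
  show "om u (pw i (g r b)) = 0"
  proof (cases "i < ls ! r")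
    case True
    thus ?thesis using u[of "(r, \<not> b, ls ! r - 1 - i)"] r by (simp add: Js_def)
  next
    case False
    thus ?thesis using pw_ge[OF frameD(3)[OF g r, of b], of i] by simp
  qed
qed

lemma frame_bas: "frame ls g \<Longrightarrow> p \<in> Js ls \<Longrightarrow> bas g p \<in> V"
  using frameD(2)[of ls g "fst p"] by (intro V_pw) (auto simp: Js_def)

lemma frame_sum_le:
  assumes "frame ls g"
  shows "sum_list ls \<le> n"
proof (rule ccontr)
  assume "\<not> sum_list ls \<le> n"
  hence c: "2 * n < card (Js ls)" by (simp add: card_Js)
  have im: "bas g ` Js ls \<subseteq> V" by (intro image_subsetI frame_bas[OF assms])
  obtain x where x: "\<exists>j\<in>Js ls. x j \<noteq> 0" "(\<Sum>p\<in>Js ls. x p \<star> bas g p) = 0" using dependent[OF Js_finite c im] by blast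
  have "x q * ep q = 0" if "q \<in> Js ls" for q using comb_pair[OF assms that, of x] by (simp add: x(2))
  thus False using x(1) by simp
qed

lemma orth_zero:
  assumes g: "frame ls g" and n: "sum_list ls = n" and u: "u \<in> V" "orth ls g u"
  shows "u = 0"
proof (rule ccontr)
  assume u0: "u \<noteq> 0"
  \<comment> \<open>An index outside the frame, for adjoining \<open>u\<close> to the basis; the
    enlarged family is too big to be independent.\<close>
  define z where "z = (length ls, True, 0 :: nat)"
  have z: "z \<notin> Js ls" by (simp add: z_def Js_def)
  define w where "w p = (if p = z then u else bas g p)" for p
  have "w ` insert z (Js ls) \<subseteq> V" using u frame_bas[OF g] by (auto simp: w_def)
  then obtain x where x: "\<exists>j\<in>insert z (Js ls). x j \<noteq> 0" "(\<Sum>p\<in>insert z (Js ls). x p \<star> w p) = 0"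
    using dependent[of "insert z (Js ls)" w] Js_finite z n by (auto simp: card_Js)
  have "(\<Sum>p\<in>Js ls. x p \<star> w p) = (\<Sum>p\<in>Js ls. x p \<star> bas g p)" using z by (intro sum.cong refl) (auto simp: w_def)
  hence 0: "x z \<star> u + (\<Sum>p\<in>Js ls. x p \<star> bas g p) = 0" using x(2) z Js_finite by (simp add: w_def)
  have xq: "x q = 0" if q: "q \<in> Js ls" for q
  proof -
    have "om (x z \<star> u + (\<Sum>p\<in>Js ls. x p \<star> bas g p)) (dua ls g q) = x q * ep q"
      unfolding om_add comb_pair[OF g q] using u(2) q by (auto simp: om_sc orth_def Js_def)
    thus ?thesis using 0 by simp
  qed
  hence "x z \<star> u = 0" "x z \<noteq> 0" using 0 x(1) by auto
  hence "inverse (x z) \<star> (x z \<star> u) = 1 \<star> u" unfolding sc_sc by simp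
  thus False using \<open>x z \<star> u = 0\<close> u0 by (simp add: sc_one)
qed

definition coe :: "nat list \<Rightarrow> (nat \<Rightarrow> bool \<Rightarrow> 'v) \<Rightarrow> 'v \<Rightarrow> nat \<times> bool \<times> nat \<Rightarrow> 'k" where
  "coe ls g u p = om u (dua ls g p) * ep p"

lemma orth_projection:
  assumes g: "frame ls g"
  shows "orth ls g (u - (\<Sum>p\<in>Js ls. coe ls g u p \<star> bas g p))"
  by (rule orthI[OF g]) (simp only: om_diff comb_pair[OF g] coe_def mult.assoc ep_ep mult_1_right, simp)

lemma frame_expand:
  assumes g: "frame ls g" and n: "sum_list ls = n" and u: "u \<in> V"
  shows "u = (\<Sum>p\<in>Js ls. coe ls g u p \<star> bas g p)"
proof -
  have "(\<Sum>p\<in>Js ls. coe ls g u p \<star> bas g p) \<in> V" by (intro V_sum V_sc frame_bas[OF g])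
  hence "u - (\<Sum>p\<in>Js ls. coe ls g u p \<star> bas g p) = 0"
    using orth_zero[OF g n _ orth_projection[OF g]] u V_diff by blast
  thus ?thesis by simp
qed

text \<open>The unwanted pairings are removed from the top down: subtracting a multiple of A^t f
  clears the pairing with A^(l-1-t) y without disturbing the higher ones, since A^l y = 0.\<close>

lemma adjust:
  assumes S: "\<And>u v. u \<in> S \<Longrightarrow> v \<in> S \<Longrightarrow> u - v \<in> S" "\<And>u c. u \<in> S \<Longrightarrow> c \<star> u \<in> S" "\<And>u. u \<in> S \<Longrightarrow> A u \<in> S"
    and h: "h \<in> S" "om (pw (l - 1) y) h = 1" and y: "pw l y = 0" and l: "0 < l"
  shows "\<exists>f\<in>S. \<forall>i. om (pw i y) f = (if i = l - 1 then 1 else 0)"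
proof -
  have "\<exists>f\<in>S. \<forall>i. l - t \<le> i \<longrightarrow> om (pw i y) f = (if i = l - 1 then 1 else 0)" if "1 \<le> t" "t \<le> l" for t using that
  proof (induction t rule: dec_induct)
    case base
    have z: "om (pw i y) h = 0" if "l \<le> i" for i using pw_ge[OF y that] by simp
    show ?case
    proof (intro bexI[of _ h] allI impI h(1))
      fix i assume "l - 1 \<le> i"
      hence "i = l - 1 \<or> l \<le> i \<and> i \<noteq> l - 1" using l by auto
      thus "om (pw i y) h = (if i = l - 1 then 1 else 0)" using h(2) z by auto
    qed
  next
    case (step t)
    then obtain f where f: "f \<in> S" "\<And>i. l - t \<le> i \<Longrightarrow> om (pw i y) f = (if i = l - 1 then 1 else 0)" by auto
    define c where "c = om (pw (l - Suc t) y) f"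
    have "pw t f \<in> S" by (induction t) (auto intro: f S(3))
    hence f': "f - c \<star> pw t f \<in> S" by (intro S f)
    have "om (pw i y) (f - c \<star> pw t f) = (if i = l - 1 then 1 else 0)" if i: "l - Suc t \<le> i" for i
    proof -
      have e: "om (pw i y) (f - c \<star> pw t f) = om (pw i y) f - c * om (pw (i + t) y) f"
        by (simp add: om_diff om_sc_right om_pw_pw)
      show ?thesis
      proof (cases "i = l - Suc t")
        case True
        hence "i + t = l - 1" "i \<noteq> l - 1" using step by auto
        thus ?thesis using f(2)[of "i + t"] step(1) unfolding e by (simp add: c_def True)
      next
        case False
        hence "l - t \<le> i" "l - t \<le> i + t" "i + t \<noteq> l - 1" using i step by auto
        thus ?thesis unfolding e by (simp add: f(2))
      qed
    qed
    thus ?case using f' by blast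
  qed
  from this[of l] l show ?thesis by auto
qed

text \<open>Let l be the least power of \<open>A\<close> killing the complement of the frame and e a
  vector there with A^(l-1) e nonzero: e and a suitable partner form a pair of length l. Passing the
  bound on makes the lengths descend.\<close>

lemma frame_extend:
  assumes g: "frame ls g" and n: "sum_list ls < n"
    and bound: "\<And>u. u \<in> V \<Longrightarrow> orth ls g u \<Longrightarrow> pw B u = 0"
  obtains l g' where "frame (ls @ [l]) g'" "l \<le> B" "\<And>u. u \<in> V \<Longrightarrow> orth (ls @ [l]) g' u \<Longrightarrow> pw l u = 0"
proof -
  let ?U = "{u \<in> V. orth ls g u}"
  let ?m = "length ls"
  have U1: "u - v \<in> ?U" if "u \<in> ?U" "v \<in> ?U" for u v using that V_diff by (auto simp: orth_def om_diff)
  have U2: "c \<star> u \<in> ?U" if "u \<in> ?U" for u c using that V_sc by (auto simp: orth_def om_sc)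
  have U3: "A u \<in> ?U" if "u \<in> ?U" for u
  proof -
    have "om (A u) (pw i w) = om u (pw (Suc i) w)" for i w by (simp add: om_adj)
    thus ?thesis using that V_A by (auto simp: orth_def simp del: funpow.simps)
  qed
  have Upw: "pw i u \<in> ?U" if "u \<in> ?U" for i u
  proof (induction i)
    case (Suc i)
    from U3[OF this] show ?case by simp
  qed (use that in simp)
  obtain u0 where u0: "u0 \<in> ?U" "u0 \<noteq> 0"
    using orthogonal[OF Js_finite, of ls "dua ls g"] n orthI[OF g] by (auto simp: card_Js)
  define l where "l = (LEAST l. \<forall>u\<in>?U. pw l u = 0)"
  have l: "\<forall>u\<in>?U. pw l u = 0" "l \<le> B"
  proof -
    have B: "\<forall>u\<in>?U. pw B u = 0" using bound by blast
    show "\<forall>u\<in>?U. pw l u = 0" unfolding l_def by (rule LeastI[of "\<lambda>l. \<forall>u\<in>?U. pw l u = 0", OF B])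
    show "l \<le> B" unfolding l_def by (rule Least_le[of "\<lambda>l. \<forall>u\<in>?U. pw l u = 0", OF B])
  qed
  have l0: "0 < l" using l(1) u0 by (cases l) auto
  hence "\<not> (\<forall>u\<in>?U. pw (l - 1) u = 0)" unfolding l_def by (intro not_less_Least) auto
  then obtain e where e: "e \<in> ?U" "pw (l - 1) e \<noteq> 0" by blast
  then obtain v where v: "v \<in> V" "om (pw (l - 1) e) v = 1" using nondeg Upw[of e "l - 1"] by blast
  \<comment> \<open>Projection to the complement of the frame; the pairing with A^(l-1) e is
    unaffected, as that vector is orthogonal to the frame.\<close>
  define h where "h = v - (\<Sum>p\<in>Js ls. coe ls g v p \<star> bas g p)"
  have "(\<Sum>p\<in>Js ls. coe ls g v p \<star> bas g p) \<in> V" by (intro V_sum V_sc frame_bas[OF g])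
  hence h: "h \<in> ?U" using orth_projection[OF g, of v] v V_diff by (simp add: h_def)
  have "om (pw (l - 1) e) (\<Sum>p\<in>Js ls. coe ls g v p \<star> bas g p) = 0"
    using Upw[OF e(1), of "l - 1"] unfolding om_sum om_sc_right
    by (intro sum.neutral ballI) (auto simp: orth_def Js_def)
  hence h1: "om (pw (l - 1) e) h = 1" using v(2) by (simp add: h_def om_diff)
  have "\<exists>f\<in>?U. \<forall>i. om (pw i e) f = (if i = l - 1 then 1 else 0)"
    by (rule adjust[OF U1 U2 U3 h h1]) (use l e l0 in auto)
  then obtain f where f: "f \<in> ?U" "\<And>i. om (pw i e) f = (if i = l - 1 then 1 else 0)" by blast
  define g' where "g' = g(?m := (\<lambda>b. if b then e else f))"
  have fe: "om (pw i f) e = - (if i = l - 1 then 1 else 0)" for i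
    using om_swap[of "pw i f" e] om_pw[of e i f] f(2)[of i] by simp
  have gU: "g' ?m b \<in> ?U" for b using e f by (simp add: g'_def)
  have cross: "om (pw i (g' ?m b)) (g r b') = 0" "om (pw i (g r b')) (g' ?m b) = 0" if "r < ?m" for i b r b'
  proof -
    have "orth ls g (pw i (g' ?m b))" using Upw[OF gU, of i b] by simp
    hence "om (pw i (g' ?m b)) (pw 0 (g r b')) = 0" using that unfolding orth_def by blast
    thus "om (pw i (g' ?m b)) (g r b') = 0" by simp
    show "om (pw i (g r b')) (g' ?m b) = 0" using gU[of b] that om_swap[of "pw i (g r b')" "g' ?m b"] by (auto simp: orth_def)
  qed
  have pm: "om (pw i (g' ?m b)) (g' ?m b') = (if i = l - 1 then sg b b' else 0)" for i b b'
    using f(2)[of i] fe[of i] by (auto simp: g'_def sg_def)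
  have g'r: "g' r = g r" if "r < ?m" for r using that by (simp add: g'_def)
  have "frame (ls @ [l]) g'" unfolding frame_def
  proof (intro conjI allI impI)
    fix r b assume "r < length (ls @ [l])"
    then consider "r < ?m" | "r = ?m" by fastforce
    thus "0 < (ls @ [l]) ! r" "g' r b \<in> V" "pw ((ls @ [l]) ! r) (g' r b) = 0"
      using frameD(1-3)[OF g, of r] gU l0 l(1) by (cases; simp add: nth_append g'r)+
  next
    fix r s b b' i assume "r < length (ls @ [l])" "s < length (ls @ [l])"
    hence "r < ?m \<or> r = ?m" "s < ?m \<or> s = ?m" by auto
    thus "om (pw i (g' r b)) (g' s b') = (if r = s \<and> i = (ls @ [l]) ! r - 1 then sg b b' else 0)"
      using frameD(4)[OF g, of r s] cross pm by (elim disjE) (simp_all add: nth_append g'r)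
  qed
  moreover have "pw l u = 0" if u: "u \<in> V" "orth (ls @ [l]) g' u" for u
  proof -
    have "orth ls g u" unfolding orth_def
    proof (intro allI impI)
      fix r b i assume "r < ?m"
      thus "om u (pw i (g r b)) = 0" using u(2) g'r[of r] unfolding orth_def by (metis length_append_singleton less_SucI)
    qed
    thus ?thesis using l(1) u(1) by simp
  qed
  ultimately show thesis using that l(2) by blast
qed

lemma frame_exists:
  assumes nil: "\<And>u. u \<in> V \<Longrightarrow> pw d u = 0"
  obtains ls g where "frame ls g" "sum_list ls = n" "sorted_wrt (\<ge>) ls"
proof -
  have "\<exists>ls' g'. frame ls' g' \<and> sum_list ls' = n \<and> sorted_wrt (\<ge>) ls'"
    if "frame ls g" "sorted_wrt (\<ge>) ls" "\<forall>l\<in>set ls. B \<le> l" "\<And>u. u \<in> V \<Longrightarrow> orth ls g u \<Longrightarrow> pw B u = 0" for ls g B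
    using that
  proof (induction "n - sum_list ls" arbitrary: ls g B rule: less_induct)
    case less
    show ?case
    proof (cases "sum_list ls = n")
      case True
      thus ?thesis using less.prems by blast
    next
      case False
      hence lt: "sum_list ls < n" using frame_sum_le[OF less.prems(1)] by simp
      obtain l g' where *: "frame (ls @ [l]) g'" "l \<le> B" "\<And>u. u \<in> V \<Longrightarrow> orth (ls @ [l]) g' u \<Longrightarrow> pw l u = 0"
        using frame_extend[OF less.prems(1) lt less.prems(4)] by blast
      have "0 < l" using frameD(1)[OF *(1), of "length ls"] by simp
      hence "n - sum_list (ls @ [l]) < n - sum_list ls" using lt by simp
      moreover have "sorted_wrt (\<ge>) (ls @ [l])" "\<forall>l'\<in>set (ls @ [l]). l \<le> l'"
        using less.prems(2,3) *(2) by (auto simp: sorted_wrt_append)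
      ultimately show ?thesis using less.hyps[OF _ *(1) _ _ *(3)] by blast
    qed
  qed
  from this[of "[]" undefined d] nil that show thesis by (auto simp: frame_def)
qed

subsection \<open>Position of a vector\<close>

text \<open>For a full frame this is the span of the pair number \<open>r\<close> under
  \<open>A\<close>. Equations describe it in order to make its stability under \<open>A\<close>
  evident.\<close>

definition blk :: "nat list \<Rightarrow> (nat \<Rightarrow> bool \<Rightarrow> 'v) \<Rightarrow> nat \<Rightarrow> 'v set" where
  "blk ls g r = {u \<in> V. pw (ls ! r) u = 0 \<and> (\<forall>s<length ls. s \<noteq> r \<longrightarrow> (\<forall>b i. om u (pw i (g s b)) = 0))}"

lemma blk_closed:
  "u \<in> blk ls g r \<Longrightarrow> v \<in> blk ls g r \<Longrightarrow> u - v \<in> blk ls g r"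
  "u \<in> blk ls g r \<Longrightarrow> c \<star> u \<in> blk ls g r" "u \<in> blk ls g r \<Longrightarrow> A u \<in> blk ls g r"
proof -
  assume u: "u \<in> blk ls g r"
  have "om (A u) (pw i w) = om u (pw (Suc i) w)" for i w by (simp add: om_adj)
  moreover have "pw (ls ! r) (A u) = A (pw (ls ! r) u)" by (simp add: funpow_swap1)
  ultimately show "A u \<in> blk ls g r" using u V_A by (auto simp: blk_def simp del: funpow.simps)
qed (auto simp: blk_def om_diff om_sc pw_diff pw_sc V_diff V_sc)

lemma blk_zero: "0 \<in> blk ls g r"
  by (simp add: blk_def V_zero)

lemma blk_sum: "(\<And>i. i \<in> I \<Longrightarrow> w i \<in> blk ls g r) \<Longrightarrow> sum w I \<in> blk ls g r"
proof (induction I rule: infinite_finite_induct)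
  case (insert i I)
  have "w i - (0 - sum w I) \<in> blk ls g r" using insert by (intro blk_closed(1) blk_zero) auto
  thus ?case using insert by simp
qed (auto intro: blk_zero)

lemma blk_pw: "u \<in> blk ls g r \<Longrightarrow> pw i u \<in> blk ls g r"
  by (induction i) (auto intro: blk_closed)

lemma frame_blk: "frame ls g \<Longrightarrow> r < length ls \<Longrightarrow> g r b \<in> blk ls g r"
  using frameD[of ls g r] frameD(4)[of ls g r] by (auto simp: blk_def om_pw)

lemma blk_expand:
  assumes g: "frame ls g" and n: "sum_list ls = n" and r: "r < length ls" and u: "u \<in> blk ls g r"
  shows "u = (\<Sum>q\<in>UNIV \<times> {..<ls ! r}. coe ls g u (r, q) \<star> bas g (r, q))"
proof -
  have "u = (\<Sum>p\<in>Js ls. coe ls g u p \<star> bas g p)" by (rule frame_expand[OF g n]) (use u in \<open>simp add: blk_def\<close>)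
  also have "\<dots> = (\<Sum>p\<in>Pair r ` (UNIV \<times> {..<ls ! r}). coe ls g u p \<star> bas g p)"
  proof (rule sum.mono_neutral_right[OF Js_finite])
    show "\<forall>p\<in>Js ls - Pair r ` (UNIV \<times> {..<ls ! r}). coe ls g u p \<star> bas g p = 0"
    proof
      fix p assume p: "p \<in> Js ls - Pair r ` (UNIV \<times> {..<ls ! r})"
      hence "fst p < length ls" "fst p \<noteq> r" by (auto simp: Js_def image_iff)
      thus "coe ls g u p \<star> bas g p = 0" using u by (simp add: coe_def blk_def)
    qed
  qed (use r in \<open>auto simp: Js_def\<close>)
  also have "\<dots> = (\<Sum>q\<in>UNIV \<times> {..<ls ! r}. coe ls g u (r, q) \<star> bas g (r, q))"
    by (subst sum.reindex) (auto simp: inj_on_def)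
  finally show ?thesis .
qed

lemma blk_orth:
  assumes g: "frame ls g" "sum_list ls = n" and rs: "r < length ls" "s < length ls" "r \<noteq> s"
    and uv: "u \<in> blk ls g r" "v \<in> blk ls g s"
  shows "om u v = 0"
proof -
  have "om v (bas g (r, q)) = 0" for q using uv(2) rs by (auto simp: blk_def)
  hence "om (bas g (r, q)) v = 0" for q using om_swap[of "bas g (r, q)" v] by simp
  thus ?thesis by (subst blk_expand[OF g rs(1) uv(1)]) (simp add: om_sum om_sc)
qed

text \<open>The hypothesis kills the coefficients of the two generators themselves, so only terms
  with a positive power of \<open>A\<close> remain.\<close>

lemma blk_div:
  assumes g: "frame ls g" "sum_list ls = n" and r: "r < length ls" and u: "u \<in> blk ls g r"
    and 0: "\<And>b. om (pw (ls ! r - 1) u) (g r b) = 0"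
  shows "\<exists>v\<in>blk ls g r. u = A v"
proof
  let ?l = "ls ! r"
  let ?t = "\<lambda>q. coe ls g u (r, q) \<star> pw (snd q - 1) (g r (fst q))"
  let ?v = "\<Sum>q\<in>UNIV \<times> {1..<?l}. ?t q"
  show "?v \<in> blk ls g r" by (intro blk_sum blk_closed(2) blk_pw frame_blk[OF g(1) r])
  have "u = (\<Sum>q\<in>UNIV \<times> {..<?l}. coe ls g u (r, q) \<star> bas g (r, q))" by (rule blk_expand[OF g r u])
  also have "\<dots> = (\<Sum>q\<in>UNIV \<times> {1..<?l}. coe ls g u (r, q) \<star> bas g (r, q))"
  proof (rule sum.mono_neutral_right)
    show "\<forall>q\<in>UNIV \<times> {..<?l} - UNIV \<times> {1..<?l}. coe ls g u (r, q) \<star> bas g (r, q) = 0"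
    proof
      fix q :: "bool \<times> nat" assume "q \<in> UNIV \<times> {..<?l} - UNIV \<times> {1..<?l}"
      hence "snd q = 0" by (cases q) auto
      thus "coe ls g u (r, q) \<star> bas g (r, q) = 0" using 0 by (simp add: coe_def om_pw)
    qed
  qed auto
  also have "\<dots> = A ?v" unfolding A_sum
  proof (intro sum.cong refl)
    fix q :: "bool \<times> nat" assume "q \<in> UNIV \<times> {1..<?l}"
    then obtain c where "snd q = Suc c" by (cases "snd q") auto
    thus "coe ls g u (r, q) \<star> bas g (r, q) = A (?t q)" by (simp add: A_sc)
  qed
  finally show "u = A ?v" .
qed

lemma frame_change:
  assumes g: "frame ls g" "sum_list ls = n"
    and g': "\<And>r b. r < length ls \<Longrightarrow> g' r b \<in> blk ls g r"
    and p: "\<And>r i. r < length ls \<Longrightarrow> om (pw i (g' r True)) (g' r False) = (if i = ls ! r - 1 then 1 else 0)"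
  shows "frame ls g'"
  unfolding frame_def
proof (intro conjI allI impI)
  fix r b assume r: "r < length ls"
  show "0 < ls ! r" by (rule frameD(1)[OF g(1) r])
  show "g' r b \<in> V" "pw (ls ! r) (g' r b) = 0" using g'[OF r, of b] by (auto simp: blk_def)
next
  fix r s b b' i assume rs: "r < length ls" "s < length ls"
  show "om (pw i (g' r b)) (g' s b') = (if r = s \<and> i = ls ! r - 1 then sg b b' else 0)"
  proof (cases "r = s")
    case False
    thus ?thesis using blk_orth[OF g rs False blk_pw[OF g'[OF rs(1)]] g'[OF rs(2)]] by simp
  next
    case True
    have "om (pw i (g' r False)) (g' r True) = - om (pw i (g' r True)) (g' r False)"
      using om_swap[of "pw i (g' r False)" "g' r True"] by (simp add: om_pw)
    thus ?thesis using True p[OF rs(1), of i] by (cases b; cases b') (auto simp: sg_def)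
  qed
qed

definition vec_of :: "(nat \<Rightarrow> bool \<Rightarrow> 'v) \<Rightarrow> nat list \<Rightarrow> 'v" where
  "vec_of g as = (\<Sum>r<length as. pw (as ! r) (g r True))"

definition typed :: "'v \<Rightarrow> nat list \<Rightarrow> nat list \<Rightarrow> bool" where
  "typed x ls as \<longleftrightarrow> sum_list ls = n \<and> length as = length ls \<and> (\<forall>r<length ls. as ! r \<le> ls ! r) \<and>
     (\<exists>g. frame ls g \<and> x = vec_of g as)"

text \<open>In each block the component of \<open>x\<close> is A^a y with a maximal. Then y is not
  divisible by \<open>A\<close> in the block, so it pairs nontrivially in top degree and can replace
  the generator e_r.\<close>

lemma typed_exists:
  assumes g: "frame ls g" "sum_list ls = n" and x: "x \<in> V"
  shows "\<exists>as. typed x ls as"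
proof -
  have pair: "\<exists>a e f. a \<le> ls ! r \<and> e \<in> blk ls g r \<and> f \<in> blk ls g r \<and> z = pw a e \<and>
      (\<forall>i. om (pw i e) f = (if i = ls ! r - 1 then 1 else 0))" if r: "r < length ls" and z: "z \<in> blk ls g r" for r z
  proof -
    let ?l = "ls ! r"
    have l: "0 < ?l" by (rule frameD(1)[OF g(1) r])
    \<comment> \<open>The bound by the length matters for a zero component, which is divisible by
      every power; it receives the exponent l.\<close>
    define a where "a = (GREATEST a. a \<le> ?l \<and> (\<exists>y\<in>blk ls g r. z = pw a y))"
    have "0 \<le> ?l \<and> (\<exists>y\<in>blk ls g r. z = pw 0 y)" using z by auto
    hence a: "a \<le> ?l \<and> (\<exists>y\<in>blk ls g r. z = pw a y)" unfolding a_def by (rule GreatestI_nat) auto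
    have amax: "a' \<le> a" if "a' \<le> ?l \<and> (\<exists>y\<in>blk ls g r. z = pw a' y)" for a'
      unfolding a_def using that by (rule Greatest_le_nat) auto
    show ?thesis
    proof (cases "a = ?l")
      case True
      have "z = pw a (g r True)" using a True frameD(3)[OF g(1) r, of True] by (auto simp: blk_def)
      thus ?thesis using True frame_blk[OF g(1) r] frameD(4)[OF g(1) r r, of _ True False]
        by (intro exI[of _ a] exI[of _ "g r True"] exI[of _ "g r False"]) (auto simp: sg_def)
    next
      case False
      obtain y where y: "y \<in> blk ls g r" "z = pw a y" using a by blast
      have "\<exists>b. om (pw (?l - 1) y) (g r b) \<noteq> 0"
      proof (rule ccontr)
        assume "\<not> ?thesis"
        then obtain v where v: "v \<in> blk ls g r" "y = A v" using blk_div[OF g r y(1)] by blast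
        hence "z = pw (Suc a) v" using y(2) by (simp add: funpow_swap1)
        thus False using amax[of "Suc a"] v(1) a False by auto
      qed
      then obtain b where b: "om (pw (?l - 1) y) (g r b) \<noteq> 0" by blast
      define h where "h = inverse (om (pw (?l - 1) y) (g r b)) \<star> g r b"
      have "\<exists>f\<in>blk ls g r. \<forall>i. om (pw i y) f = (if i = ?l - 1 then 1 else 0)"
      proof (rule adjust)
        show "h \<in> blk ls g r" unfolding h_def by (intro blk_closed(2) frame_blk[OF g(1) r])
        show "om (pw (?l - 1) y) h = 1" using b by (simp add: h_def om_sc_right)
        show "pw ?l y = 0" using y(1) by (simp add: blk_def)
      qed (use l blk_closed in auto)
      thus ?thesis using a y by blast
    qed
  qed
  define z where "z r = (\<Sum>q\<in>UNIV \<times> {..<ls ! r}. coe ls g x (r, q) \<star> bas g (r, q))" for r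
  have zb: "z r \<in> blk ls g r" if "r < length ls" for r
    unfolding z_def by (intro blk_sum blk_closed(2)) (auto intro!: blk_pw frame_blk[OF g(1) that])
  have xz: "x = (\<Sum>r<length ls. z r)"
  proof -
    have "(\<Sum>p\<in>Js ls. coe ls g x p \<star> bas g p) = (\<Sum>r<length ls. z r)"
      unfolding Js_def z_def by (subst sum.Sigma) (auto simp: split_beta intro!: sum.cong)
    with frame_expand[OF g x] show ?thesis by (simp only:)
  qed
  define Q where "Q r a e f \<longleftrightarrow> a \<le> ls ! r \<and> e \<in> blk ls g r \<and> f \<in> blk ls g r \<and> z r = pw a e \<and>
      (\<forall>i. om (pw i e) f = (if i = ls ! r - 1 then 1 else 0))" for r a e f
  have "\<exists>a e f. Q r a e f" if "r < length ls" for r using pair[OF that zb[OF that]] unfolding Q_def .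
  then obtain a e f where "\<And>r. r < length ls \<Longrightarrow> Q r (a r) (e r) (f r)" by metis
  hence aef: "a r \<le> ls ! r" "e r \<in> blk ls g r" "f r \<in> blk ls g r" "z r = pw (a r) (e r)"
    "om (pw i (e r)) (f r) = (if i = ls ! r - 1 then 1 else 0)" if "r < length ls" for r i
    using that unfolding Q_def by blast+
  let ?g = "\<lambda>r b. if b then e r else f r"
  have "frame ls ?g" by (rule frame_change[OF g]) (auto simp: aef)
  moreover have "x = vec_of ?g (map a [0..<length ls])"
    unfolding xz vec_of_def by (auto simp: aef(4) intro!: sum.cong)
  ultimately show ?thesis using g(2) aef(1) by (intro exI[of _ "map a [0..<length ls]"]) (auto simp: typed_def)
qed

end

subsection \<open>Saturated types\<close>

text \<open>A shear between the blocks r and s can lower a_r to a_s + max(0, l_r - l_s); a saturated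
  list admits no such lowering. The truncated subtraction supplies the maximum.\<close>

definition saturated :: "nat list \<Rightarrow> nat list \<Rightarrow> bool" where
  "saturated ls as \<longleftrightarrow> (\<forall>r<length ls. \<forall>s<length ls. as ! r \<le> as ! s + (ls ! r - ls ! s))"

context symplectic
begin

lemma pw_minus: "pw i (- u) = - pw i u"
  using pw_diff[of i 0 u] by simp

text \<open>Replacing \<open>e\<^sub>s\<close> by \<open>e\<^sub>s + A\<^sup>c e\<^sub>r\<close> forces \<open>f\<^sub>r\<close> to become \<open>f\<^sub>r - A\<^sup>c\<^sup>' f\<^sub>s\<close>; the exponents are the
  least ones allowed by the lengths of the two blocks.\<close>

lemma frame_shear:
  assumes g: "frame ls g" and rs: "r < length ls" "s < length ls" "r \<noteq> s"
  shows "frame ls (\<lambda>t b. if t = s \<and> b then g s True + pw (ls ! r - ls ! s) (g r True)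
    else if t = r \<and> \<not> b then g r False - pw (ls ! s - ls ! r) (g s False) else g t b)" (is "frame ls ?h")
proof -
  define c where "c = ls ! r - ls ! s"
  define c' where "c' = ls ! s - ls ! r"
  define \<delta> where "\<delta> t b = (if t = s \<and> b then pw c (g r True) else if t = r \<and> \<not> b then - pw c' (g s False) else 0)" for t b
  have h: "?h t b = g t b + \<delta> t b" for t b using rs by (auto simp: \<delta>_def c_def c'_def)
  note G = frameD(4)[OF g]
  have pos: "0 < ls ! r" "0 < ls ! s" using frameD(1)[OF g] rs by auto
  have E: "i + c = ls ! r - 1 \<longleftrightarrow> i + c' = ls ! s - 1" for i using pos by (auto simp: c_def c'_def)
  show ?thesis unfolding frame_def
  proof (intro conjI allI impI)
    fix t b assume t: "t < length ls"
    show "0 < ls ! t" by (rule frameD(1)[OF g t])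
    show "?h t b \<in> V" using frameD(2)[OF g] t rs by (auto intro!: V_add V_diff V_pw)
    have "pw (ls ! s) (pw c (g r True)) = 0"
      unfolding pw_pw by (rule pw_ge[OF frameD(3)[OF g rs(1)]]) (simp add: c_def)
    moreover have "pw (ls ! r) (pw c' (g s False)) = 0"
      unfolding pw_pw by (rule pw_ge[OF frameD(3)[OF g rs(2)]]) (simp add: c'_def)
    ultimately have "pw (ls ! t) (\<delta> t b) = 0" by (simp add: \<delta>_def pw_minus)
    thus "pw (ls ! t) (?h t b) = 0" unfolding h pw_add using frameD(3)[OF g t] by simp
  next
    fix t t' b b' i assume t: "t < length ls" "t' < length ls"
    let ?c = "i + c = ls ! r - 1"
    let ?C = "(t = s \<and> b \<and> t' = r \<and> \<not> b' \<or> t = r \<and> \<not> b \<and> t' = s \<and> b') \<and> ?c"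
    have "om (pw i (?h t b)) (?h t' b') = om (pw i (g t b)) (g t' b') + om (pw i (\<delta> t b)) (g t' b')
        + om (pw i (g t b)) (\<delta> t' b') + om (pw i (\<delta> t b)) (\<delta> t' b')"
      unfolding h by (simp add: pw_add om_add om_add_right add_ac)
    moreover have "om (pw i (\<delta> t b)) (\<delta> t' b') = 0"
      using rs by (simp add: \<delta>_def om_minus pw_pw om_pw_pw sg_def pw_minus
        G[OF rs(1) rs(2)] G[OF rs(2) rs(1)] G[OF rs(1) rs(1)] G[OF rs(2) rs(2)])
    moreover have "om (pw i (\<delta> t b)) (g t' b') =
        (if ?C then 1 else 0)"
    proof -
      have "om (pw i (pw c (g r True))) (g t' b') = (if t' = r \<and> \<not> b' \<and> ?c then 1 else 0)"
        unfolding pw_pw G[OF rs(1) t(2)] by (auto simp: sg_def)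
      moreover have "om (pw i (- pw c' (g s False))) (g t' b') = (if t' = s \<and> b' \<and> ?c then 1 else 0)"
        unfolding pw_minus om_minus pw_pw G[OF rs(2) t(2)] E by (auto simp: sg_def)
      ultimately show ?thesis using rs(3) by (auto simp: \<delta>_def)
    qed
    moreover have "om (pw i (g t b)) (\<delta> t' b') =
        - (if ?C then 1 else 0)"
    proof -
      have "om (pw i (g t b)) (pw c (g r True)) = - (if t = r \<and> \<not> b \<and> ?c then 1 else 0)"
        unfolding om_pw_pw G[OF t(1) rs(1)] by (auto simp: sg_def)
      moreover have "om (pw i (g t b)) (- pw c' (g s False)) = - (if t = s \<and> b \<and> ?c then 1 else 0)"
        unfolding om_minus om_pw_pw G[OF t(1) rs(2)] E by (auto simp: sg_def)
      ultimately show ?thesis using rs(3) by (auto simp: \<delta>_def)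
    qed
    ultimately show "om (pw i (?h t b)) (?h t' b') = (if t = t' \<and> i = ls ! t - 1 then sg b b' else 0)"
      using G[OF t] by (simp only: add_0_right add_uminus_conv_diff add_diff_cancel_right')
  qed
qed

text \<open>After the shear, rewriting A^(a_s) e_s leaves the term A^(a_r) e_r - A^(a_s+c) e_r in
  the block r. This is A^(a_s+c) applied to A^d e_r - e_r, which again generates the block.\<close>

lemma saturate_step:
  assumes g: "frame ls g" "sum_list ls = n" and l: "length as = length ls" "\<forall>r<length ls. as ! r \<le> ls ! r"
    and rs: "r < length ls" "s < length ls" and less: "as ! s + (ls ! r - ls ! s) < as ! r"
  shows "\<exists>g'. frame ls g' \<and> vec_of g as = vec_of g' (as[r := as ! s + (ls ! r - ls ! s)])"
proof -
  have ne: "r \<noteq> s" using less by auto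
  define c where "c = ls ! r - ls ! s"
  define h where "h t b = (if t = s \<and> b then g s True + pw c (g r True)
    else if t = r \<and> \<not> b then g r False - pw (ls ! s - ls ! r) (g s False) else g t b)" for t b
  have h: "frame ls h" unfolding h_def c_def by (rule frame_shear[OF g(1) rs ne])
  define d where "d = as ! r - (as ! s + c)"
  have d: "0 < d" "as ! s + c + d = as ! r" using less by (auto simp: d_def c_def)
  have hr: "h r True = g r True" using ne by (simp add: h_def)
  \<comment> \<open>The new e_r. Up to sign it differs from the old one by a positive power of
    \<open>A\<close>, so its pairing in top degree stays a unit.\<close>
  define y where "y = pw d (g r True) - g r True"
  have y: "y \<in> blk ls h r" unfolding y_def hr[symmetric] by (intro blk_closed(1) blk_pw frame_blk[OF h rs(1)])
  have l0: "0 < ls ! r" by (rule frameD(1)[OF g(1) rs(1)])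
  have "\<exists>f\<in>blk ls h r. \<forall>i. om (pw i y) f = (if i = ls ! r - 1 then 1 else 0)"
  proof (rule adjust[OF _ _ _ _ _ _ l0])
    show "0 - h r False \<in> blk ls h r" by (intro blk_closed(1) blk_zero frame_blk[OF h rs(1)])
    have "om (pw (ls ! r - 1) y) (h r False) = - 1" unfolding y_def hr[symmetric] using d(1) l0
      by (simp add: pw_diff om_diff pw_pw frameD(4)[OF h rs(1) rs(1)] sg_def)
    thus "om (pw (ls ! r - 1) y) (0 - h r False) = 1" by (simp add: om_minus)
    show "pw (ls ! r) y = 0" using y by (simp add: blk_def)
  qed (auto intro: blk_closed)
  then obtain f where f: "f \<in> blk ls h r" "\<And>i. om (pw i y) f = (if i = ls ! r - 1 then 1 else 0)" by blast
  define g' where "g' t b = (if t = r then if b then y else f else h t b)" for t b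
  have "frame ls g'"
  proof (rule frame_change[OF h g(2)])
    show "g' t b \<in> blk ls h t" if "t < length ls" for t b using y f(1) frame_blk[OF h that] by (auto simp: g'_def)
    show "om (pw i (g' t True)) (g' t False) = (if i = ls ! t - 1 then 1 else 0)" if "t < length ls" for t i
      using f(2) frameD(4)[OF h that that, of i True False] by (auto simp: g'_def sg_def)
  qed
  moreover have "vec_of g as = vec_of g' (as[r := as ! s + c])"
  proof -
    let ?E = "pw (as ! s + c) (g r True)"
    have "pw (as[r := as ! s + c] ! t) (g' t True) = pw (as ! t) (g t True) + (if t = s then ?E else 0) - (if t = r then ?E else 0)"
      if "t < length as" for t
    proof -
      consider "t = r" | "t = s" "t \<noteq> r" | "t \<noteq> s" "t \<noteq> r" by blast
      thus ?thesis using that ne d(2) by cases (simp_all add: g'_def h_def y_def pw_diff pw_add pw_pw)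
    qed
    hence "vec_of g' (as[r := as ! s + c]) =
        (\<Sum>t<length as. pw (as ! t) (g t True) + (if t = s then ?E else 0) - (if t = r then ?E else 0))"
      unfolding vec_of_def by (intro sum.cong) auto
    thus ?thesis using rs l(1) by (simp add: sum_subtractf sum.distrib vec_of_def)
  qed
  ultimately show ?thesis unfolding c_def by blast
qed

lemma saturated_exists:
  assumes "typed x ls as"
  shows "\<exists>as'. typed x ls as' \<and> saturated ls as'"
  using assms
proof (induction "sum_list as" arbitrary: as rule: less_induct)
  case less
  show ?case
  proof (cases "saturated ls as")
    case False
    then obtain r s where rs: "r < length ls" "s < length ls" "as ! s + (ls ! r - ls ! s) < as ! r"
      by (auto simp: saturated_def not_le)
    obtain g where g: "frame ls g" "sum_list ls = n" "length as = length ls" "\<forall>r<length ls. as ! r \<le> ls ! r" "x = vec_of g as"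
      using less.prems by (auto simp: typed_def)
    let ?as = "as[r := as ! s + (ls ! r - ls ! s)]"
    have "typed x ls ?as" using saturate_step[OF g(1-4) rs] g rs by (auto simp: typed_def nth_list_update)
    moreover have "sum_list ?as < sum_list as"
      using rs g(3) elem_le_sum_list[of r as] by (simp add: sum_list_update)
    ultimately show ?thesis using less.hyps by blast
  qed (use less.prems in blast)
qed

subsection \<open>Uniqueness of the type\<close>

text \<open>The count is half the dimension of the kernel of \<open>A\<close> intersected with the
  image of A^k. If one frame had more such blocks, a nonzero vector of this intersection would be
  orthogonal to the whole other frame.\<close>

lemma frame_count_le:
  assumes g: "frame ls g" "sum_list ls = n" and g': "frame ls' g'" "sum_list ls' = n"
  shows "card {r. r < length ls \<and> k < ls ! r} \<le> card {r. r < length ls' \<and> k < ls' ! r}"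
proof (rule ccontr)
  let ?R = "{r. r < length ls \<and> k < ls ! r}" and ?R' = "{r. r < length ls' \<and> k < ls' ! r}"
  let ?J = "?R \<times> (UNIV :: bool set)" and ?I = "?R' \<times> (UNIV :: bool set)"
  assume "\<not> card ?R \<le> card ?R'"
  hence "card ?I < card ?J" by (simp add: card_cartesian_product)
  moreover have "finite ?I" "finite ?J" by auto
  ultimately obtain x where x: "\<exists>j\<in>?J. x j \<noteq> 0"
    "\<forall>i\<in>?I. (\<Sum>j\<in>?J. x j * om (pw (ls ! fst j - 1) (g (fst j) (snd j))) (g' (fst i) (snd i))) = 0"
    using system[of ?I ?J "\<lambda>i j. om (pw (ls ! fst j - 1) (g (fst j) (snd j))) (g' (fst i) (snd i))"] by blast
  define w where "w j = pw (ls ! fst j - 1) (g (fst j) (snd j))" for j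
  define u where "u = (\<Sum>j\<in>?J. x j \<star> w j)"
  have uV: "u \<in> V" unfolding u_def w_def using frameD(2)[OF g(1)] by (intro V_sum V_sc V_pw) auto
  have Aw: "A (w j) = 0" if "j \<in> ?J" for j
    using that frameD(3)[OF g(1), of "fst j" "snd j"] frameD(1)[OF g(1), of "fst j"]
    by (cases "ls ! fst j") (auto simp: w_def)
  have Au: "A u = 0" unfolding u_def A_sum by (intro sum.neutral ballI) (simp only: A_sc Aw sc_zero)
  have "w j = pw k (pw (ls ! fst j - 1 - k) (g (fst j) (snd j)))" if "j \<in> ?J" for j
    using that by (auto simp: w_def pw_pw)
  hence uk: "u = pw k (\<Sum>j\<in>?J. x j \<star> pw (ls ! fst j - 1 - k) (g (fst j) (snd j)))"
    unfolding u_def pw_sum by (intro sum.cong refl) (simp add: pw_sc)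
  have "orth ls' g' u" unfolding orth_def
  proof (intro allI impI)
    fix r b i assume r: "r < length ls'"
    show "om u (pw i (g' r b)) = 0"
    proof (cases i)
      case (Suc i')
      hence "pw i u = 0" using Au by (simp add: funpow_swap1)
      thus ?thesis by (simp add: om_pw)
    next
      case 0
      show ?thesis
      proof (cases "k < ls' ! r")
        case True
        thus ?thesis using x(2)[rule_format, of "(r, b)"] r 0 by (simp add: u_def om_sum om_sc w_def)
      next
        case False
        hence "pw k (g' r b) = 0" using pw_ge[OF frameD(3)[OF g'(1) r]] by simp
        thus ?thesis using 0 by (subst uk) (simp add: om_pw[symmetric])
      qed
    qed
  qed
  hence u0: "u = 0" by (rule orth_zero[OF g' uV])
  obtain r b where rb: "r < length ls" "k < ls ! r" "x (r, b) \<noteq> 0" using x(1) by auto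
  have "om (w j) (g r (\<not> b)) = (if j = (r, b) then sg b (\<not> b) else 0)" if "j \<in> ?J" for j
    using that frameD(4)[OF g(1), of "fst j" r "ls ! fst j - 1" "snd j" "\<not> b"] rb
    by (cases j) (auto simp: w_def sg_def)
  hence "om u (g r (\<not> b)) = (\<Sum>j\<in>?J. if j = (r, b) then x j * sg b (\<not> b) else 0)"
    unfolding u_def om_sum om_sc by (intro sum.cong refl) simp
  also have "\<dots> = x (r, b) * sg b (\<not> b)" using rb by (subst sum.delta) auto
  finally show False using u0 rb by (simp add: sg_def split: if_splits)
qed

end

lemma sorted_count_unique:
  assumes "sorted_wrt (\<ge>) xs" "sorted_wrt (\<ge>) (ys :: nat list)" "\<forall>x\<in>set xs. 0 < x" "\<forall>y\<in>set ys. 0 < y"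
    and eq: "\<And>k. card {r. r < length xs \<and> k < xs ! r} = card {r. r < length ys \<and> k < ys ! r}"
  shows "xs = ys"
proof -
  have c: "count (mset zs) (Suc k) = card {r. r < length zs \<and> k < zs ! r} - card {r. r < length zs \<and> Suc k < zs ! r}" for zs k
  proof -
    have "count (mset zs) (Suc k) = card {r. r < length zs \<and> zs ! r = Suc k}"
      by (simp add: count_mset count_list_eq_length_filter length_filter_conv_card eq_commute)
    also have "{r. r < length zs \<and> zs ! r = Suc k} = {r. r < length zs \<and> k < zs ! r} - {r. r < length zs \<and> Suc k < zs ! r}"
      by auto
    also have "card \<dots> = card {r. r < length zs \<and> k < zs ! r} - card {r. r < length zs \<and> Suc k < zs ! r}"
      by (intro card_Diff_subset) auto
    finally show ?thesis .
  qed
  have "count (mset xs) v = count (mset ys) v" for v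
  proof (cases v)
    case 0
    hence "v \<notin># mset xs" "v \<notin># mset ys" using assms by auto
    hence "count (mset xs) v = 0" "count (mset ys) v = 0" unfolding not_in_iff .
    thus ?thesis by (simp only:)
  qed (simp add: c eq)
  hence "mset (rev xs) = mset (rev ys)" by (simp add: multiset_eq_iff)
  moreover have "sorted (rev xs)" "sorted (rev ys)" using assms(1,2) by (simp_all add: sorted_wrt_rev)
  ultimately have "sort (rev ys) = rev xs" "sort (rev ys) = rev ys" by (intro properties_for_sort; simp)+
  thus ?thesis by simp
qed

context symplectic
begin

lemma frame_lengths_unique:
  assumes "frame ls g" "sum_list ls = n" "frame ls' g'" "sum_list ls' = n"
    "sorted_wrt (\<ge>) ls" "sorted_wrt (\<ge>) ls'"
  shows "ls = ls'"
proof (rule sorted_count_unique[OF assms(5,6)])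
  show "\<forall>l\<in>set ls. 0 < l" using frameD(1)[OF assms(1)] by (auto simp: in_set_conv_nth)
  show "\<forall>l\<in>set ls'. 0 < l" using frameD(1)[OF assms(3)] by (auto simp: in_set_conv_nth)
  show "card {r. r < length ls \<and> k < ls ! r} = card {r. r < length ls' \<and> k < ls' ! r}" for k
    by (rule antisym[OF frame_count_le[OF assms(1-4)] frame_count_le[OF assms(3,4,1,2)]])
qed

text \<open>A description of a_r in terms of \<open>x\<close> and l_r that does not refer to the
  frame. Saturation ensures that the remaining blocks do not obstruct the divisibility.\<close>

lemma exponent_iff:
  assumes g: "frame ls g" and as: "length as = length ls" "\<forall>r<length ls. as ! r \<le> ls ! r" "saturated ls as"
    and r: "r < length ls" and i: "i \<le> ls ! r"
  shows "i \<le> as ! r \<longleftrightarrow> (\<exists>u\<in>V. pw (ls ! r - i) (vec_of g as) = pw (ls ! r) u)"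
proof
  let ?l = "ls ! r"
  assume ir: "i \<le> as ! r"
  let ?u = "\<Sum>t<length as. if i \<le> as ! t then pw (as ! t - i) (g t True) else 0"
  have "pw (?l - i) (pw (as ! t) (g t True)) = pw ?l (if i \<le> as ! t then pw (as ! t - i) (g t True) else 0)"
    if t: "t < length as" for t
  proof (cases "i \<le> as ! t")
    case True
    thus ?thesis using i by (simp add: pw_pw)
  next
    case False
    \<comment> \<open>A block whose exponent is below i is too short to matter: by saturation
      A^(l-i) already kills its component.\<close>
    have "as ! r \<le> as ! t + (?l - ls ! t)" using as(1,3) r t by (auto simp: saturated_def)
    hence "ls ! t \<le> ?l - i + as ! t" using ir False i by linarith
    thus ?thesis using False pw_ge[OF frameD(3)[OF g], of t _ True] t as(1) by (simp add: pw_pw)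
  qed
  hence "pw (?l - i) (vec_of g as) = pw ?l ?u" unfolding vec_of_def pw_sum by (intro sum.cong refl) auto
  moreover have "?u \<in> V" using frameD(2)[OF g] as(1) by (auto intro!: V_sum V_pw V_zero)
  ultimately show "\<exists>u\<in>V. pw (?l - i) (vec_of g as) = pw ?l u" by blast
next
  let ?l = "ls ! r"
  assume "\<exists>u\<in>V. pw (?l - i) (vec_of g as) = pw ?l u"
  then obtain u where u: "pw (?l - i) (vec_of g as) = pw ?l u" by blast
  show "i \<le> as ! r"
  proof (rule ccontr)
    assume "\<not> i \<le> as ! r"
    hence lt: "as ! r < i" by simp
    \<comment> \<open>The powers add up to (l - i) + a_r + (i - 1 - a_r) = l - 1, so this vector
      detects the component in block r, while it is orthogonal to the image of A^l.\<close>
    let ?f = "pw (i - 1 - as ! r) (g r False)"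
    have "om (pw (?l - i) (pw (as ! t) (g t True))) ?f = (if t = r then 1 else 0)" if t: "t < length as" for t
    proof -
      have "om (pw (?l - i) (pw (as ! t) (g t True))) ?f = om (pw (?l - i + as ! t + (i - 1 - as ! r)) (g t True)) (g r False)"
        by (simp only: pw_pw om_pw_pw)
      also have "\<dots> = (if t = r then 1 else 0)" using frameD(4)[OF g, of t r] t r as(1) lt i by (auto simp: sg_def)
      finally show ?thesis .
    qed
    hence "om (pw (?l - i) (vec_of g as)) ?f = 1" unfolding vec_of_def pw_sum om_sum using r as(1) by simp
    moreover have "om (pw ?l u) ?f = om u (pw (i - 1 - as ! r) (pw ?l (g r False)))"
      unfolding pw_pw add.commute[of _ ?l] by (simp only: pw_pw[symmetric] om_pw)
    hence "om (pw ?l u) ?f = 0" using frameD(3)[OF g r] by simp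
    ultimately show False using u by simp
  qed
qed

lemma typed_unique:
  assumes t: "typed x ls as" "sorted_wrt (\<ge>) ls" "saturated ls as"
    and t': "typed x ls' as'" "sorted_wrt (\<ge>) ls'" "saturated ls' as'"
  shows "ls = ls' \<and> as = as'"
proof -
  obtain g where g: "frame ls g" "sum_list ls = n" "length as = length ls" "\<forall>r<length ls. as ! r \<le> ls ! r" "x = vec_of g as"
    using t(1) by (auto simp: typed_def)
  obtain g' where g': "frame ls' g'" "sum_list ls' = n" "length as' = length ls'" "\<forall>r<length ls'. as' ! r \<le> ls' ! r" "x = vec_of g' as'"
    using t'(1) by (auto simp: typed_def)
  have ls: "ls = ls'" by (rule frame_lengths_unique[OF g(1,2) g'(1,2) t(2) t'(2)])
  have "i \<le> as ! r \<longleftrightarrow> i \<le> as' ! r" if "r < length ls" "i \<le> ls ! r" for r i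
    using exponent_iff[OF g(1,3,4) t(3) that] exponent_iff[OF g'(1,3,4) t'(3)] that g(5) g'(5) by (simp add: ls)
  hence "as ! r = as' ! r" if "r < length ls" for r using that g(4) g'(4) ls by (meson antisym order_refl)
  thus ?thesis using ls g(3) g'(3) by (simp add: nth_equalityI)
qed

end

definition types :: "nat \<Rightarrow> (nat list \<times> nat list) set" where
  "types n = {(ls, as). sorted_wrt (\<ge>) ls \<and> (\<forall>l\<in>set ls. 0 < l) \<and> sum_list ls = n \<and> length as = length ls \<and>
     (\<forall>r<length ls. as ! r \<le> ls ! r) \<and> saturated ls as}"

lemma finite_types: "finite (types n)"
proof (rule finite_subset)
  let ?L = "{xs :: nat list. set xs \<subseteq> {..n} \<and> length xs \<le> n}"
  show "types n \<subseteq> ?L \<times> ?L"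
  proof
    fix p assume "p \<in> types n"
    then obtain ls as where p: "p = (ls, as)" and ls: "\<forall>l\<in>set ls. 0 < l" "sum_list ls = n" "length as = length ls"
      "\<forall>r<length ls. as ! r \<le> ls ! r" by (auto simp: types_def)
    have "length ls \<le> sum_list ls" using ls(1) by (induction ls) auto
    moreover have "l \<le> n" if "l \<in> set ls" for l using member_le_sum_list[OF that] ls(2) by simp
    moreover hence "a \<le> n" if "a \<in> set as" for a using that ls(3,4) by (metis in_set_conv_nth le_trans nth_mem)
    ultimately show "p \<in> ?L \<times> ?L" using ls p by auto
  qed
  show "finite (?L \<times> ?L)" by (intro finite_cartesian_product finite_lists_length_le) auto
qed

lemma (in symplectic) type_exists:
  assumes nil: "\<And>u. u \<in> V \<Longrightarrow> pw d u = 0" and x: "x \<in> V"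
  obtains ls as where "(ls, as) \<in> types n" "typed x ls as"
proof -
  obtain ls g where g: "frame ls g" "sum_list ls = n" "sorted_wrt (\<ge>) ls" using frame_exists[OF nil] by blast
  obtain as where as: "typed x ls as" "saturated ls as" using typed_exists[OF g(1,2) x] saturated_exists by blast
  have "(ls, as) \<in> types n" using as g frameD(1)[OF g(1)] by (auto simp: types_def typed_def in_set_conv_nth)
  thus thesis using that as(1) by blast
qed

section \<open>Orbits in the nilcone\<close>

lemma sum_fun_apply: "sum f S x = (\<Sum>i\<in>S. f i x)" for f :: "'i \<Rightarrow> 'a \<Rightarrow> 'b::comm_monoid_add"
  by (induction S rule: infinite_finite_induct) simp_all

lemma underdetermined:
  fixes a :: "'i \<Rightarrow> 'j \<Rightarrow> 'k::field"
  assumes fin: "finite I" "finite J" and less: "card I < card J"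
  shows "\<exists>x. (\<exists>j\<in>J. x j \<noteq> 0) \<and> (\<forall>i\<in>I. (\<Sum>j\<in>J. x j * a i j) = 0)"
proof -
  let ?p = "card I" and ?q = "card J"
  obtain h where h: "bij_betw h {0..<?p} I" using ex_bij_betw_nat_finite[OF fin(1)] by blast
  obtain f where f: "bij_betw f {0..<?q} J" using ex_bij_betw_nat_finite[OF fin(2)] by blast
  \<comment> \<open>The system is padded to a square one; its last row is zero because there are
    fewer equations than unknowns.\<close>
  define M where "M = mat\<^sub>r ?q ?q (\<lambda>i. if i = ?q - 1 then 0\<^sub>v ?q else vec ?q (\<lambda>j. if i < ?p then a (h i) (f j) else 0))"
  have M: "M \<in> carrier_mat ?q ?q" by (simp add: M_def)
  have "det M = 0" unfolding M_def by (rule det_row_0) (use less in auto)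
  then obtain v where v: "v \<in> carrier_vec ?q" "v \<noteq> 0\<^sub>v ?q" "M *\<^sub>v v = 0\<^sub>v ?q"
    using det_0_iff_vec_prod_zero_field[OF M] by blast
  obtain k where k: "k < ?q" "v $ k \<noteq> 0" using v(1,2) by (auto simp: vec_eq_iff)
  define x where "x j = v $ inv_into {0..<?q} f j" for j
  have xf: "x (f k) = v $ k" if "k < ?q" for k using f that by (simp add: x_def bij_betw_def)
  have "(\<Sum>j\<in>J. x j * a i j) = 0" if i: "i \<in> I" for i
  proof -
    have "i \<in> h ` {0..<?p}" using h i by (simp add: bij_betw_def)
    then obtain l where l: "l < ?p" "i = h l" by auto
    have "(\<Sum>j\<in>J. x j * a i j) = (\<Sum>k\<in>{0..<?q}. x (f k) * a i (f k))" by (rule sum.reindex_bij_betw[OF f, symmetric])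
    also have "\<dots> = (\<Sum>k\<in>{0..<?q}. M $$ (l, k) * v $ k)"
    proof (intro sum.cong refl)
      fix k assume "k \<in> {0..<?q}"
      moreover have "l < ?q" "l \<noteq> ?q - 1" using l less by auto
      ultimately show "x (f k) * a i (f k) = M $$ (l, k) * v $ k"
        using l by (simp add: M_def xf mult.commute[of "v $ k"])
    qed
    also have "\<dots> = (M *\<^sub>v v) $ l" using l less v(1) M by (simp add: scalar_prod_def)
    finally show ?thesis using l less by (simp add: v(3))
  qed
  moreover have "f k \<in> J" using f k(1) by (auto simp: bij_betw_def)
  moreover have "x (f k) \<noteq> 0" using k xf by simp
  ultimately show ?thesis by blast
qed

definition vsp :: "nat \<Rightarrow> (nat \<Rightarrow> 'k::zero) set" where
  "vsp n = {u. \<forall>i\<ge>2 * n. u i = 0}"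

definition unit :: "nat \<Rightarrow> nat \<Rightarrow> 'k::zero_neq_one" where
  "unit k i = (if i = k then 1 else 0)"

lemma omf_unit_right: "k < 2 * n \<Longrightarrow> omf n u (\<lambda>i. c * unit k i) = c * (if k < n then - u (k + n) else u (k - n))"
proof -
  assume k: "k < 2 * n"
  have "omf n u (\<lambda>i. c * unit k i) = (\<Sum>i<n. (if i + n = k then c * u i else 0) - (if i = k then c * u (i + n) else 0))"
    unfolding omf_def by (intro sum.cong refl) (auto simp: unit_def)
  also have "\<dots> = c * (if k < n then - u (k + n) else u (k - n))"
  proof (cases "k < n")
    case True
    thus ?thesis by (auto simp: sum_subtractf sum_negf)
  next
    case False
    hence "i + n = k \<longleftrightarrow> i = k - n" for i by auto
    thus ?thesis using False k by (auto simp: sum_subtractf)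
  qed
  finally show ?thesis .
qed

lemma avec_vsp: "avec n Y u \<in> vsp n"
  by (simp add: vsp_def avec_def)

lemma symplectic_avec:
  fixes Y :: "'k::field mat"
  assumes Y: "Y \<in> alt_mat (2 * n)"
  shows "symplectic (\<lambda>c u i. c * u i) (avec n Y) (omf n) (vsp n) n"
proof -
  interpret selfadj "\<lambda>c u i. c * u i" "avec n Y" "omf n" by (rule selfadj_avec[OF Y])
  show ?thesis
  proof unfold_locales
    show "\<exists>v\<in>vsp n. omf n u v = 1" if u: "u \<in> vsp n" "u \<noteq> 0" for u :: "nat \<Rightarrow> 'k"
    proof -
      obtain i where i: "u i \<noteq> 0" using u(2) by (auto simp: fun_eq_iff)
      hence i2: "i < 2 * n" using u(1) by (auto simp: vsp_def not_le[symmetric])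
      define k where "k = (if i < n then i + n else i - n)"
      define c where "c = (if i < n then 1 else - 1) * inverse (u i)"
      have k: "k < 2 * n" using i2 by (auto simp: k_def)
      have "omf n u (\<lambda>j. c * unit k j) = 1" unfolding omf_unit_right[OF k] using i i2 by (auto simp: k_def c_def)
      moreover have "(\<lambda>j. c * unit k j) \<in> vsp n" using k by (auto simp: vsp_def unit_def)
      ultimately show ?thesis by blast
    qed
    show "\<exists>x. (\<exists>j\<in>J. x j \<noteq> 0) \<and> (\<Sum>j\<in>J. (\<lambda>i. x j * w j i)) = 0"
      if J: "finite J" "2 * n < card J" "w ` J \<subseteq> vsp n" for J :: "(nat \<times> bool \<times> nat) set" and w :: "_ \<Rightarrow> nat \<Rightarrow> 'k"
    proof -
      obtain x where x: "\<exists>j\<in>J. x j \<noteq> 0" "\<forall>i\<in>{..<2 * n}. (\<Sum>j\<in>J. x j * w j i) = 0"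
        using underdetermined[of "{..<2 * n}" J "\<lambda>i j. w j i"] J by auto
      have "(\<Sum>j\<in>J. x j * w j i) = 0" for i
      proof (cases "i < 2 * n")
        case False
        hence "w j i = 0" if "j \<in> J" for j using J(3) that by (auto simp: vsp_def image_subset_iff)
        thus ?thesis by simp
      qed (use x(2) in simp)
      thus ?thesis using x(1) by (intro exI[of _ x]) (auto simp: fun_eq_iff sum_fun_apply)
    qed
    show "\<exists>u\<in>vsp n. u \<noteq> 0 \<and> (\<forall>i\<in>I. omf n u (w i) = 0)"
      if I: "finite I" "card I < 2 * n" for I :: "(nat \<times> bool \<times> nat) set" and w :: "_ \<Rightarrow> nat \<Rightarrow> 'k"
    proof -
      obtain x where x: "\<exists>j\<in>{..<2 * n}. x j \<noteq> 0"
        "\<forall>i\<in>I. (\<Sum>j<2 * n. x j * (if j < n then w i (j + n) else - w i (j - n))) = 0"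
        using underdetermined[of I "{..<2 * n}" "\<lambda>i j. if j < n then w i (j + n) else - w i (j - n)"] I by auto
      let ?u = "\<lambda>j. if j < 2 * n then x j else 0"
      have "omf n ?u v = (\<Sum>j<2 * n. x j * (if j < n then v (j + n) else - v (j - n)))" for v
        unfolding sum_lessThan_2n omf_def by (intro sum.cong refl) auto
      hence "\<forall>i\<in>I. omf n ?u (w i) = 0" using x(2) by simp
      moreover have "?u \<noteq> 0" using x(1) by (auto simp: fun_eq_iff)
      moreover have "?u \<in> vsp n" by (simp add: vsp_def)
      ultimately show ?thesis by blast
    qed
    show "\<exists>x. (\<exists>j\<in>J. x j \<noteq> 0) \<and> (\<forall>i\<in>I. (\<Sum>j\<in>J. x j * a i j) = 0)"
      if "finite I" "finite J" "card I < card J" for I J :: "(nat \<times> bool) set" and a :: "_ \<Rightarrow> _ \<Rightarrow> 'k"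
      using that by (rule underdetermined)
  qed (auto simp: vsp_def avec_def)
qed

section \<open>Types of points and their transport under the group\<close>

definition xfun :: "nat \<Rightarrow> 'k::zero vec \<Rightarrow> nat \<Rightarrow> 'k" where
  "xfun n x i = (if i < 2 * n then x $ i else 0)"

definition has_type :: "nat \<Rightarrow> ('k::field vec \<times> 'k mat) \<Rightarrow> nat list \<Rightarrow> nat list \<Rightarrow> bool" where
  "has_type n p ls as \<longleftrightarrow> symplectic.typed (avec n (snd p)) (omf n) (vsp n) n (xfun n (fst p)) ls as"

definition mv :: "nat \<Rightarrow> 'k::comm_ring_1 mat \<Rightarrow> (nat \<Rightarrow> 'k) \<Rightarrow> nat \<Rightarrow> 'k" where
  "mv n M u = xfun n (M *\<^sub>v vec (2 * n) u)"

lemma mv_vec: "M \<in> sq_mats n \<Longrightarrow> vec (2 * n) (mv n M u) = M *\<^sub>v vec (2 * n) u"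
  by (rule eq_vecI) (auto simp: mv_def xfun_def)

lemma omf_vec: "omf n u v = vec (2 * n) u \<bullet> (symp_form n *\<^sub>v vec (2 * n) v)"
  unfolding omf_matrix by (auto simp: scalar_prod_def atLeast0LessThan intro!: sum.cong)

lemma avec_vec: "Y \<in> sq_mats n \<Longrightarrow> vec (2 * n) (avec n Y u) = amat n Y *\<^sub>v vec (2 * n) u"
proof (rule eq_vecI)
  assume Y: "Y \<in> sq_mats n"
  note d = carrier_matD[OF amat_carrier[OF Y]]
  show "vec (2 * n) (avec n Y u) $ i = (amat n Y *\<^sub>v vec (2 * n) u) $ i" if "i < dim_vec (amat n Y *\<^sub>v vec (2 * n) u)" for i
    using that by (simp add: d avec_def scalar_prod_def atLeast0LessThan)
  show "dim_vec (vec (2 * n) (avec n Y u)) = dim_vec (amat n Y *\<^sub>v vec (2 * n) u)" by (simp add: d)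
qed

lemma omf_mv:
  assumes "M \<in> Sp n"
  shows "omf n (mv n M u) (mv n M v) = omf n u v"
proof -
  note M = SpD[OF assms]
  let ?u = "vec (2 * n) u" and ?v = "vec (2 * n) v"
  have "omf n (mv n M u) (mv n M v) = (M *\<^sub>v ?u) \<bullet> (symp_form n *\<^sub>v (M *\<^sub>v ?v))"
    by (simp add: omf_vec mv_vec[OF M(1)])
  also have "\<dots> = ?u \<bullet> (M\<^sup>T *\<^sub>v (symp_form n *\<^sub>v (M *\<^sub>v ?v)))"
  proof -
    have "symp_form n *\<^sub>v (M *\<^sub>v ?v) \<in> carrier_vec (2 * n)" using M(1) by (intro sq_mult_vec[of _ n]) auto
    thus ?thesis
      using transpose_vec_mult_scalar[of "M\<^sup>T" "2 * n" "2 * n" "symp_form n *\<^sub>v (M *\<^sub>v ?v)" ?u] M(1) by simp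
  qed
  also have "M\<^sup>T *\<^sub>v (symp_form n *\<^sub>v (M *\<^sub>v ?v)) = (M\<^sup>T * symp_form n * M) *\<^sub>v ?v"
    using M(1) by (simp add: sq_assoc_vec[of _ n] sq_mult_vec[of _ n])
  finally show ?thesis by (simp add: M(2) omf_vec)
qed

lemma mv_vsp: "mv n M u \<in> vsp n"
  by (simp add: mv_def vsp_def xfun_def)

lemma avec_mv:
  fixes M :: "'k::field mat"
  assumes M: "M \<in> Sp n" and Y: "Y \<in> sq_mats n"
  shows "avec n (M * Y * M\<^sup>T) (mv n M u) = mv n M (avec n Y u)"
proof -
  note Mc = SpD(1)[OF M]
  have c: "M * Y * M\<^sup>T \<in> sq_mats n" using Mc Y by (intro sq_mult[of _ n]) auto
  have "vec (2 * n) (avec n (M * Y * M\<^sup>T) (mv n M u)) = (amat n (M * Y * M\<^sup>T) * M) *\<^sub>v vec (2 * n) u"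
    unfolding avec_vec[OF c] mv_vec[OF Mc] using Mc amat_carrier[OF c] by (simp add: sq_assoc_vec[of _ n])
  also have "\<dots> = vec (2 * n) (mv n M (avec n Y u))"
    unfolding amat_act[OF M Y] mv_vec[OF Mc] avec_vec[OF Y] using Mc amat_carrier[OF Y]
    by (simp add: sq_assoc_vec[of _ n])
  finally have e: "vec (2 * n) (avec n (M * Y * M\<^sup>T) (mv n M u)) = vec (2 * n) (mv n M (avec n Y u))" .
  show ?thesis
  proof
    fix i
    show "avec n (M * Y * M\<^sup>T) (mv n M u) i = mv n M (avec n Y u) i"
      using arg_cong[OF e, of "\<lambda>v. v $ i"] by (cases "i < 2 * n") (simp_all add: avec_def[of n "M * Y * M\<^sup>T"] mv_def xfun_def)
  qed
qed

lemma avec_pow_mv: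
  fixes M :: "'k::field mat"
  assumes "M \<in> Sp n" "Y \<in> sq_mats n"
  shows "(avec n (M * Y * M\<^sup>T) ^^ k) (mv n M u) = mv n M ((avec n Y ^^ k) u)"
  by (induction k) (simp_all add: avec_mv[OF assms])

lemma mv_sum:
  assumes "M \<in> sq_mats n"
  shows "mv n M (sum f S) = (\<Sum>s\<in>S. mv n M (f s))"
proof
  fix i
  show "mv n M (sum f S) i = (\<Sum>s\<in>S. mv n M (f s)) i" using assms unfolding sum_fun_apply
    by (auto simp: mv_def xfun_def scalar_prod_def sum_fun_apply sum_distrib_left intro: sum.swap)
qed

lemma has_type_act:
  fixes M :: "'k::field mat"
  assumes M: "M \<in> Sp n" and p: "p \<in> V_points n" and t: "has_type n p ls as"
  shows "has_type n (act M p) ls as"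
proof -
  note V = V_pointsD[OF p]
  note Mc = SpD(1)[OF M]
  have V': "act M p \<in> V_points n" by (rule act_V_points[OF Mc p])
  interpret P: symplectic "\<lambda>c u i. c * u i" "avec n (snd p)" "omf n" "vsp n" n by (rule symplectic_avec[OF V(2)])
  interpret Q: symplectic "\<lambda>c u i. c * u i" "avec n (snd (act M p))" "omf n" "vsp n" n
    by (rule symplectic_avec[OF V_pointsD(2)[OF V']])
  obtain g where g: "P.frame ls g" "xfun n (fst p) = P.vec_of g as"
    and l: "sum_list ls = n" "length as = length ls" "\<forall>r<length ls. as ! r \<le> ls ! r"
    using t unfolding has_type_def P.typed_def by blast
  define h where "h r b = mv n M (g r b)" for r b
  have pw: "Q.pw k (mv n M u) = mv n M (P.pw k u)" for k u using avec_pow_mv[OF M V(3)] by (simp add: act_def)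
  have z: "mv n M 0 = 0" using mv_sum[OF Mc, of "\<lambda>_. 0" "{} :: nat set"] by simp
  have "Q.frame ls h" unfolding Q.frame_def h_def pw omf_mv[OF M]
    using g(1) mv_vsp[of n M] z unfolding P.frame_def by auto
  moreover have "xfun n (fst (act M p)) = Q.vec_of h as"
  proof -
    have "xfun n (fst (act M p)) = mv n M (xfun n (fst p))"
    proof -
      have "vec (2 * n) (xfun n (fst p)) = fst p" using V(1) by (intro eq_vecI) (auto simp: xfun_def)
      thus ?thesis by (simp add: act_def mv_def)
    qed
    also have "\<dots> = Q.vec_of h as" unfolding g(2) P.vec_of_def Q.vec_of_def h_def pw by (rule mv_sum[OF Mc])
    finally show ?thesis .
  qed
  ultimately show ?thesis using l unfolding has_type_def Q.typed_def by blast
qed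

subsection \<open>Standard points\<close>

definition off :: "nat list \<Rightarrow> nat \<Rightarrow> nat" where
  "off ls r = sum_list (take r ls)"

lemma off_Suc: "r < length ls \<Longrightarrow> off ls (Suc r) = off ls r + ls ! r"
  by (simp add: off_def take_Suc_conv_app_nth)

lemma off_0 [simp]: "off ls 0 = 0"
  by (simp add: off_def)

lemma off_mono: "r \<le> s \<Longrightarrow> off ls r \<le> off ls s"
proof -
  assume "r \<le> s"
  then obtain d where "s = r + d" by (auto simp: le_iff_add)
  thus ?thesis by (simp add: off_def take_add)
qed

lemma off_less: "r < length ls \<Longrightarrow> c < ls ! r \<Longrightarrow> off ls r + c < sum_list ls"
  using off_mono[of "Suc r" "length ls" ls] off_Suc[of r ls] by (simp add: off_def)

lemma off_inj:
  assumes "r < length ls" "c < ls ! r" "s < length ls" "c' < ls ! s" "off ls r + c = off ls s + c'"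
  shows "r = s \<and> c = c'"
proof -
  have "\<not> r < s" using off_mono[of "Suc r" s ls] off_Suc[of r ls] assms by auto
  moreover have "\<not> s < r" using off_mono[of "Suc s" r ls] off_Suc[of s ls] assms by auto
  ultimately show ?thesis using assms(5) by simp
qed

lemma off_cases:
  assumes "j < sum_list ls"
  obtains r c where "r < length ls" "c < ls ! r" "j = off ls r + c"
proof -
  define r where "r = (LEAST r. j < off ls (Suc r))"
  have l: "0 < length ls" using assms by auto
  have ex: "j < off ls (Suc (length ls - 1))" using assms l by (simp add: off_def)
  have r: "j < off ls (Suc r)" unfolding r_def by (rule LeastI[of "\<lambda>r. j < off ls (Suc r)", OF ex])
  have "r \<le> length ls - 1" unfolding r_def by (rule Least_le[of "\<lambda>r. j < off ls (Suc r)", OF ex])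
  with l have rl: "r < length ls" by linarith
  have "off ls r \<le> j"
  proof (cases r)
    case (Suc r')
    hence "\<not> j < off ls (Suc r')" unfolding r_def by (intro not_less_Least) simp
    thus ?thesis using Suc by simp
  qed simp
  thus thesis using that[of r "j - off ls r"] r rl off_Suc[OF rl] by simp
qed

definition bstd :: "nat list \<Rightarrow> nat \<Rightarrow> nat \<Rightarrow> 'k::comm_ring_1" where
  "bstd ls i j = (if i = Suc j \<and> i \<notin> off ls ` {..<length ls} then 1 else 0)"

text \<open>An exponent equal to the length of its block stands for a zero component, hence the
  strict inequality in the vector.\<close>

definition std_point :: "nat \<Rightarrow> nat list \<Rightarrow> nat list \<Rightarrow> 'k::comm_ring_1 vec \<times> 'k mat" where
  "std_point n ls as = (vec (2 * n) (\<lambda>i. \<Sum>r<length ls. if as ! r < ls ! r \<and> i = off ls r + as ! r then 1 else 0),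
     bmat n (bstd ls))"

lemma std_point_V: "std_point n ls as \<in> V_points n"
  by (simp add: std_point_def V_points_def bmat_alt)

text \<open>The index of A^c f_r among the f_j. The order is reversed because \<open>A\<close> acts
  on the f_j by the transposed shift.\<close>

definition top :: "nat list \<Rightarrow> nat \<Rightarrow> nat \<Rightarrow> nat" where
  "top ls r c = off ls r + (ls ! r - Suc c)"

lemma off_start:
  assumes "r < length ls" "c < ls ! r" "\<forall>l\<in>set ls. 0 < l"
  shows "off ls r + c \<in> off ls ` {..<length ls} \<longleftrightarrow> c = 0"
  using off_inj[of r ls c _ 0] assms by (auto simp: image_iff)

lemma avec_bmat:
  assumes "j < n"
  shows "avec n (bmat n b) (unit j) i = (if i < n then b i j else 0)"
    "avec n (bmat n b) (unit (n + j)) i = (if n \<le> i \<and> i < 2 * n then b j (i - n) else 0)"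
proof -
  note Zc = alt_matD(1)[OF bmat_alt[of n b]]
  have e: "avec n (bmat n b) (unit k) i = (if i < 2 * n then amat n (bmat n b) $$ (i, k) else 0)" if "k < 2 * n" for k
    using that by (simp add: avec_def unit_def if_distrib[of "\<lambda>x. _ * x"] cong: if_cong)
  show "avec n (bmat n b) (unit j) i = (if i < n then b i j else 0)"
    using assms by (simp add: e amat_index[OF Zc]) (auto simp: bmat_def)
  show "avec n (bmat n b) (unit (n + j)) i = (if n \<le> i \<and> i < 2 * n then b j (i - n) else 0)"
    using assms by (simp add: e amat_index[OF Zc]) (auto simp: bmat_def)
qed

context
  fixes n :: nat and ls as :: "nat list"
  assumes ty: "(ls, as) \<in> types n"
begin

lemma ty': "\<forall>l\<in>set ls. 0 < l" "sum_list ls = n" "length as = length ls" "\<forall>r<length ls. as ! r \<le> ls ! r"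
  "sorted_wrt (\<ge>) ls" "saturated ls as" using ty by (auto simp: types_def)

lemma std_pow:
  assumes r: "r < length ls"
  shows "(avec n (bmat n (bstd ls)) ^^ c) (unit (off ls r)) = (if c < ls ! r then unit (off ls r + c) else (0 :: nat \<Rightarrow> 'k::comm_ring_1))"
    "(avec n (bmat n (bstd ls)) ^^ c) (unit (n + top ls r 0)) =
       (if c < ls ! r then unit (n + top ls r c) else (0 :: nat \<Rightarrow> 'k))"
proof -
  let ?b = "bstd ls :: nat \<Rightarrow> nat \<Rightarrow> 'k"
  let ?A = "avec n (bmat n ?b)"
  have pos: "0 < ls ! r" using ty'(1) r by simp
  have lt: "off ls r + c < n" if "c < ls ! r" for c using off_less[OF r that] ty'(2) by simp
  have start: "off ls r + c \<in> off ls ` {..<length ls} \<longleftrightarrow> c = 0" if "c < ls ! r" for c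
    using off_start[OF r that ty'(1)] .
  \<comment> \<open>The shift ends with the block: the next index either starts another block or
    lies outside the first half.\<close>
  have stop: "off ls r + ls ! r = n \<or> off ls r + ls ! r \<in> off ls ` {..<length ls}"
  proof (cases "Suc r < length ls")
    case True
    thus ?thesis using off_Suc[OF r] by (metis imageI lessThan_iff)
  next
    case False
    hence "Suc r = length ls" using r by simp
    hence "off ls (Suc r) = n" using ty'(2) by (simp add: off_def)
    thus ?thesis using off_Suc[OF r] by simp
  qed
  have A0: "?A 0 = 0" by (rule ext) (simp add: avec_def)
  have e: "?A (unit (off ls r + c)) = (if Suc c < ls ! r then unit (off ls r + Suc c) else 0)" if c: "c < ls ! r" for c
  proof
    fix i
    show "?A (unit (off ls r + c)) i = (if Suc c < ls ! r then unit (off ls r + Suc c) else 0) i"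
    proof (cases "Suc c < ls ! r")
      case True
      thus ?thesis unfolding avec_bmat(1)[OF lt[OF c]]
        using start[OF True] lt[OF True] by (auto simp: bstd_def unit_def)
    next
      case False
      hence "ls ! r = Suc c" using c by simp
      thus ?thesis unfolding avec_bmat(1)[OF lt[OF c]] using stop by (auto simp: bstd_def)
    qed
  qed
  have f: "?A (unit (n + (off ls r + c))) = (if c = 0 then 0 else unit (n + (off ls r + (c - 1))))" if c: "c < ls ! r" for c
  proof
    fix i
    show "?A (unit (n + (off ls r + c))) i = (if c = 0 then 0 else unit (n + (off ls r + (c - 1)))) i"
      unfolding avec_bmat(2)[OF lt[OF c]] using start[OF c] lt[OF c] by (auto simp: bstd_def unit_def)
  qed
  show "(?A ^^ c) (unit (off ls r)) = (if c < ls ! r then unit (off ls r + c) else 0)"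
    by (induction c) (use pos in \<open>auto simp: e A0\<close>)
  show "(?A ^^ c) (unit (n + top ls r 0)) = (if c < ls ! r then unit (n + top ls r c) else 0)"
  proof (induction c)
    case (Suc c)
    have "?A (unit (n + top ls r c)) = (if Suc c < ls ! r then unit (n + top ls r (Suc c)) else 0)"
      if "c < ls ! r" using f[of "ls ! r - Suc c"] that by (auto simp: top_def)
    thus ?case using Suc A0 by auto
  qed (use pos in simp)
qed

lemma std_point_type: "has_type n (std_point n ls as :: 'k::field vec \<times> 'k mat) ls as"
proof -
  let ?p = "std_point n ls as :: 'k vec \<times> 'k mat"
  interpret symplectic "\<lambda>c u i. c * u i" "avec n (snd ?p)" "omf n" "vsp n :: (nat \<Rightarrow> 'k) set" n
    by (rule symplectic_avec[OF V_pointsD(2)[OF std_point_V]])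
  define g :: "nat \<Rightarrow> bool \<Rightarrow> nat \<Rightarrow> 'k" where
    "g r b = (if b then unit (off ls r) else unit (n + top ls r 0))" for r b
  have pos: "0 < ls ! r" if "r < length ls" for r using ty'(1) that by simp
  have lt: "off ls r + c < n" if "r < length ls" "c < ls ! r" for r c using off_less[OF that] ty'(2) by simp
  have pw: "pw c (g r b) = (if c < ls ! r then unit (if b then off ls r + c else n + top ls r c) else 0)"
    if "r < length ls" for r c b using std_pow[OF that, of c, where 'k = 'k] by (simp add: g_def std_point_def)
  have om: "omf n (unit a) (unit k) = (if k < n then - unit a (k + n) else unit a (k - n))" if "k < 2 * n" for a k
    using omf_unit_right[OF that, of "unit a" 1] by simp
  have "frame ls g" unfolding frame_def
  proof (intro conjI allI impI)
    fix r b assume r: "r < length ls"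
    show "0 < ls ! r" by (rule pos[OF r])
    show "g r b \<in> vsp n" using lt[OF r, of 0] lt[OF r, of "ls ! r - Suc 0"] pos[OF r] by (auto simp: g_def vsp_def unit_def top_def)
    show "pw (ls ! r) (g r b) = 0" using pw[OF r] by simp
  next
    fix r s b b' i assume rs: "r < length ls" "s < length ls"
    have l: "off ls s < n" "top ls s 0 < n" "off ls r + i < n" "top ls r i < n" if "i < ls ! r"
      using lt[OF rs(2), of 0] lt[OF rs(2), of "ls ! s - Suc 0"] lt[OF rs(1), of i] lt[OF rs(1), of "ls ! r - Suc i"]
        pos[OF rs(1)] pos[OF rs(2)] that by (auto simp: top_def)
    show "omf n (pw i (g r b)) (g s b') = (if r = s \<and> i = ls ! r - 1 then sg b b' else 0)"
    proof (cases "i < ls ! r")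
      case False
      thus ?thesis using pw[OF rs(1)] pos[OF rs(1)] by auto
    next
      case True
      note l = l[OF True]
      have ef: "top ls s 0 = off ls r + i \<longleftrightarrow> r = s \<and> i = ls ! r - 1"
        using off_inj[OF rs(1) True rs(2), of "ls ! s - 1"] pos[OF rs(2)] by (auto simp: top_def)
      have fe: "off ls s = top ls r i \<longleftrightarrow> r = s \<and> i = ls ! r - 1"
        using off_inj[OF rs(1) _ rs(2), of "ls ! r - Suc i" 0] pos[OF rs(1)] pos[OF rs(2)] True by (auto simp: top_def)
      have gs: "g s b' = unit (if b' then off ls s else n + top ls s 0)" by (simp add: g_def)
      have pr: "pw i (g r b) = unit (if b then off ls r + i else n + top ls r i)" using pw[OF rs(1)] True by simp
      have k: "(if b' then off ls s else n + top ls s 0) < 2 * n" using l by auto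
      note u = gs pr om[OF k] sg_def
      show ?thesis
      proof (cases b; cases b')
        assume b: b b'
        have "unit (off ls r + i) (off ls s + n) = (0 :: 'k)" using l by (simp add: unit_def)
        thus ?thesis unfolding u using b l by simp
      next
        assume b: b "\<not> b'"
        thus ?thesis unfolding u using ef by (simp add: unit_def)
      next
        assume b: "\<not> b" b'
        have "unit (n + top ls r i) (off ls s + n) = (if r = s \<and> i = ls ! r - 1 then 1 else 0 :: 'k)"
          unfolding fe[symmetric] by (auto simp: unit_def)
        thus ?thesis unfolding u using b l by simp
      next
        assume b: "\<not> b" "\<not> b'"
        have "unit (n + top ls r i) (top ls s 0) = (0 :: 'k)" using l by (simp add: unit_def)
        thus ?thesis unfolding u using b by simp
      qed
    qed
  qed
  moreover have "xfun n (fst ?p) = vec_of g as"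
  proof
    fix i
    have "vec_of g as i = (\<Sum>r<length ls. if as ! r < ls ! r \<and> i = off ls r + as ! r then 1 else 0)"
      unfolding vec_of_def sum_fun_apply ty'(3) by (intro sum.cong refl) (auto simp: pw unit_def)
    moreover have "(\<Sum>r<length ls. if as ! r < ls ! r \<and> i = off ls r + as ! r then 1 else 0) = (0 :: 'k)" if "\<not> i < 2 * n"
      using that lt by (intro sum.neutral) fastforce
    ultimately show "xfun n (fst ?p) i = vec_of g as i" by (simp add: xfun_def std_point_def)
  qed
  ultimately show ?thesis unfolding has_type_def typed_def using ty' by blast
qed

text \<open>The powers of the generators e_r, paired with complementary powers of f_r, form a
  symplectic basis in which the bivector and the vector take their standard shape.\<close>

lemma std_point_conj:
  fixes p :: "'k::field vec \<times> 'k mat"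
  assumes p: "p \<in> V_points n" and t: "has_type n p ls as"
  shows "\<exists>M\<in>Sp n. act M (std_point n ls as) = p"
proof -
  note V = V_pointsD[OF p]
  interpret symplectic "\<lambda>c u i. c * u i" "avec n (snd p)" "omf n" "vsp n" n by (rule symplectic_avec[OF V(2)])
  obtain g where g: "frame ls g" "xfun n (fst p) = vec_of g as" using t unfolding has_type_def typed_def by blast
  \<comment> \<open>The inverse of (r, c) \<mapsto> off ls r + c.\<close>
  define rc where "rc j = (SOME q. fst q < length ls \<and> snd q < ls ! fst q \<and> j = off ls (fst q) + snd q)" for j
  have rc: "rc (off ls r + c) = (r, c)" if "r < length ls" "c < ls ! r" for r c
  proof -
    have "fst (rc (off ls r + c)) < length ls \<and> snd (rc (off ls r + c)) < ls ! fst (rc (off ls r + c)) \<and>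
        off ls r + c = off ls (fst (rc (off ls r + c))) + snd (rc (off ls r + c))"
      unfolding rc_def by (rule someI[of _ "(r, c)"]) (use that in simp)
    thus ?thesis using off_inj[OF that] by (metis prod.collapse)
  qed
  define w where "w j = pw (snd (rc j)) (g (fst (rc j)) True)" for j
  define f where "f j = pw (ls ! fst (rc j) - 1 - snd (rc j)) (g (fst (rc j)) False)" for j
  have w: "w (off ls r + c) = pw c (g r True)" and f: "f (off ls r + c) = pw (ls ! r - 1 - c) (g r False)"
    if "r < length ls" "c < ls ! r" for r c using rc[OF that] by (simp_all add: w_def f_def)
  have gr: "gram n n w f" unfolding gram_def
  proof (intro allI impI)
    fix i j assume "i < n" "j < n"
    then obtain r c s c' where i: "r < length ls" "c < ls ! r" "i = off ls r + c"
      and j: "s < length ls" "c' < ls ! s" "j = off ls s + c'" using off_cases ty'(2) by metis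
    have "i = j \<longleftrightarrow> r = s \<and> c = c'" using off_inj[OF i(1,2) j(1,2)] i(3) j(3) by auto
    thus "omf n (w i) (w j) = 0 \<and> omf n (f i) (f j) = 0 \<and> omf n (w i) (f j) = (if i = j then 1 else 0)"
      unfolding i(3) j(3) w[OF i(1,2)] w[OF j(1,2)] f[OF i(1,2)] f[OF j(1,2)] om_pw_pw
        frameD(4)[OF g(1) i(1) j(1)] using i(2) j(2) by (auto simp: sg_def)
  qed
  have conj: "fmat n w f * bmat n (bstd ls) * (fmat n w f)\<^sup>T = snd p"
  proof (rule frame_conj[OF gr V(2)])
    fix i j assume ij: "j < n" "i < 2 * n"
    obtain r c where j: "r < length ls" "c < ls ! r" "j = off ls r + c" using off_cases ij(1) ty'(2) by metis
    have start: "off ls r + c' \<in> off ls ` {..<length ls} \<longleftrightarrow> c' = 0" if "c' < ls ! r" for c'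
      using off_start[OF j(1) that ty'(1)] .
    have Aw: "avec n (snd p) (w j) = pw (Suc c) (g r True)" by (simp add: j w)
    have "(\<Sum>k<n. bstd ls k j * w k i) = (\<Sum>k<n. if k = Suc j then (if k \<notin> off ls ` {..<length ls} then w k i else 0) else 0)"
      by (intro sum.cong refl) (simp add: bstd_def)
    also have "\<dots> = (if Suc j < n \<and> Suc j \<notin> off ls ` {..<length ls} then w (Suc j) i else 0)" by simp
    also have "\<dots> = pw (Suc c) (g r True) i"
    proof (cases "Suc c < ls ! r")
      case True
      thus ?thesis using start[OF True] w[OF j(1) True] off_less[OF j(1) True] j ty'(2) by simp
    next
      case False
      hence c: "Suc c = ls ! r" using j by simp
      hence "Suc j = off ls (Suc r)" using off_Suc[OF j(1)] j(3) by simp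
      moreover have "Suc r < length ls \<or> off ls (Suc r) = n"
        using j(1) ty'(2) by (cases "Suc r = length ls") (auto simp: off_def)
      ultimately show ?thesis unfolding c using frameD(3)[OF g(1) j(1), of True] by auto
    qed
    finally show "avec n (snd p) (w j) i = (\<Sum>k<n. bstd ls k j * w k i)" by (simp only: Aw)
    have Af: "avec n (snd p) (f j) = pw (ls ! r - c) (g r False)"
    proof -
      have "Suc (ls ! r - 1 - c) = ls ! r - c" using j(2) by simp
      thus ?thesis by (simp add: j f flip: funpow.simps(2)[THEN fun_cong, unfolded comp_apply])
    qed
    have "(\<Sum>k<n. bstd ls j k * f k i) = (\<Sum>k<n. if j = Suc k then (if c \<noteq> 0 then f k i else 0) else 0)"
      by (intro sum.cong refl) (use start[OF j(2)] j(3) in \<open>simp add: bstd_def\<close>)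
    also have "\<dots> = pw (ls ! r - c) (g r False) i"
    proof (cases c)
      case 0
      show ?thesis unfolding 0 using frameD(3)[OF g(1) j(1), of False] by (simp cong: if_cong)
    next
      case (Suc c')
      hence e: "j = Suc k \<longleftrightarrow> k = off ls r + c'" for k using j(3) by auto
      have l: "off ls r + c' < n" "c' < ls ! r" using ij(1) j Suc by auto
      have "(\<Sum>k<n. if j = Suc k then (if c \<noteq> 0 then f k i else 0) else 0) = f (off ls r + c') i"
        unfolding e using l(1) Suc by simp
      thus ?thesis using f[OF j(1) l(2)] Suc by simp
    qed
    finally show "avec n (snd p) (f j) i = (\<Sum>k<n. bstd ls j k * f k i)" by (simp only: Af)
  qed
  have "fmat n w f *\<^sub>v fst (std_point n ls as) = fst p"
  proof (rule eq_vecI)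
    fix i assume "i < dim_vec (fst p)"
    hence i: "i < 2 * n" using V(1) by simp
    let ?d = "\<lambda>r j. if as ! r < ls ! r \<and> j = off ls r + as ! r then 1 else 0 :: 'k"
    have "(fmat n w f *\<^sub>v fst (std_point n ls as)) $ i = (\<Sum>j<2 * n. fmat n w f $$ (i, j) * (\<Sum>r<length ls. ?d r j))"
      using i by (auto simp: std_point_def fmat_def scalar_prod_def atLeast0LessThan intro!: sum.cong)
    also have "\<dots> = (\<Sum>r<length ls. \<Sum>j<2 * n. fmat n w f $$ (i, j) * ?d r j)"
      by (subst sum.swap) (simp only: sum_distrib_left)
    also have "\<dots> = (\<Sum>r<length as. pw (as ! r) (g r True) i)" unfolding ty'(3)
    proof (intro sum.cong refl)
      fix r assume "r \<in> {..<length ls}"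
      hence r: "r < length ls" by simp
      show "(\<Sum>j<2 * n. fmat n w f $$ (i, j) * ?d r j) = pw (as ! r) (g r True) i"
      proof (cases "as ! r < ls ! r")
        case True
        have l: "off ls r + as ! r < n" using off_less[OF r True] ty'(2) by simp
        have "(\<Sum>j<2 * n. fmat n w f $$ (i, j) * ?d r j) = (\<Sum>j<2 * n. if j = off ls r + as ! r then fmat n w f $$ (i, j) else 0)"
          using True by (intro sum.cong refl) simp
        also have "\<dots> = w (off ls r + as ! r) i" using l i by (simp add: fmat_def)
        finally show ?thesis by (simp add: w[OF r True])
      next
        case False
        moreover have "as ! r \<le> ls ! r" using ty'(4) r by blast
        ultimately have "as ! r = ls ! r" by simp
        thus ?thesis using frameD(3)[OF g(1) r, of True] by simp
      qed
    qed
    also have "\<dots> = fst p $ i" using fun_cong[OF g(2), of i] i by (simp add: xfun_def vec_of_def sum_fun_apply)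
    finally show "(fmat n w f *\<^sub>v fst (std_point n ls as)) $ i = fst p $ i" .
  qed (use V(1) in \<open>simp add: fmat_def\<close>)
  hence "act (fmat n w f) (std_point n ls as) = p" using conj by (simp add: act_def std_point_def prod_eq_iff)
  thus ?thesis using fmat_Sp[OF gr] by blast
qed

end

section \<open>Points of the nilcone over a field and nilpotency\<close>

lemma nilcone_points_iff:
  "p \<in> nilcone_points n \<longleftrightarrow> p \<in> V_points n \<and> gpol n (snd p) = 1"
proof (cases "p \<in> V_points n")
  case True
  note ev = eval_Cgen[OF True refl]
  let ?z = "\<forall>j\<in>{1..n}. eval_pt p (Cgen n j) = 0"
  have "(\<forall>f\<in>nilcone_ideal n. eval_pt p f = 0) \<longleftrightarrow> ?z"
  proof
    assume "\<forall>f\<in>nilcone_ideal n. eval_pt p f = 0"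
    moreover have "Cgen n j \<in> nilcone_ideal n" if "j \<in> {1..n}" for j
      using that Cgen_in_polys[of n j] unfolding nilcone_ideal_eq by (auto intro: idl.span_base)
    ultimately show ?z by blast
  next
    assume 0: ?z
    have "eval_pt p f \<in> idl.span {}" if "f \<in> Cideal n" for f
      by (rule ideal_hom_image[OF eval_hom.comm_ring_hom_axioms that]) (use 0 in auto)
    thus "\<forall>f\<in>nilcone_ideal n. eval_pt p f = 0" unfolding nilcone_ideal_eq by simp
  qed
  also have "\<dots> \<longleftrightarrow> gpol n (snd p) = 1"
  proof
    assume 0: ?z
    show "gpol n (snd p) = 1"
    proof (rule fps_ext)
      fix j
      consider "j = 0" | "j \<in> {1..n}" | "j > n" by fastforce
      thus "fps_nth (gpol n (snd p)) j = fps_nth 1 j"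
      proof cases
        case 1
        thus ?thesis by (simp add: gpol_def)
      next
        case 2
        thus ?thesis using 0 ev[of j] by simp
      next
        case 3
        thus ?thesis using ev[of j] by (simp add: Cgen_large)
      qed
    qed
  qed (simp add: ev)
  finally show ?thesis using True by (simp add: nilcone_points_def)
qed (simp add: nilcone_points_def)

text \<open>Polynomials of degree at most \<open>d\<close>, regarded as power series.\<close>

definition low :: "nat \<Rightarrow> 'a::comm_ring_1 fps set" where
  "low d = {f. \<forall>k>d. fps_nth f k = 0}"

lemma low_mult:
  assumes "f \<in> low c" "g \<in> low d"
  shows "f * g \<in> low (c + d)"
proof -
  have "fps_nth f i * fps_nth g (k - i) = 0" if "k > c + d" for i k
  proof (cases "i > c")
    case True
    thus ?thesis using assms(1) by (simp add: low_def)
  next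
    case False
    hence "k - i > d" using that by simp
    thus ?thesis using assms(2) by (simp add: low_def)
  qed
  thus ?thesis by (auto simp: low_def fps_mult_nth intro!: sum.neutral)
qed

lemma low_prod:
  assumes "finite S" "\<And>i. i \<in> S \<Longrightarrow> f i \<in> low 1"
  shows "prod f S \<in> low (card S)"
  using assms
proof (induction S rule: finite_induct)
  case empty
  thus ?case by (simp add: low_def)
next
  case (insert x S)
  hence "f x * prod f S \<in> low (1 + card S)" by (intro low_mult) auto
  thus ?case using insert by simp
qed

lemma low_sign: "f \<in> low d \<Longrightarrow> (- 1) ^ i * f \<in> low d" "f \<in> low d \<Longrightarrow> signof p * f \<in> low d"
  by (auto simp: low_def minus_one_power_iff sign_def)

lemma low_det:
  assumes "C \<in> carrier_mat k k" "\<And>i j. i < k \<Longrightarrow> j < k \<Longrightarrow> C $$ (i, j) \<in> low 1"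
  shows "det C \<in> low k"
proof -
  have "signof p * (\<Prod>i=0..<k. C $$ (i, p i)) \<in> low k" if "p permutes {0..<k}" for p
  proof -
    have "(\<Prod>i=0..<k. C $$ (i, p i)) \<in> low (card {0..<k})"
      using permutes_in_image[OF that] by (intro low_prod assms(2)) auto
    thus ?thesis using low_sign(2) by simp
  qed
  thus ?thesis unfolding det_def'[OF assms(1)] by (auto simp: low_def fps_sum_nth)
qed

text \<open>If \<open>det (1 - s A) = 1\<close>, the adjugate of \<open>1 - s A\<close> is the geometric series of \<open>s A\<close>; as it has
  degree less than the size of \<open>A\<close>, the endomorphism \<open>A\<close> is nilpotent.\<close>

lemma gpol_nilpotent:
  fixes Y :: "'k::field mat"
  assumes Y: "Y \<in> alt_mat (2 * n)" and 1: "gpol n Y = 1" and u: "u \<in> vsp n"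
  shows "(avec n Y ^^ (2 * n)) u = 0"
proof -
  let ?N = "2 * n"
  define C where "C = amat n Y"
  define D where "D = charmat ?N C"
  have D: "D \<in> carrier_mat ?N ?N" by (simp add: D_def charmat_def)
  have d1: "det D = 1" using gpol_square[OF Y] 1 by (simp add: D_def C_def)
  define B where "B i j = adj_mat D $$ (i, j)" for i j
  have Bl: "B i j \<in> low (?N - 1)" if "i < ?N" "j < ?N" for i j
  proof -
    have "det (mat_delete D j i) \<in> low (?N - 1)"
    proof (rule low_det)
      show "mat_delete D j i \<in> carrier_mat (?N - 1) (?N - 1)" using D by (rule mat_delete_carrier)
      show "mat_delete D j i $$ (a, b) \<in> low 1" if "a < ?N - 1" "b < ?N - 1" for a b
        using that by (auto simp: mat_delete_def D_def charmat_def low_def)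
    qed
    hence "(- 1) ^ (j + i) * det (mat_delete D j i) \<in> low (?N - 1)" by (rule low_sign)
    thus ?thesis using that D by (simp add: B_def adj_mat_def cofactor_def)
  qed
  have rec: "B i j = (if i = j then 1 else 0) + fps_X * (\<Sum>l<?N. B i l * fps_const (C $$ (l, j)))"
    if ij: "i < ?N" "j < ?N" for i j
  proof -
    have "(if i = j then 1 else 0) = (adj_mat D * D) $$ (i, j)" using ij by (simp add: adj_mat(3)[OF D] d1)
    also have "\<dots> = (\<Sum>l<?N. B i l * D $$ (l, j))"
      using ij adj_mat(1)[OF D] D unfolding B_def by (subst sq_index[of _ n]) auto
    also have "\<dots> = (\<Sum>l<?N. (if l = j then B i l else 0) - fps_X * (B i l * fps_const (C $$ (l, j))))"
      using ij by (intro sum.cong refl) (auto simp: D_def charmat_def algebra_simps)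
    also have "\<dots> = B i j - fps_X * (\<Sum>l<?N. B i l * fps_const (C $$ (l, j)))"
      using ij by (simp add: sum_subtractf sum_distrib_left)
    finally show ?thesis by simp
  qed
  have B0: "fps_nth (B i j) 0 = (if i = j then 1 else 0)" if "i < ?N" "j < ?N" for i j by (subst rec[OF that]) simp
  have BS: "fps_nth (B i j) (Suc k) = (\<Sum>l<?N. fps_nth (B i l) k * C $$ (l, j))" if "i < ?N" "j < ?N" for i j k
    by (subst rec[OF that]) (simp add: fps_sum_nth)
  have "(avec n Y ^^ k) u i = (\<Sum>j<?N. fps_nth (B i j) k * u j)" if "i < ?N" "u \<in> vsp n" for k i u using that(2)
  proof (induction k arbitrary: u)
    case 0
    have "(\<Sum>j<?N. fps_nth (B i j) 0 * u j) = (\<Sum>j<?N. if j = i then u j else 0)"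
      using that(1) by (intro sum.cong refl) (auto simp: B0)
    thus ?case using that(1) by simp
  next
    case (Suc k)
    have "(avec n Y ^^ Suc k) u i = (avec n Y ^^ k) (avec n Y u) i" by (simp add: funpow_swap1)
    also have "\<dots> = (\<Sum>l<?N. fps_nth (B i l) k * avec n Y u l)" by (rule Suc.IH[OF avec_vsp])
    also have "\<dots> = (\<Sum>l<?N. \<Sum>j<?N. fps_nth (B i l) k * C $$ (l, j) * u j)"
      by (intro sum.cong refl) (simp add: avec_def C_def sum_distrib_left mult.assoc)
    also have "\<dots> = (\<Sum>j<?N. fps_nth (B i j) (Suc k) * u j)"
      using that(1) by (subst sum.swap) (simp add: BS sum_distrib_right)
    finally show ?case .
  qed
  moreover have "fps_nth (B i j) ?N = 0" if "i < ?N" "j < ?N" for i j using Bl[OF that] that by (simp add: low_def)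
  ultimately have "(avec n Y ^^ ?N) u i = 0" if "i < ?N" for i using u that by simp
  moreover have "(avec n Y ^^ ?N) u \<in> vsp n" using u avec_vsp[of n Y] by (cases n) auto
  ultimately show ?thesis by (auto simp: fun_eq_iff vsp_def not_less[symmetric])
qed

lemma std_point_nilcone: "std_point n ls as \<in> nilcone_points n"
  unfolding nilcone_points_iff using std_point_V
  by (auto simp: std_point_def gpol_def bstd_def intro: gser_bmat_strict)

section \<open>The group action and the bijection between types and orbits\<close>

lemma act_mult:
  assumes "g \<in> sq_mats n" "h \<in> sq_mats n" "p \<in> V_points n"
  shows "act (g * h) p = act g (act h p)"
proof -
  note V = V_pointsD[OF assms(3)]
  note a = sq_assoc[of _ n]
  note c = sq_mult[of _ n]
  have "g * h * snd p * (g * h)\<^sup>T = g * (h * snd p * h\<^sup>T) * g\<^sup>T"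
    using assms V by (simp add: sq_transpose[of _ n] a c)
  thus ?thesis using assms V by (simp add: act_def sq_assoc_vec[of _ n])
qed

lemma act_one: "p \<in> V_points n \<Longrightarrow> act (1\<^sub>m (2 * n)) p = p"
  using V_pointsD[of p n] by (simp add: act_def)

lemma Sp_mult:
  assumes "g \<in> Sp n" "h \<in> Sp n"
  shows "g * h \<in> Sp n"
proof -
  note g = SpD[OF assms(1)] and h = SpD[OF assms(2)]
  note a = sq_assoc[of _ n]
  note c = sq_mult[of _ n]
  have "(g * h)\<^sup>T * symp_form n * (g * h) = h\<^sup>T * (g\<^sup>T * symp_form n * g) * h"
    using g(1) h(1) by (simp add: sq_transpose[of _ n] a c)
  thus ?thesis using g h c[OF g(1) h(1)] by (simp add: Sp_def)
qed

lemma sp_inv_Sp: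
  fixes g :: "'a::field mat"
  assumes "g \<in> Sp n"
  shows "sp_inv n g \<in> Sp n"
proof -
  note g = SpD[OF assms]
  let ?i = "sp_inv n g"
  have i: "?i \<in> sq_mats n" using g by simp
  note a = sq_assoc[of _ n]
  note c = sq_mult[of _ n]
  have "?i\<^sup>T * symp_form n * ?i = ?i\<^sup>T * (g\<^sup>T * symp_form n * g) * ?i" by (simp only: g(2))
  also have "\<dots> = (g * ?i)\<^sup>T * symp_form n * (g * ?i)" using g(1) i by (simp add: sq_transpose[of _ n] a c)
  also have "\<dots> = symp_form n" unfolding sp_inv_right[OF assms] by simp
  finally show ?thesis using i by (simp add: Sp_def)
qed

definition type_locus :: "nat \<Rightarrow> nat list \<times> nat list \<Rightarrow> ('k::field vec \<times> 'k mat) set" where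
  "type_locus n t = {p \<in> V_points n. has_type n p (fst t) (snd t)}"

lemma orbit_type_locus:
  fixes p :: "'k::field vec \<times> 'k mat"
  assumes t: "t \<in> types n" and p: "p \<in> type_locus n t"
  shows "(\<lambda>g. act g p) ` Sp n = type_locus n t"
proof
  have V: "p \<in> V_points n" using p by (simp add: type_locus_def)
  show "(\<lambda>g. act g p) ` Sp n \<subseteq> type_locus n t"
    using p has_type_act[OF _ V] act_V_points[OF SpD(1) V] by (auto simp: type_locus_def)
  obtain ls as where ls: "t = (ls, as)" by (cases t)
  let ?s = "std_point n ls as :: 'k vec \<times> 'k mat"
  show "type_locus n t \<subseteq> (\<lambda>g. act g p) ` Sp n"
  proof
    fix q :: "'k vec \<times> 'k mat" assume q: "q \<in> type_locus n t"
    obtain M where M: "M \<in> Sp n" "act M ?s = p"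
      using std_point_conj[of ls as n p] t p by (auto simp: type_locus_def ls)
    obtain M' where M': "M' \<in> Sp n" "act M' ?s = q"
      using std_point_conj[of ls as n q] t q by (auto simp: type_locus_def ls)
    note i = sp_inv_Sp[OF M(1)]
    have "?s = act (sp_inv n M * M) ?s" by (simp add: sp_inv_left[OF M(1)] act_one std_point_V)
    also have "\<dots> = act (sp_inv n M) p" using act_mult[OF SpD(1)[OF i] SpD(1)[OF M(1)] std_point_V] M(2) by simp
    finally have "q = act (M' * sp_inv n M) p" using act_mult[OF SpD(1)[OF M'(1)] SpD(1)[OF i] V] M'(2) by simp
    thus "q \<in> (\<lambda>g. act g p) ` Sp n" using Sp_mult[OF M'(1) i] by blast
  qed
qed

text \<open>Points of one type are all conjugate to its standard point, which lies in the nilcone.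
  Injectivity is the uniqueness of saturated types, surjectivity the nilpotency of points of the
  nilcone together with \<open>type_exists\<close>.\<close>

lemma orbits_types:
  "bij_betw (type_locus n) (types n) (nilcone_orbits n :: ('k::field vec \<times> 'k mat) set set)"
proof -
  have std: "std_point n (fst t) (snd t) \<in> (type_locus n t :: ('k vec \<times> 'k mat) set)" if "t \<in> types n" for t
    unfolding type_locus_def by (intro CollectI conjI std_point_V std_point_type) (use that in simp)
  show ?thesis
  proof (rule bij_betwI')
    fix t t' :: "nat list \<times> nat list" assume t: "t \<in> types n" and t': "t' \<in> types n"
    show "type_locus n t = (type_locus n t' :: ('k vec \<times> 'k mat) set) \<longleftrightarrow> t = t'"
    proof
      let ?p = "std_point n (fst t) (snd t) :: 'k vec \<times> 'k mat"
      assume "type_locus n t = (type_locus n t' :: ('k vec \<times> 'k mat) set)"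
      hence h: "has_type n ?p (fst t) (snd t)" "has_type n ?p (fst t') (snd t')"
        using std[OF t] by (auto simp: type_locus_def)
      interpret symplectic "\<lambda>c u i. c * u i" "avec n (snd ?p)" "omf n" "vsp n" n
        by (rule symplectic_avec[OF V_pointsD(2)[OF std_point_V]])
      have s: "sorted_wrt (\<ge>) (fst t)" "saturated (fst t) (snd t)"
          "sorted_wrt (\<ge>) (fst t')" "saturated (fst t') (snd t')"
        using t t' by (simp_all add: types_def split_beta)
      have "fst t = fst t' \<and> snd t = snd t'"
        by (rule typed_unique[OF h(1)[unfolded has_type_def] s(1,2) h(2)[unfolded has_type_def] s(3,4)])
      thus "t = t'" by (simp add: prod_eq_iff)
    qed simp
  next
    fix t :: "nat list \<times> nat list" assume t: "t \<in> types n"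
    show "type_locus n t \<in> (nilcone_orbits n :: ('k vec \<times> 'k mat) set set)"
      unfolding nilcone_orbits_def orbit_type_locus[OF t std[OF t], symmetric] by (intro imageI std_point_nilcone)
  next
    fix Q :: "('k vec \<times> 'k mat) set" assume "Q \<in> nilcone_orbits n"
    then obtain p where p: "p \<in> V_points n" "gpol n (snd p) = 1" "Q = (\<lambda>g. act g p) ` Sp n"
      unfolding nilcone_orbits_def by (auto simp: nilcone_points_iff)
    note V = V_pointsD[OF p(1)]
    interpret symplectic "\<lambda>c u i. c * u i" "avec n (snd p)" "omf n" "vsp n" n by (rule symplectic_avec[OF V(2)])
    have "xfun n (fst p) \<in> vsp n" by (simp add: xfun_def vsp_def)
    then obtain ls as where ls: "(ls, as) \<in> types n" "typed (xfun n (fst p)) ls as"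
      using type_exists[OF gpol_nilpotent[OF V(2) p(2)]] by blast
    hence "p \<in> type_locus n (ls, as)" using p(1) by (simp add: type_locus_def has_type_def)
    thus "\<exists>t\<in>types n. Q = type_locus n t" using ls(1) p(3) by (intro bexI[of _ "(ls, as)"]) (simp_all add: orbit_type_locus)
  qed
qed

theorem theorem1:
  fixes n :: nat
  shows "normal_Spec (nilcone_ring n)
    \<and> flat_Spec_over_int TYPE('p) TYPE('q) (nilcone_ring n)
    \<and> finite (nilcone_orbits n :: ('k::alg_closed_field vec \<times> 'k mat) set set)
    \<and> finite (nilcone_orbits n :: ('l::alg_closed_field vec \<times> 'l mat) set set)
    \<and> card (nilcone_orbits n :: ('k vec \<times> 'k mat) set set)
      = card (nilcone_orbits n :: ('l vec \<times> 'l mat) set set)"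
proof -
  note a = orbits_types[of n, where 'k = 'k] and b = orbits_types[of n, where 'k = 'l]
  have "finite (nilcone_orbits n :: ('k vec \<times> 'k mat) set set)"
    "finite (nilcone_orbits n :: ('l vec \<times> 'l mat) set set)"
    using finite_types[of n] bij_betw_finite[OF a] bij_betw_finite[OF b] by simp_all
  thus ?thesis using nilcone_normal nilcone_flat bij_betw_same_card[OF a] bij_betw_same_card[OF b] by simp
qed

end
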